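(* Let $\vec\mu=(\mu_1,\mu_2)$ be an Angelesco system with $\Delta_1<\Delta_2$ and fix $X\in\mathcal V$. The map $$\alpha(x)\mapsto\widehat\alpha=\{\widehat\alpha_Y\}_{Y\in\mathcal V_{[X]}},\qquad\widehat\alpha_Y=\int\alpha(x)\Psi_Y(X;x)\,d\rho_{[X]}(x),$$ is a unitary map from $L^2(\rho_{[X]})$ onto $\mathfrak C_{[X]}^{(X)}$. In particular, $$\|\alpha\|^2_{L^2(\rho_{[X]})}=\|\widehat\alpha\|^2_{\ell^2(\mathcal V_{[X]})}\quad\text{and}\quad\mathfrak C_{[X]}^{(X)}=\{\widehat\alpha:\alpha\in L^2(\rho_{[X]})\}.$$ Thus the formula $\alpha(\mathcal J_{[X]})\delta^{(X)}=\widehat\alpha=\int\alpha(x)\Psi(X;x)\,d\rho_{[X]}(x)$, which holds for continuous $\alpha$, extends the definition of $\alpha(\mathcal J_{[X]})\delta^{(X)}$ from continuous functions $\alpha$ to all $\alpha\in L^2(\rho_{[X]})$. Moreover, under this map $$x\alpha(x)\mapsto\mathcal J_{[X]}\widehat\alpha,\qquad\alpha\in L^2(\rho_{[X]}).$$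
   Context: Angelesco system: $\mu_1,\mu_2$ are finite positive Borel measures on $\mathbb R$ with compact supports of infinite cardinality; $\Delta_i=[\alpha_i,\beta_i]$ is the convex hull of $\operatorname{supp}\mu_i$; $\Delta_1\cap\Delta_2=\varnothing$, labelled so that $\beta_1<\alpha_2$ (written $\Delta_1<\Delta_2$). $\|\mu_k\|=\mu_k(\mathbb R)$, $\widehat\mu_k(z)=\int\frac{d\mu_k(x)}{z-x}$. Multiple orthogonality. For $\vec n\in\mathbb Z_+^2\setminus\{(0,0)\}$, $A^{(1)}_{\vec n},A^{(2)}_{\vec n}$ are the polynomials with $\deg A_{\vec n}^{(k)}\le n_k-1$ ($A_{\vec n}^{(k)}=0$ if $n_k=0$), $\int x^m(A_{\vec n}^{(1)}d\mu_1+A_{\vec n}^{(2)}d\mu_2)=0$ for $0\le m\le|\vec n|-2$ and $=1$ for $m=|\vec n|-1$; $P_{\vec n}$ is the monic polynomial of degree $|\vec n|=n_1+n_2$ with $\int P_{\vec n}x^md\mu_k=0$, $0\le m<n_k$, $k=1,2$. Angelesco systems are perfect (these polynomials exist uniquely), and there are uniformly bounded real recurrence coefficients with $xP_{\vec n}=P_{\vec n+\vec e_i}+b_{\vec n,i}P_{\vec n}+a_{\vec n,1}P_{\vec n-\vec e_1}+a_{\vec n,2}P_{\vec n-\vec e_2}$, $i\in\{1,2\}$ ($\vec e_1=(1,0)$, $\vec e_2=(0,1)$; terms with negative indices are $0$), where $a_{\vec n,i}>0$ for $\vec n\in\mathbb N^2$. Set $A_{\vec n}^{(0)}(z)=\sum_{k=1}^2\int\frac{A_{\vec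 n}^{(k)}(z)-A_{\vec n}^{(k)}(x)}{z-x}d\mu_k(x)$ and $L_{\vec n}(z)=\int\frac{A^{(1)}_{\vec n}(x)d\mu_1(x)+A^{(2)}_{\vec n}(x)d\mu_2(x)}{z-x}$. Tree and operator. $\mathcal V$ is the vertex set of the infinite rooted binary tree with root $O$: each $Y$ has two children $Y_{(ch),1},Y_{(ch),2}$; $Y_{(p)}$ is the parent of $Y\ne O$. $\Pi(O)=(1,1)$, $\Pi(Y_{(ch),i})=\Pi(Y)+\vec e_i$; $\iota_Y=i$ if $Y$ is the $i$-th child of its parent. For a fixed $\vec\kappa\in\mathbb R^2$ with $\kappa_1+\kappa_2=1$: $V_O=\kappa_1b_{(0,1),1}+\kappa_2b_{(1,0),2}$, $W_O=1$; $V_Y=b_{\Pi(Y_{(p)}),\iota_Y}$, $W_Y=a_{\Pi(Y_{(p)}),\iota_Y}>0$ for $Y\neq O$; with $f_{O_{(p)}}:=0$, $$(\mathcal J_{\vec\kappa}f)_Y=V_Yf_Y+W_Y^{1/2}f_{Y_{(p)}}+W_{Y_{(ch),1}}^{1/2}f_{Y_{(ch),1}}+W_{Y_{(ch),2}}^{1/2}f_{Y_{(ch),2}},$$ a bounded self-adjoint operator on $\ell^2(\mathcal V)$. $\mathcal V_{[X]}$ is the set consisting of $X$ and all its descendants; $\mathcal J_{[X]}$ is the restriction of $\mathcal J_{\vec\kappa}$ to functions on $\mathcal V_{[X]}$ (same formula, with the term involving the parent of $X$ dropped), so $\mathcal J_{[O]}=\mathcal J_{\vec\kappa}$. $\delta^{(X)}$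 is the Kronecker delta; $\rho_{[X]}$ is the spectral measure: $\langle(\mathcal J_{[X]}-z)^{-1}\delta^{(X)},\delta^{(X)}\rangle=\int\frac{d\rho_{[X]}(x)}{x-z}$. $\mathfrak C_{[X]}^{(X)}=\overline{\mathrm{span}\{\mathcal J_{[X]}^n\delta^{(X)}:n\in\mathbb Z_+\}}$ in $\ell^2(\mathcal V_{[X]})$. Generalized eigenfunctions. $m_Y=\prod_{Z\in\mathrm{path}(Y,O)}W_Z^{-1/2}$ (both ends included); $\Lambda^{(k)}_Y=m_Y^{-1}A^{(k)}_{\Pi(Y)}$, $k\in\{0,1,2\}$; $l_Y=m_Y^{-1}L_{\Pi(Y)}$. $[f,g]^{(Z)}=f_Zg-fg_Z$ for functions $f,g$ on $\mathcal V$ and a vertex $Z$. For $X\ne O$ and $x\in\Delta_1\cup\Delta_2$ (which contains $\operatorname{supp}\rho_{[X]}$): $\Psi(X;x)=\widetilde\Psi(X;x)/\widetilde\Psi_X(X;x)$ on $\mathcal V_{[X]}$, where $$\widetilde\Psi(X;x)=m_{X_{(p)}}m_X\sum_{k=1}^2\Big([\Lambda^{(k)}(x),\Lambda^{(0)}(x)]^{(X_{(p)})}+[\Lambda^{(3-k)}(x),\Lambda^{(k)}(x)]^{(X_{(p)})}\,\widehat\mu_{3-k}(x)\Big)\chi_{\Delta_k}(x)$$ and $\widetilde\Psi_X(X;x)>0$. For $X=O$: let $\vec\varkappa=(\varkappa_1,\varkappa_2)=(\kappa_2,\kappa_1)$, $L_{\vec\varkappa}=\varkappa_1\|\mu_1\|^{-1}\widehat\mu_1+\varkappa_2\|\mu_2\|^{-1}\widehat\mu_2$,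 $E_{\vec\varkappa}=\{E\in\mathbb R\setminus(\Delta_1\cup\Delta_2):L_{\vec\varkappa}(E)=0\}$, $\Xi_{\vec\mu}=\|\mu_2\|^{-1}\int t\,d\mu_2-\|\mu_1\|^{-1}\int t\,d\mu_1$, $S_O=(\Xi_{\vec\mu}\|\mu_1\|\|\mu_2\|)^{-1}(\widehat\mu_1\chi_{\Delta_2}-\widehat\mu_2\chi_{\Delta_1})$. Then $\operatorname{supp}\rho_{[O]}\subseteq\Delta_1\cup\Delta_2\cup E_{\vec\varkappa}$, $\Psi(O;E)=l(E)/L_{(1,1)}(E)$ for $E\in E_{\vec\varkappa}$, and for $x\in\Delta_k$ $$\Psi(O;x)=S_O^{-1}(x)\Big(\Lambda^{(0)}(x)\tfrac{\varkappa_k}{\|\mu_k\|}+(-1)^k\widehat\mu_{3-k}(x)\big(\Lambda^{(2)}(x)\tfrac{\varkappa_1}{\|\mu_1\|}-\Lambda^{(1)}(x)\tfrac{\varkappa_2}{\|\mu_2\|}\big)\Big).$$ *)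

theory Defs
  imports "HOL-Analysis.Analysis" "HOL-Computational_Algebra.Polynomial"
begin

section \<open>Angelesco systems\<close>

text \<open>The index set \<open>{1, 2}\<close>; multi-indices, pairs of measures, and the parameters
  \<open>\<kappa>\<close> are functions on it.\<close>

datatype ix = I1 | I2

fun other :: "ix \<Rightarrow> ix" where
  "other I1 = I2"
| "other I2 = I1"

definition msupp :: "real measure \<Rightarrow> real set" where
  "msupp M = {x. \<forall>U. open U \<longrightarrow> x \<in> U \<longrightarrow> emeasure M U > 0}"

definition Delta :: "(ix \<Rightarrow> real measure) \<Rightarrow> ix \<Rightarrow> real set" where
  "Delta \<mu> k = convex hull (msupp (\<mu> k))"

definition angelesco :: "(ix \<Rightarrow> real measure) \<Rightarrow> bool" where
  "angelesco \<mu> \<longleftrightarrow>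
     (\<forall>k. sets (\<mu> k) = sets borel \<and> finite_measure (\<mu> k) \<and>
          compact (msupp (\<mu> k)) \<and> infinite (msupp (\<mu> k))) \<and>
     (\<forall>x \<in> Delta \<mu> I1. \<forall>y \<in> Delta \<mu> I2. x < y)"

definition mass :: "real measure \<Rightarrow> real" where
  "mass M = measure M UNIV"

text \<open>Only its values at real points outside the support of \<open>M\<close> matter below.\<close>

definition cauchy :: "real measure \<Rightarrow> real \<Rightarrow> real" where
  "cauchy M z = (\<integral>x. 1 / (z - x) \<partial>M)"

section \<open>Multiple orthogonal polynomials\<close>

definition msize :: "(ix \<Rightarrow> nat) \<Rightarrow> nat" where
  "msize n = n I1 + n I2"

definition inc :: "(ix \<Rightarrow> nat) \<Rightarrow> ix \<Rightarrow> (ix \<Rightarrow> nat)" where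
  "inc n i = n(i := n i + 1)"

definition dec :: "(ix \<Rightarrow> nat) \<Rightarrow> ix \<Rightarrow> (ix \<Rightarrow> nat)" where
  "dec n i = n(i := n i - 1)"

definition unit_ix :: "ix \<Rightarrow> (ix \<Rightarrow> nat)" where
  "unit_ix i = inc (\<lambda>_. 0) i"

text \<open>The coefficient condition says \<open>deg A\<^sub>k \<le> n\<^sub>k - 1\<close>, and \<open>A\<^sub>k = 0\<close> if \<open>n\<^sub>k = 0\<close>.\<close>

definition is_type_I :: "(ix \<Rightarrow> real measure) \<Rightarrow> (ix \<Rightarrow> nat) \<Rightarrow> (ix \<Rightarrow> real poly) \<Rightarrow> bool" where
  "is_type_I \<mu> n A \<longleftrightarrow>
     (\<forall>k. \<forall>j \<ge> n k. coeff (A k) j = 0) \<and>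
     (\<forall>m. m + 1 < msize n \<longrightarrow> (\<Sum>k\<in>{I1, I2}. \<integral>x. x ^ m * poly (A k) x \<partial>(\<mu> k)) = 0) \<and>
     (\<forall>m. m + 1 = msize n \<longrightarrow> (\<Sum>k\<in>{I1, I2}. \<integral>x. x ^ m * poly (A k) x \<partial>(\<mu> k)) = 1)"

definition type_I :: "(ix \<Rightarrow> real measure) \<Rightarrow> (ix \<Rightarrow> nat) \<Rightarrow> ix \<Rightarrow> real poly" where
  "type_I \<mu> n = (THE A. is_type_I \<mu> n A)"

definition is_type_II :: "(ix \<Rightarrow> real measure) \<Rightarrow> (ix \<Rightarrow> nat) \<Rightarrow> real poly \<Rightarrow> bool" where
  "is_type_II \<mu> n P \<longleftrightarrow>
     lead_coeff P = 1 \<and> degree P = msize n \<and>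
     (\<forall>k. \<forall>m < n k. (\<integral>x. poly P x * x ^ m \<partial>(\<mu> k)) = 0)"

definition type_II :: "(ix \<Rightarrow> real measure) \<Rightarrow> (ix \<Rightarrow> nat) \<Rightarrow> real poly" where
  "type_II \<mu> n = (THE P. is_type_II \<mu> n P)"

text \<open>The coefficient \<open>a n k\<close> with \<open>n k = 0\<close> multiplies a polynomial of negative index and is
  undetermined by the recurrences; the convention \<open>a n k = 0\<close> makes the coefficients unique.\<close>

definition is_rec_coeffs ::
  "(ix \<Rightarrow> real measure) \<Rightarrow> ((ix \<Rightarrow> nat) \<Rightarrow> ix \<Rightarrow> real) \<times> ((ix \<Rightarrow> nat) \<Rightarrow> ix \<Rightarrow> real) \<Rightarrow> bool" where
  "is_rec_coeffs \<mu> = (\<lambda>(a, b).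
     (\<forall>n k. n k = 0 \<longrightarrow> a n k = 0) \<and>
     (\<forall>n i. [:0, 1:] * type_II \<mu> n =
        type_II \<mu> (inc n i) + smult (b n i) (type_II \<mu> n)
        + (\<Sum>k\<in>{I1, I2}. if n k = 0 then 0 else smult (a n k) (type_II \<mu> (dec n k)))))"

definition rec_a :: "(ix \<Rightarrow> real measure) \<Rightarrow> (ix \<Rightarrow> nat) \<Rightarrow> ix \<Rightarrow> real" where
  "rec_a \<mu> = fst (THE ab. is_rec_coeffs \<mu> ab)"

definition rec_b :: "(ix \<Rightarrow> real measure) \<Rightarrow> (ix \<Rightarrow> nat) \<Rightarrow> ix \<Rightarrow> real" where
  "rec_b \<mu> = snd (THE ab. is_rec_coeffs \<mu> ab)"

text \<open>For a polynomial \<open>A\<close>, \<open>poly (synthetic_div A x) z\<close> is the polynomial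
  \<open>(A(z) - A(x)) / (z - x)\<close>, with value \<open>A'(x)\<close> at \<open>z = x\<close>. Literal division would give \<open>0\<close> there,
  which is wrong when \<open>x\<close> is an atom.\<close>

definition A0 :: "(ix \<Rightarrow> real measure) \<Rightarrow> (ix \<Rightarrow> nat) \<Rightarrow> real \<Rightarrow> real" where
  "A0 \<mu> n z = (\<Sum>k\<in>{I1, I2}. \<integral>x. poly (synthetic_div (type_I \<mu> n k) x) z \<partial>(\<mu> k))"

definition Lfun :: "(ix \<Rightarrow> real measure) \<Rightarrow> (ix \<Rightarrow> nat) \<Rightarrow> real \<Rightarrow> real" where
  "Lfun \<mu> n z = (\<Sum>k\<in>{I1, I2}. \<integral>x. poly (type_I \<mu> n k) x / (z - x) \<partial>(\<mu> k))"

section \<open>The tree and the Jacobi operators\<close>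

datatype vertex = Root | Child vertex ix

fun Pi_ix :: "vertex \<Rightarrow> (ix \<Rightarrow> nat)" where
  "Pi_ix Root = (\<lambda>_. 1)"
| "Pi_ix (Child Y i) = inc (Pi_ix Y) i"

inductive_set subtree :: "vertex \<Rightarrow> vertex set" for X where
  self: "X \<in> subtree X"
| child: "Y \<in> subtree X \<Longrightarrow> Child Y i \<in> subtree X"

fun path_to_root :: "vertex \<Rightarrow> vertex set" where
  "path_to_root Root = {Root}"
| "path_to_root (Child Y i) = insert (Child Y i) (path_to_root Y)"

fun potV :: "(ix \<Rightarrow> real measure) \<Rightarrow> (ix \<Rightarrow> real) \<Rightarrow> vertex \<Rightarrow> real" where
  "potV \<mu> \<kappa> Root = \<kappa> I1 * rec_b \<mu> (unit_ix I2) I1 + \<kappa> I2 * rec_b \<mu> (unit_ix I1) I2"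
| "potV \<mu> \<kappa> (Child Y i) = rec_b \<mu> (Pi_ix Y) i"

fun potW :: "(ix \<Rightarrow> real measure) \<Rightarrow> vertex \<Rightarrow> real" where
  "potW \<mu> Root = 1"
| "potW \<mu> (Child Y i) = rec_a \<mu> (Pi_ix Y) i"

fun at_parent :: "(vertex \<Rightarrow> complex) \<Rightarrow> vertex \<Rightarrow> complex" where
  "at_parent f Root = 0"
| "at_parent f (Child Y i) = f Y"

text \<open>Functions on \<open>subtree X\<close> are represented by functions on all vertices vanishing off
  \<open>subtree X\<close>.\<close>

definition jacobi ::
  "(ix \<Rightarrow> real measure) \<Rightarrow> (ix \<Rightarrow> real) \<Rightarrow> vertex \<Rightarrow> (vertex \<Rightarrow> complex) \<Rightarrow> (vertex \<Rightarrow> complex)" where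
  "jacobi \<mu> \<kappa> X f = (\<lambda>Y. if Y \<in> subtree X then
       of_real (potV \<mu> \<kappa> Y) * f Y
       + (if Y = X then 0 else of_real (sqrt (potW \<mu> Y)) * at_parent f Y)
       + (\<Sum>i\<in>{I1, I2}. of_real (sqrt (potW \<mu> (Child Y i))) * f (Child Y i))
     else 0)"

section \<open>Operators on square-summable functions\<close>

definition ell2 :: "'v set \<Rightarrow> ('v \<Rightarrow> complex) set" where
  "ell2 S = {f. (\<forall>v. v \<notin> S \<longrightarrow> f v = 0) \<and> (\<lambda>v. (cmod (f v))\<^sup>2) summable_on S}"

definition ell2_inner :: "'v set \<Rightarrow> ('v \<Rightarrow> complex) \<Rightarrow> ('v \<Rightarrow> complex) \<Rightarrow> complex" where
  "ell2_inner S f g = (\<Sum>\<^sub>\<infinity>v\<in>S. f v * cnj (g v))"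

definition ell2_norm :: "'v set \<Rightarrow> ('v \<Rightarrow> complex) \<Rightarrow> real" where
  "ell2_norm S f = sqrt (\<Sum>\<^sub>\<infinity>v\<in>S. (cmod (f v))\<^sup>2)"

definition kdelta :: "'v \<Rightarrow> 'v \<Rightarrow> complex" where
  "kdelta X = (\<lambda>Y. if Y = X then 1 else 0)"

definition shift :: "(('v \<Rightarrow> complex) \<Rightarrow> ('v \<Rightarrow> complex)) \<Rightarrow> complex \<Rightarrow> ('v \<Rightarrow> complex) \<Rightarrow> ('v \<Rightarrow> complex)" where
  "shift T z f = (\<lambda>v. T f v - z * f v)"

definition resolvent_at ::
  "'v set \<Rightarrow> (('v \<Rightarrow> complex) \<Rightarrow> ('v \<Rightarrow> complex)) \<Rightarrow> complex \<Rightarrow> ('v \<Rightarrow> complex) \<Rightarrow> ('v \<Rightarrow> complex)" where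
  "resolvent_at S T z g = (THE f. f \<in> ell2 S \<and> shift T z f = g)"

definition op_spectrum :: "'v set \<Rightarrow> (('v \<Rightarrow> complex) \<Rightarrow> ('v \<Rightarrow> complex)) \<Rightarrow> complex set" where
  "op_spectrum S T = {z. \<not> (bij_betw (shift T z) (ell2 S) (ell2 S) \<and>
     (\<exists>C. \<forall>f \<in> ell2 S. ell2_norm S f \<le> C * ell2_norm S (shift T z f)))}"

definition is_spectral_measure ::
  "'v set \<Rightarrow> (('v \<Rightarrow> complex) \<Rightarrow> ('v \<Rightarrow> complex)) \<Rightarrow> 'v \<Rightarrow> real measure \<Rightarrow> bool" where
  "is_spectral_measure S T X \<rho> \<longleftrightarrow>
     sets \<rho> = sets borel \<and> finite_measure \<rho> \<and>
     (\<forall>z. Im z \<noteq> 0 \<longrightarrow>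
        ell2_inner S (resolvent_at S T z (kdelta X)) (kdelta X)
          = (\<integral>x. 1 / (of_real x - z) \<partial>\<rho>))"

definition poly_calc ::
  "(('v \<Rightarrow> complex) \<Rightarrow> ('v \<Rightarrow> complex)) \<Rightarrow> complex poly \<Rightarrow> ('v \<Rightarrow> complex) \<Rightarrow> ('v \<Rightarrow> complex)" where
  "poly_calc T p f = (\<lambda>v. \<Sum>j\<le>degree p. coeff p j * (T ^^ j) f v)"

text \<open>The vectors \<open>poly_calc T p (kdelta X)\<close> are exactly the complex linear combinations of the
  vectors \<open>T\<^sup>n \<delta>\<^sub>X\<close>.\<close>

definition cyclic_subspace ::
  "'v set \<Rightarrow> (('v \<Rightarrow> complex) \<Rightarrow> ('v \<Rightarrow> complex)) \<Rightarrow> 'v \<Rightarrow> ('v \<Rightarrow> complex) set" where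
  "cyclic_subspace S T X = {f \<in> ell2 S. \<forall>e > 0. \<exists>p.
     ell2_norm S (\<lambda>v. f v - poly_calc T p (kdelta X) v) < e}"

text \<open>The continuous functional calculus of a bounded self-adjoint operator \<open>T\<close>, applied to the
  vector \<open>f\<close>: the limit of \<open>p\<^sub>n(T) f\<close> for polynomials \<open>p\<^sub>n\<close> converging to \<open>\<alpha>\<close> uniformly on the
  spectrum.\<close>

definition cont_calc ::
  "'v set \<Rightarrow> (('v \<Rightarrow> complex) \<Rightarrow> ('v \<Rightarrow> complex)) \<Rightarrow> (real \<Rightarrow> complex) \<Rightarrow> ('v \<Rightarrow> complex) \<Rightarrow> ('v \<Rightarrow> complex)" where
  "cont_calc S T \<alpha> f = (THE g. g \<in> ell2 S \<and>
     (\<forall>p. uniform_limit {x. of_real x \<in> op_spectrum S T} (\<lambda>n x. poly (p n) (of_real x)) \<alpha> sequentially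
        \<longrightarrow> (\<lambda>n. ell2_norm S (\<lambda>v. poly_calc T (p n) f v - g v)) \<longlonglongrightarrow> 0))"

section \<open>Square-integrable functions\<close>

text \<open>Elements of \<open>L\<^sup>2\<close> are represented by functions; almost everywhere equality is handled in
  \<open>unitary_L2_onto\<close>.\<close>

definition L2 :: "real measure \<Rightarrow> (real \<Rightarrow> complex) set" where
  "L2 \<rho> = {\<alpha> \<in> borel_measurable \<rho>. integrable \<rho> (\<lambda>x. (cmod (\<alpha> x))\<^sup>2)}"

definition L2_inner :: "real measure \<Rightarrow> (real \<Rightarrow> complex) \<Rightarrow> (real \<Rightarrow> complex) \<Rightarrow> complex" where
  "L2_inner \<rho> \<alpha> \<beta> = (\<integral>x. \<alpha> x * cnj (\<beta> x) \<partial>\<rho>)"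

definition L2_norm :: "real measure \<Rightarrow> (real \<Rightarrow> complex) \<Rightarrow> real" where
  "L2_norm \<rho> \<alpha> = sqrt (\<integral>x. (cmod (\<alpha> x))\<^sup>2 \<partial>\<rho>)"

definition unitary_L2_onto ::
  "real measure \<Rightarrow> 'v set \<Rightarrow> ('v \<Rightarrow> complex) set \<Rightarrow> ((real \<Rightarrow> complex) \<Rightarrow> ('v \<Rightarrow> complex)) \<Rightarrow> bool" where
  "unitary_L2_onto \<rho> S C U \<longleftrightarrow>
     (\<forall>\<alpha> \<in> L2 \<rho>. \<forall>\<beta> \<in> L2 \<rho>. (AE x in \<rho>. \<alpha> x = \<beta> x) \<longrightarrow> U \<alpha> = U \<beta>) \<and>
     (\<forall>\<alpha> \<in> L2 \<rho>. \<forall>\<beta> \<in> L2 \<rho>. \<forall>c d.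
        U (\<lambda>x. c * \<alpha> x + d * \<beta> x) = (\<lambda>v. c * U \<alpha> v + d * U \<beta> v)) \<and>
     (\<forall>\<alpha> \<in> L2 \<rho>. \<forall>\<beta> \<in> L2 \<rho>. ell2_inner S (U \<alpha>) (U \<beta>) = L2_inner \<rho> \<alpha> \<beta>) \<and>
     U ` L2 \<rho> = C \<and> C \<subseteq> ell2 S"

section \<open>Generalized eigenfunctions\<close>

definition mfac :: "(ix \<Rightarrow> real measure) \<Rightarrow> vertex \<Rightarrow> real" where
  "mfac \<mu> Y = (\<Prod>Z\<in>path_to_root Y. 1 / sqrt (potW \<mu> Z))"

definition Lam :: "(ix \<Rightarrow> real measure) \<Rightarrow> ix \<Rightarrow> real \<Rightarrow> vertex \<Rightarrow> real" where
  "Lam \<mu> k x Y = poly (type_I \<mu> (Pi_ix Y) k) x / mfac \<mu> Y"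

definition Lam0 :: "(ix \<Rightarrow> real measure) \<Rightarrow> real \<Rightarrow> vertex \<Rightarrow> real" where
  "Lam0 \<mu> x Y = A0 \<mu> (Pi_ix Y) x / mfac \<mu> Y"

definition lfun :: "(ix \<Rightarrow> real measure) \<Rightarrow> real \<Rightarrow> vertex \<Rightarrow> real" where
  "lfun \<mu> x Y = Lfun \<mu> (Pi_ix Y) x / mfac \<mu> Y"

definition brk :: "vertex \<Rightarrow> (vertex \<Rightarrow> real) \<Rightarrow> (vertex \<Rightarrow> real) \<Rightarrow> vertex \<Rightarrow> real" where
  "brk Z f g Y = f Z * g Y - f Y * g Z"

text \<open>\<open>PsiT \<mu> Z X x\<close> is the unnormalized eigenfunction for the vertex \<open>X\<close> with parent \<open>Z\<close>.\<close>

definition PsiT :: "(ix \<Rightarrow> real measure) \<Rightarrow> vertex \<Rightarrow> vertex \<Rightarrow> real \<Rightarrow> vertex \<Rightarrow> real" where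
  "PsiT \<mu> Z X x Y = mfac \<mu> Z * mfac \<mu> X *
     (\<Sum>k\<in>{I1, I2}. (brk Z (Lam \<mu> k x) (Lam0 \<mu> x) Y
        + brk Z (Lam \<mu> (other k) x) (Lam \<mu> k x) Y * cauchy (\<mu> (other k)) x)
        * indicator (Delta \<mu> k) x)"

text \<open>\<open>vkap \<kappa>\<close> is \<open>(\<kappa>\<^sub>2, \<kappa>\<^sub>1)\<close>.\<close>

definition vkap :: "(ix \<Rightarrow> real) \<Rightarrow> ix \<Rightarrow> real" where
  "vkap \<kappa> k = \<kappa> (other k)"

definition Lvk :: "(ix \<Rightarrow> real measure) \<Rightarrow> (ix \<Rightarrow> real) \<Rightarrow> real \<Rightarrow> real" where
  "Lvk \<mu> \<kappa> z = (\<Sum>k\<in>{I1, I2}. vkap \<kappa> k / mass (\<mu> k) * cauchy (\<mu> k) z)"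

definition Evk :: "(ix \<Rightarrow> real measure) \<Rightarrow> (ix \<Rightarrow> real) \<Rightarrow> real set" where
  "Evk \<mu> \<kappa> = {E. E \<notin> Delta \<mu> I1 \<union> Delta \<mu> I2 \<and> Lvk \<mu> \<kappa> E = 0}"

definition Xi :: "(ix \<Rightarrow> real measure) \<Rightarrow> real" where
  "Xi \<mu> = (\<integral>t. t \<partial>(\<mu> I2)) / mass (\<mu> I2) - (\<integral>t. t \<partial>(\<mu> I1)) / mass (\<mu> I1)"

definition S_root :: "(ix \<Rightarrow> real measure) \<Rightarrow> real \<Rightarrow> real" where
  "S_root \<mu> x = (cauchy (\<mu> I1) x * indicator (Delta \<mu> I2) x
       - cauchy (\<mu> I2) x * indicator (Delta \<mu> I1) x) / (Xi \<mu> * mass (\<mu> I1) * mass (\<mu> I2))"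

definition PsiR :: "(ix \<Rightarrow> real measure) \<Rightarrow> (ix \<Rightarrow> real) \<Rightarrow> ix \<Rightarrow> real \<Rightarrow> vertex \<Rightarrow> real" where
  "PsiR \<mu> \<kappa> k x Y = (Lam0 \<mu> x Y * vkap \<kappa> k / mass (\<mu> k)
       + (case k of I1 \<Rightarrow> - 1 | I2 \<Rightarrow> 1) * cauchy (\<mu> (other k)) x *
         (Lam \<mu> I2 x Y * vkap \<kappa> I1 / mass (\<mu> I1) - Lam \<mu> I1 x Y * vkap \<kappa> I2 / mass (\<mu> I2)))
     / S_root \<mu> x"

text \<open>The value outside \<open>\<Delta>\<^sub>1 \<union> \<Delta>\<^sub>2\<close> (respectively \<open>\<Delta>\<^sub>1 \<union> \<Delta>\<^sub>2 \<union> E\<close> at the root), where \<open>\<Psi>\<close> is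
  not defined, is \<open>0\<close>; that set is null for the spectral measure.\<close>

fun Psi :: "(ix \<Rightarrow> real measure) \<Rightarrow> (ix \<Rightarrow> real) \<Rightarrow> vertex \<Rightarrow> real \<Rightarrow> vertex \<Rightarrow> real" where
  "Psi \<mu> \<kappa> (Child Z i) x Y = PsiT \<mu> Z (Child Z i) x Y / PsiT \<mu> Z (Child Z i) x (Child Z i)"
| "Psi \<mu> \<kappa> Root x Y =
     (if x \<in> Delta \<mu> I1 then PsiR \<mu> \<kappa> I1 x Y
      else if x \<in> Delta \<mu> I2 then PsiR \<mu> \<kappa> I2 x Y
      else if x \<in> Evk \<mu> \<kappa> then lfun \<mu> x Y / Lfun \<mu> (\<lambda>_. 1) x
      else 0)"

definition hat ::
  "(ix \<Rightarrow> real measure) \<Rightarrow> (ix \<Rightarrow> real) \<Rightarrow> vertex \<Rightarrow> real measure \<Rightarrow> (real \<Rightarrow> complex) \<Rightarrow> vertex \<Rightarrow> complex" where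
  "hat \<mu> \<kappa> X \<rho> \<alpha> = (\<lambda>Y. if Y \<in> subtree X
     then (\<integral>x. \<alpha> x * of_real (Psi \<mu> \<kappa> X x Y) \<partial>\<rho>) else 0)"

end

theory Submission imports Defs
begin

text \<open>For each vertex \<open>Y\<close> the functional \<open>p \<mapsto> (p(J) \<delta>)\<^sub>Y\<close> on polynomials is bounded in \<open>L\<^sup>2(\<rho>)\<close>, hence is
  integration against some \<open>\<psi>\<^sub>Y\<close>; the map with kernel \<open>\<psi>\<close> is then unitary onto the cyclic subspace by
  density of polynomials. What has to be shown is \<open>\<psi> = \<Psi>\<close> almost everywhere.

  Write \<open>D p(x, t)\<close> for the divided difference of \<open>p\<close>, and let the index \<open>Z\<close> refer to the parent of \<open>X\<close>. The
  recurrence of the type I polynomials, together with orthogonality, shows by induction on \<open>p\<close> that \<open>D p\<close>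
  integrated in \<open>t\<close> against the form \<open>A\<^sub>Z\<close> and in \<open>x\<close> against \<open>\<psi>\<^sub>Y d\<rho>\<close> gives \<open>\<integral> p dA\<^sub>Y\<close>, and that integrated in \<open>t\<close>
  against \<open>A\<^sub>X\<close> and in \<open>x\<close> against \<open>\<psi>\<^sub>Y d\<rho>\<close> it gives the same as integrated against \<open>A\<^sub>Y\<close> and \<open>d\<rho>\<close>. These are polynomial
  versions of \<open>L\<^sub>Z \<psi>\<^sub>Y = 0\<close> and \<open>L\<^sub>X \<psi>\<^sub>Y = L\<^sub>Y\<close> off the supports. On \<open>\<Delta>\<^sub>k\<close> the singular parts
  cancel in the combination of both identities that is a Wronskian in \<open>Y\<close> and \<open>Z\<close>, and \<open>C\<^sup>1\<close> limits of
  polynomials localise the result to \<open>N\<^sub>X \<psi>\<^sub>Y = N\<^sub>Y\<close>, where \<open>N\<^sub>Y\<close> is the numerator of \<open>\<Psi>\<close>. The denominators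
  do not vanish because Angelesco systems with weights of constant sign are still normal; the same normality
  gives the interlacing of zeros that bounds the recurrence coefficients.\<close>

subsection \<open>Square integrable functions\<close>

text \<open>The kernel has to be identified inside the supports, where the Cauchy integrals of
  \<mu>_k need not exist. Every identity is therefore stated first for polynomials, where
  \<open>(p(x) - p(t)) / (x - t)\<close> is harmless even at atoms, and is localised afterwards by
  test functions with a double zero on the singular intervals; C1 convergence keeps their divided
  differences uniformly convergent up to the diagonal. On \<Delta>_k itself the test function must
  not vanish. There the Wronskian combination is decisive, because it removes all divided
  differences of the test function with respect to \<mu>_k. Off the intervals the choice Y = X,
  where \<psi> = 1, shows that \<rho> lives on the zeros of the form of the parent. The form of a
  genuine vertex has no zeros there; at the root they are the points of E. The measure \<rho> is
  given only through its Stieltjes transform. Its support and its moments are extracted from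
  resolvent estimates, so unitarity rests on symmetry and boundedness of J alone and no spectral
  theorem is invoked.\<close>

definition sqi :: "'a measure \<Rightarrow> ('a \<Rightarrow> complex) \<Rightarrow> bool" where
  "sqi M f \<longleftrightarrow> f \<in> borel_measurable M \<and> integrable M (\<lambda>x. (cmod (f x))\<^sup>2)"

text \<open>For \<open>M = count_space S\<close> this is the \<open>ell2\<close> norm, so one theory
  serves both \<rho> and the functions on the tree.\<close>

definition n2 :: "'a measure \<Rightarrow> ('a \<Rightarrow> complex) \<Rightarrow> real" where
  "n2 M f = sqrt (\<integral>x. (cmod (f x))\<^sup>2 \<partial>M)"

definition ip :: "'a measure \<Rightarrow> ('a \<Rightarrow> complex) \<Rightarrow> ('a \<Rightarrow> complex) \<Rightarrow> complex" where
  "ip M f g = (\<integral>x. f x * cnj (g x) \<partial>M)"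

lemma sqi_meas [measurable_dest]: "sqi M f \<Longrightarrow> f \<in> borel_measurable M"
  by (simp add: sqi_def)

lemma sqi_int: "sqi M f \<Longrightarrow> integrable M (\<lambda>x. (cmod (f x))\<^sup>2)"
  by (simp add: sqi_def)

lemma cmod_mult_le: "cmod (a * b) \<le> (cmod a)\<^sup>2 + (cmod b)\<^sup>2"
proof -
  have "2 * (cmod a * cmod b) \<le> (cmod a)\<^sup>2 + (cmod b)\<^sup>2" "0 \<le> cmod a * cmod b"
    using sum_squares_bound[of "cmod a" "cmod b"] by simp_all
  then show ?thesis unfolding norm_mult by linarith
qed

lemma cmod_add_sq_le: "(cmod (a + b))\<^sup>2 \<le> 2 * (cmod a)\<^sup>2 + 2 * (cmod b)\<^sup>2"
proof -
  have "(cmod (a + b))\<^sup>2 \<le> (cmod a + cmod b)\<^sup>2"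
    by (simp add: norm_triangle_ineq power_mono)
  also have "\<dots> \<le> 2 * (cmod a)\<^sup>2 + 2 * (cmod b)\<^sup>2"
    using sum_squares_bound[of "cmod a" "cmod b"] by (simp add: power2_sum)
  finally show ?thesis .
qed

lemma sqi_add: assumes "sqi M f" "sqi M g" shows "sqi M (\<lambda>x. f x + g x)"
proof -
  have [measurable]: "f \<in> borel_measurable M" "g \<in> borel_measurable M"
    using assms by (auto simp: sqi_def)
  have "integrable M (\<lambda>x. 2 * (cmod (f x))\<^sup>2 + 2 * (cmod (g x))\<^sup>2)"
    using assms by (auto simp: sqi_def)
  then have "integrable M (\<lambda>x. (cmod (f x + g x))\<^sup>2)"
    by (rule Bochner_Integration.integrable_bound) (auto simp: cmod_add_sq_le intro!: AE_I2 order.trans[OF cmod_add_sq_le])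
  then show ?thesis by (simp add: sqi_def)
qed

lemma sqi_scale: assumes "sqi M f" shows "sqi M (\<lambda>x. c * f x)"
  using assms by (auto simp: sqi_def norm_mult power_mult_distrib)

lemma sqi_diff: "sqi M f \<Longrightarrow> sqi M g \<Longrightarrow> sqi M (\<lambda>x. f x - g x)"
  using sqi_add[of M f "\<lambda>x. (-1) * g x"] sqi_scale[of M g "-1"] by simp

lemma sqi_zero [simp]: "sqi M (\<lambda>x. 0)" by (simp add: sqi_def)

lemma sqi_cnj: "sqi M f \<Longrightarrow> sqi M (\<lambda>x. cnj (f x))"
  by (auto simp: sqi_def intro: borel_measurable_continuous_onI[THEN measurable_compose_rev] continuous_intros)

lemma sqi_mult_integrable: assumes "sqi M f" "sqi M g" shows "integrable M (\<lambda>x. f x * g x)"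
proof -
  have [measurable]: "f \<in> borel_measurable M" "g \<in> borel_measurable M"
    using assms by (auto simp: sqi_def)
  have "integrable M (\<lambda>x. (cmod (f x))\<^sup>2 + (cmod (g x))\<^sup>2)"
    using assms by (auto simp: sqi_def)
  then show ?thesis
    by (rule Bochner_Integration.integrable_bound) (auto simp: intro!: AE_I2 order.trans[OF cmod_mult_le])
qed

lemma ip_integrable: "sqi M f \<Longrightarrow> sqi M g \<Longrightarrow> integrable M (\<lambda>x. f x * cnj (g x))"
  by (rule sqi_mult_integrable) (auto intro: sqi_cnj)

lemma n2_nonneg [simp]: "0 \<le> n2 M f" by (simp add: n2_def)

lemma n2_sq: "(n2 M f)\<^sup>2 = (\<integral>x. (cmod (f x))\<^sup>2 \<partial>M)"
  by (simp add: n2_def)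

lemma ip_self: "ip M f f = of_real ((n2 M f)\<^sup>2)"
  unfolding ip_def n2_sq complex_norm_square[symmetric] by (simp flip: of_real_power)

lemma ip_cnj: "cnj (ip M f g) = ip M g f"
  unfolding ip_def
  using integral_bounded_linear'[OF bounded_linear_cnj bounded_linear_cnj, of M "\<lambda>x. f x * cnj (g x)"]
  by (simp add: mult.commute)

lemma ip_add_left: "sqi M f \<Longrightarrow> sqi M g \<Longrightarrow> sqi M h \<Longrightarrow> ip M (\<lambda>x. f x + g x) h = ip M f h + ip M g h"
  unfolding ip_def by (simp add: distrib_right ip_integrable)

lemma ip_scale_left: "ip M (\<lambda>x. c * f x) h = c * ip M f h"
  unfolding ip_def by (simp add: mult.assoc)

lemma ip_add_right: "sqi M f \<Longrightarrow> sqi M g \<Longrightarrow> sqi M h \<Longrightarrow> ip M h (\<lambda>x. f x + g x) = ip M h f + ip M h g"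
  using arg_cong[OF ip_add_left[of M f g h], of cnj] by (simp add: ip_cnj)

lemma ip_scale_right: "ip M h (\<lambda>x. c * f x) = cnj c * ip M h f"
  using arg_cong[OF ip_scale_left[of M c f h], of cnj] by (simp add: ip_cnj)

lemma ip_diff_left: "sqi M f \<Longrightarrow> sqi M g \<Longrightarrow> sqi M h \<Longrightarrow> ip M (\<lambda>x. f x - g x) h = ip M f h - ip M g h"
  unfolding ip_def by (simp add: left_diff_distrib ip_integrable)

lemma ip_diff_right: "sqi M f \<Longrightarrow> sqi M g \<Longrightarrow> sqi M h \<Longrightarrow> ip M h (\<lambda>x. f x - g x) = ip M h f - ip M h g"
  using arg_cong[OF ip_diff_left[of M f g h], of cnj] by (simp add: ip_cnj)

lemma n2_scale: "n2 M (\<lambda>x. c * f x) = cmod c * n2 M f"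
  by (simp add: n2_def norm_mult power_mult_distrib real_sqrt_mult)

lemma n2_add_sq: assumes "sqi M f" "sqi M g"
  shows "(n2 M (\<lambda>x. f x + g x))\<^sup>2 = (n2 M f)\<^sup>2 + (n2 M g)\<^sup>2 + 2 * Re (ip M f g)"
proof -
  have s: "sqi M (\<lambda>x. f x + g x)" using assms by (rule sqi_add)
  have "of_real ((n2 M (\<lambda>x. f x + g x))\<^sup>2) = ip M (\<lambda>x. f x + g x) (\<lambda>x. f x + g x)"
    by (simp only: ip_self)
  also have "\<dots> = ip M f f + ip M f g + (ip M g f + ip M g g)"
    by (simp add: ip_add_left ip_add_right assms s)
  finally have "of_real ((n2 M (\<lambda>x. f x + g x))\<^sup>2) = of_real ((n2 M f)\<^sup>2) + ip M f g + (cnj (ip M f g) + of_real ((n2 M g)\<^sup>2))"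
    by (simp add: ip_self ip_cnj)
  then have "Re (of_real ((n2 M (\<lambda>x. f x + g x))\<^sup>2)) = Re (of_real ((n2 M f)\<^sup>2) + ip M f g + (cnj (ip M f g) + of_real ((n2 M g)\<^sup>2)))"
    by (rule arg_cong)
  then show ?thesis by simp
qed

lemma n2_diff_sq: assumes "sqi M f" "sqi M g"
  shows "(n2 M (\<lambda>x. f x - g x))\<^sup>2 = (n2 M f)\<^sup>2 + (n2 M g)\<^sup>2 - 2 * Re (ip M f g)"
  using n2_add_sq[OF assms(1) sqi_scale[OF assms(2), of "-1"]]
  using ip_scale_right[of M f "-1" g] n2_scale[of M "-1" g] by simp

text \<open>Expand the norm of \<open>f - t c g\<close> with \<open>c = ip M f g\<close> and
  \<open>t\<close> real. If \<open>n2 M g\<close> is positive, \<open>t = 1 / (n2 M g)^2\<close>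
  gives the bound; if it is zero, the estimate holds for every \<open>t\<close> and a large one
  forces \<open>c = 0\<close>.\<close>

lemma cauchy_schwarz: assumes "sqi M f" "sqi M g" shows "cmod (ip M f g) \<le> n2 M f * n2 M g"
proof -
  define c where "c = ip M f g"
  have key: "2 * t * (cmod c)\<^sup>2 \<le> (n2 M f)\<^sup>2 + t\<^sup>2 * (cmod c)\<^sup>2 * (n2 M g)\<^sup>2" for t :: real
  proof -
    have "0 \<le> (n2 M (\<lambda>x. f x - (of_real t * c) * g x))\<^sup>2" by simp
    also have "\<dots> = (n2 M f)\<^sup>2 + (n2 M (\<lambda>x. (of_real t * c) * g x))\<^sup>2 - 2 * Re (ip M f (\<lambda>x. (of_real t * c) * g x))"
      by (intro n2_diff_sq assms sqi_scale)
    also have "ip M f (\<lambda>x. (of_real t * c) * g x) = of_real (t * (cmod c)\<^sup>2)"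
      unfolding ip_scale_right by (simp add: c_def[symmetric] mult.assoc)
        (metis complex_norm_square mult.commute of_real_power)
    also have "n2 M (\<lambda>x. (of_real t * c) * g x) = \<bar>t\<bar> * cmod c * n2 M g"
      unfolding n2_scale by (simp add: norm_mult)
    finally show ?thesis by (simp add: power_mult_distrib)
  qed
  show ?thesis
  proof (cases "n2 M g = 0")
    case True
    have "c = 0"
    proof (rule ccontr)
      assume "c \<noteq> 0"
      then have "0 < (cmod c)\<^sup>2" by simp
      moreover have "2 * (((n2 M f)\<^sup>2 + 1) / (2 * (cmod c)\<^sup>2)) * (cmod c)\<^sup>2 \<le> (n2 M f)\<^sup>2"
        using key[of "((n2 M f)\<^sup>2 + 1) / (2 * (cmod c)\<^sup>2)"] True by simp
      ultimately show False by (simp add: field_simps)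
    qed
    then show ?thesis by (simp add: c_def)
  next
    case False
    then have p: "0 < (n2 M g)\<^sup>2" by simp
    have "2 * (1 / (n2 M g)\<^sup>2) * (cmod c)\<^sup>2 \<le> (n2 M f)\<^sup>2 + (1 / (n2 M g)\<^sup>2)\<^sup>2 * (cmod c)\<^sup>2 * (n2 M g)\<^sup>2"
      by (rule key)
    also have "(1 / (n2 M g)\<^sup>2)\<^sup>2 * (cmod c)\<^sup>2 * (n2 M g)\<^sup>2 = (cmod c)\<^sup>2 / (n2 M g)\<^sup>2"
      using False by (simp add: field_simps power2_eq_square)
    finally have "(cmod c)\<^sup>2 / (n2 M g)\<^sup>2 \<le> (n2 M f)\<^sup>2" by simp
    then have "(cmod c)\<^sup>2 \<le> (n2 M f * n2 M g)\<^sup>2"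
      using p by (simp add: field_simps power_mult_distrib)
    then show ?thesis unfolding c_def[symmetric] by (rule power2_le_imp_le) simp
  qed
qed

lemma n2_triangle: assumes "sqi M f" "sqi M g"
  shows "n2 M (\<lambda>x. f x + g x) \<le> n2 M f + n2 M g"
proof (rule power2_le_imp_le)
  have "Re (ip M f g) \<le> n2 M f * n2 M g"
    using cauchy_schwarz[OF assms] complex_Re_le_cmod order_trans by blast
  then show "(n2 M (\<lambda>x. f x + g x))\<^sup>2 \<le> (n2 M f + n2 M g)\<^sup>2"
    unfolding n2_add_sq[OF assms] by (simp add: power2_sum)
qed simp

lemma n2_minus_commute: "n2 M (\<lambda>x. f x - g x) = n2 M (\<lambda>x. g x - f x)"
  by (simp add: n2_def norm_minus_commute)

lemma n2_triangle_diff: assumes "sqi M f" "sqi M g" "sqi M h"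
  shows "n2 M (\<lambda>x. f x - h x) \<le> n2 M (\<lambda>x. f x - g x) + n2 M (\<lambda>x. g x - h x)"
  using n2_triangle[OF sqi_diff[OF assms(1,2)] sqi_diff[OF assms(2,3)]] by simp

lemma n2_le_add: assumes "sqi M f" "sqi M g"
  shows "n2 M f \<le> n2 M g + n2 M (\<lambda>x. f x - g x)"
  using n2_triangle[OF assms(2) sqi_diff[OF assms]] by simp

lemma n2_abs_diff: assumes "sqi M f" "sqi M g"
  shows "\<bar>n2 M f - n2 M g\<bar> \<le> n2 M (\<lambda>x. f x - g x)"
  using n2_le_add[OF assms] n2_le_add[OF assms(2,1)] n2_minus_commute[of M f g] by linarith

lemma n2_cong_AE: assumes "sqi M f" "sqi M g" "AE x in M. f x = g x" shows "n2 M f = n2 M g"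
  unfolding n2_def
  by (intro arg_cong[where f=sqrt] integral_cong_AE)
     (use assms in \<open>auto simp: sqi_def\<close>)

lemma ip_tendsto: assumes "\<And>n. sqi M (f n)" "sqi M f'" "sqi M g"
    and "(\<lambda>n. n2 M (\<lambda>x. f n x - f' x)) \<longlonglongrightarrow> 0"
  shows "(\<lambda>n. ip M (f n) g) \<longlonglongrightarrow> ip M f' g"
proof -
  have "(\<lambda>n. ip M (f n) g - ip M f' g) \<longlonglongrightarrow> 0"
  proof (rule Lim_null_comparison)
    show "\<forall>\<^sub>F n in sequentially. norm (ip M (f n) g - ip M f' g) \<le> n2 M (\<lambda>x. f n x - f' x) * n2 M g"
      using cauchy_schwarz[OF sqi_diff[OF assms(1,2)] assms(3)] by (simp add: ip_diff_left assms)
    show "(\<lambda>n. n2 M (\<lambda>x. f n x - f' x) * n2 M g) \<longlonglongrightarrow> 0"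
      using tendsto_mult_left_zero[OF assms(4)] by simp
  qed
  then show ?thesis by (simp add: LIM_zero_iff)
qed

section \<open>Completeness of L2 by Fatou's lemma\<close>

definition n2_Cauchy :: "'a measure \<Rightarrow> (nat \<Rightarrow> 'a \<Rightarrow> complex) \<Rightarrow> bool" where
  "n2_Cauchy M f \<longleftrightarrow> (\<forall>e>0. \<exists>N. \<forall>m\<ge>N. \<forall>n\<ge>N. n2 M (\<lambda>x. f m x - f n x) < e)"

lemma n2_nn: assumes "sqi M f"
  shows "(\<integral>\<^sup>+x. ennreal ((cmod (f x))\<^sup>2) \<partial>M) = ennreal ((n2 M f)\<^sup>2)"
  unfolding n2_sq by (rule nn_integral_eq_integral) (use assms in \<open>auto simp: sqi_def\<close>)

lemma sqi_nnI: assumes "f \<in> borel_measurable M" "(\<integral>\<^sup>+x. ennreal ((cmod (f x))\<^sup>2) \<partial>M) \<le> ennreal c" "0 \<le> c"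
  shows "sqi M f" "(n2 M f)\<^sup>2 \<le> c"
proof -
  show s: "sqi M f" unfolding sqi_def
    using assms by (auto intro!: integrableI_nonneg simp: less_top[symmetric] top_unique)
  show "(n2 M f)\<^sup>2 \<le> c" using n2_nn[OF s] assms by simp
qed

text \<open>Fatou, applied to \<open>f m - f (r n)\<close> as n grows, turns convergence almost
  everywhere of a subsequence into norm convergence of the whole Cauchy sequence; square
  integrability of \<open>g\<close> is part of the outcome. Besides completeness this identifies
  limits in \<open>ell2\<close> from pointwise convergence.\<close>

lemma n2_fatou:
  assumes f: "\<And>n. sqi M (f n)" and g: "g \<in> borel_measurable M"
    and r: "strict_mono r" and lim: "AE x in M. (\<lambda>n. f (r n) x) \<longlonglongrightarrow> g x" and C: "n2_Cauchy M f"
  shows "sqi M g" "(\<lambda>n. n2 M (\<lambda>x. f n x - g x)) \<longlonglongrightarrow> 0"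
proof -
  have fm[measurable]: "f n \<in> borel_measurable M" for n using f by (rule sqi_meas)
  note g[measurable]
  have key: "sqi M (\<lambda>x. f m x - g x) \<and> (n2 M (\<lambda>x. f m x - g x))\<^sup>2 \<le> e\<^sup>2"
    if m: "m \<ge> N" and e: "e > 0" and N: "\<forall>m\<ge>N. \<forall>n\<ge>N. n2 M (\<lambda>x. f m x - f n x) < e" for m N e
  proof -
    have "(\<integral>\<^sup>+x. ennreal ((cmod (f m x - g x))\<^sup>2) \<partial>M)
        = (\<integral>\<^sup>+x. liminf (\<lambda>n. ennreal ((cmod (f m x - f (r n) x))\<^sup>2)) \<partial>M)"
    proof (rule nn_integral_cong_AE, use lim in eventually_elim)
      case (elim x)
      have "(\<lambda>n. ennreal ((cmod (f m x - f (r n) x))\<^sup>2)) \<longlonglongrightarrow> ennreal ((cmod (f m x - g x))\<^sup>2)"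
        using elim by (intro tendsto_intros)
      from lim_imp_Liminf[OF _ this] show ?case by simp
    qed
    also have "\<dots> \<le> liminf (\<lambda>n. \<integral>\<^sup>+x. ennreal ((cmod (f m x - f (r n) x))\<^sup>2) \<partial>M)"
      by (rule nn_integral_liminf) simp
    also have "\<dots> \<le> ennreal (e\<^sup>2)"
    proof (rule Liminf_le)
      have "\<forall>\<^sub>F n in sequentially. r n \<ge> N"
        using r by (meson eventually_at_top_linorder le_trans seq_suble)
      then show "\<forall>\<^sub>F n in sequentially. (\<integral>\<^sup>+x. ennreal ((cmod (f m x - f (r n) x))\<^sup>2) \<partial>M) \<le> ennreal (e\<^sup>2)"
      proof eventually_elim
        case (elim n)
        have "n2 M (\<lambda>x. f m x - f (r n) x) < e" using N m elim by blast
        then show ?case unfolding n2_nn[OF sqi_diff[OF f f]]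
          by (intro ennreal_leI power_mono) auto
      qed
    qed simp
    finally show ?thesis using sqi_nnI[of "\<lambda>x. f m x - g x" M "e\<^sup>2"] by simp
  qed
  from C obtain N where N: "\<forall>m\<ge>N. \<forall>n\<ge>N. n2 M (\<lambda>x. f m x - f n x) < 1"
    unfolding n2_Cauchy_def by (meson zero_less_one)
  have "sqi M (\<lambda>x. f N x - g x)" using key[of N N 1] N by auto
  from sqi_diff[OF f[of N] this] show "sqi M g" by simp
  show "(\<lambda>n. n2 M (\<lambda>x. f n x - g x)) \<longlonglongrightarrow> 0"
  proof (rule LIMSEQ_I)
    fix e :: real assume e: "0 < e"
    then obtain N where N: "\<forall>m\<ge>N. \<forall>n\<ge>N. n2 M (\<lambda>x. f m x - f n x) < e/2"
      using C unfolding n2_Cauchy_def by (meson half_gt_zero)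
    have "n2 M (\<lambda>x. f m x - g x) \<le> e/2" if "m \<ge> N" for m
      using key[OF that _ N] e power2_le_imp_le[of "n2 M (\<lambda>x. f m x - g x)" "e/2"] by auto
    then show "\<exists>no. \<forall>n\<ge>no. norm (n2 M (\<lambda>x. f n x - g x) - 0) < e"
      using e by (intro exI[of _ N]) fastforce
  qed
qed

lemma n2_conv_Cauchy: assumes "\<And>n. sqi M (f n)" "sqi M g" "(\<lambda>n. n2 M (\<lambda>x. f n x - g x)) \<longlonglongrightarrow> 0"
  shows "n2_Cauchy M f"
  unfolding n2_Cauchy_def
proof (intro allI impI)
  fix e :: real assume "e > 0"
  then obtain N where N: "\<forall>n\<ge>N. n2 M (\<lambda>x. f n x - g x) < e/2"
    using LIMSEQ_D[OF assms(3), of "e/2"] by auto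
  have "n2 M (\<lambda>x. f m x - f n x) < e" if "m \<ge> N" "n \<ge> N" for m n
    using n2_triangle_diff[OF assms(1)[of m] assms(2) assms(1)[of n]] N[rule_format, OF that(1)]
      N[rule_format, OF that(2)] n2_minus_commute[of M g "f n"] by linarith
  then show "\<exists>N. \<forall>m\<ge>N. \<forall>n\<ge>N. n2 M (\<lambda>x. f m x - f n x) < e" by blast
qed

lemma n2_complete: assumes f: "\<And>n. sqi M (f n)" and C: "n2_Cauchy M f"
  obtains g where "sqi M g" "(\<lambda>n. n2 M (\<lambda>x. f n x - g x)) \<longlonglongrightarrow> 0"
proof -
  have fm[measurable]: "f n \<in> borel_measurable M" for n using f by (rule sqi_meas)
  have "\<exists>N. \<forall>m\<ge>N. \<forall>n\<ge>N. n2 M (\<lambda>x. f m x - f n x) < (1/2)^k" for k :: nat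
    using C unfolding n2_Cauchy_def by (meson half_gt_zero zero_less_power zero_less_one)
  then obtain N where N: "\<And>k m n. m \<ge> N k \<Longrightarrow> n \<ge> N k \<Longrightarrow> n2 M (\<lambda>x. f m x - f n x) < (1/2)^k"
    by metis
  \<comment> \<open>The summand \<open>k\<close> makes \<open>r\<close> strictly increasing, and the
    sum makes it dominate every \<open>N i\<close> with \<open>i \<le> k\<close>.\<close>
  define r where "r k = k + (\<Sum>i\<le>k. N i)" for k
  have r: "strict_mono r" unfolding strict_mono_Suc_iff r_def by simp
  have rN: "r k \<ge> N k" for k
    unfolding r_def using member_le_sum[of k "{..k}" N] by (simp add: trans_le_add2)
  define d where "d k x = cmod (f (r (Suc k)) x - f (r k) x)" for k x
  have dm[measurable]: "d k \<in> borel_measurable M" for k unfolding d_def by measurable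
  have dn: "(\<integral>\<^sup>+x. ennreal ((d k x)\<^sup>2) \<partial>M) \<le> ennreal ((1/4)^k)" for k
  proof -
    have "n2 M (\<lambda>x. f (r (Suc k)) x - f (r k) x) < (1/2)^k"
      by (rule N) (use rN[of k] strict_monoD[OF r, of k "Suc k"] in auto)
    then have "(n2 M (\<lambda>x. f (r (Suc k)) x - f (r k) x))\<^sup>2 \<le> ((1/2)^k)\<^sup>2"
      by (intro power_mono) auto
    also have "((1/2::real)^k)\<^sup>2 = (1/4)^k"
      by (simp add: power2_eq_square power_mult_distrib[symmetric])
    finally show ?thesis unfolding d_def n2_nn[OF sqi_diff[OF f f]] by (rule ennreal_leI)
  qed
  \<comment> \<open>The weights \<open>2^k\<close> are affordable since the squares of
    \<open>d k\<close> have integral at most \<open>4^-k\<close>. They allow the pointwise bound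
    \<open>d k \<le> 2^k (d k)^2 + 2^-k\<close>, which makes the telescoping series converge
    absolutely almost everywhere.\<close>
  have "(\<integral>\<^sup>+x. (\<Sum>k. ennreal (2^k * (d k x)\<^sup>2)) \<partial>M) = (\<Sum>k. \<integral>\<^sup>+x. ennreal (2^k * (d k x)\<^sup>2) \<partial>M)"
    by (rule nn_integral_suminf) simp
  also have "\<dots> \<le> (\<Sum>k. ennreal ((1/2)^k))"
  proof (rule suminf_le)
    fix k
    have "(\<integral>\<^sup>+x. ennreal (2^k * (d k x)\<^sup>2) \<partial>M) = ennreal (2^k) * (\<integral>\<^sup>+x. ennreal ((d k x)\<^sup>2) \<partial>M)"
      by (subst nn_integral_cmult[symmetric]) (auto simp: ennreal_mult)
    also have "\<dots> \<le> ennreal (2^k) * ennreal ((1/4)^k)" by (rule mult_left_mono[OF dn]) simp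
    also have "\<dots> = ennreal ((1/2)^k)"
      by (simp add: ennreal_mult[symmetric] power_mult_distrib[symmetric])
    finally show "(\<integral>\<^sup>+x. ennreal (2^k * (d k x)\<^sup>2) \<partial>M) \<le> ennreal ((1/2)^k)" .
  qed auto
  also have "\<dots> = ennreal (\<Sum>k. (1/2)^k)" by (rule suminf_ennreal2) (auto intro: summable_geometric)
  also have "\<dots> < \<infinity>" by simp
  finally have "AE x in M. (\<Sum>k. ennreal (2^k * (d k x)\<^sup>2)) \<noteq> \<infinity>"
    by (intro nn_integral_noteq_infinite) auto
  then have AE: "AE x in M. convergent (\<lambda>n. f (r n) x)"
  proof eventually_elim
    case (elim x)
    then have s: "summable (\<lambda>k. 2^k * (d k x)\<^sup>2)"
      by (intro summable_suminf_not_top) auto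
    have "summable (\<lambda>k. 2^k * (d k x)\<^sup>2 + (1/2)^k)"
      by (intro summable_add s summable_geometric) auto
    then have "summable (\<lambda>k. d k x)"
    proof (rule summable_comparison_test'[where N=0])
      fix k :: nat
      have "2 * ((2^k * d k x) * 1) \<le> (2^k * d k x)\<^sup>2 + 1\<^sup>2"
        using sum_squares_bound[of "2^k * d k x" 1] by simp
      then have "(2^k * d k x) \<le> (2^k * d k x)\<^sup>2 + 1"
        by (smt (verit) d_def mult_nonneg_nonneg norm_ge_zero one_power2 zero_le_power)
      then have "(1/2)^k * (2^k * d k x) \<le> (1/2)^k * ((2^k * d k x)\<^sup>2 + 1)"
        by (rule mult_left_mono) simp
      then show "norm (d k x) \<le> 2^k * (d k x)\<^sup>2 + (1/2)^k"
        by (simp add: d_def power_one_over field_simps power2_eq_square)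
    qed
    then have "summable (\<lambda>k. f (r (Suc k)) x - f (r k) x)"
      unfolding d_def by (rule summable_norm_cancel)
    then have "convergent (\<lambda>n. \<Sum>k<n. f (r (Suc k)) x - f (r k) x)"
      by (simp add: summable_iff_convergent)
    then have "convergent (\<lambda>n. f (r n) x - f (r 0) x)"
      by (subst (asm) sum_lessThan_telescope)
    then show ?case using convergent_add[OF _ convergent_const[of "f (r 0) x"]] by fastforce
  qed
  define g where "g x = lim (\<lambda>n. f (r n) x)" for x
  have gm: "g \<in> borel_measurable M" unfolding g_def by measurable
  have lim: "AE x in M. (\<lambda>n. f (r n) x) \<longlonglongrightarrow> g x"
    using AE unfolding g_def convergent_LIMSEQ_iff .
  show ?thesis using that n2_fatou[OF f gm r lim C] by blast
qed

section \<open>Riesz representation on a subspace\<close>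

lemma LIMSEQ_inv_plus1: "(\<lambda>n. 1 / (real n + 1)) \<longlonglongrightarrow> 0"
  using LIMSEQ_inverse_real_of_nat by (simp add: inverse_eq_divide add.commute)

text \<open>The representative minimises \<open>|p|^2 - 2 Re (l p)\<close>. Since \<open>V\<close>
  need not be closed, it is obtained as the limit of a minimising sequence, which is Cauchy by the
  parallelogram estimate; the sequence is returned because it places \<phi> in the closure of
  \<open>V\<close>.\<close>

lemma riesz_subspace:
  fixes V :: "('a \<Rightarrow> complex) set" and l :: "('a \<Rightarrow> complex) \<Rightarrow> complex"
  assumes V: "\<And>p. p \<in> V \<Longrightarrow> sqi M p" and V0: "V \<noteq> {}"
    and Vadd: "\<And>p q c. p \<in> V \<Longrightarrow> q \<in> V \<Longrightarrow> (\<lambda>x. p x + c * q x) \<in> V"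
    and lin: "\<And>p q c. p \<in> V \<Longrightarrow> q \<in> V \<Longrightarrow> l (\<lambda>x. p x + c * q x) = l p + c * l q"
    and bd: "\<And>p. p \<in> V \<Longrightarrow> cmod (l p) \<le> K * n2 M p"
  obtains p \<phi> where "\<And>n. p n \<in> V" "sqi M \<phi>" "(\<lambda>n. n2 M (\<lambda>x. p n x - \<phi> x)) \<longlonglongrightarrow> 0"
    "\<And>q. q \<in> V \<Longrightarrow> ip M q \<phi> = l q"
proof -
  define I where "I p = (n2 M p)\<^sup>2 - 2 * Re (l p)" for p
  have Ilow: "- K\<^sup>2 \<le> I p" if "p \<in> V" for p
  proof -
    have "Re (l p) \<le> K * n2 M p" using bd[OF that] complex_Re_le_cmod order_trans by blast
    then show ?thesis unfolding I_def
      using zero_le_power2[of "n2 M p - K"] unfolding power2_diff by (simp add: mult.commute)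
  qed
  define m where "m = Inf (I ` V)"
  have bb: "bdd_below (I ` V)" using Ilow by (intro bdd_belowI[of _ "- K\<^sup>2"]) auto
  have mI: "m \<le> I p" if "p \<in> V" for p
    unfolding m_def using bb that by (intro cInf_lower) auto
  have "\<exists>p\<in>V. I p < m + 1 / (real n + 1)" for n
    using cInf_lessD[of "I ` V" "m + 1 / (real n + 1)"] V0 unfolding m_def by auto
  then obtain p where p: "\<And>n. p n \<in> V" "\<And>n. I (p n) < m + 1 / (real n + 1)" by metis
  have Iadd: "I (\<lambda>x. a x + c * b x) = I a + 2 * Re (cnj c * ip M a b) - 2 * Re (c * l b) + (cmod c)\<^sup>2 * (n2 M b)\<^sup>2"
    if "a \<in> V" "b \<in> V" for a b c
    unfolding I_def n2_add_sq[OF V[OF that(1)] sqi_scale[OF V[OF that(2)]]] lin[OF that] n2_scale ip_scale_right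
    by (simp add: power_mult_distrib)
  have par: "(n2 M (\<lambda>x. a x - b x))\<^sup>2 \<le> 2 * (I a - m) + 2 * (I b - m)" if "a \<in> V" "b \<in> V" for a b
  proof -
    \<comment> \<open>Closure of \<open>V\<close> is available only in the form
      \<open>p + c q\<close>, so a scalar multiple is reached through the zero function.\<close>
    have "(\<lambda>x. a x + (-1) * a x) \<in> V" by (rule Vadd) (use that in auto)
    from Vadd[OF this that(1), of "1/2"] have h: "(\<lambda>x. (1/2) * a x) \<in> V" by simp
    have l0: "l (\<lambda>x. a x + (-1) * a x) = 0" using lin[OF that(1) that(1), of "-1"] by simp
    have lh: "l (\<lambda>x. (1/2) * a x) = (1/2) * l a"
      using lin[OF \<open>(\<lambda>x. a x + (-1) * a x) \<in> V\<close> that(1), of "1/2"] l0 by simp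
    have "m \<le> I (\<lambda>x. (1/2) * a x + (1/2) * b x)" by (rule mI, rule Vadd[OF h that(2)])
    also have "\<dots> = (n2 M (\<lambda>x. (1/2) * a x + (1/2) * b x))\<^sup>2 - Re (l a) - Re (l b)"
      unfolding I_def lin[OF h that(2)] lh by simp
    also have "(n2 M (\<lambda>x. (1/2) * a x + (1/2) * b x))\<^sup>2 = (n2 M (\<lambda>x. (1/2) * a x))\<^sup>2 + (n2 M (\<lambda>x. (1/2) * b x))\<^sup>2
        + 2 * Re (ip M (\<lambda>x. (1/2) * a x) (\<lambda>x. (1/2) * b x))"
      by (intro n2_add_sq sqi_scale V that)
    also have "\<dots> = (n2 M a)\<^sup>2 / 4 + (n2 M b)\<^sup>2 / 4 + Re (ip M a b) / 2"
      unfolding n2_scale ip_scale_left ip_scale_right by (simp add: power_mult_distrib power2_eq_square)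
    finally show ?thesis unfolding n2_diff_sq[OF V[OF that(1)] V[OF that(2)]] I_def by simp
  qed
  have "n2_Cauchy M p" unfolding n2_Cauchy_def
  proof (intro allI impI)
    fix e :: real assume e: "e > 0"
    then obtain N :: nat where N: "4 / e\<^sup>2 < real N + 1"
      by (meson reals_Archimedean2 less_add_one less_trans)
    have "n2 M (\<lambda>x. p i x - p j x) < e" if "i \<ge> N" "j \<ge> N" for i j
    proof -
      have a: "1 / (real k + 1) < e\<^sup>2 / 4" if "k \<ge> N" for k
      proof -
        have "1 / (real k + 1) \<le> 1 / (real N + 1)" using that by (simp add: frac_le)
        also have "\<dots> < e\<^sup>2 / 4" using N e by (simp add: field_simps)
        finally show ?thesis .
      qed
      have "(n2 M (\<lambda>x. p i x - p j x))\<^sup>2 < e\<^sup>2"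
      proof -
        have "I (p k) - m < e\<^sup>2 / 4" if "k \<ge> N" for k
          using less_trans[OF p(2)[of k] add_strict_left_mono[OF a[OF that], of m]] by simp
        from this[OF that(1)] this[OF that(2)] show ?thesis
          using par[OF p(1)[of i] p(1)[of j]] by simp
      qed
      then show ?thesis by (rule power2_less_imp_less) (use e in simp)
    qed
    then show "\<exists>N. \<forall>m\<ge>N. \<forall>n\<ge>N. n2 M (\<lambda>x. p m x - p n x) < e" by blast
  qed
  from n2_complete[OF V[OF p(1)] this] obtain \<phi> where
    phi: "sqi M \<phi>" "(\<lambda>n. n2 M (\<lambda>x. p n x - \<phi> x)) \<longlonglongrightarrow> 0" by blast
  have "ip M q \<phi> = l q" if q: "q \<in> V" for q
  proof -
    define w where "w = ip M q \<phi> - l q"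
    \<comment> \<open>Minimality, tested with the variation \<open>c q\<close> and passed to the
      limit along the minimising sequence.\<close>
    have ge: "0 \<le> 2 * Re (c * w) + (cmod c)\<^sup>2 * (n2 M q)\<^sup>2" for c
    proof (rule LIMSEQ_le_const)
      have "(\<lambda>n. ip M (p n) q) \<longlonglongrightarrow> ip M \<phi> q" by (rule ip_tendsto[OF V[OF p(1)] phi(1) V[OF q] phi(2)])
      then have "(\<lambda>n. 1 / (real n + 1) + 2 * Re (cnj c * ip M (p n) q) - 2 * Re (c * l q) + (cmod c)\<^sup>2 * (n2 M q)\<^sup>2)
        \<longlonglongrightarrow> 0 + 2 * Re (cnj c * ip M \<phi> q) - 2 * Re (c * l q) + (cmod c)\<^sup>2 * (n2 M q)\<^sup>2"
        by (intro tendsto_intros LIMSEQ_inv_plus1)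
      moreover have "Re (cnj c * ip M \<phi> q) = Re (c * ip M q \<phi>)"
        by (metis complex_cnj_cnj complex_cnj_mult ip_cnj cnj.sel(1))
      ultimately show "(\<lambda>n. 1 / (real n + 1) + 2 * Re (cnj c * ip M (p n) q) - 2 * Re (c * l q) + (cmod c)\<^sup>2 * (n2 M q)\<^sup>2)
        \<longlonglongrightarrow> 2 * Re (c * w) + (cmod c)\<^sup>2 * (n2 M q)\<^sup>2"
        by (simp only: w_def right_diff_distrib minus_complex.simps add_0_left)
      show "\<exists>N. \<forall>n\<ge>N. 0 \<le> 1 / (real n + 1) + 2 * Re (cnj c * ip M (p n) q) - 2 * Re (c * l q) + (cmod c)\<^sup>2 * (n2 M q)\<^sup>2"
      proof (intro exI allI impI)
        fix n :: nat
        have "m \<le> I (\<lambda>x. p n x + c * q x)" by (rule mI[OF Vadd[OF p(1) q]])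
        then show "0 \<le> 1 / (real n + 1) + 2 * Re (cnj c * ip M (p n) q) - 2 * Re (c * l q) + (cmod c)\<^sup>2 * (n2 M q)\<^sup>2"
          unfolding Iadd[OF p(1) q] using p(2)[of n] by linarith
      qed
    qed
    have "w = 0"
    proof (rule ccontr)
      assume "w \<noteq> 0"
      then have wp: "0 < (cmod w)\<^sup>2" by simp
      \<comment> \<open>With \<open>c = - s cnj w\<close> the linear term wins because
        \<open>s (n2 M q)^2 < 2\<close>; the added 1 covers the case of a vanishing norm.\<close>
      define s where "s = 1 / ((n2 M q)\<^sup>2 + 1)"
      have s: "s > 0" unfolding s_def by (simp add: add_nonneg_pos)
      have "0 \<le> 2 * Re ((- of_real s * cnj w) * w) + (cmod (- of_real s * cnj w))\<^sup>2 * (n2 M q)\<^sup>2" by (rule ge)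
      also have "(- of_real s * cnj w) * w = - of_real (s * (cmod w)\<^sup>2)"
        using complex_norm_square[of w] by (simp add: mult.assoc mult.commute)
      also have "(cmod (- of_real s * cnj w))\<^sup>2 = s\<^sup>2 * (cmod w)\<^sup>2" by (simp add: norm_mult power_mult_distrib)
      finally have "0 \<le> s * (cmod w)\<^sup>2 * (s * (n2 M q)\<^sup>2 - 2)"
        by (simp add: algebra_simps power2_eq_square)
      moreover have "0 < s * (cmod w)\<^sup>2" using s wp by simp
      ultimately have "2 \<le> s * (n2 M q)\<^sup>2" by (simp only: zero_le_mult_iff) linarith
      moreover have "s * (n2 M q)\<^sup>2 \<le> s * ((n2 M q)\<^sup>2 + 1)" using s by (intro mult_left_mono) auto
      moreover have "s * ((n2 M q)\<^sup>2 + 1) = 1"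
        unfolding s_def using zero_le_power2[of "n2 M q"] by (simp add: add_nonneg_eq_0_iff)
      ultimately show False by simp
    qed
    then show ?thesis by (simp add: w_def)
  qed
  with that[of p \<phi>] p phi show ?thesis by blast
qed

subsection \<open>Polynomial approximation and determinacy\<close>

lemma poly_map_of_real [simp]:
  "poly (map_poly complex_of_real p) (of_real x) = of_real (poly p x)"
  by (induct p) (simp_all add: map_poly_pCons)

lemma real_poly_approx:
  fixes f :: "real \<Rightarrow> real"
  assumes "compact K" "continuous_on K f" "0 < e"
  obtains p :: "real poly" where "\<And>x. x \<in> K \<Longrightarrow> \<bar>f x - poly p x\<bar> < e"
proof -
  from Stone_Weierstrass_real_polynomial_function[OF assms] obtain g where
    g: "real_polynomial_function g" "\<And>x. x \<in> K \<Longrightarrow> \<bar>f x - g x\<bar> < e" by blast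
  then obtain a n where "g = (\<lambda>x. \<Sum>i\<le>n. a i * x ^ i)"
    using real_polynomial_function_iff_sum by blast
  then have "g x = poly (\<Sum>i\<le>n. monom (a i) i) x" for x
    by (simp add: poly_sum poly_monom)
  with g(2) that show ?thesis by metis
qed

lemma complex_poly_approx:
  fixes f :: "real \<Rightarrow> complex"
  assumes "compact K" "continuous_on K f" "0 < e"
  obtains p :: "complex poly" where "\<And>x. x \<in> K \<Longrightarrow> cmod (f x - poly p (of_real x)) < e"
proof -
  obtain p where p: "\<And>x. x \<in> K \<Longrightarrow> \<bar>Re (f x) - poly p x\<bar> < e/2"
    by (rule real_poly_approx[of K "\<lambda>x. Re (f x)" "e/2"]) (use assms in \<open>auto intro: continuous_intros\<close>)
  obtain q where q: "\<And>x. x \<in> K \<Longrightarrow> \<bar>Im (f x) - poly q x\<bar> < e/2"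
    by (rule real_poly_approx[of K "\<lambda>x. Im (f x)" "e/2"]) (use assms in \<open>auto intro: continuous_intros\<close>)
  have "cmod (f x - poly (map_poly of_real p + smult \<i> (map_poly of_real q)) (of_real x)) < e" if "x \<in> K" for x
  proof -
    have "f x - poly (map_poly of_real p + smult \<i> (map_poly of_real q)) (of_real x)
       = Complex (Re (f x) - poly p x) (Im (f x) - poly q x)"
      by (simp add: complex_eq_iff)
    then show ?thesis using p[OF that] q[OF that] complex_norm_square
      using cmod_le[of "Complex (Re (f x) - poly p x) (Im (f x) - poly q x)"] by simp
  qed
  with that show ?thesis by blast
qed

section \<open>Simultaneous approximation of a function and its derivative\<close>

lemma ex_poly_antideriv: "\<exists>q :: real poly. pderiv q = p"
proof (rule exI)
  show "pderiv (\<Sum>i\<le>degree p. monom (coeff p i / real (Suc i)) (Suc i)) = p"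
  proof (rule poly_eqI)
    fix n
    have "coeff (pderiv (\<Sum>i\<le>degree p. monom (coeff p i / real (Suc i)) (Suc i))) n =
      real (Suc n) * (\<Sum>i\<le>degree p. if i = n then coeff p i / real (Suc i) else 0)"
      by (simp add: coeff_pderiv coeff_sum)
    also have "\<dots> = coeff p n" by (simp add: coeff_eq_0)
    finally show "coeff (pderiv (\<Sum>i\<le>degree p. monom (coeff p i / real (Suc i)) (Suc i))) n = coeff p n" .
  qed
qed

text \<open>Convergence of the values alone would not control divided differences near the diagonal,
  where they approach derivatives.\<close>

definition C1_conv :: "real \<Rightarrow> (nat \<Rightarrow> real poly) \<Rightarrow> (real \<Rightarrow> real) \<Rightarrow> (real \<Rightarrow> real) \<Rightarrow> bool" where
  "C1_conv R f F F' \<longleftrightarrow> (\<forall>x\<in>{-R..R}. (F has_real_derivative F' x) (at x)) \<and>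
     uniform_limit {-R..R} (\<lambda>n x. poly (f n) x) F sequentially \<and>
     uniform_limit {-R..R} (\<lambda>n x. poly (pderiv (f n)) x) F' sequentially"

text \<open>Approximate \<open>F'\<close> and integrate: by the mean value theorem an error
  \<open>e\<close> in the derivative costs at most \<open>e * (2 * R)\<close> in the values once
  they agree at 0.\<close>

lemma C1_approx:
  fixes F F' :: "real \<Rightarrow> real"
  assumes R: "0 < R" and d: "\<And>x. (F has_real_derivative F' x) (at x)" and c: "continuous_on UNIV F'"
  obtains f where "C1_conv R f F F'"
proof -
  have "\<exists>p. (\<forall>x\<in>{-R..R}. \<bar>F x - poly p x\<bar> \<le> e * (2 * R)) \<and> (\<forall>x\<in>{-R..R}. \<bar>F' x - poly (pderiv p) x\<bar> < e)"
    if e: "e > 0" for e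
  proof -
    obtain q where q: "\<And>x. x \<in> {-R..R} \<Longrightarrow> \<bar>F' x - poly q x\<bar> < e"
      by (rule real_poly_approx[of "{-R..R}" F' e]) (use c e in \<open>auto intro: continuous_on_subset\<close>)
    obtain p0 where p0: "pderiv p0 = q" using ex_poly_antideriv by blast
    define p where "p = p0 + [:F 0 - poly p0 0:]"
    have pd: "pderiv p = q" by (simp add: p_def pderiv_add p0 pderiv_pCons)
    have "\<bar>F x - poly p x\<bar> \<le> e * (2 * R)" if x: "x \<in> {-R..R}" for x
    proof -
      have "norm ((F x - poly p x) - (F 0 - poly p 0)) \<le> e * norm (x - 0)"
      proof (rule field_differentiable_bound[of "{-R..R}" _ "\<lambda>x. F' x - poly q x"])
        fix z :: real assume z: "z \<in> {-R..R}"
        show "((\<lambda>x. F x - poly p x) has_real_derivative F' z - poly q z) (at z within {-R..R})"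
          unfolding pd[symmetric] by (intro DERIV_diff DERIV_subset[OF d] DERIV_subset[OF poly_DERIV]) auto
        show "norm (F' z - poly q z) \<le> e" using q[OF z] by simp
      qed (use x R in auto)
      also have "\<dots> \<le> e * (2 * R)" using x e by (intro mult_left_mono) auto
      finally show ?thesis by (simp add: p_def)
    qed
    with q pd show ?thesis by blast
  qed
  then have "\<exists>p. (\<forall>x\<in>{-R..R}. \<bar>F x - poly p x\<bar> \<le> 1 / (real n + 1) * (2 * R)) \<and>
     (\<forall>x\<in>{-R..R}. \<bar>F' x - poly (pderiv p) x\<bar> < 1 / (real n + 1))" for n
    by (metis of_nat_0_le_iff add_nonneg_pos zero_less_one zero_less_divide_1_iff)
  then obtain f where f: "\<And>n x. x\<in>{-R..R} \<Longrightarrow> \<bar>F x - poly (f n) x\<bar> \<le> 1 / (real n + 1) * (2 * R)"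
     "\<And>n x. x\<in>{-R..R} \<Longrightarrow> \<bar>F' x - poly (pderiv (f n)) x\<bar> < 1 / (real n + 1)"
    by metis
  have "uniform_limit {-R..R} (\<lambda>n x. poly (f n) x) F sequentially"
  proof (rule uniform_limitI)
    fix e :: real assume e: "e > 0"
    have "(\<lambda>n. 1 / (real n + 1) * (2 * R)) \<longlonglongrightarrow> 0 * (2 * R)" by (intro tendsto_intros LIMSEQ_inv_plus1)
    then have "\<forall>\<^sub>F n in sequentially. 1 / (real n + 1) * (2 * R) < e"
      using e by (simp add: order_tendstoD)
    then show "\<forall>\<^sub>F n in sequentially. \<forall>x\<in>{-R..R}. dist (poly (f n) x) (F x) < e"
    proof eventually_elim
      case (elim n)
      show ?case using f(1)[of _ n] elim by (fastforce simp: dist_real_def abs_minus_commute)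
    qed
  qed
  moreover have "uniform_limit {-R..R} (\<lambda>n x. poly (pderiv (f n)) x) F' sequentially"
  proof (rule uniform_limitI)
    fix e :: real assume e: "e > 0"
    have "\<forall>\<^sub>F n in sequentially. 1 / (real n + 1) < e"
      using LIMSEQ_inv_plus1 e by (simp add: order_tendstoD)
    then show "\<forall>\<^sub>F n in sequentially. \<forall>x\<in>{-R..R}. dist (poly (pderiv (f n)) x) (F' x) < e"
    proof eventually_elim
      case (elim n)
      show ?case using f(2)[of _ n] elim by (fastforce simp: dist_real_def abs_minus_commute)
    qed
  qed
  ultimately show ?thesis using that d unfolding C1_conv_def by blast
qed

lemma poly_bounded_interval: obtains B where "\<And>x. x \<in> {-R..R::real} \<Longrightarrow> \<bar>poly p x\<bar> \<le> B"
proof -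
  have "compact (poly p ` {-R..R})" by (intro compact_continuous_image continuous_intros) auto
  then have "bounded (poly p ` {-R..R})" by (rule compact_imp_bounded)
  then obtain B where "\<forall>y\<in>poly p ` {-R..R}. norm y \<le> B" unfolding bounded_iff by blast
  with that[of B] show ?thesis by simp
qed

lemma uniform_limit_mult_poly:
  fixes F :: "real \<Rightarrow> real"
  assumes "uniform_limit {-R..R} f F sequentially"
  shows "uniform_limit {-R..R} (\<lambda>n x. f n x * poly q x) (\<lambda>x. F x * poly q x) sequentially"
proof (rule uniform_limitI)
  fix e :: real assume e: "e > 0"
  obtain B where B: "\<And>x. x \<in> {-R..R} \<Longrightarrow> \<bar>poly q x\<bar> \<le> B" using poly_bounded_interval by blast
  define C where "C = max B 1"
  have C: "C > 0" by (simp add: C_def)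
  have "\<forall>\<^sub>F n in sequentially. \<forall>x\<in>{-R..R}. dist (f n x) (F x) < e / C"
    by (rule uniform_limitD[OF assms]) (use e C in simp)
  then show "\<forall>\<^sub>F n in sequentially. \<forall>x\<in>{-R..R}. dist (f n x * poly q x) (F x * poly q x) < e"
  proof eventually_elim
    case (elim n)
    show ?case
    proof
      fix x assume x: "x \<in> {-R..R}"
      have "\<bar>f n x - F x\<bar> * \<bar>poly q x\<bar> \<le> \<bar>f n x - F x\<bar> * C"
        using B[OF x] by (intro mult_left_mono) (auto simp: C_def)
      also have "\<dots> < e" using elim[rule_format, OF x] C by (simp add: dist_real_def field_simps)
      finally show "dist (f n x * poly q x) (F x * poly q x) < e"
        by (simp add: dist_real_def left_diff_distrib[symmetric] abs_mult)
    qed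
  qed
qed

lemma C1_conv_mult:
  assumes "C1_conv R f F F'"
  shows "C1_conv R (\<lambda>n. f n * q) (\<lambda>x. F x * poly q x) (\<lambda>x. F' x * poly q x + F x * poly (pderiv q) x)"
  unfolding C1_conv_def
proof (intro conjI ballI)
  fix x assume "x \<in> {-R..R}"
  then show "((\<lambda>x. F x * poly q x) has_real_derivative F' x * poly q x + F x * poly (pderiv q) x) (at x)"
    using assms unfolding C1_conv_def by (auto intro!: derivative_eq_intros poly_DERIV)
next
  show "uniform_limit {-R..R} (\<lambda>n x. poly (f n * q) x) (\<lambda>x. F x * poly q x) sequentially"
    using assms unfolding C1_conv_def by (simp add: uniform_limit_mult_poly)
  have "uniform_limit {-R..R} (\<lambda>n x. poly (pderiv (f n)) x * poly q x + poly (f n) x * poly (pderiv q) x)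
     (\<lambda>x. F' x * poly q x + F x * poly (pderiv q) x) sequentially"
    using assms unfolding C1_conv_def by (intro uniform_limit_add uniform_limit_mult_poly) auto
  then show "uniform_limit {-R..R} (\<lambda>n x. poly (pderiv (f n * q)) x)
     (\<lambda>x. F' x * poly q x + F x * poly (pderiv q) x) sequentially"
    by (simp add: pderiv_mult algebra_simps)
qed

section \<open>Determinacy and density of polynomials on a bounded interval\<close>

locale bounded_borel = finite_measure \<rho> for \<rho> :: "real measure" +
  fixes R :: real
  assumes sets_rho [measurable_cong]: "sets \<rho> = sets borel" and R_pos: "0 < R"
    and AE_R: "AE x in \<rho>. \<bar>x\<bar> \<le> R"
begin

lemma integrable_cont_mult:
  fixes h :: "real \<Rightarrow> real"
  assumes F: "F \<in> borel_measurable borel" "\<And>x. x \<in> {-R..R} \<Longrightarrow> \<bar>F x\<bar> \<le> B" and h: "integrable \<rho> h"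
  shows "integrable \<rho> (\<lambda>x. F x * h x)"
proof (rule Bochner_Integration.integrable_bound)
  show "integrable \<rho> (\<lambda>x. B * h x)" using h by simp
  show "(\<lambda>x. F x * h x) \<in> borel_measurable \<rho>" using F(1) h by measurable
  show "AE x in \<rho>. norm (F x * h x) \<le> norm (B * h x)"
    using AE_R
  proof eventually_elim
    case (elim x)
    have "\<bar>F x\<bar> \<le> B" by (rule F(2)) (use elim in auto)
    then show ?case by (simp add: abs_mult mult_right_mono)
  qed
qed

lemma integrable_poly_mult:
  fixes h :: "real \<Rightarrow> real"
  assumes h: "integrable \<rho> h" shows "integrable \<rho> (\<lambda>x. poly p x * h x)"
proof -
  obtain B where "\<And>x. x \<in> {-R..R} \<Longrightarrow> \<bar>poly p x\<bar> \<le> B" using poly_bounded_interval by blast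
  then show ?thesis
    by (intro integrable_cont_mult[OF _ _ h]) (auto intro!: borel_measurable_continuous_onI continuous_intros)
qed

text \<open>Weierstrass passes from polynomials to continuous functions, ramps pass to indicators of
  half-lines, and half-lines determine the finite measures whose densities are the positive and the
  negative part of \<open>h\<close>.\<close>

lemma determinacy_real:
  fixes h :: "real \<Rightarrow> real"
  assumes h: "integrable \<rho> h" and 0: "\<And>p. (\<integral>x. poly p x * h x \<partial>\<rho>) = 0"
  shows "AE x in \<rho>. h x = 0"
proof -
  have hm[measurable]: "h \<in> borel_measurable borel" using h sets_rho by (metis borel_measurable_integrable measurable_cong_sets)
  have cont: "(\<integral>x. F x * h x \<partial>\<rho>) = 0" if F: "continuous_on UNIV F" for F :: "real \<Rightarrow> real"
  proof -
    have bnd: "\<bar>\<integral>x. F x * h x \<partial>\<rho>\<bar> \<le> e * (\<integral>x. \<bar>h x\<bar> \<partial>\<rho>)" if e: "e > 0" for e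
    proof -
      obtain p where p: "\<And>x. x \<in> {-R..R} \<Longrightarrow> \<bar>F x - poly p x\<bar> < e"
        by (rule real_poly_approx[of "{-R..R}" F e]) (use F e in \<open>auto intro: continuous_on_subset\<close>)
      have "compact (F ` {-R..R})" by (intro compact_continuous_image continuous_on_subset[OF F]) auto
      then have "bounded (F ` {-R..R})" by (rule compact_imp_bounded)
      then obtain B where "\<forall>y\<in>F ` {-R..R}. norm y \<le> B" unfolding bounded_iff by blast
      then have B: "\<And>x. x \<in> {-R..R} \<Longrightarrow> \<bar>F x\<bar> \<le> B" by simp
      have Fm[measurable]: "F \<in> borel_measurable borel" using F by (rule borel_measurable_continuous_onI)
      have iF: "integrable \<rho> (\<lambda>x. F x * h x)" by (rule integrable_cont_mult[OF Fm B h])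
      have "(\<integral>x. F x * h x \<partial>\<rho>) = (\<integral>x. F x * h x \<partial>\<rho>) - (\<integral>x. poly p x * h x \<partial>\<rho>)"
        by (simp add: 0)
      also have "\<dots> = (\<integral>x. (F x - poly p x) * h x \<partial>\<rho>)"
        unfolding left_diff_distrib by (rule Bochner_Integration.integral_diff[symmetric, OF iF integrable_poly_mult[OF h]])
      also have "\<bar>\<dots>\<bar> \<le> (\<integral>x. \<bar>(F x - poly p x) * h x\<bar> \<partial>\<rho>)" by (rule integral_abs_bound)
      also have "\<dots> \<le> (\<integral>x. e * \<bar>h x\<bar> \<partial>\<rho>)"
      proof (rule integral_mono_AE)
        have "integrable \<rho> (\<lambda>x. (F x - poly p x) * h x)"
          unfolding left_diff_distrib by (intro Bochner_Integration.integrable_diff iF integrable_poly_mult h)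
        then show "integrable \<rho> (\<lambda>x. \<bar>(F x - poly p x) * h x\<bar>)" by (rule integrable_abs)
        show "integrable \<rho> (\<lambda>x. e * \<bar>h x\<bar>)" using h by simp
        show "AE x in \<rho>. \<bar>(F x - poly p x) * h x\<bar> \<le> e * \<bar>h x\<bar>"
          using AE_R
        proof eventually_elim
          case (elim x)
          have "\<bar>F x - poly p x\<bar> \<le> e" by (rule less_imp_le[OF p]) (use elim in auto)
          then show ?case by (simp add: abs_mult mult_right_mono)
        qed
      qed
      finally show ?thesis by simp
    qed
    have *: "\<bar>\<integral>x. F x * h x \<partial>\<rho>\<bar> \<le> e" if "e > 0" for e
    proof -
      define I where "I = (\<integral>x. \<bar>h x\<bar> \<partial>\<rho>)"
      have I: "I \<ge> 0" unfolding I_def by simp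
      have "\<bar>\<integral>x. F x * h x \<partial>\<rho>\<bar> \<le> (e / (I + 1)) * I"
        unfolding I_def[symmetric] using bnd[of "e / (I + 1)"] I that unfolding I_def[symmetric] by simp
      also have "\<dots> \<le> e" using I that by (simp add: field_simps)
      finally show ?thesis .
    qed
    have "\<bar>\<integral>x. F x * h x \<partial>\<rho>\<bar> \<le> 0" by (rule field_le_epsilon) (use * in simp)
    then show ?thesis by simp
  qed
  have half: "(\<integral>x. indicator {a<..} x * h x \<partial>\<rho>) = 0" for a
  proof -
    \<comment> \<open>A ramp of slope n starting at \<open>a\<close>; it increases to the indicator
      of the open half-line.\<close>
    define F where "F n x = min 1 (max 0 (real n * (x - a)))" for n x
    have Fc: "continuous_on UNIV (F n)" for n unfolding F_def by (intro continuous_intros)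
    have Fm[measurable]: "F n \<in> borel_measurable borel" for n using Fc by (rule borel_measurable_continuous_onI)
    have "(\<lambda>n. \<integral>x. F n x * h x \<partial>\<rho>) \<longlonglongrightarrow> (\<integral>x. indicator {a<..} x * h x \<partial>\<rho>)"
    proof (rule integral_dominated_convergence[where w="\<lambda>x. \<bar>h x\<bar>"])
      show "AE x in \<rho>. (\<lambda>n. F n x * h x) \<longlonglongrightarrow> indicator {a<..} x * h x"
      proof (rule AE_I2)
        fix x
        have "(\<lambda>n. F n x) \<longlonglongrightarrow> indicator {a<..} x"
        proof (cases "x > a")
          case True
          obtain N :: nat where N: "1 / (x - a) < real N" using reals_Archimedean2 by blast
          have "\<forall>n\<ge>N. F n x = 1"
          proof (intro allI impI)
            fix n assume "n \<ge> N"
            then have "1 / (x - a) \<le> real n" using N by linarith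
            then have "1 \<le> real n * (x - a)" using True by (simp add: field_simps)
            then show "F n x = 1" by (simp add: F_def)
          qed
          then have "(\<lambda>n. F n x) \<longlonglongrightarrow> 1"
            by (intro tendsto_eventually) (auto simp: eventually_sequentially)
          then show ?thesis using True by simp
        next
          case False
          then have "F n x = 0" for n by (simp add: F_def mult_nonneg_nonpos)
          then show ?thesis using False by simp
        qed
        then show "(\<lambda>n. F n x * h x) \<longlonglongrightarrow> indicator {a<..} x * h x" by (rule tendsto_mult_right)
      qed
      show "AE x in \<rho>. norm (F n x * h x) \<le> \<bar>h x\<bar>" for n
        by (rule AE_I2) (auto simp: F_def abs_mult intro!: mult_left_le_one_le)
    qed (use h in auto)
    moreover have "(\<integral>x. F n x * h x \<partial>\<rho>) = 0" for n by (rule cont[OF Fc])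
    ultimately show ?thesis by (simp add: LIMSEQ_const_iff)
  qed
  have em: "emeasure (density \<rho> (\<lambda>x. ennreal (g x))) {a<..} = ennreal (\<integral>x. indicator {a<..} x * max 0 (g x) \<partial>\<rho>)"
    if g: "integrable \<rho> g" for g :: "real \<Rightarrow> real" and a
  proof -
    have gm[measurable]: "g \<in> borel_measurable borel" using g sets_rho by (metis borel_measurable_integrable measurable_cong_sets)
    have "emeasure (density \<rho> (\<lambda>x. ennreal (g x))) {a<..} = (\<integral>\<^sup>+x. ennreal (g x) * indicator {a<..} x \<partial>\<rho>)"
      by (rule emeasure_density) auto
    also have "\<dots> = (\<integral>\<^sup>+x. ennreal (indicator {a<..} x * max 0 (g x)) \<partial>\<rho>)"
      by (rule nn_integral_cong) (auto simp: indicator_def max_def ennreal_neg)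
    also have "\<dots> = ennreal (\<integral>x. indicator {a<..} x * max 0 (g x) \<partial>\<rho>)"
    proof (rule nn_integral_eq_integral)
      show "integrable \<rho> (\<lambda>x. indicator {a<..} x * max 0 (g x))"
        by (rule Bochner_Integration.integrable_bound[OF g]) (auto simp: indicator_def)
    qed auto
    finally show ?thesis .
  qed
  \<comment> \<open>\<open>ennreal\<close> truncates negative numbers to 0, so these are the
    densities of the positive and the negative part. Their equality almost everywhere makes both
    vanish.\<close>
  have "density \<rho> (\<lambda>x. ennreal (h x)) = density \<rho> (\<lambda>x. ennreal (- h x))"
  proof (rule measure_eqI_lessThan)
    fix a
    have ih: "integrable \<rho> (\<lambda>x. - h x)" using h by simp
    show "emeasure (density \<rho> (\<lambda>x. ennreal (h x))) {a<..} < \<infinity>" unfolding em[OF h] by simp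
    have i: "integrable \<rho> (\<lambda>x. indicator {a<..} x * max 0 (h x))" "integrable \<rho> (\<lambda>x. indicator {a<..} x * max 0 (- h x))"
      by (rule Bochner_Integration.integrable_bound[OF h]; auto simp: indicator_def)+
    have "(\<integral>x. indicator {a<..} x * max 0 (h x) \<partial>\<rho>) - (\<integral>x. indicator {a<..} x * max 0 (- h x) \<partial>\<rho>)
      = (\<integral>x. indicator {a<..} x * h x \<partial>\<rho>)"
      unfolding Bochner_Integration.integral_diff[OF i, symmetric]
      by (rule Bochner_Integration.integral_cong) (auto simp: indicator_def max_def)
    then show "emeasure (density \<rho> (\<lambda>x. ennreal (h x))) {a<..} = emeasure (density \<rho> (\<lambda>x. ennreal (- h x))) {a<..}"
      unfolding em[OF h] em[OF ih] half by simp
  qed (auto simp: sets_rho)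
  then have "AE x in \<rho>. ennreal (h x) = ennreal (- h x)"
    by (subst (asm) density_unique_iff) auto
  then show ?thesis
  proof eventually_elim
    case (elim x)
    then show ?case by (cases "h x \<ge> 0") (auto simp: ennreal_neg)
  qed
qed

lemma determinacy:
  fixes h :: "real \<Rightarrow> complex"
  assumes h: "integrable \<rho> h" and 0: "\<And>p. (\<integral>x. of_real (poly p x) * h x \<partial>\<rho>) = 0"
  shows "AE x in \<rho>. h x = 0"
proof -
  have i: "integrable \<rho> (\<lambda>x. of_real (poly p x) * h x)" for p
  proof (rule Bochner_Integration.integrable_bound)
    have "integrable \<rho> (\<lambda>x. norm (h x))" using h by simp
    then show "integrable \<rho> (\<lambda>x. poly p x * norm (h x))" by (rule integrable_poly_mult)
    have [measurable]: "poly p \<in> borel_measurable borel"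
      by (auto intro!: borel_measurable_continuous_onI continuous_intros)
    show "(\<lambda>x. of_real (poly p x) * h x) \<in> borel_measurable \<rho>" using h by measurable
  qed (auto simp: norm_mult abs_mult)
  have "AE x in \<rho>. Re (h x) = 0"
  proof (rule determinacy_real)
    fix p have "Re (\<integral>x. of_real (poly p x) * h x \<partial>\<rho>) = 0" by (simp add: 0)
    then show "(\<integral>x. poly p x * Re (h x) \<partial>\<rho>) = 0"
      by (subst (asm) integral_Re[OF i, symmetric]) simp
  qed (use h in simp)
  moreover have "AE x in \<rho>. Im (h x) = 0"
  proof (rule determinacy_real)
    fix p have "Im (\<integral>x. of_real (poly p x) * h x \<partial>\<rho>) = 0" by (simp add: 0)
    then show "(\<integral>x. poly p x * Im (h x) \<partial>\<rho>) = 0"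
      by (subst (asm) integral_Im[OF i, symmetric]) simp
  qed (use h in simp)
  ultimately show ?thesis by eventually_elim (simp add: complex_eq_iff)
qed

lemma sqi_bounded: assumes "f \<in> borel_measurable borel" "\<And>x. x \<in> {-R..R} \<Longrightarrow> cmod (f x) \<le> B"
  shows "sqi \<rho> f"
  unfolding sqi_def
proof
  show "f \<in> borel_measurable \<rho>" using assms(1) by measurable
  show "integrable \<rho> (\<lambda>x. (cmod (f x))\<^sup>2)"
  proof (rule integrable_const_bound)
    show "AE x in \<rho>. norm ((cmod (f x))\<^sup>2) \<le> B\<^sup>2"
      using AE_R by eventually_elim (auto intro!: power_mono assms(2))
  qed (use assms(1) in measurable)
qed

lemma sqi_poly: "sqi \<rho> (\<lambda>x. poly p (of_real x))"
proof -
  have c: "continuous_on UNIV (\<lambda>x::real. poly p (complex_of_real x))"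
    by (intro continuous_intros)
  then have "compact ((\<lambda>x. poly p (complex_of_real x)) ` {-R..R})"
    by (intro compact_continuous_image) (auto intro: continuous_on_subset)
  then have "bounded ((\<lambda>x. poly p (complex_of_real x)) ` {-R..R})" by (rule compact_imp_bounded)
  then obtain B where "\<forall>y\<in>(\<lambda>x. poly p (complex_of_real x)) ` {-R..R}. norm y \<le> B"
    unfolding bounded_iff by blast
  then have "\<And>x. x \<in> {-R..R} \<Longrightarrow> cmod (poly p (complex_of_real x)) \<le> B" by simp
  then show ?thesis using borel_measurable_continuous_onI[OF c] by (intro sqi_bounded) auto
qed

lemma sqi_integrable: "sqi \<rho> f \<Longrightarrow> integrable \<rho> f"
  using sqi_mult_integrable[of \<rho> f "\<lambda>x. poly [:1:] (of_real x)"] sqi_poly[of "[:1:]"] by simp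

text \<open>Represent the functional \<open>ip \<rho> _ \<alpha>\<close> on the polynomials: the
  representative lies in their closure, and its difference to \<alpha> is orthogonal to all
  polynomials, hence null by determinacy.\<close>

lemma poly_dense:
  assumes a: "sqi \<rho> \<alpha>"
  obtains p where "(\<lambda>n. n2 \<rho> (\<lambda>x. poly (p n) (of_real x) - \<alpha> x)) \<longlonglongrightarrow> 0"
proof -
  define V where "V = range (\<lambda>p::complex poly. \<lambda>x. poly p (complex_of_real x))"
  have V: "sqi \<rho> f" if "f \<in> V" for f using that by (auto simp: V_def sqi_poly)
  obtain P \<phi> where P: "\<And>n. P n \<in> V" "sqi \<rho> \<phi>" "(\<lambda>n. n2 \<rho> (\<lambda>x. P n x - \<phi> x)) \<longlonglongrightarrow> 0"
    "\<And>q. q \<in> V \<Longrightarrow> ip \<rho> q \<phi> = ip \<rho> q \<alpha>"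
  proof (rule riesz_subspace[of V \<rho> "\<lambda>f. ip \<rho> f \<alpha>" "n2 \<rho> \<alpha>"])
    fix f g c assume fg: "f \<in> V" "g \<in> V"
    then obtain p q where "f = (\<lambda>x. poly p (complex_of_real x))" "g = (\<lambda>x. poly q (complex_of_real x))"
      by (auto simp: V_def)
    then show "(\<lambda>x. f x + c * g x) \<in> V"
      by (auto simp: V_def intro!: image_eqI[of _ _ "p + smult c q"])
    show "ip \<rho> (\<lambda>x. f x + c * g x) \<alpha> = ip \<rho> f \<alpha> + c * ip \<rho> g \<alpha>"
      by (simp add: ip_add_left[OF V[OF fg(1)] sqi_scale[OF V[OF fg(2)]] a] ip_scale_left)
  next
    fix f assume "f \<in> V"
    from cauchy_schwarz[OF V[OF this] a] show "cmod (ip \<rho> f \<alpha>) \<le> n2 \<rho> \<alpha> * n2 \<rho> f" by (simp add: mult.commute)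
  qed (auto simp: V V_def)
  have "AE x in \<rho>. cnj (\<phi> x - \<alpha> x) = 0"
  proof (rule determinacy)
    show "integrable \<rho> (\<lambda>x. cnj (\<phi> x - \<alpha> x))"
      by (intro sqi_integrable sqi_cnj sqi_diff P a)
    fix p
    have p: "sqi \<rho> (\<lambda>x. of_real (poly p x))" using sqi_poly[of "map_poly of_real p"] by simp
    have "(\<lambda>x. poly (map_poly of_real p) (complex_of_real x)) \<in> V" unfolding V_def by (rule rangeI)
    from P(4)[OF this] have "ip \<rho> (\<lambda>x. of_real (poly p x)) (\<lambda>x. \<phi> x - \<alpha> x) = 0"
      using p by (simp add: ip_diff_right P a)
    then show "(\<integral>x. of_real (poly p x) * cnj (\<phi> x - \<alpha> x) \<partial>\<rho>) = 0" by (simp add: ip_def)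
  qed
  then have ae: "AE x in \<rho>. \<phi> x = \<alpha> x" by eventually_elim simp
  from P(1) have "\<forall>n. \<exists>p. P n = (\<lambda>x. poly p (complex_of_real x))" by (auto simp: V_def)
  then obtain p where p: "\<And>n. P n = (\<lambda>x. poly (p n) (complex_of_real x))" by metis
  have "n2 \<rho> (\<lambda>x. poly (p n) (of_real x) - \<alpha> x) = n2 \<rho> (\<lambda>x. P n x - \<phi> x)" for n
    by (rule n2_cong_AE) (use ae P a sqi_poly in \<open>auto intro!: sqi_diff simp: p\<close>)
  with P(3) show ?thesis using that[of p] by simp
qed

end

text \<open>Lindelof reduces the cover of the complement by open null sets to a countable
  one.\<close>

lemma AE_from_local_null:
  fixes M :: "real measure"
  assumes M: "sets M = sets borel"
    and loc: "\<And>x. x \<notin> F \<Longrightarrow> \<exists>U. open U \<and> x \<in> U \<and> emeasure M U = 0"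
  shows "AE x in M. x \<in> F"
proof -
  define G where "G = {U. open U \<and> emeasure M U = 0}"
  obtain G' where G': "G' \<subseteq> G" "countable G'" "\<Union>G' = \<Union>G"
    using Lindelof[of G] by (auto simp: G_def)
  have "(\<Union>U\<in>G'. U) \<in> null_sets M"
    by (rule null_sets_UN') (use G' M in \<open>auto simp: G_def null_sets_def subset_iff\<close>)
  then have "AE x in M. x \<notin> \<Union>G'" using AE_not_in by fastforce
  then show ?thesis
  proof eventually_elim
    case (elim x)
    then show ?case using loc[of x] G' by (auto simp: G_def)
  qed
qed

subsection \<open>Bounded self-adjoint operators and their spectral measures\<close>

lemma ell2_iff: "f \<in> ell2 S \<longleftrightarrow> (\<forall>v. v \<notin> S \<longrightarrow> f v = 0) \<and> sqi (count_space S) f"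
proof -
  have "(\<lambda>v. (cmod (f v))\<^sup>2) summable_on S \<longleftrightarrow> Infinite_Sum.abs_summable_on (\<lambda>v. (cmod (f v))\<^sup>2) S"
    by (rule summable_on_iff_abs_summable_on_real)
  also have "\<dots> \<longleftrightarrow> Infinite_Set_Sum.abs_summable_on (\<lambda>v. (cmod (f v))\<^sup>2) S"
    by (rule abs_summable_equivalent)
  finally show ?thesis by (simp add: ell2_def sqi_def Infinite_Set_Sum.abs_summable_on_def)
qed

lemma ell2_sqi: "f \<in> ell2 S \<Longrightarrow> sqi (count_space S) f"
  by (simp add: ell2_iff)

lemma ell2_norm_n2: "f \<in> ell2 S \<Longrightarrow> ell2_norm S f = n2 (count_space S) f"
  using infsetsum_infsum[of "\<lambda>v. (cmod (f v))\<^sup>2" S]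
  by (auto simp: ell2_iff sqi_def ell2_norm_def n2_def Infinite_Set_Sum.abs_summable_on_def infsetsum_def)

lemma ell2_inner_ip: "f \<in> ell2 S \<Longrightarrow> g \<in> ell2 S \<Longrightarrow> ell2_inner S f g = ip (count_space S) f g"
  using infsetsum_infsum[of "\<lambda>v. f v * cnj (g v)" S] ip_integrable[of "count_space S" f g]
  by (auto simp: ell2_iff ell2_inner_def ip_def Infinite_Set_Sum.abs_summable_on_def infsetsum_def)

lemma ell2_add: "f \<in> ell2 S \<Longrightarrow> g \<in> ell2 S \<Longrightarrow> (\<lambda>v. f v + g v) \<in> ell2 S"
  by (simp add: ell2_iff sqi_add)

lemma ell2_diff: "f \<in> ell2 S \<Longrightarrow> g \<in> ell2 S \<Longrightarrow> (\<lambda>v. f v - g v) \<in> ell2 S"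
  by (simp add: ell2_iff sqi_diff)

lemma ell2_scale: "f \<in> ell2 S \<Longrightarrow> (\<lambda>v. c * f v) \<in> ell2 S"
  by (simp add: ell2_iff sqi_scale)

lemma ell2_zero [simp]: "(\<lambda>v. 0) \<in> ell2 S"
  by (simp add: ell2_iff)

lemma ell2_sum: "finite I \<Longrightarrow> (\<And>i. i \<in> I \<Longrightarrow> f i \<in> ell2 S) \<Longrightarrow> (\<lambda>v. \<Sum>i\<in>I. f i v) \<in> ell2 S"
  by (induct I rule: finite_induct) (auto intro: ell2_add)

lemma integrable_count_space_support1:
  fixes f :: "'v \<Rightarrow> 'b :: {banach, second_countable_topology}"
  assumes "X \<in> S" "\<And>v. v \<noteq> X \<Longrightarrow> f v = 0"
  shows "integrable (count_space S) f" "(\<integral>v. f v \<partial>count_space S) = f X"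
proof -
  have sub: "{a \<in> S. f a \<noteq> 0} \<subseteq> {X}" using assms(2) by auto
  then have fin: "finite {a \<in> S. f a \<noteq> 0}" by (rule finite_subset) simp
  show "integrable (count_space S) f"
    by (rule integrableI_bounded_set[of "{X}" _ _ "norm (f X)"]) (use assms in \<open>auto intro!: AE_I2\<close>)
  show "(\<integral>v. f v \<partial>count_space S) = f X"
    unfolding lebesgue_integral_count_space_finite_support[OF fin]
    using assms by (subst sum.mono_neutral_left[OF _ sub]) auto
qed

lemma kdelta_ell2: "X \<in> S \<Longrightarrow> kdelta X \<in> ell2 S"
  using integrable_count_space_support1(1)[of X S "\<lambda>v. (cmod (kdelta X v))\<^sup>2"]
  by (auto simp: ell2_iff sqi_def kdelta_def)

lemma n2_kdelta: "X \<in> S \<Longrightarrow> n2 (count_space S) (kdelta X) = 1"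
  using integrable_count_space_support1(2)[of X S "\<lambda>v. (cmod (kdelta X v))\<^sup>2"]
  by (auto simp: n2_def kdelta_def)

lemma ip_kdelta: "X \<in> S \<Longrightarrow> ip (count_space S) f (kdelta X) = f X"
  using integrable_count_space_support1(2)[of X S "\<lambda>v. f v * cnj (kdelta X v)"]
  by (auto simp: ip_def kdelta_def)

lemma ell2_point_le: "f \<in> ell2 S \<Longrightarrow> v \<in> S \<Longrightarrow> cmod (f v) \<le> n2 (count_space S) f"
  using cauchy_schwarz[of "count_space S" f "kdelta v"] by (simp add: ip_kdelta n2_kdelta ell2_sqi kdelta_ell2)

lemma ell2_eqI: assumes "f \<in> ell2 S" "g \<in> ell2 S" "n2 (count_space S) (\<lambda>v. f v - g v) = 0" shows "f = g"
proof
  fix v show "f v = g v"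
  proof (cases "v \<in> S")
    case True
    show ?thesis using ell2_point_le[OF ell2_diff[OF assms(1,2)] True] assms(3) by simp
  qed (use assms in \<open>auto simp: ell2_iff\<close>)
qed

lemma ell2_pointwise_limit:
  assumes f: "\<And>n. f n \<in> ell2 S" and g0: "\<And>v. v \<notin> S \<Longrightarrow> g v = 0"
    and lim: "\<And>v. v \<in> S \<Longrightarrow> (\<lambda>n. f n v) \<longlonglongrightarrow> g v" and C: "n2_Cauchy (count_space S) f"
  shows "g \<in> ell2 S" "(\<lambda>n. n2 (count_space S) (\<lambda>x. f n x - g x)) \<longlonglongrightarrow> 0"
proof -
  have a: "AE v in count_space S. (\<lambda>n. f (id n) v) \<longlonglongrightarrow> g v" using lim by (simp add: AE_count_space)
  note * = n2_fatou[OF ell2_sqi[OF f] _ strict_mono_id a C]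
  show "g \<in> ell2 S" using *(1) g0 by (simp add: ell2_iff)
  show "(\<lambda>n. n2 (count_space S) (\<lambda>x. f n x - g x)) \<longlonglongrightarrow> 0" using *(2) by simp
qed

lemma ell2_complete:
  assumes f: "\<And>n. f n \<in> ell2 S" and C: "n2_Cauchy (count_space S) f"
  obtains g where "g \<in> ell2 S" "(\<lambda>n. n2 (count_space S) (\<lambda>x. f n x - g x)) \<longlonglongrightarrow> 0"
proof -
  obtain g0 where g0: "sqi (count_space S) g0" "(\<lambda>n. n2 (count_space S) (\<lambda>x. f n x - g0 x)) \<longlonglongrightarrow> 0"
    using n2_complete[OF ell2_sqi[OF f] C] by blast
  define g where "g v = (if v \<in> S then g0 v else 0)" for v
  have i: "(\<integral>v. (cmod (h v (g v)))\<^sup>2 \<partial>count_space S) = (\<integral>v. (cmod (h v (g0 v)))\<^sup>2 \<partial>count_space S)" for h :: "'a \<Rightarrow> complex \<Rightarrow> complex"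
    by (rule Bochner_Integration.integral_cong) (auto simp: g_def)
  have "integrable (count_space S) (\<lambda>v. (cmod (g v))\<^sup>2)"
    using g0(1) unfolding sqi_def by (subst Bochner_Integration.integrable_cong[OF refl, of _ _ "\<lambda>v. (cmod (g0 v))\<^sup>2"]) (auto simp: g_def)
  then have "g \<in> ell2 S" by (simp add: ell2_iff sqi_def g_def)
  moreover have "n2 (count_space S) (\<lambda>x. f n x - g x) = n2 (count_space S) (\<lambda>x. f n x - g0 x)" for n
    unfolding n2_def using i[of "\<lambda>v z. f n v - z"] by simp
  ultimately show ?thesis using that g0(2) by simp
qed

text \<open>Banach's fixed point theorem for the affine map \<open>K f + g\<close>, in the abstract
  metric space whose carrier is the set \<open>ell2 S\<close>.\<close>

lemma ell2_contraction:
  assumes K: "\<And>f. f \<in> ell2 S \<Longrightarrow> K f \<in> ell2 S"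
    and lin: "\<And>f g. f \<in> ell2 S \<Longrightarrow> g \<in> ell2 S \<Longrightarrow> K (\<lambda>v. f v - g v) = (\<lambda>v. K f v - K g v)"
    and bd: "\<And>f. f \<in> ell2 S \<Longrightarrow> n2 (count_space S) (K f) \<le> q * n2 (count_space S) f" and q: "q < 1"
    and g: "g \<in> ell2 S"
  obtains f where "f \<in> ell2 S" "f = (\<lambda>v. K f v + g v)"
proof -
  define d where "d f h = n2 (count_space S) (\<lambda>v. f v - h v)" for f h
  interpret E: Metric_space "ell2 S" d
  proof
    show "0 \<le> d x y" for x y by (simp add: d_def)
    show "d x y = d y x" for x y unfolding d_def by (rule n2_minus_commute)
    show "(d x y = 0) = (x = y)" if "x \<in> ell2 S" "y \<in> ell2 S" for x y
      using ell2_eqI[OF that] by (auto simp: d_def n2_def)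
    show "d x z \<le> d x y + d y z" if "x \<in> ell2 S" "y \<in> ell2 S" "z \<in> ell2 S" for x y z
      unfolding d_def by (intro n2_triangle_diff ell2_sqi that)
  qed
  have "E.mcomplete" unfolding E.mcomplete_def
  proof (intro allI impI)
    fix \<sigma> assume s: "E.MCauchy \<sigma>"
    then have 1: "\<sigma> n \<in> ell2 S" for n by (auto simp: E.MCauchy_def)
    have "n2_Cauchy (count_space S) \<sigma>" unfolding n2_Cauchy_def
    proof (intro allI impI)
      fix e :: real assume "0 < e"
      then obtain N where "\<forall>n n'. N \<le> n \<longrightarrow> N \<le> n' \<longrightarrow> d (\<sigma> n) (\<sigma> n') < e"
        using s unfolding E.MCauchy_def by auto
      then show "\<exists>N. \<forall>m\<ge>N. \<forall>n\<ge>N. n2 (count_space S) (\<lambda>x. \<sigma> m x - \<sigma> n x) < e" unfolding d_def by (intro exI[of _ N]) simp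
    qed
    from ell2_complete[OF 1 this] obtain h where "h \<in> ell2 S" "(\<lambda>n. d (\<sigma> n) h) \<longlonglongrightarrow> 0"
      unfolding d_def by blast
    then show "\<exists>x. limitin E.mtopology \<sigma> x sequentially"
      unfolding E.limitin_metric_dist_null using 1 by (intro exI[of _ h]) simp
  qed
  then obtain f where "f \<in> ell2 S" "(\<lambda>v. K f v + g v) = f"
  proof (rule E.Banach_fixedpoint_thm[of "\<lambda>f v. K f v + g v" q])
    show "(\<lambda>f v. K f v + g v) \<in> ell2 S \<rightarrow> ell2 S" using K g by (auto intro: ell2_add)
    show "d (\<lambda>v. K x v + g v) (\<lambda>v. K y v + g v) \<le> q * d x y" if "x \<in> ell2 S" "y \<in> ell2 S" for x y
      using bd[OF ell2_diff[OF that]] by (simp add: d_def lin[OF that])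
  qed (use q ell2_zero in \<open>auto intro: exI[of _ "\<lambda>_. 0"] simp del: ell2_zero\<close>)
  with that show ?thesis by metis
qed

section \<open>Lower bounds, resolvent and spectrum of a symmetric operator\<close>

locale sa_op =
  fixes S :: "'v set" and T :: "('v \<Rightarrow> complex) \<Rightarrow> 'v \<Rightarrow> complex" and C :: real
  assumes T_ell2: "f \<in> ell2 S \<Longrightarrow> T f \<in> ell2 S"
    and T_lin: "f \<in> ell2 S \<Longrightarrow> g \<in> ell2 S \<Longrightarrow> T (\<lambda>v. a * f v + b * g v) = (\<lambda>v. a * T f v + b * T g v)"
    and T_bound: "f \<in> ell2 S \<Longrightarrow> n2 (count_space S) (T f) \<le> C * n2 (count_space S) f"
    and T_sym: "f \<in> ell2 S \<Longrightarrow> g \<in> ell2 S \<Longrightarrow> ip (count_space S) (T f) g = ip (count_space S) f (T g)"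
    and C_nonneg: "0 \<le> C"
begin

abbreviation "nm \<equiv> n2 (count_space S)"
abbreviation "inn \<equiv> ip (count_space S)"

lemma T_diff: "f \<in> ell2 S \<Longrightarrow> g \<in> ell2 S \<Longrightarrow> T (\<lambda>v. f v - g v) = (\<lambda>v. T f v - T g v)"
  using T_lin[of f g 1 "-1"] by simp

lemma T_scale: "f \<in> ell2 S \<Longrightarrow> T (\<lambda>v. a * f v) = (\<lambda>v. a * T f v)"
  using T_lin[of f f a 0] by simp

lemma shift_ell2: "f \<in> ell2 S \<Longrightarrow> shift T z f \<in> ell2 S"
  unfolding shift_def by (intro ell2_diff ell2_scale T_ell2)

lemma shift_diff: "f \<in> ell2 S \<Longrightarrow> g \<in> ell2 S \<Longrightarrow> shift T z (\<lambda>v. f v - g v) = (\<lambda>v. shift T z f v - shift T z g v)"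
  unfolding shift_def by (simp add: T_diff fun_eq_iff algebra_simps)

lemma shift_commute: "f \<in> ell2 S \<Longrightarrow> shift T z (shift T w f) = shift T w (shift T z f)"
  unfolding shift_def by (simp add: T_diff T_scale ell2_scale T_ell2 algebra_simps)

lemma inn_shift: assumes "f \<in> ell2 S" "g \<in> ell2 S" shows "inn (shift T z f) g = inn f (shift T (cnj z) g)"
proof -
  have "inn (shift T z f) g = inn (T f) g - z * inn f g"
    unfolding shift_def using assms by (subst ip_diff_left) (auto intro!: ell2_sqi T_ell2 ell2_scale simp: ip_scale_left)
  also have "\<dots> = inn f (shift T (cnj z) g)"
    unfolding shift_def using assms
    by (subst ip_diff_right) (auto intro!: ell2_sqi T_ell2 ell2_scale simp: ip_scale_right T_sym)
  finally show ?thesis .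
qed

text \<open>\<open>T - z\<close> is normal: it commutes with its adjoint \<open>T - cnj z\<close>.
  Hence a lower bound at \<open>z\<close> is also one at \<open>cnj z\<close>.\<close>

lemma nm_shift_cnj: assumes f: "f \<in> ell2 S" shows "nm (shift T (cnj z) f) = nm (shift T z f)"
proof -
  have "of_real ((nm (shift T (cnj z) f))\<^sup>2) = inn (shift T (cnj z) f) (shift T (cnj z) f)" by (simp only: ip_self)
  also have "\<dots> = inn f (shift T z (shift T (cnj z) f))" by (simp add: inn_shift f shift_ell2)
  also have "\<dots> = inn f (shift T (cnj z) (shift T z f))" by (simp add: shift_commute f)
  also have "\<dots> = inn (shift T z f) (shift T z f)" by (simp add: inn_shift f shift_ell2)
  also have "\<dots> = of_real ((nm (shift T z f))\<^sup>2)" by (simp only: ip_self)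
  finally have "(nm (shift T (cnj z) f))\<^sup>2 = (nm (shift T z f))\<^sup>2" using of_real_eq_iff by blast
  then show ?thesis by (rule power2_eq_imp_eq) simp_all
qed

lemma nm_shift_le: assumes f: "f \<in> ell2 S" shows "nm (shift T z f) \<le> (C + cmod z) * nm f"
proof -
  have "nm (shift T z f) \<le> nm (T f) + nm (\<lambda>v. (-z) * f v)"
    unfolding shift_def using n2_triangle[of "count_space S" "T f" "\<lambda>v. (-z) * f v"] f
    sqi_scale[OF ell2_sqi[OF f], of "-z"] by (simp add: ell2_sqi T_ell2)
  also have "nm (\<lambda>v. (-z) * f v) = cmod z * nm f" unfolding n2_scale by simp
  finally show ?thesis using T_bound[OF f] by (simp add: distrib_right)
qed

text \<open>For a normal operator being bounded below already implies bijectivity, so this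
  quantitative condition describes the resolvent set.\<close>

definition lb :: "complex \<Rightarrow> real \<Rightarrow> bool" where
  "lb z c \<longleftrightarrow> 0 < c \<and> (\<forall>f\<in>ell2 S. c * nm f \<le> nm (shift T z f))"

lemma lb_perturb: assumes l: "lb z c" and d: "cmod (w - z) \<le> c / 2" shows "lb w (c / 2)"
  unfolding lb_def
proof (intro conjI ballI)
  show "0 < c / 2" using l by (simp add: lb_def)
  fix f assume f: "f \<in> ell2 S"
  have "nm (shift T z f) \<le> nm (shift T w f) + nm (\<lambda>v. (w - z) * f v)"
    using n2_triangle[of "count_space S" "shift T w f" "\<lambda>v. (w - z) * f v"] f
    by (simp add: ell2_sqi shift_ell2 sqi_scale) (simp add: shift_def algebra_simps)
  also have "nm (\<lambda>v. (w - z) * f v) \<le> c / 2 * nm f" unfolding n2_scale using d by (rule mult_right_mono) simp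
  finally show "c / 2 * nm f \<le> nm (shift T w f)" using l f unfolding lb_def by (auto simp: field_simps)
qed

lemma lb_large: assumes "C < cmod z" shows "lb z (cmod z - C)"
  unfolding lb_def
proof (intro conjI ballI)
  fix f assume f: "f \<in> ell2 S"
  have "nm (\<lambda>v. z * f v) \<le> nm (T f) + nm (\<lambda>v. z * f v - T f v)"
    by (rule n2_le_add) (use f in \<open>auto intro!: ell2_sqi T_ell2 ell2_scale\<close>)
  also have "nm (\<lambda>v. z * f v - T f v) = nm (shift T z f)" unfolding shift_def by (rule n2_minus_commute)
  finally show "(cmod z - C) * nm f \<le> nm (shift T z f)"
    using T_bound[OF f] unfolding n2_scale by (simp add: left_diff_distrib)
qed (use assms in simp)

lemma lb_nonreal: assumes "Im z \<noteq> 0" shows "lb z \<bar>Im z\<bar>"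
  unfolding lb_def
proof (intro conjI ballI)
  fix f assume f: "f \<in> ell2 S"
  have "cnj (inn (T f) f) = inn (T f) f" using f by (simp add: ip_cnj T_sym T_ell2)
  then have "Im (inn (T f) f) = 0" by (simp add: complex_eq_iff)
  moreover have "inn (shift T z f) f = inn (T f) f - z * of_real ((nm f)\<^sup>2)"
    unfolding shift_def ip_self[symmetric] using f
    by (subst ip_diff_left) (auto intro!: ell2_sqi T_ell2 ell2_scale simp: ip_scale_left)
  ultimately have "\<bar>Im z\<bar> * (nm f)\<^sup>2 = \<bar>Im (inn (shift T z f) f)\<bar>" by (simp add: abs_mult)
  also have "\<bar>Im (inn (shift T z f) f)\<bar> \<le> nm (shift T z f) * nm f"
    using abs_Im_le_cmod order_trans cauchy_schwarz[OF ell2_sqi[OF shift_ell2[OF f]] ell2_sqi[OF f]] by blast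
  finally have "nm f * (\<bar>Im z\<bar> * nm f) \<le> nm f * nm (shift T z f)"
    by (simp add: power2_eq_square mult_ac)
  then show "\<bar>Im z\<bar> * nm f \<le> nm (shift T z f)"
    by (cases "nm f = 0") (auto simp: mult_le_cancel_left less_le)
qed (use assms in simp)

text \<open>Only surjectivity has content. The equation \<open>(T - z) (T - cnj z) f = g\<close> is
  solved by the damped iteration \<open>K = 1 - \<eta> (T - z) (T - cnj z)\<close>, which contracts
  because the lower bound also holds for the adjoint.\<close>

lemma lb_bij: assumes l: "lb z c" shows "bij_betw (shift T z) (ell2 S) (ell2 S)"
  unfolding bij_betw_def
proof
  show "inj_on (shift T z) (ell2 S)"
  proof (rule inj_onI)
    fix f g assume fg: "f \<in> ell2 S" "g \<in> ell2 S" and eq: "shift T z f = shift T z g"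
    have "c * nm (\<lambda>v. f v - g v) \<le> nm (shift T z (\<lambda>v. f v - g v))"
      using l ell2_diff[OF fg] by (auto simp: lb_def)
    also have "\<dots> = 0" by (simp add: shift_diff fg eq n2_def)
    finally have "nm (\<lambda>v. f v - g v) \<le> 0" using l by (auto simp: lb_def mult_le_0_iff)
    then show "f = g" using ell2_eqI[OF fg] n2_nonneg order_antisym by blast
  qed
  show "shift T z ` ell2 S = ell2 S"
  proof
    show "shift T z ` ell2 S \<subseteq> ell2 S" using shift_ell2 by blast
    show "ell2 S \<subseteq> shift T z ` ell2 S"
    proof
      fix g assume g: "g \<in> ell2 S"
      define B where "B = C + cmod z + 1"
      have B: "B > 0" using C_nonneg by (simp add: B_def add_nonneg_pos)
      have Bb: "nm (shift T z f) \<le> B * nm f" if "f \<in> ell2 S" for f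
      proof -
        have "(C + cmod z) * nm f \<le> B * nm f" by (intro mult_right_mono) (auto simp: B_def)
        then show ?thesis using nm_shift_le[OF that, of z] by simp
      qed
      \<comment> \<open>With this step size \<open>\<eta>^2 |A|^2 \<le> t^2 / B^2\<close> and
        \<open>2 \<eta> t^2 = 2 t^2 / B^2\<close>, which leaves a net gain of
        \<open>t^2 / B^2\<close> in the estimate of \<open>nm (K f)\<close>.\<close>
      define \<eta> where "\<eta> = 1 / B\<^sup>2"
      define K where "K f = (\<lambda>v. f v - of_real \<eta> * shift T z (shift T (cnj z) f) v)" for f
      \<comment> \<open>The maximum matters only if \<open>ell2 S\<close> is trivial: any nonzero
        vector gives \<open>c \<le> B\<close>.\<close>
      define q where "q = sqrt (max 0 (1 - c\<^sup>2 / B\<^sup>2))"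
      have c: "c > 0" using l by (simp add: lb_def)
      have "max 0 (1 - c\<^sup>2 / B\<^sup>2) < 1" using B c by simp
      then have q: "q < 1" unfolding q_def using real_sqrt_lt_1_iff by blast
      obtain f where f: "f \<in> ell2 S" "f = (\<lambda>v. K f v + of_real \<eta> * g v)"
      proof (rule ell2_contraction[of S K q "\<lambda>v. of_real \<eta> * g v"])
        show "K f \<in> ell2 S" if "f \<in> ell2 S" for f
          unfolding K_def by (intro ell2_diff ell2_scale shift_ell2 that)
        show "K (\<lambda>v. f v - h v) = (\<lambda>v. K f v - K h v)" if "f \<in> ell2 S" "h \<in> ell2 S" for f h
          unfolding K_def by (simp add: shift_diff that shift_ell2 algebra_simps)
        show "nm (K f) \<le> q * nm f" if f: "f \<in> ell2 S" for f
        proof -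
          define A where "A = shift T z (shift T (cnj z) f)"
          have A: "A \<in> ell2 S" unfolding A_def by (intro shift_ell2 f)
          define t where "t = nm (shift T z f)"
          have t: "nm (shift T (cnj z) f) = t" by (simp add: t_def nm_shift_cnj f)
          have "inn f A = cnj (inn A f)" by (simp add: ip_cnj)
          also have "inn A f = inn (shift T (cnj z) f) (shift T (cnj z) f)"
            unfolding A_def by (simp add: inn_shift shift_ell2 f)
          also have "\<dots> = of_real (t\<^sup>2)" unfolding ip_self t ..
          finally have fA: "inn f A = of_real (t\<^sup>2)" by simp
          have "nm A \<le> B * t" unfolding A_def using Bb[OF shift_ell2[OF f, of "cnj z"]] t by simp
          then have "(nm A)\<^sup>2 \<le> (B * t)\<^sup>2" by (rule power_mono) simp
          then have nA: "\<eta>\<^sup>2 * (nm A)\<^sup>2 \<le> \<eta>\<^sup>2 * (B * t)\<^sup>2" by (rule mult_left_mono) simp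
          have "(nm (K f))\<^sup>2 = (nm f)\<^sup>2 + (nm (\<lambda>v. of_real \<eta> * A v))\<^sup>2 - 2 * Re (inn f (\<lambda>v. of_real \<eta> * A v))"
            unfolding K_def A_def[symmetric] by (intro n2_diff_sq sqi_scale ell2_sqi f A)
          also have "\<dots> = (nm f)\<^sup>2 + \<eta>\<^sup>2 * (nm A)\<^sup>2 - 2 * \<eta> * t\<^sup>2"
            unfolding n2_scale ip_scale_right fA by (simp add: power_mult_distrib flip: of_real_power)
          also have "\<dots> \<le> (nm f)\<^sup>2 + \<eta>\<^sup>2 * (B * t)\<^sup>2 - 2 * \<eta> * t\<^sup>2" using nA by simp
          also have "\<dots> = (nm f)\<^sup>2 - t\<^sup>2 / B\<^sup>2"
            unfolding \<eta>_def using B by (simp add: field_simps power2_eq_square)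
          also have "\<dots> \<le> (nm f)\<^sup>2 - (c * nm f)\<^sup>2 / B\<^sup>2"
          proof -
            have "c * nm f \<le> t" using l f by (simp add: lb_def t_def)
            then have "(c * nm f)\<^sup>2 \<le> t\<^sup>2" using c by (intro power_mono) auto
            then show ?thesis using B by (simp add: divide_right_mono)
          qed
          also have "\<dots> = (1 - c\<^sup>2 / B\<^sup>2) * (nm f)\<^sup>2" by (simp add: algebra_simps power_mult_distrib)
          also have "\<dots> \<le> q\<^sup>2 * (nm f)\<^sup>2" by (rule mult_right_mono) (auto simp: q_def)
          finally have "(nm (K f))\<^sup>2 \<le> (q * nm f)\<^sup>2" by (simp add: power_mult_distrib)
          then show ?thesis by (rule power2_le_imp_le) (simp add: q_def)
        qed
        show "(\<lambda>v. of_real \<eta> * g v) \<in> ell2 S" by (intro ell2_scale g)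
      qed (use q in auto)
      have "shift T z (shift T (cnj z) f) v = g v" for v
      proof -
        have "f v = f v - of_real \<eta> * shift T z (shift T (cnj z) f) v + of_real \<eta> * g v"
          using fun_cong[OF f(2), of v] by (simp add: K_def)
        moreover have "b = c" if "a = a - b + c" for a b c :: complex using that by (simp add: algebra_simps)
        ultimately have "of_real \<eta> * shift T z (shift T (cnj z) f) v = of_real \<eta> * g v" by blast
        moreover have "\<eta> \<noteq> 0" using B by (simp add: \<eta>_def)
        ultimately show ?thesis by auto
      qed
      then have "g = shift T z (shift T (cnj z) f)" by auto
      then show "g \<in> shift T z ` ell2 S" using shift_ell2[OF f(1)] by blast
    qed
  qed
qed

lemma spectrum_iff: "z \<notin> op_spectrum S T \<longleftrightarrow> (\<exists>c. lb z c)"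
proof
  assume "z \<notin> op_spectrum S T"
  then obtain D where D: "\<And>f. f \<in> ell2 S \<Longrightarrow> ell2_norm S f \<le> D * ell2_norm S (shift T z f)"
    by (auto simp: op_spectrum_def)
  \<comment> \<open>The given constant \<open>D\<close> may fail to be positive.\<close>
  have "lb z (1 / max D 1)" unfolding lb_def
  proof (intro conjI ballI)
    fix f assume f: "f \<in> ell2 S"
    have "nm f \<le> D * nm (shift T z f)" using D[OF f] by (simp add: ell2_norm_n2 f shift_ell2)
    also have "\<dots> \<le> max D 1 * nm (shift T z f)" by (rule mult_right_mono) auto
    finally show "1 / max D 1 * nm f \<le> nm (shift T z f)" by (simp add: field_simps)
  qed simp
  then show "\<exists>c. lb z c" ..
next
  assume "\<exists>c. lb z c"
  then obtain c where l: "lb z c" ..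
  have "ell2_norm S f \<le> (1 / c) * ell2_norm S (shift T z f)" if f: "f \<in> ell2 S" for f
    using l f by (auto simp: lb_def ell2_norm_n2 shift_ell2 field_simps)
  then have "\<exists>D. \<forall>f\<in>ell2 S. ell2_norm S f \<le> D * ell2_norm S (shift T z f)" by blast
  then show "z \<notin> op_spectrum S T" using lb_bij[OF l] by (auto simp: op_spectrum_def)
qed

definition \<sigma> :: "real set" where "\<sigma> = {x. of_real x \<in> op_spectrum S T}"

lemma compact_sigma: "compact \<sigma>"
proof -
  have "open (- \<sigma>)" unfolding open_dist
  proof
    fix x assume "x \<in> - \<sigma>"
    then obtain c where c: "lb (of_real x) c" using spectrum_iff by (auto simp: \<sigma>_def)
    have "y \<in> - \<sigma>" if "dist y x < c / 2" for y
    proof -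
      have "cmod (of_real y - of_real x) \<le> c / 2" using that by (simp add: dist_real_def flip: of_real_diff)
      from lb_perturb[OF c this] show ?thesis using spectrum_iff by (auto simp: \<sigma>_def)
    qed
    then show "\<exists>e>0. \<forall>y. dist y x < e \<longrightarrow> y \<in> - \<sigma>" using c by (intro exI[of _ "c/2"]) (auto simp: lb_def)
  qed
  moreover have "\<sigma> \<subseteq> {-C..C}"
  proof
    fix x assume x: "x \<in> \<sigma>"
    have "\<not> C < \<bar>x\<bar>"
    proof
      assume "C < \<bar>x\<bar>"
      then have "lb (of_real x) (\<bar>x\<bar> - C)" using lb_large[of "of_real x"] by simp
      then show False using x spectrum_iff by (auto simp: \<sigma>_def)
    qed
    then show "x \<in> {-C..C}" by auto
  qed
  then have "bounded \<sigma>" by (rule bounded_subset[rotated]) simp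
  ultimately show ?thesis by (simp add: compact_eq_bounded_closed closed_def)
qed

end

section \<open>The resolvent vector and the support of the spectral measure\<close>

lemma poly_calc_pCons_aux:
  "poly_calc T p f v = (\<Sum>j\<le>n. coeff p j * (T ^^ j) f v)" if "degree p \<le> n"
  unfolding poly_calc_def
  by (rule sum.mono_neutral_left) (use that in \<open>auto simp: coeff_eq_0\<close>)

locale spectral_op = sa_op S T C for S :: "'v set" and T C +
  fixes X :: 'v and \<rho> :: "real measure"
  assumes X: "X \<in> S" and spec: "is_spectral_measure S T X \<rho>"
begin

lemma sets_rho [measurable_cong]: "sets \<rho> = sets borel"
  using spec by (simp add: is_spectral_measure_def)

lemma fin_rho: "finite_measure \<rho>"
  using spec by (simp add: is_spectral_measure_def)

lemma kd [simp]: "kdelta X \<in> ell2 S" using X by (rule kdelta_ell2)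

definition u :: "complex \<Rightarrow> 'v \<Rightarrow> complex" where "u z = resolvent_at S T z (kdelta X)"

lemma u: assumes "Im z \<noteq> 0" shows "u z \<in> ell2 S" "shift T z (u z) = kdelta X"
proof -
  have b: "bij_betw (shift T z) (ell2 S) (ell2 S)" using lb_bij[OF lb_nonreal[OF assms]] .
  then have "kdelta X \<in> shift T z ` ell2 S" by (simp add: bij_betw_def)
  then obtain f where f: "f \<in> ell2 S" "shift T z f = kdelta X" by auto
  have "\<exists>!f. f \<in> ell2 S \<and> shift T z f = kdelta X"
  proof (rule ex1I[of _ f])
    fix g assume g: "g \<in> ell2 S \<and> shift T z g = kdelta X"
    show "g = f" by (rule inj_onD[OF bij_betw_imp_inj_on[OF b]]) (use f g in auto)
  qed (use f in simp)
  then have "u z \<in> ell2 S \<and> shift T z (u z) = kdelta X"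
    unfolding u_def resolvent_at_def by (rule theI')
  then show "u z \<in> ell2 S" "shift T z (u z) = kdelta X" by auto
qed

lemma Tu: assumes "Im z \<noteq> 0" shows "T (u z) = (\<lambda>v. kdelta X v + z * u z v)"
  using u(2)[OF assms] by (auto simp: shift_def fun_eq_iff algebra_simps)

lemma u_transform: assumes z: "Im z \<noteq> 0" shows "inn (u z) (kdelta X) = (\<integral>x. 1 / (of_real x - z) \<partial>\<rho>)"
proof -
  have "ell2_inner S (u z) (kdelta X) = (\<integral>x. 1 / (of_real x - z) \<partial>\<rho>)"
    using spec z unfolding is_spectral_measure_def u_def by blast
  then show ?thesis by (simp add: ell2_inner_ip u(1)[OF z])
qed

text \<open>Replace \<open>kdelta X\<close> by \<open>(T - z) u\<close> in the second slot; by
  symmetry \<open>inn u (T u)\<close> is real, so only the term with \<open>cnj z\<close>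
  contributes.\<close>

lemma Im_u: assumes z: "Im z \<noteq> 0" shows "Im (inn (u z) (kdelta X)) = Im z * (nm (u z))\<^sup>2"
proof -
  note uz = u(1)[OF z]
  have "inn (u z) (kdelta X) = inn (u z) (shift T z (u z))" by (simp add: u(2)[OF z])
  also have "\<dots> = inn (u z) (T (u z)) - cnj z * of_real ((nm (u z))\<^sup>2)"
    unfolding shift_def ip_self[symmetric] using uz
    by (subst ip_diff_right) (auto intro!: ell2_sqi T_ell2 ell2_scale simp: ip_scale_right)
  finally have 1: "inn (u z) (kdelta X) = inn (u z) (T (u z)) - cnj z * of_real ((nm (u z))\<^sup>2)" .
  have "cnj (inn (u z) (T (u z))) = inn (u z) (T (u z))" using uz by (simp add: ip_cnj T_sym T_ell2)
  then have "Im (inn (u z) (T (u z))) = 0" by (simp add: complex_eq_iff)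
  with 1 show ?thesis by simp
qed

lemma nm_u: assumes z: "Im z \<noteq> 0" and l: "lb z c" shows "nm (u z) \<le> 1 / c"
proof -
  have "c * nm (u z) \<le> nm (shift T z (u z))" using l u(1)[OF z] by (auto simp: lb_def)
  also have "\<dots> = 1" by (simp add: u(2)[OF z] n2_kdelta X)
  finally show ?thesis using l by (simp add: lb_def field_simps)
qed

lemma stieltjes_integrable: assumes "Im z \<noteq> 0" shows "integrable \<rho> (\<lambda>x. 1 / (complex_of_real x - z))"
proof -
  interpret finite_measure \<rho> by (rule fin_rho)
  show ?thesis
  proof (rule integrable_const_bound)
    show "AE x in \<rho>. norm (1 / (complex_of_real x - z)) \<le> 1 / \<bar>Im z\<bar>"
    proof (rule AE_I2)
      fix x
      have "\<bar>Im z\<bar> \<le> cmod (of_real x - z)" using abs_Im_le_cmod[of "of_real x - z"] by simp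
      then show "norm (1 / (complex_of_real x - z)) \<le> 1 / \<bar>Im z\<bar>"
        using assms by (simp add: norm_divide frac_le)
    qed
  qed measurable
qed

text \<open>The imaginary part of the Stieltjes transform at height \<open>\<epsilon>\<close> bounds the mass of an interval of
  length \<open>2\<epsilon>\<close>, and it is \<open>O(\<epsilon>)\<close> near a point of the resolvent set.\<close>

lemma measure_small_interval:
  assumes e: "0 < \<epsilon>" and l: "lb (Complex y \<epsilon>) c"
  shows "measure \<rho> {y - \<epsilon>..y + \<epsilon>} \<le> 2 * \<epsilon>\<^sup>2 / c\<^sup>2"
proof -
  interpret finite_measure \<rho> by (rule fin_rho)
  define z where "z = Complex y \<epsilon>"
  have z: "Im z \<noteq> 0" using e by (simp add: z_def)
  have c: "0 < c" using l by (simp add: lb_def)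
  have "measure \<rho> {y - \<epsilon>..y + \<epsilon>} / (2 * \<epsilon>) = (\<integral>x. indicator {y - \<epsilon>..y + \<epsilon>} x / (2 * \<epsilon>) \<partial>\<rho>)"
    by simp
  also have "\<dots> \<le> (\<integral>x. Im (1 / (complex_of_real x - z)) \<partial>\<rho>)"
  proof (rule integral_mono)
    show "integrable \<rho> (\<lambda>x. indicator {y - \<epsilon>..y + \<epsilon>} x / (2 * \<epsilon>))"
      by (intro integrable_divide integrable_real_indicator) (auto simp: sets_rho emeasure_eq_measure)
    show "integrable \<rho> (\<lambda>x. Im (1 / (complex_of_real x - z)))"
      by (rule integrable_Im[OF stieltjes_integrable[OF z]])
    fix x
    have im: "Im (1 / (complex_of_real x - z)) = \<epsilon> / ((x - y)\<^sup>2 + \<epsilon>\<^sup>2)"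
      by (simp add: Im_divide z_def)
    show "indicator {y - \<epsilon>..y + \<epsilon>} x / (2 * \<epsilon>) \<le> Im (1 / (complex_of_real x - z))"
    proof (cases "x \<in> {y - \<epsilon>..y + \<epsilon>}")
      case True
      then have "\<bar>x - y\<bar> \<le> \<epsilon>" by auto
      then have "(x - y)\<^sup>2 \<le> \<epsilon>\<^sup>2" by (simp add: abs_le_square_iff[symmetric] e less_imp_le)
      then have "\<epsilon> / (2 * \<epsilon>\<^sup>2) \<le> \<epsilon> / ((x - y)\<^sup>2 + \<epsilon>\<^sup>2)"
        using e by (intro divide_left_mono mult_pos_pos add_nonneg_pos) auto
      then show ?thesis using True e by (simp add: im power2_eq_square)
    next
      case False
      then show ?thesis using e by (simp add: im)
    qed
  qed
  also have "\<dots> = Im (inn (u z) (kdelta X))"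
    unfolding u_transform[OF z] by (rule integral_Im[OF stieltjes_integrable[OF z]])
  also have "\<dots> = \<epsilon> * (nm (u z))\<^sup>2" unfolding Im_u[OF z] by (simp add: z_def)
  also have "\<dots> \<le> \<epsilon> * (1 / c)\<^sup>2"
    using nm_u[OF z l[folded z_def]] e by (intro mult_left_mono power_mono) auto
  finally show ?thesis using e c by (simp add: field_simps power2_eq_square)
qed

text \<open>Cover a fixed interval around \<open>x\<close> by n intervals of length
  \<open>2 r / n\<close>. Each has mass \<open>O(1 / n^2)\<close> by the previous estimate, so the
  total is \<open>O(1 / n)\<close>.\<close>

lemma null_near_resolvent:
  assumes l: "lb (of_real x) c" shows "\<exists>U. open U \<and> x \<in> U \<and> emeasure \<rho> U = 0"
proof -
  interpret finite_measure \<rho> by (rule fin_rho)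
  have c: "0 < c" using l by (simp add: lb_def)
  \<comment> \<open>Then all centres \<open>y j + i \<epsilon>\<close> lie within
    \<open>2 r = c / 4\<close> of \<open>x\<close>, inside the disc of radius \<open>c / 2\<close>
    where the lower bound survives with constant \<open>c / 2\<close>.\<close>
  define r where "r = c / 8"
  have r: "r > 0" using c by (simp add: r_def)
  have bound: "measure \<rho> {x - r..x + r} \<le> (8 * r\<^sup>2 / c\<^sup>2) * inverse (real (Suc m))" for m
  proof -
    define n where "n = Suc m"
    define \<epsilon> where "\<epsilon> = r / real n"
    have e: "0 < \<epsilon>" "\<epsilon> \<le> r" using r by (auto simp: \<epsilon>_def n_def field_simps)
    have ne: "real n * \<epsilon> = r" by (simp add: \<epsilon>_def n_def)
    define y where "y j = x - r + (2 * real j + 1) * \<epsilon>" for j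
    have sub: "{x - r..x + r} \<subseteq> (\<Union>j<n. {y j - \<epsilon>..y j + \<epsilon>})"
    proof
      fix t assume t: "t \<in> {x - r..x + r}"
      define s where "s = (t - (x - r)) / (2 * \<epsilon>)"
      have s: "0 \<le> s" "s \<le> real n" using t e ne by (auto simp: s_def field_simps)
      have ts: "t = x - r + 2 * \<epsilon> * s" using e by (simp add: s_def)
      show "t \<in> (\<Union>j<n. {y j - \<epsilon>..y j + \<epsilon>})"
      proof (cases "s = real n")
        case True
        have "t \<in> {y (n - 1) - \<epsilon>..y (n - 1) + \<epsilon>}"
          using e unfolding ts True y_def by (simp add: n_def algebra_simps)
        then show ?thesis by (force simp: n_def)
      next
        case False
        define j where "j = nat \<lfloor>s\<rfloor>"
        have j: "real j \<le> s" "s < real j + 1" using s(1) by (auto simp: j_def)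
        then have "j < n" using False s(2) by linarith
        moreover have "2 * \<epsilon> * real j \<le> 2 * \<epsilon> * s" "2 * \<epsilon> * s \<le> 2 * \<epsilon> * (real j + 1)"
          using j e by (auto intro!: mult_left_mono)
        then have "t \<in> {y j - \<epsilon>..y j + \<epsilon>}"
          unfolding ts y_def by (simp add: algebra_simps)
        ultimately show ?thesis by blast
      qed
    qed
    have each: "measure \<rho> {y j - \<epsilon>..y j + \<epsilon>} \<le> 8 * \<epsilon>\<^sup>2 / c\<^sup>2" if "j < n" for j
    proof -
      have "2 * real j + 1 \<le> 2 * real n" using that by linarith
      then have "(2 * real j + 1) * \<epsilon> \<le> 2 * (real n * \<epsilon>)"
        using mult_right_mono[of "2 * real j + 1" "2 * real n" \<epsilon>] e by simp
      then have yx: "\<bar>y j - x\<bar> \<le> r" using e ne by (auto simp: y_def abs_le_iff)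
      have "cmod (Complex (y j) \<epsilon> - of_real x) \<le> \<bar>y j - x\<bar> + \<bar>\<epsilon>\<bar>"
        using cmod_le[of "Complex (y j) \<epsilon> - of_real x"] by simp
      also have "\<dots> \<le> c / 2" using yx e c by (simp add: r_def)
      finally have "lb (Complex (y j) \<epsilon>) (c / 2)" by (rule lb_perturb[OF l])
      from measure_small_interval[OF e(1) this] show ?thesis by (simp add: power_divide)
    qed
    have "measure \<rho> {x - r..x + r} \<le> measure \<rho> (\<Union>j<n. {y j - \<epsilon>..y j + \<epsilon>})"
      by (rule finite_measure_mono[OF sub]) (auto simp: sets_rho)
    also have "\<dots> \<le> (\<Sum>j<n. measure \<rho> {y j - \<epsilon>..y j + \<epsilon>})"
      by (rule finite_measure_subadditive_finite) (auto simp: sets_rho)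
    also have "\<dots> \<le> (\<Sum>j<n. 8 * \<epsilon>\<^sup>2 / c\<^sup>2)" by (rule sum_mono) (use each in auto)
    also have "\<dots> = 8 * (real n * \<epsilon>) * \<epsilon> / c\<^sup>2" by (simp add: power2_eq_square)
    also have "\<dots> = (8 * r\<^sup>2 / c\<^sup>2) * inverse (real n)"
      unfolding ne by (simp add: \<epsilon>_def power2_eq_square divide_inverse mult_ac)
    finally show ?thesis by (simp add: n_def)
  qed
  have "(\<lambda>m. (8 * r\<^sup>2 / c\<^sup>2) * inverse (real (Suc m))) \<longlonglongrightarrow> (8 * r\<^sup>2 / c\<^sup>2) * 0"
    by (intro tendsto_intros LIMSEQ_inverse_real_of_nat)
  then have "measure \<rho> {x - r..x + r} \<le> (8 * r\<^sup>2 / c\<^sup>2) * 0"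
    by (rule LIMSEQ_le_const) (use bound in blast)
  then have 0: "measure \<rho> {x - r..x + r} = 0" by (simp add: measure_le_0_iff)
  have "measure \<rho> {x - r<..<x + r} \<le> measure \<rho> {x - r..x + r}"
    by (rule finite_measure_mono) (auto simp: sets_rho)
  then have "emeasure \<rho> {x - r<..<x + r} = 0" using 0 by (simp add: emeasure_eq_measure measure_le_0_iff)
  then show ?thesis using r by (intro exI[of _ "{x - r<..<x + r}"]) auto
qed

lemma AE_sigma: "AE x in \<rho>. x \<in> \<sigma>"
proof (rule AE_from_local_null[OF sets_rho])
  fix x assume "x \<notin> \<sigma>"
  then obtain c where "lb (of_real x) c" using spectrum_iff by (auto simp: \<sigma>_def)
  then show "\<exists>U. open U \<and> x \<in> U \<and> emeasure \<rho> U = 0" by (rule null_near_resolvent)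
qed

lemma sigma_subset: "\<sigma> \<subseteq> {-C..C}"
proof
  fix x assume x: "x \<in> \<sigma>"
  have "\<not> C < \<bar>x\<bar>"
  proof
    assume "C < \<bar>x\<bar>"
    then have "lb (of_real x) (\<bar>x\<bar> - C)" using lb_large[of "of_real x"] by simp
    then show False using x spectrum_iff by (auto simp: \<sigma>_def)
  qed
  then show "x \<in> {-C..C}" by auto
qed

text \<open>The radius is \<open>C + 1\<close> because it has to be positive even if
  \<open>C = 0\<close>.\<close>

sublocale bb: bounded_borel \<rho> "C + 1"
proof -
  interpret finite_measure \<rho> by (rule fin_rho)
  show "bounded_borel \<rho> (C + 1)"
  proof
    show "sets \<rho> = sets borel" by (rule sets_rho)
    show "0 < C + 1" using C_nonneg by simp
    show "AE x in \<rho>. \<bar>x\<bar> \<le> C + 1"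
      using AE_sigma by eventually_elim (use sigma_subset in force)
  qed
qed

section \<open>Moments of the spectral measure\<close>

lemma Tpow_ell2: "f \<in> ell2 S \<Longrightarrow> (T ^^ k) f \<in> ell2 S"
  by (induct k) (auto intro: T_ell2)

lemma Tpow_bound: "f \<in> ell2 S \<Longrightarrow> nm ((T ^^ k) f) \<le> C ^ k * nm f"
proof (induct k)
  case (Suc k)
  have "nm (T ((T ^^ k) f)) \<le> C * nm ((T ^^ k) f)" by (rule T_bound[OF Tpow_ell2[OF Suc(2)]])
  also have "\<dots> \<le> C * (C ^ k * nm f)" by (rule mult_left_mono[OF Suc(1)[OF Suc(2)] C_nonneg])
  finally show ?case by (simp add: mult.assoc)
qed simp

lemma Tpow_lin: "f \<in> ell2 S \<Longrightarrow> g \<in> ell2 S \<Longrightarrow> (T ^^ k) (\<lambda>v. a * f v + b * g v) = (\<lambda>v. a * (T ^^ k) f v + b * (T ^^ k) g v)"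
  by (induct k) (auto simp: T_lin Tpow_ell2)

lemma moment_stieltjes_integrable: assumes "Im z \<noteq> 0"
  shows "integrable \<rho> (\<lambda>x. of_real x ^ k / (complex_of_real x - z))"
proof -
  have [measurable]: "(\<lambda>x. 1 / (complex_of_real x - z)) \<in> borel_measurable borel" by measurable
  have "sqi \<rho> (\<lambda>x. 1 / (complex_of_real x - z))"
  proof (rule bb.sqi_bounded)
    fix x
    have "\<bar>Im z\<bar> \<le> cmod (of_real x - z)" using abs_Im_le_cmod[of "of_real x - z"] by simp
    then show "cmod (1 / (complex_of_real x - z)) \<le> 1 / \<bar>Im z\<bar>"
      using assms by (simp add: norm_divide frac_le)
  qed simp
  from sqi_mult_integrable[OF bb.sqi_poly[of "monom 1 k"] this] show ?thesis by (simp add: poly_monom)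
qed

lemma integrable_pow: "integrable \<rho> (\<lambda>x. complex_of_real x ^ k)"
  using bb.sqi_integrable[OF bb.sqi_poly[of "monom 1 k"]] by (simp add: poly_monom)

text \<open>On the imaginary axis \<open>T u = \<delta> + z u\<close> and
  \<open>x / (x - z) = 1 + z / (x - z)\<close> give the same recursion for the resolvent elements
  and for the Stieltjes integrals. If these agree at order k, the two k-th moments differ by a
  quantity of order \<open>1 / y\<close>, hence coincide, and agreement passes to order k + 1. Both
  claims therefore share one induction.\<close>

lemma moments_aux:
  "(\<forall>y>0. inn ((T ^^ k) (u (Complex 0 y))) (kdelta X) = (\<integral>x. of_real x ^ k / (of_real x - Complex 0 y) \<partial>\<rho>))
   \<and> (\<forall>j<k. inn ((T ^^ j) (kdelta X)) (kdelta X) = (\<integral>x. of_real x ^ j \<partial>\<rho>))"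
proof (induct k)
  case 0
  show ?case using u_transform by auto
next
  case (Suc k)
  define s where "s = inn ((T ^^ k) (kdelta X)) (kdelta X)"
  define m where "m = (\<integral>x. complex_of_real x ^ k \<partial>\<rho>)"
  define e where "e k y = inn ((T ^^ k) (u (Complex 0 y))) (kdelta X)" for k y
  define E where "E k y = (\<integral>x. complex_of_real x ^ k / (of_real x - Complex 0 y) \<partial>\<rho>)" for k y
  have eE: "e k y = E k y" if "y > 0" for y using Suc that by (simp add: e_def E_def)
  have e1: "e (Suc k) y = s + Complex 0 y * e k y" if y: "y > 0" for y
  proof -
    have z: "Im (Complex 0 y) \<noteq> 0" using y by simp
    have "(T ^^ Suc k) (u (Complex 0 y)) = (T ^^ k) (\<lambda>v. 1 * kdelta X v + Complex 0 y * u (Complex 0 y) v)"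
      unfolding funpow_Suc_right comp_def Tu[OF z] by simp
    also have "\<dots> = (\<lambda>v. (T ^^ k) (kdelta X) v + Complex 0 y * (T ^^ k) (u (Complex 0 y)) v)"
      by (subst Tpow_lin) (use u(1)[OF z] in auto)
    finally show ?thesis unfolding e_def s_def
      by (simp add: ip_add_left ip_scale_left ell2_sqi Tpow_ell2 ell2_scale u(1)[OF z] del: funpow.simps)
  qed
  have E1: "E (Suc k) y = m + Complex 0 y * E k y" if y: "y > 0" for y
  proof -
    have z: "Im (Complex 0 y) \<noteq> 0" using y by simp
    have "E (Suc k) y = (\<integral>x. complex_of_real x ^ k + Complex 0 y * (of_real x ^ k / (of_real x - Complex 0 y)) \<partial>\<rho>)"
      unfolding E_def
    proof (rule Bochner_Integration.integral_cong[OF refl])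
      fix x
      have "complex_of_real x - Complex 0 y \<noteq> 0" using y by (simp add: complex_eq_iff)
      then show "complex_of_real x ^ Suc k / (of_real x - Complex 0 y) =
         complex_of_real x ^ k + Complex 0 y * (of_real x ^ k / (of_real x - Complex 0 y))"
        by (simp add: field_simps)
    qed
    also have "\<dots> = m + Complex 0 y * E k y" unfolding m_def E_def
    proof (subst Bochner_Integration.integral_add)
      show "integrable \<rho> (\<lambda>x. Complex 0 y * (of_real x ^ k / (of_real x - Complex 0 y)))"
        by (intro integrable_mult_right moment_stieltjes_integrable z)
      show "(\<integral>x. complex_of_real x ^ k \<partial>\<rho>) + (\<integral>x. Complex 0 y * (of_real x ^ k / (of_real x - Complex 0 y)) \<partial>\<rho>)
        = (\<integral>x. complex_of_real x ^ k \<partial>\<rho>) + Complex 0 y * (\<integral>x. of_real x ^ k / (of_real x - Complex 0 y) \<partial>\<rho>)"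
        by (simp only: integral_mult_right_zero)
    qed (rule integrable_pow)
    finally show ?thesis .
  qed
  \<comment> \<open>At height \<open>y\<close> the resolvent vector has norm at most
    \<open>1 / y\<close> and the Stieltjes kernel modulus at most \<open>1 / y\<close>; powers of
    the operator and of \<open>x\<close> contribute the constants.\<close>
  define K where "K = C ^ Suc k + (C + 1) ^ Suc k * measure \<rho> (space \<rho>)"
  have bd: "cmod (s - m) \<le> K * inverse (real (Suc n))" for n
  proof -
    define y where "y = real (Suc n)"
    have y: "y > 0" by (simp add: y_def)
    have z: "Im (Complex 0 y) \<noteq> 0" using y by simp
    have "s - m = e (Suc k) y - E (Suc k) y" using e1[OF y] E1[OF y] eE[OF y] by simp
    also have "cmod \<dots> \<le> cmod (e (Suc k) y) + cmod (E (Suc k) y)" by (rule norm_triangle_ineq4)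
    also have "cmod (e (Suc k) y) \<le> nm ((T ^^ Suc k) (u (Complex 0 y))) * 1"
      unfolding e_def using cauchy_schwarz[OF ell2_sqi[OF Tpow_ell2[OF u(1)[OF z]]] ell2_sqi[OF kd], of "Suc k"]
      by (simp add: n2_kdelta X)
    also have "\<dots> \<le> C ^ Suc k * nm (u (Complex 0 y))" using Tpow_bound[OF u(1)[OF z], of "Suc k"] by simp
    also have "\<dots> \<le> C ^ Suc k * (1 / y)"
      using nm_u[OF z lb_nonreal[OF z]] y C_nonneg by (intro mult_left_mono) auto
    also have "cmod (E (Suc k) y) \<le> (\<integral>x. cmod (complex_of_real x ^ Suc k / (of_real x - Complex 0 y)) \<partial>\<rho>)"
      unfolding E_def by (rule integral_norm_bound)
    also have "\<dots> \<le> (\<integral>x. (C + 1) ^ Suc k * (1 / y) \<partial>\<rho>)"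
    proof (rule integral_mono_AE)
      show "integrable \<rho> (\<lambda>x. cmod (complex_of_real x ^ Suc k / (of_real x - Complex 0 y)))"
        by (intro integrable_norm moment_stieltjes_integrable z)
      show "AE x in \<rho>. cmod (complex_of_real x ^ Suc k / (of_real x - Complex 0 y)) \<le> (C + 1) ^ Suc k * (1 / y)"
        using bb.AE_R
      proof eventually_elim
        case (elim x)
        have "y \<le> cmod (of_real x - Complex 0 y)" using abs_Im_le_cmod[of "of_real x - Complex 0 y"] y by simp
        then have 1: "1 / cmod (of_real x - Complex 0 y) \<le> 1 / y" using y by (simp add: frac_le)
        have 2: "\<bar>x\<bar> ^ Suc k \<le> (C + 1) ^ Suc k" using elim by (intro power_mono) auto
        have "\<bar>x\<bar> ^ Suc k * (1 / cmod (of_real x - Complex 0 y)) \<le> (C + 1) ^ Suc k * (1 / y)"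
          by (rule mult_mono[OF 2 1]) (use C_nonneg in auto)
        then show ?case by (simp add: norm_divide norm_mult norm_power)
      qed
    qed simp
    finally show ?thesis by (simp add: K_def y_def inverse_eq_divide distrib_right algebra_simps del: power_Suc)
  qed
  have "(\<lambda>n. K * inverse (real (Suc n))) \<longlonglongrightarrow> K * 0"
    by (intro tendsto_intros LIMSEQ_inverse_real_of_nat)
  then have "cmod (s - m) \<le> K * 0"
    by (rule LIMSEQ_le_const) (use bd in blast)
  then have sm: "s = m" by simp
  show ?case
  proof (intro conjI allI impI)
    fix y :: real assume y: "0 < y"
    show "inn ((T ^^ Suc k) (u (Complex 0 y))) (kdelta X) = (\<integral>x. of_real x ^ Suc k / (of_real x - Complex 0 y) \<partial>\<rho>)"
      using e1[OF y] E1[OF y] eE[OF y] sm unfolding e_def E_def by simp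
  next
    fix j assume "j < Suc k"
    then show "inn ((T ^^ j) (kdelta X)) (kdelta X) = (\<integral>x. of_real x ^ j \<partial>\<rho>)"
      using Suc sm by (cases "j = k") (auto simp: s_def m_def)
  qed
qed

lemma moments: "inn ((T ^^ k) (kdelta X)) (kdelta X) = (\<integral>x. of_real x ^ k \<partial>\<rho>)"
  using moments_aux[of "Suc k"] by blast

section \<open>Polynomials in the operator, applied to the root vector\<close>

definition U :: "complex poly \<Rightarrow> 'v \<Rightarrow> complex" where "U p = poly_calc T p (kdelta X)"

lemma U_ell2: "U p \<in> ell2 S"
  unfolding U_def poly_calc_def by (intro ell2_sum ell2_scale Tpow_ell2) auto

lemma U_alt: "degree p \<le> n \<Longrightarrow> U p v = (\<Sum>j\<le>n. coeff p j * (T ^^ j) (kdelta X) v)"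
  unfolding U_def by (rule poly_calc_pCons_aux)

lemma U_add_smult: "U (smult a p + smult b q) = (\<lambda>v. a * U p v + b * U q v)"
proof
  fix v
  define n where "n = max (degree p) (degree q)"
  have "degree (smult a p + smult b q) \<le> n"
    unfolding n_def by (rule order_trans[OF degree_add_le_max]) (auto intro: le_max_iff_disj[THEN iffD2] order_trans[OF degree_smult_le] max.mono)
  then have "U (smult a p + smult b q) v = (\<Sum>j\<le>n. coeff (smult a p + smult b q) j * (T ^^ j) (kdelta X) v)"
    by (rule U_alt)
  also have "\<dots> = a * (\<Sum>j\<le>n. coeff p j * (T ^^ j) (kdelta X) v) + b * (\<Sum>j\<le>n. coeff q j * (T ^^ j) (kdelta X) v)"
    by (simp add: sum_distrib_left sum.distrib algebra_simps)
  also have "\<dots> = a * U p v + b * U q v" by (simp add: U_alt[of _ n] n_def)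
  finally show "U (smult a p + smult b q) v = a * U p v + b * U q v" .
qed

lemma T_sum: "finite I \<Longrightarrow> (\<And>i. i \<in> I \<Longrightarrow> f i \<in> ell2 S) \<Longrightarrow>
    T (\<lambda>v. \<Sum>i\<in>I. c i * f i v) = (\<lambda>v. \<Sum>i\<in>I. c i * T (f i) v)"
proof (induct I rule: finite_induct)
  case empty
  show ?case using T_lin[of "\<lambda>v. 0" "\<lambda>v. 0" 0 0] by simp
next
  case (insert i I)
  have "T (\<lambda>v. c i * f i v + 1 * (\<Sum>i\<in>I. c i * f i v)) = (\<lambda>v. c i * T (f i) v + 1 * T (\<lambda>v. \<Sum>i\<in>I. c i * f i v) v)"
    by (rule T_lin) (use insert in \<open>auto intro!: ell2_sum ell2_scale\<close>)
  then show ?case using insert by simp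
qed

lemma U_pCons: "U (pCons a p) = (\<lambda>v. a * kdelta X v + T (U p) v)"
proof
  fix v
  have "U (pCons a p) v = (\<Sum>j\<le>Suc (degree p). coeff (pCons a p) j * (T ^^ j) (kdelta X) v)"
    by (rule U_alt) (simp add: degree_pCons_le)
  also have "\<dots> = a * kdelta X v + (\<Sum>j\<le>degree p. coeff p j * T ((T ^^ j) (kdelta X)) v)"
    by (subst sum.atMost_Suc_shift) simp
  also have "(\<Sum>j\<le>degree p. coeff p j * T ((T ^^ j) (kdelta X)) v) = T (U p) v"
    unfolding U_def poly_calc_def by (subst T_sum) (auto intro: Tpow_ell2)
  finally show "U (pCons a p) v = a * kdelta X v + T (U p) v" .
qed

lemma U_0 [simp]: "U 0 = (\<lambda>v. 0)" by (simp add: U_def poly_calc_def)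

lemma inn_U_kd: "inn (U p) (kdelta X) = (\<integral>x. poly p (of_real x) \<partial>\<rho>)"
proof -
  have "inn (U p) (kdelta X) = (\<Sum>j\<le>degree p. coeff p j * inn ((T ^^ j) (kdelta X)) (kdelta X))"
    by (simp add: U_def poly_calc_def ip_kdelta X)
  also have "\<dots> = (\<Sum>j\<le>degree p. \<integral>x. coeff p j * of_real x ^ j \<partial>\<rho>)"
    by (simp add: moments)
  also have "\<dots> = (\<integral>x. (\<Sum>j\<le>degree p. coeff p j * of_real x ^ j) \<partial>\<rho>)"
    by (rule Bochner_Integration.integral_sum[symmetric]) (intro integrable_mult_right integrable_pow)
  finally show ?thesis by (simp add: poly_altdef)
qed

abbreviation "cp p \<equiv> (\<lambda>x. poly p (complex_of_real x))"

text \<open>Symmetry moves one factor \<open>T\<close> at a time from \<open>q\<close> to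
  \<open>p\<close>, which is why \<open>p\<close> is arbitrary in the induction; the base of the
  recursion is the moment formula.\<close>

lemma inn_U: "inn (U p) (U q) = ip \<rho> (cp p) (cp q)"
proof (induct q arbitrary: p)
  case 0
  show ?case by (simp add: ip_def)
next
  case (pCons a q)
  have "inn (U p) (U (pCons a q)) = cnj a * inn (U p) (kdelta X) + inn (U p) (T (U q))"
    unfolding U_pCons by (simp add: ip_add_right ip_scale_right ell2_sqi U_ell2 T_ell2 ell2_scale)
  also have "inn (U p) (T (U q)) = inn (U (pCons 0 p)) (U q)"
    unfolding U_pCons by (simp add: T_sym U_ell2)
  also have "\<dots> = ip \<rho> (cp (pCons 0 p)) (cp q)" by (rule pCons)
  also have "cnj a * inn (U p) (kdelta X) = (\<integral>x. cnj a * poly p (of_real x) \<partial>\<rho>)"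
    by (simp add: inn_U_kd)
  also have "(\<integral>x. cnj a * poly p (of_real x) \<partial>\<rho>) + ip \<rho> (cp (pCons 0 p)) (cp q)
     = (\<integral>x. cnj a * poly p (of_real x) + cp (pCons 0 p) x * cnj (cp q x) \<partial>\<rho>)"
    unfolding ip_def
    by (rule Bochner_Integration.integral_add[symmetric])
      (rule bb.sqi_integrable[OF sqi_scale[OF bb.sqi_poly]] ip_integrable[OF bb.sqi_poly bb.sqi_poly])+
  also have "\<dots> = ip \<rho> (cp p) (cp (pCons a q))" unfolding ip_def
    by (rule Bochner_Integration.integral_cong) (auto simp: algebra_simps)
  finally show ?case .
qed

lemma nm_U: "nm (U p) = n2 \<rho> (cp p)"
proof -
  have "of_real ((nm (U p))\<^sup>2) = complex_of_real ((n2 \<rho> (cp p))\<^sup>2)"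
    using inn_U[of p p] by (simp only: ip_self)
  then have "(nm (U p))\<^sup>2 = (n2 \<rho> (cp p))\<^sup>2" using of_real_eq_iff by blast
  then show ?thesis by (rule power2_eq_imp_eq) simp_all
qed

lemma U_diff: "U (p - q) = (\<lambda>v. U p v - U q v)"
  using U_add_smult[of 1 p "-1" q] by simp

text \<open>The Riesz lemma needs a functional on functions, so a polynomial has to be recoverable
  from its restriction to the real line.\<close>

lemma cp_inj: assumes "cp p = cp q" shows "p = q"
proof (rule ccontr)
  assume "p \<noteq> q"
  then have "finite {z. poly (p - q) z = 0}" by (intro poly_roots_finite) simp
  moreover have "range complex_of_real \<subseteq> {z. poly (p - q) z = 0}"
  proof
    fix z assume "z \<in> range complex_of_real"
    then obtain x where "z = of_real x" by blast
    with fun_cong[OF assms, of x] show "z \<in> {z. poly (p - q) z = 0}" by simp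
  qed
  ultimately have "finite (range complex_of_real)" by (rule finite_subset[rotated])
  then have "finite (UNIV :: real set)" by (rule finite_imageD) (simp add: inj_on_def)
  then show False using infinite_UNIV_char_0[where 'a=real] by blast
qed

text \<open>A coordinate is bounded by the norm, and \<open>p \<mapsto> U p\<close> is isometric, so
  \<open>p \<mapsto> U p Y\<close> is bounded in L2. The conjugate of the representative turns the
  inner product into a bilinear pairing.\<close>

lemma ex_density: assumes Y: "Y \<in> S"
  obtains \<psi> where "sqi \<rho> \<psi>" "\<And>p. (\<integral>x. poly p (of_real x) * \<psi> x \<partial>\<rho>) = U p Y"
proof -
  define l where "l f = U (SOME p. f = cp p) Y" for f
  have l: "l (cp p) = U p Y" for p
  proof -
    have "cp p = cp (SOME q. cp p = cp q)" by (rule someI[of "\<lambda>q. cp p = cp q" p]) simp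
    then have "p = (SOME q. cp p = cp q)" by (rule cp_inj)
    then show ?thesis by (simp add: l_def)
  qed
  obtain P \<phi> where P: "sqi \<rho> \<phi>" "\<And>f. f \<in> range cp \<Longrightarrow> ip \<rho> f \<phi> = l f"
  proof (rule riesz_subspace[of "range cp" \<rho> l 1])
    fix f g c assume "f \<in> range cp" "g \<in> range cp"
    then obtain p q where pq: "f = cp p" "g = cp q" by auto
    have e: "(\<lambda>x. f x + c * g x) = cp (smult 1 p + smult c q)" by (simp add: pq)
    show "(\<lambda>x. f x + c * g x) \<in> range cp" unfolding e by (rule rangeI)
    show "l (\<lambda>x. f x + c * g x) = l f + c * l g" unfolding e l U_add_smult unfolding pq l by simp
  next
    fix f assume "f \<in> range cp"
    then obtain p where "f = cp p" by auto
    then show "cmod (l f) \<le> 1 * n2 \<rho> f" using ell2_point_le[OF U_ell2 Y] by (simp add: l nm_U)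
  qed (auto intro: bb.sqi_poly)
  show ?thesis
  proof (rule that[of "\<lambda>x. cnj (\<phi> x)"])
    show "sqi \<rho> (\<lambda>x. cnj (\<phi> x))" by (rule sqi_cnj[OF P(1)])
    show "(\<integral>x. poly p (of_real x) * cnj (\<phi> x) \<partial>\<rho>) = U p Y" for p
      using P(2)[of "cp p"] by (simp add: ip_def l)
  qed
qed

end

subsection \<open>Unitarity of the transform with kernel \<open>\<psi>\<close>\<close>

locale spectral_transform = spectral_op S T C X \<rho> for S :: "'v set" and T C X \<rho> +
  fixes \<psi> :: "'v \<Rightarrow> real \<Rightarrow> complex"
  assumes psi_sqi: "Y \<in> S \<Longrightarrow> sqi \<rho> (\<psi> Y)"
    and psi_U: "Y \<in> S \<Longrightarrow> (\<integral>x. poly p (of_real x) * \<psi> Y x \<partial>\<rho>) = U p Y"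
begin

definition hatF :: "(real \<Rightarrow> complex) \<Rightarrow> 'v \<Rightarrow> complex" where
  "hatF \<alpha> Y = (if Y \<in> S then \<integral>x. \<alpha> x * \<psi> Y x \<partial>\<rho> else 0)"

lemma hat_poly: "hatF (cp p) = U p"
proof
  fix Y show "hatF (cp p) Y = U p Y"
    using U_ell2[of p] by (auto simp: hatF_def psi_U ell2_iff)
qed

lemma hat_lin: assumes "sqi \<rho> \<alpha>" "sqi \<rho> \<beta>"
  shows "hatF (\<lambda>x. c * \<alpha> x + d * \<beta> x) = (\<lambda>v. c * hatF \<alpha> v + d * hatF \<beta> v)"
proof
  fix Y
  show "hatF (\<lambda>x. c * \<alpha> x + d * \<beta> x) Y = c * hatF \<alpha> Y + d * hatF \<beta> Y"
  proof (cases "Y \<in> S")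
    case True
    have i: "integrable \<rho> (\<lambda>x. c * (\<alpha> x * \<psi> Y x))" "integrable \<rho> (\<lambda>x. d * (\<beta> x * \<psi> Y x))"
      by (intro integrable_mult_right sqi_mult_integrable assms psi_sqi True)+
    have "(\<integral>x. (c * \<alpha> x + d * \<beta> x) * \<psi> Y x \<partial>\<rho>) = (\<integral>x. c * (\<alpha> x * \<psi> Y x) + d * (\<beta> x * \<psi> Y x) \<partial>\<rho>)"
      by (rule Bochner_Integration.integral_cong) (auto simp: algebra_simps)
    also have "\<dots> = c * (\<integral>x. \<alpha> x * \<psi> Y x \<partial>\<rho>) + d * (\<integral>x. \<beta> x * \<psi> Y x \<partial>\<rho>)"
      unfolding Bochner_Integration.integral_add[OF i] by simp
    finally show ?thesis using True by (simp add: hatF_def)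
  qed (simp add: hatF_def)
qed

lemma hat_ip: "Y \<in> S \<Longrightarrow> hatF \<alpha> Y = ip \<rho> \<alpha> (\<lambda>x. cnj (\<psi> Y x))"
  by (simp add: hatF_def ip_def)

lemma hat_tendsto:
  assumes "\<And>n. sqi \<rho> (f n)" "sqi \<rho> \<alpha>" "(\<lambda>n. n2 \<rho> (\<lambda>x. f n x - \<alpha> x)) \<longlonglongrightarrow> 0" "Y \<in> S"
  shows "(\<lambda>n. hatF (f n) Y) \<longlonglongrightarrow> hatF \<alpha> Y"
  unfolding hat_ip[OF assms(4)] by (intro ip_tendsto assms sqi_cnj psi_sqi)

lemma U_Cauchy: "n2_Cauchy (count_space S) (\<lambda>n. U (p n)) \<longleftrightarrow> n2_Cauchy \<rho> (\<lambda>n. cp (p n))"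
proof -
  have "nm (\<lambda>v. U (p m) v - U (p n) v) = n2 \<rho> (\<lambda>x. cp (p m) x - cp (p n) x)" for m n
    using nm_U[of "p m - p n"] by (simp add: U_diff)
  then show ?thesis by (simp add: n2_Cauchy_def)
qed

text \<open>By isometry \<open>U (p n)\<close> is Cauchy in \<open>ell2\<close>; its limit must be
  \<open>hatF \<alpha>\<close> because each coordinate is an L2 pairing with \<psi> and therefore
  converges.\<close>

lemma hat_limit:
  assumes a: "sqi \<rho> \<alpha>" and p: "(\<lambda>n. n2 \<rho> (\<lambda>x. cp (p n) x - \<alpha> x)) \<longlonglongrightarrow> 0"
  shows "hatF \<alpha> \<in> ell2 S" "(\<lambda>n. nm (\<lambda>v. U (p n) v - hatF \<alpha> v)) \<longlonglongrightarrow> 0"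
proof -
  have C: "n2_Cauchy (count_space S) (\<lambda>n. U (p n))"
    unfolding U_Cauchy by (rule n2_conv_Cauchy[OF bb.sqi_poly a p])
  have lim: "(\<lambda>n. U (p n) v) \<longlonglongrightarrow> hatF \<alpha> v" if "v \<in> S" for v
    using hat_tendsto[OF bb.sqi_poly a p that] by (simp add: hat_poly)
  note * = ell2_pointwise_limit[OF U_ell2 _ lim C, simplified]
  show "hatF \<alpha> \<in> ell2 S" by (rule *(1)) (auto simp: hatF_def)
  show "(\<lambda>n. nm (\<lambda>v. U (p n) v - hatF \<alpha> v)) \<longlonglongrightarrow> 0" by (rule *(2)) (auto simp: hatF_def)
qed

lemma norm_tendsto:
  assumes "\<And>n. sqi M (f n)" "sqi M g" "(\<lambda>n. n2 M (\<lambda>x. f n x - g x)) \<longlonglongrightarrow> 0"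
  shows "(\<lambda>n. n2 M (f n)) \<longlonglongrightarrow> n2 M g"
proof -
  have "(\<lambda>n. n2 M (f n) - n2 M g) \<longlonglongrightarrow> 0"
    by (rule Lim_null_comparison[OF _ assms(3)]) (use n2_abs_diff[OF assms(1,2)] in simp)
  then show ?thesis by (simp add: LIM_zero_iff)
qed

lemma hat_ell2: assumes a: "sqi \<rho> \<alpha>" shows "hatF \<alpha> \<in> ell2 S"
  using bb.poly_dense[OF a] hat_limit(1)[OF a] by blast

lemma hat_norm: assumes a: "sqi \<rho> \<alpha>" shows "nm (hatF \<alpha>) = n2 \<rho> \<alpha>"
proof -
  obtain p where p: "(\<lambda>n. n2 \<rho> (\<lambda>x. cp (p n) x - \<alpha> x)) \<longlonglongrightarrow> 0" using bb.poly_dense[OF a] by blast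
  have "(\<lambda>n. nm (U (p n))) \<longlonglongrightarrow> nm (hatF \<alpha>)"
    by (rule norm_tendsto[OF ell2_sqi[OF U_ell2] ell2_sqi[OF hat_ell2[OF a]] hat_limit(2)[OF a p]])
  moreover have "(\<lambda>n. n2 \<rho> (cp (p n))) \<longlonglongrightarrow> n2 \<rho> \<alpha>"
    by (rule norm_tendsto[OF bb.sqi_poly a p])
  ultimately show ?thesis unfolding nm_U by (rule LIMSEQ_unique)
qed

text \<open>Polarisation: norms of sums give the real part, and replacing \<beta> by
  \<open>\<i> * \<beta>\<close> gives the imaginary part.\<close>

lemma hat_inner: assumes a: "sqi \<rho> \<alpha>" and b: "sqi \<rho> \<beta>"
  shows "inn (hatF \<alpha>) (hatF \<beta>) = ip \<rho> \<alpha> \<beta>"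
proof -
  have re: "Re (inn (hatF f) (hatF g)) = Re (ip \<rho> f g)" if f: "sqi \<rho> f" and g: "sqi \<rho> g" for f g
  proof -
    have "hatF (\<lambda>x. f x + g x) = (\<lambda>v. hatF f v + hatF g v)" using hat_lin[OF f g, of 1 1] by simp
    then have "nm (\<lambda>v. hatF f v + hatF g v) = n2 \<rho> (\<lambda>x. f x + g x)"
      using hat_norm[OF sqi_add[OF f g]] by simp
    then show ?thesis
      using n2_add_sq[OF f g] n2_add_sq[OF ell2_sqi[OF hat_ell2[OF f]] ell2_sqi[OF hat_ell2[OF g]]]
      by (simp add: hat_norm f g)
  qed
  have "hatF (\<lambda>x. \<i> * \<beta> x) = (\<lambda>v. \<i> * hatF \<beta> v)" using hat_lin[OF b b, of \<i> 0] by simp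
  with re[OF a sqi_scale[OF b, of \<i>]] have "Im (inn (hatF \<alpha>) (hatF \<beta>)) = Im (ip \<rho> \<alpha> \<beta>)"
    by (simp add: ip_scale_right)
  with re[OF a b] show ?thesis by (simp add: complex_eq_iff)
qed

lemma hat_cyclic: assumes a: "sqi \<rho> \<alpha>" shows "hatF \<alpha> \<in> cyclic_subspace S T X"
  unfolding cyclic_subspace_def
proof (intro CollectI conjI allI impI)
  show h: "hatF \<alpha> \<in> ell2 S" by (rule hat_ell2[OF a])
  fix e :: real assume e: "0 < e"
  obtain p where p: "(\<lambda>n. n2 \<rho> (\<lambda>x. cp (p n) x - \<alpha> x)) \<longlonglongrightarrow> 0" using bb.poly_dense[OF a] by blast
  obtain n where n: "norm (nm (\<lambda>v. U (p n) v - hatF \<alpha> v) - 0) < e"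
    using LIMSEQ_D[OF hat_limit(2)[OF a p] e] by blast
  have "ell2_norm S (\<lambda>v. hatF \<alpha> v - U (p n) v) = nm (\<lambda>v. U (p n) v - hatF \<alpha> v)"
    by (subst ell2_norm_n2[OF ell2_diff[OF h U_ell2]]) (rule n2_minus_commute)
  then show "\<exists>p. ell2_norm S (\<lambda>v. hatF \<alpha> v - poly_calc T p (kdelta X) v) < e"
    using n by (intro exI[of _ "p n"]) (simp add: U_def)
qed

text \<open>A sequence \<open>U (p n)\<close> converging to \<open>f\<close> is Cauchy, so by
  isometry the polynomials are Cauchy in L2, and completeness provides the preimage.\<close>

lemma cyclic_hat: assumes f: "f \<in> cyclic_subspace S T X" obtains \<alpha> where "sqi \<rho> \<alpha>" "f = hatF \<alpha>"
proof -
  have fe: "f \<in> ell2 S" using f by (simp add: cyclic_subspace_def)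
  have "\<exists>p. nm (\<lambda>v. U p v - f v) < 1 / (real n + 1)" for n
  proof -
    have "0 < 1 / (real n + 1)" by simp
    then obtain p where p: "ell2_norm S (\<lambda>v. f v - U p v) < 1 / (real n + 1)"
      using f unfolding cyclic_subspace_def U_def by blast
    have "ell2_norm S (\<lambda>v. f v - U p v) = nm (\<lambda>v. U p v - f v)"
      by (subst ell2_norm_n2[OF ell2_diff[OF fe U_ell2]]) (rule n2_minus_commute)
    with p show ?thesis by auto
  qed
  then obtain p where p: "\<And>n. nm (\<lambda>v. U (p n) v - f v) < 1 / (real n + 1)" by metis
  have lim: "(\<lambda>n. nm (\<lambda>v. U (p n) v - f v)) \<longlonglongrightarrow> 0"
    by (rule Lim_null_comparison[OF _ LIMSEQ_inv_plus1]) (use p in \<open>auto intro!: always_eventually less_imp_le\<close>)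
  have "n2_Cauchy (count_space S) (\<lambda>n. U (p n))"
    by (rule n2_conv_Cauchy[OF ell2_sqi[OF U_ell2] ell2_sqi[OF fe] lim])
  then have "n2_Cauchy \<rho> (\<lambda>n. cp (p n))" unfolding U_Cauchy .
  then obtain \<alpha> where a: "sqi \<rho> \<alpha>" "(\<lambda>n. n2 \<rho> (\<lambda>x. cp (p n) x - \<alpha> x)) \<longlonglongrightarrow> 0"
    using n2_complete[OF bb.sqi_poly] by blast
  have "f = hatF \<alpha>"
  proof (rule ell2_eqI[OF fe hat_ell2[OF a(1)]])
    have "nm (\<lambda>v. f v - hatF \<alpha> v) \<le> nm (\<lambda>v. U (p n) v - f v) + nm (\<lambda>v. U (p n) v - hatF \<alpha> v)" for n
      using n2_triangle_diff[OF ell2_sqi[OF fe] ell2_sqi[OF U_ell2[of "p n"]] ell2_sqi[OF hat_ell2[OF a(1)]]]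
        n2_minus_commute[of "count_space S" f "U (p n)"] by simp
    moreover have "(\<lambda>n. nm (\<lambda>v. U (p n) v - f v) + nm (\<lambda>v. U (p n) v - hatF \<alpha> v)) \<longlonglongrightarrow> 0 + 0"
      by (intro tendsto_add lim hat_limit(2)[OF a])
    ultimately have "nm (\<lambda>v. f v - hatF \<alpha> v) \<le> 0 + 0" by (intro LIMSEQ_le_const) auto
    then show "nm (\<lambda>v. f v - hatF \<alpha> v) = 0" by (simp add: order_antisym)
  qed
  with that a show ?thesis by blast
qed

section \<open>Multiplication by x and the continuous functional calculus\<close>

lemma sqi_mult_x: assumes a: "sqi \<rho> \<alpha>"
  shows "sqi \<rho> (\<lambda>x. of_real x * \<alpha> x)" "n2 \<rho> (\<lambda>x. of_real x * \<alpha> x) \<le> (C + 1) * n2 \<rho> \<alpha>"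
proof -
  have am[measurable]: "\<alpha> \<in> borel_measurable \<rho>" using a by (rule sqi_meas)
  have ae: "AE x in \<rho>. (cmod (of_real x * \<alpha> x))\<^sup>2 \<le> (C + 1)\<^sup>2 * (cmod (\<alpha> x))\<^sup>2"
    using bb.AE_R
  proof eventually_elim
    case (elim x)
    have "x\<^sup>2 \<le> (C + 1)\<^sup>2" using elim by (simp add: abs_le_square_iff[symmetric])
    then show ?case by (simp add: norm_mult power_mult_distrib mult_right_mono)
  qed
  have i: "integrable \<rho> (\<lambda>x. (C + 1)\<^sup>2 * (cmod (\<alpha> x))\<^sup>2)" using sqi_int[OF a] by simp
  have xm: "(\<lambda>x. of_real x * \<alpha> x) \<in> borel_measurable \<rho>"
    by (intro borel_measurable_times am) (simp add: measurable_cong_sets[OF sets_rho refl])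
  have i2: "integrable \<rho> (\<lambda>x. (cmod (of_real x * \<alpha> x))\<^sup>2)"
    by (rule Bochner_Integration.integrable_bound[OF i]) (use ae xm in auto)
  then show s: "sqi \<rho> (\<lambda>x. of_real x * \<alpha> x)" using xm by (simp add: sqi_def)
  have "(n2 \<rho> (\<lambda>x. of_real x * \<alpha> x))\<^sup>2 \<le> ((C + 1) * n2 \<rho> \<alpha>)\<^sup>2"
    unfolding power_mult_distrib n2_sq using integral_mono_AE[OF i2 i ae] by simp
  then show "n2 \<rho> (\<lambda>x. of_real x * \<alpha> x) \<le> (C + 1) * n2 \<rho> \<alpha>"
    by (rule power2_le_imp_le) (use C_nonneg in simp)
qed

text \<open>For polynomials this is \<open>U_pCons\<close> with constant term 0. Both sides are
  continuous in \<alpha>: multiplication by \<open>x\<close> is bounded because \<rho> has bounded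
  support.\<close>

lemma hat_mult_x: assumes a: "sqi \<rho> \<alpha>"
  shows "hatF (\<lambda>x. of_real x * \<alpha> x) = T (hatF \<alpha>)"
proof
  fix Y
  note h = hat_ell2[OF a]
  show "hatF (\<lambda>x. of_real x * \<alpha> x) Y = T (hatF \<alpha>) Y"
  proof (cases "Y \<in> S")
    case Y: True
    obtain p where p: "(\<lambda>n. n2 \<rho> (\<lambda>x. cp (p n) x - \<alpha> x)) \<longlonglongrightarrow> 0" using bb.poly_dense[OF a] by blast
    have 1: "(\<lambda>n. hatF (cp (pCons 0 (p n))) Y) \<longlonglongrightarrow> hatF (\<lambda>x. of_real x * \<alpha> x) Y"
    proof (rule hat_tendsto[OF bb.sqi_poly sqi_mult_x(1)[OF a] _ Y])
      have le: "n2 \<rho> (\<lambda>x. cp (pCons 0 (p n)) x - of_real x * \<alpha> x) \<le> (C + 1) * n2 \<rho> (\<lambda>x. cp (p n) x - \<alpha> x)" for n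
        using sqi_mult_x(2)[OF sqi_diff[OF bb.sqi_poly[of "p n"] a]] by (simp add: algebra_simps)
      have lim: "(\<lambda>n. (C + 1) * n2 \<rho> (\<lambda>x. cp (p n) x - \<alpha> x)) \<longlonglongrightarrow> 0"
        using tendsto_mult_right_zero[OF p] by simp
      show "(\<lambda>n. n2 \<rho> (\<lambda>x. cp (pCons 0 (p n)) x - of_real x * \<alpha> x)) \<longlonglongrightarrow> 0"
        by (rule Lim_null_comparison[OF _ lim], rule always_eventually, rule allI)
          (simp only: real_norm_def abs_of_nonneg[OF n2_nonneg] le)
    qed
    have 2: "(\<lambda>n. T (U (p n)) Y - T (hatF \<alpha>) Y) \<longlonglongrightarrow> 0"
    proof (rule Lim_null_comparison)
      show "\<forall>\<^sub>F n in sequentially. norm (T (U (p n)) Y - T (hatF \<alpha>) Y) \<le> C * nm (\<lambda>v. U (p n) v - hatF \<alpha> v)"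
      proof (rule always_eventually, rule allI)
        fix n
        have "cmod (T (\<lambda>v. U (p n) v - hatF \<alpha> v) Y) \<le> nm (T (\<lambda>v. U (p n) v - hatF \<alpha> v))"
          by (rule ell2_point_le[OF T_ell2[OF ell2_diff[OF U_ell2 h]] Y])
        also have "\<dots> \<le> C * nm (\<lambda>v. U (p n) v - hatF \<alpha> v)" by (rule T_bound[OF ell2_diff[OF U_ell2 h]])
        finally show "norm (T (U (p n)) Y - T (hatF \<alpha>) Y) \<le> C * nm (\<lambda>v. U (p n) v - hatF \<alpha> v)"
          by (simp add: T_diff[OF U_ell2 h])
      qed
      show "(\<lambda>n. C * nm (\<lambda>v. U (p n) v - hatF \<alpha> v)) \<longlonglongrightarrow> 0"
        using tendsto_mult_right_zero[OF hat_limit(2)[OF a p]] by simp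
    qed
    have "hatF (cp (pCons 0 (p n))) Y = T (U (p n)) Y" for n unfolding hat_poly U_pCons by simp
    with 1 have "(\<lambda>n. T (U (p n)) Y) \<longlonglongrightarrow> hatF (\<lambda>x. of_real x * \<alpha> x) Y" by simp
    moreover have "(\<lambda>n. T (U (p n)) Y) \<longlonglongrightarrow> T (hatF \<alpha>) Y" using 2 by (simp add: LIM_zero_iff)
    ultimately show ?thesis by (rule LIMSEQ_unique)
  next
    case False
    then show ?thesis using T_ell2[OF h] by (auto simp: hatF_def ell2_iff)
  qed
qed

text \<open>Continuity of \<alpha> is known only on the spectrum, but that compact set carries
  \<rho>.\<close>

lemma cont_sqi: assumes m: "\<alpha> \<in> borel_measurable borel" and c: "continuous_on \<sigma> \<alpha>"
  shows "sqi \<rho> \<alpha>"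
proof -
  have "bounded (\<alpha> ` \<sigma>)" by (intro compact_imp_bounded compact_continuous_image c compact_sigma)
  then obtain B where B: "\<forall>y\<in>\<alpha> ` \<sigma>. norm y \<le> B" unfolding bounded_iff by blast
  have am: "\<alpha> \<in> borel_measurable \<rho>" using m by (simp add: measurable_cong_sets[OF sets_rho refl])
  have "integrable \<rho> (\<lambda>x. (cmod (\<alpha> x))\<^sup>2)"
  proof (rule bb.integrable_const_bound)
    show "AE x in \<rho>. norm ((cmod (\<alpha> x))\<^sup>2) \<le> B\<^sup>2"
      using AE_sigma by eventually_elim (use B in \<open>auto intro!: power_mono\<close>)
  qed (use am in measurable)
  then show ?thesis using am by (simp add: sqi_def)
qed

lemma uniform_limit_n2:
  assumes a: "sqi \<rho> \<alpha>" and u: "uniform_limit \<sigma> (\<lambda>n. cp (p n)) \<alpha> sequentially"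
  shows "(\<lambda>n. n2 \<rho> (\<lambda>x. cp (p n) x - \<alpha> x)) \<longlonglongrightarrow> 0"
proof (rule LIMSEQ_I)
  fix e :: real assume e: "0 < e"
  define K where "K = sqrt (measure \<rho> (space \<rho>))"
  have K: "0 \<le> K" by (simp add: K_def)
  define d where "d = e / (K + 1)"
  have d: "d > 0" using e K by (simp add: d_def)
  obtain N where N: "\<And>n x. n \<ge> N \<Longrightarrow> x \<in> \<sigma> \<Longrightarrow> cmod (cp (p n) x - \<alpha> x) < d"
    using uniform_limitD[OF u d] unfolding eventually_sequentially dist_norm by blast
  have "n2 \<rho> (\<lambda>x. cp (p n) x - \<alpha> x) < e" if n: "n \<ge> N" for n
  proof -
    have "(n2 \<rho> (\<lambda>x. cp (p n) x - \<alpha> x))\<^sup>2 \<le> (\<integral>x. d\<^sup>2 \<partial>\<rho>)" unfolding n2_sq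
    proof (rule integral_mono_AE)
      show "integrable \<rho> (\<lambda>x. (cmod (cp (p n) x - \<alpha> x))\<^sup>2)"
        by (rule sqi_int[OF sqi_diff[OF bb.sqi_poly a]])
      show "AE x in \<rho>. (cmod (cp (p n) x - \<alpha> x))\<^sup>2 \<le> d\<^sup>2"
        using AE_sigma by eventually_elim (rule power_mono[OF less_imp_le[OF N[OF n]]], auto)
    qed simp
    also have "\<dots> = (d * K)\<^sup>2" by (simp add: K_def power_mult_distrib mult.commute)
    finally have "n2 \<rho> (\<lambda>x. cp (p n) x - \<alpha> x) \<le> d * K"
      by (rule power2_le_imp_le) (use d K in simp)
    also have "\<dots> < d * (K + 1)" using d by simp
    also have "\<dots> = e" using K by (simp add: d_def)
    finally show ?thesis .
  qed
  then show "\<exists>N. \<forall>n\<ge>N. norm (n2 \<rho> (\<lambda>x. cp (p n) x - \<alpha> x) - 0) < e" by auto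
qed

text \<open>Uniform convergence on the spectrum implies L2 convergence, so
  \<open>hatF \<alpha>\<close> has the defining property. It is the only such vector because, by
  Weierstrass on the compact spectrum, at least one approximating sequence exists.\<close>

lemma cont_calc_hat: assumes m: "\<alpha> \<in> borel_measurable borel" and c: "continuous_on \<sigma> \<alpha>"
  shows "cont_calc S T \<alpha> (kdelta X) = hatF \<alpha>"
  unfolding cont_calc_def \<sigma>_def[symmetric] U_def[symmetric]
proof (rule the_equality, intro conjI allI impI)
  note a = cont_sqi[OF m c]
  note h = hat_ell2[OF a]
  show "hatF \<alpha> \<in> ell2 S" by (rule h)
  show conv: "(\<lambda>n. ell2_norm S (\<lambda>v. U (p n) v - hatF \<alpha> v)) \<longlonglongrightarrow> 0"
    if u: "uniform_limit \<sigma> (\<lambda>n. cp (p n)) \<alpha> sequentially" for p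
    using hat_limit(2)[OF a uniform_limit_n2[OF a u]] by (simp add: ell2_norm_n2 ell2_diff U_ell2 h)
  fix g assume g: "g \<in> ell2 S \<and> (\<forall>p. uniform_limit \<sigma> (\<lambda>n. cp (p n)) \<alpha> sequentially \<longrightarrow>
      (\<lambda>n. ell2_norm S (\<lambda>v. U (p n) v - g v)) \<longlonglongrightarrow> 0)"
  have "\<exists>p. \<forall>x\<in>\<sigma>. cmod (\<alpha> x - cp p x) < 1 / (real n + 1)" for n
  proof -
    have "0 < 1 / (real n + 1)" by simp
    from complex_poly_approx[OF compact_sigma c this] show ?thesis by metis
  qed
  then obtain p where p: "\<And>n x. x \<in> \<sigma> \<Longrightarrow> cmod (\<alpha> x - cp (p n) x) < 1 / (real n + 1)" by metis
  have u: "uniform_limit \<sigma> (\<lambda>n. cp (p n)) \<alpha> sequentially"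
  proof (rule uniform_limitI)
    fix e :: real assume "e > 0"
    then have "\<forall>\<^sub>F n in sequentially. 1 / (real n + 1) < e"
      using LIMSEQ_inv_plus1 by (simp add: order_tendstoD)
    then show "\<forall>\<^sub>F n in sequentially. \<forall>x\<in>\<sigma>. dist (cp (p n) x) (\<alpha> x) < e"
    proof eventually_elim
      case (elim n)
      show ?case using less_trans[OF p elim] by (simp add: dist_norm norm_minus_commute)
    qed
  qed
  have 1: "(\<lambda>n. nm (\<lambda>v. U (p n) v - hatF \<alpha> v)) \<longlonglongrightarrow> 0" "(\<lambda>n. nm (\<lambda>v. U (p n) v - g v)) \<longlonglongrightarrow> 0"
    using conv[OF u] g u by (auto simp: ell2_norm_n2 ell2_diff U_ell2 h)
  show "g = hatF \<alpha>"
  proof (rule ell2_eqI)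
    have "nm (\<lambda>v. g v - hatF \<alpha> v) \<le> nm (\<lambda>v. U (p n) v - g v) + nm (\<lambda>v. U (p n) v - hatF \<alpha> v)" for n
      using n2_triangle_diff[of "count_space S" g "U (p n)" "hatF \<alpha>"] g
        n2_minus_commute[of "count_space S" g "U (p n)"] by (simp add: ell2_sqi U_ell2 h)
    moreover have "(\<lambda>n. nm (\<lambda>v. U (p n) v - g v) + nm (\<lambda>v. U (p n) v - hatF \<alpha> v)) \<longlonglongrightarrow> 0 + 0"
      by (intro tendsto_add 1)
    ultimately have "nm (\<lambda>v. g v - hatF \<alpha> v) \<le> 0 + 0" by (intro LIMSEQ_le_const) auto
    then show "nm (\<lambda>v. g v - hatF \<alpha> v) = 0" by (simp add: order_antisym)
  qed (use g h in auto)
qed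

lemma L2_sqi: "\<alpha> \<in> L2 \<rho> \<longleftrightarrow> sqi \<rho> \<alpha>"
  by (simp add: L2_def sqi_def)

text \<open>\<open>\<Phi>\<close> need only agree with \<open>\<psi>\<close> almost everywhere.\<close>

theorem transform_main:
  fixes \<Phi> :: "real \<Rightarrow> 'v \<Rightarrow> complex" and h :: "(real \<Rightarrow> complex) \<Rightarrow> 'v \<Rightarrow> complex"
  assumes meas: "\<And>Y. Y \<in> S \<Longrightarrow> (\<lambda>x. \<Phi> x Y) \<in> borel_measurable borel"
    and ae: "\<And>Y. Y \<in> S \<Longrightarrow> AE x in \<rho>. \<Phi> x Y = \<psi> Y x"
    and h: "\<And>\<alpha> Y. h \<alpha> Y = (if Y \<in> S then \<integral>x. \<alpha> x * \<Phi> x Y \<partial>\<rho> else 0)"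
  shows "(\<forall>\<alpha> \<in> L2 \<rho>. \<forall>Y \<in> S. integrable \<rho> (\<lambda>x. \<alpha> x * \<Phi> x Y)) \<and>
     unitary_L2_onto \<rho> S (cyclic_subspace S T X) h \<and>
     (\<forall>\<alpha> \<in> L2 \<rho>. (L2_norm \<rho> \<alpha>)\<^sup>2 = (ell2_norm S (h \<alpha>))\<^sup>2) \<and>
     cyclic_subspace S T X = {h \<alpha> | \<alpha>. \<alpha> \<in> L2 \<rho>} \<and>
     (\<forall>\<alpha> \<in> borel_measurable borel.
        continuous_on {x. of_real x \<in> op_spectrum S T} \<alpha> \<longrightarrow>
        \<alpha> \<in> L2 \<rho> \<and> cont_calc S T \<alpha> (kdelta X) = h \<alpha>) \<and>
     (\<forall>\<alpha> \<in> L2 \<rho>. (\<lambda>x. of_real x * \<alpha> x) \<in> L2 \<rho> \<and> h (\<lambda>x. of_real x * \<alpha> x) = T (h \<alpha>))"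
proof -
  have Pm: "(\<lambda>x. \<Phi> x Y) \<in> borel_measurable \<rho>" if "Y \<in> S" for Y
    using meas[OF that] by (simp add: measurable_cong_sets[OF sets_rho refl])
  have int: "integrable \<rho> (\<lambda>x. \<alpha> x * \<Phi> x Y)" if a: "sqi \<rho> \<alpha>" and Y: "Y \<in> S" for \<alpha> Y
  proof -
    have "integrable \<rho> (\<lambda>x. \<alpha> x * \<psi> Y x)" by (rule sqi_mult_integrable[OF a psi_sqi[OF Y]])
    then show ?thesis
      by (rule integrable_cong_AE_imp)
        (use ae[OF Y] Pm[OF Y] sqi_meas[OF a] in \<open>auto elim: eventually_mono\<close>)
  qed
  have hh: "h \<alpha> = hatF \<alpha>" if a: "sqi \<rho> \<alpha>" for \<alpha>
  proof
    fix Y show "h \<alpha> Y = hatF \<alpha> Y"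
    proof (cases "Y \<in> S")
      case True
      have "(\<integral>x. \<alpha> x * \<Phi> x Y \<partial>\<rho>) = (\<integral>x. \<alpha> x * \<psi> Y x \<partial>\<rho>)"
        by (rule integral_cong_AE)
          (use ae[OF True] Pm[OF True] sqi_meas[OF a] sqi_meas[OF psi_sqi[OF True]] in \<open>auto elim: eventually_mono\<close>)
      then show ?thesis using True by (simp add: h hatF_def)
    qed (simp add: h hatF_def)
  qed
  have cyc: "h ` L2 \<rho> = cyclic_subspace S T X"
  proof
    show "h ` L2 \<rho> \<subseteq> cyclic_subspace S T X" using hat_cyclic by (auto simp: L2_sqi hh)
    show "cyclic_subspace S T X \<subseteq> h ` L2 \<rho>"
    proof
      fix f assume "f \<in> cyclic_subspace S T X"
      then obtain \<alpha> where "sqi \<rho> \<alpha>" "f = hatF \<alpha>" by (rule cyclic_hat)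
      then show "f \<in> h ` L2 \<rho>" by (auto simp: L2_sqi hh intro!: image_eqI[of _ _ \<alpha>])
    qed
  qed
  have "unitary_L2_onto \<rho> S (cyclic_subspace S T X) h"
    unfolding unitary_L2_onto_def
  proof (intro conjI ballI impI allI)
    fix \<alpha> \<beta> assume "\<alpha> \<in> L2 \<rho>" "\<beta> \<in> L2 \<rho>"
    then have ab: "sqi \<rho> \<alpha>" "sqi \<rho> \<beta>" by (auto simp: L2_sqi)
    show "h \<alpha> = h \<beta>" if "AE x in \<rho>. \<alpha> x = \<beta> x"
    proof
      fix Y show "h \<alpha> Y = h \<beta> Y"
      proof (cases "Y \<in> S")
        case True
        have "(\<integral>x. \<alpha> x * \<Phi> x Y \<partial>\<rho>) = (\<integral>x. \<beta> x * \<Phi> x Y \<partial>\<rho>)"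
          by (rule integral_cong_AE)
            (use that Pm[OF True] sqi_meas[OF ab(1)] sqi_meas[OF ab(2)] in \<open>auto elim: eventually_mono\<close>)
        then show ?thesis using True by (simp add: h)
      qed (simp add: h)
    qed
    show "h (\<lambda>x. c * \<alpha> x + d * \<beta> x) = (\<lambda>v. c * h \<alpha> v + d * h \<beta> v)" for c d
      using ab by (simp add: hh sqi_add sqi_scale hat_lin)
    show "ell2_inner S (h \<alpha>) (h \<beta>) = L2_inner \<rho> \<alpha> \<beta>"
      using ab by (simp add: hh ell2_inner_ip hat_ell2 hat_inner) (simp add: ip_def L2_inner_def)
  qed (use cyc in \<open>auto simp: cyclic_subspace_def\<close>)
  moreover have "(L2_norm \<rho> \<alpha>)\<^sup>2 = (ell2_norm S (h \<alpha>))\<^sup>2" if "\<alpha> \<in> L2 \<rho>" for \<alpha>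
    using that by (simp add: L2_sqi hh ell2_norm_n2 hat_ell2 hat_norm) (simp add: n2_def L2_norm_def)
  moreover have "cyclic_subspace S T X = {h \<alpha> | \<alpha>. \<alpha> \<in> L2 \<rho>}" unfolding cyc[symmetric] by blast
  moreover have "\<alpha> \<in> L2 \<rho> \<and> cont_calc S T \<alpha> (kdelta X) = h \<alpha>"
    if "\<alpha> \<in> borel_measurable borel" "continuous_on {x. of_real x \<in> op_spectrum S T} \<alpha>" for \<alpha>
    using that cont_sqi[of \<alpha>] cont_calc_hat[of \<alpha>] by (simp add: L2_sqi hh \<sigma>_def)
  moreover have "(\<lambda>x. of_real x * \<alpha> x) \<in> L2 \<rho> \<and> h (\<lambda>x. of_real x * \<alpha> x) = T (h \<alpha>)" if "\<alpha> \<in> L2 \<rho>" for \<alpha>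
    using that by (simp add: L2_sqi hh sqi_mult_x hat_mult_x)
  ultimately show ?thesis using int by (simp add: L2_sqi)
qed

end

subsection \<open>Normality of weighted Angelesco systems\<close>

lemma poly_factor_roots:
  fixes p :: "real poly"
  assumes "p \<noteq> 0"
  obtains cs r where "p = (\<Prod>c\<leftarrow>cs. [:-c, 1:]) * r" "set cs \<subseteq> S" "\<And>x. x \<in> S \<Longrightarrow> poly r x \<noteq> 0"
  using assms
proof (induct "degree p" arbitrary: p thesis rule: less_induct)
  case less
  show ?case
  proof (cases "\<exists>x\<in>S. poly p x = 0")
    case False
    then show ?thesis using less(2)[of "[]" p] by auto
  next
    case True
    then obtain a where a: "a \<in> S" "poly p a = 0" by blast
    then obtain q where q: "p = [:-a, 1:] * q" by (meson poly_eq_0_iff_dvd dvdE)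
    then have q0: "q \<noteq> 0" using less(3) by auto
    then have "degree p = Suc (degree q)" unfolding q by (subst degree_mult_eq) auto
    then have "degree q < degree p" by simp
    from less(1)[OF this _ q0] obtain cs r where
      "q = (\<Prod>c\<leftarrow>cs. [:-c, 1:]) * r" "set cs \<subseteq> S" "\<And>x. x \<in> S \<Longrightarrow> poly r x \<noteq> 0" by blast
    then show ?thesis using less(2)[of "a # cs" r] a(1) q by (auto simp: mult.assoc simp del: mult_pCons_left)
  qed
qed

lemma poly_linear_prod: "poly (\<Prod>c\<leftarrow>cs. [:-c, 1:]) x = (\<Prod>c\<leftarrow>cs. x - c)" for x :: real
  by (induct cs) (auto simp: algebra_simps)

lemma degree_linear_prod: "degree (\<Prod>c\<leftarrow>cs. [:-c, 1::real:]) = length cs"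
proof (induct cs)
  case (Cons c cs)
  have "(\<Prod>c\<leftarrow>cs. [:-c, 1::real:]) \<noteq> 0" by (auto simp: prod_list_zero_iff)
  then show ?case using Cons by (subst list.map, subst prod_list.Cons, subst degree_mult_eq) auto
qed simp

lemma monic_linear_prod: "lead_coeff (\<Prod>c\<leftarrow>cs. [:-c, 1::real:]) = 1"
  by (induct cs) (simp_all add: lead_coeff_mult del: mult_pCons_left)

lemma linear_prod_nonzero: "(\<Prod>c\<leftarrow>cs. [:-c, 1::real:]) \<noteq> 0"
  by (auto simp: prod_list_zero_iff)

lemma linear_prod_eq_0_iff: "poly (\<Prod>c\<leftarrow>cs. [:-c, 1:]) x = 0 \<longleftrightarrow> x \<in> set cs" for x :: real
  by (auto simp: poly_linear_prod prod_list_zero_iff)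

lemma interval_const_sign:
  fixes f :: "real \<Rightarrow> real"
  assumes "continuous_on {a..b} f" "\<And>x. x \<in> {a..b} \<Longrightarrow> f x \<noteq> 0"
  obtains s where "s = 1 \<or> s = -1" "\<And>x. x \<in> {a..b} \<Longrightarrow> s * f x > 0"
proof -
  have "(\<forall>x\<in>{a..b}. f x > 0) \<or> (\<forall>x\<in>{a..b}. f x < 0)"
  proof (rule ccontr)
    assume "\<not> ?thesis"
    then obtain x y where xy: "x \<in> {a..b}" "y \<in> {a..b}" "f x \<le> 0" "f y \<ge> 0" by (auto simp: not_less)
    have "connected (f ` {a..b})" by (intro connected_continuous_image assms) auto
    then have "0 \<in> f ` {a..b}"
      using xy unfolding connected_iff_interval by blast
    then show False using assms(2) by auto
  qed
  then show ?thesis using that[of 1] that[of "-1"] by auto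
qed

lemma ix_sum: "(\<Sum>k\<in>{I1, I2}. f k) = f I1 + f I2" by simp

lemma ix_all: "(\<forall>k. P k) \<longleftrightarrow> P I1 \<and> P I2" by (metis ix.exhaust)

lemma other_other [simp]: "other (other k) = k" by (cases k) auto

lemma other_neq [simp]: "other k \<noteq> k" "k \<noteq> other k" by (cases k; simp)+

lemma ix_eq_or_other: "j = k \<or> j = other k" by (cases k; cases j; simp)

lemma ix_sum_other: "(\<Sum>j\<in>{I1, I2}. f j) = f k + (f (other k) :: 'a :: comm_monoid_add)"
  by (cases k) (auto simp: add.commute)

lemma poly_eq_sum_below: fixes p :: "real poly" assumes "\<forall>j\<ge>n. coeff p j = 0" shows "poly p x = (\<Sum>i<n. coeff p i * x ^ i)"
proof -
  have "poly p x = (\<Sum>i\<le>degree p. coeff p i * x ^ i)" by (rule poly_altdef)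
  also have "\<dots> = (\<Sum>i\<in>{i. coeff p i \<noteq> 0}. coeff p i * x ^ i)"
    by (rule sum.mono_neutral_right) (auto simp: le_degree)
  also have "\<dots> = (\<Sum>i<n. coeff p i * x ^ i)"
    by (rule sum.mono_neutral_left) (use assms in \<open>auto simp: not_less[symmetric]\<close>)
  finally show ?thesis .
qed

lemma coeff_ge_degree: "p = 0 \<or> degree p < n \<Longrightarrow> \<forall>j\<ge>n. coeff p j = 0"
  by (auto intro: coeff_eq_0)

lemma degree_lt_iff: "p \<noteq> 0 \<Longrightarrow> \<forall>j\<ge>n. coeff p j = 0 \<Longrightarrow> degree p < n"
  by (meson leading_coeff_0_iff not_less)

section \<open>The two measures and their intervals\<close>

locale angelesco_system =
  fixes \<mu> :: "ix \<Rightarrow> real measure"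
  assumes ang: "angelesco \<mu>"
begin

lemma sets_mu [measurable_cong]: "sets (\<mu> k) = sets borel"
  using ang by (simp add: angelesco_def)

lemma fin_mu: "finite_measure (\<mu> k)"
  using ang by (simp add: angelesco_def)

lemma borel_mu: "f \<in> borel_measurable borel \<Longrightarrow> f \<in> borel_measurable (\<mu> k)"
  by (simp add: measurable_cong_sets[OF sets_mu refl])

lemma AE_msupp: "AE x in \<mu> k. x \<in> msupp (\<mu> k)"
proof (rule AE_from_local_null[OF sets_mu])
  fix x assume "x \<notin> msupp (\<mu> k)"
  then show "\<exists>U. open U \<and> x \<in> U \<and> emeasure (\<mu> k) U = 0"
    by (auto simp: msupp_def zero_less_iff_neq_zero)
qed

text \<open>Infinite support enters here; it makes the integral of a nonnegative function with
  finitely many zeros strictly positive.\<close>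

lemma not_AE_finite: assumes "finite F" shows "\<not> (AE x in \<mu> k. x \<in> F)"
proof
  assume "AE x in \<mu> k. x \<in> F"
  moreover have m: "- F \<in> sets (\<mu> k)" unfolding sets_mu by (intro borel_open open_Compl finite_imp_closed assms)
  moreover have "{x \<in> space (\<mu> k). x \<notin> F} = - F" by (auto simp: sets_eq_imp_space_eq[OF sets_mu])
  ultimately have "emeasure (\<mu> k) (- F) = 0"
    using AE_iff_measurable[of "- F" "\<mu> k" "\<lambda>x. x \<in> F"] by blast
  moreover have "open (- F)" using assms by (simp add: finite_imp_closed open_Compl)
  ultimately have "msupp (\<mu> k) \<subseteq> F" by (force simp: msupp_def)
  then show False using ang assms finite_subset by (auto simp: angelesco_def)
qed

definition lo :: "ix \<Rightarrow> real" where "lo k = Inf (Delta \<mu> k)"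
definition hi :: "ix \<Rightarrow> real" where "hi k = Sup (Delta \<mu> k)"

lemma Delta_props: "Delta \<mu> k = {lo k..hi k}" "lo k \<le> hi k"
proof -
  have "infinite (msupp (\<mu> k))" using ang by (simp add: angelesco_def)
  then have "msupp (\<mu> k) \<noteq> {}" by auto
  moreover have "compact (msupp (\<mu> k))" using ang by (simp add: angelesco_def)
  ultimately have "compact (Delta \<mu> k)" "connected (Delta \<mu> k)" and ne: "Delta \<mu> k \<noteq> {}"
    unfolding Delta_def by (auto intro: compact_convex_hull convex_connected)
  then obtain a b where ab: "Delta \<mu> k = {a..b}"
    using connected_compact_interval_1[of "Delta \<mu> k"] by auto
  with ne have "a \<le> b" by auto
  then show "Delta \<mu> k = {lo k..hi k}" "lo k \<le> hi k" unfolding lo_def hi_def ab by auto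
qed

lemma lo_hi_in: "lo k \<in> Delta \<mu> k" "hi k \<in> Delta \<mu> k"
  using Delta_props by auto

lemma hi_lo: "hi I1 < lo I2"
  using ang lo_hi_in(2)[of I1] lo_hi_in(1)[of I2] by (auto simp: angelesco_def)

lemma Delta_disjoint: "x \<in> Delta \<mu> k \<Longrightarrow> x \<notin> Delta \<mu> (other k)"
  using hi_lo unfolding Delta_props by (cases k) auto

lemma AE_Delta: "AE x in \<mu> k. x \<in> Delta \<mu> k"
proof -
  have "msupp (\<mu> k) \<subseteq> Delta \<mu> k" unfolding Delta_def by (rule hull_subset)
  then show ?thesis using AE_msupp[of k] by (auto elim: eventually_mono)
qed

text \<open>A class of integrands that contains the polynomials as well as the weights
  \<open>1 / (t - x)\<close> with \<open>t\<close> outside \<Delta>_k, which are discontinuous on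
  the line but continuous on \<Delta>_k.\<close>

definition cm :: "ix \<Rightarrow> (real \<Rightarrow> real) \<Rightarrow> bool" where
  "cm k f \<longleftrightarrow> f \<in> borel_measurable borel \<and> continuous_on (Delta \<mu> k) f"

lemma cm_poly [simp]: "cm k (\<lambda>x. poly p x)"
  unfolding cm_def by (auto intro!: borel_measurable_continuous_onI continuous_intros)

lemma cm_pow [simp]: "cm k (\<lambda>x. x ^ n)"
  unfolding cm_def by (auto intro!: continuous_intros)

lemma cm_const [simp]: "cm k (\<lambda>x. c)" by (simp add: cm_def)

lemma cm_mult: "cm k f \<Longrightarrow> cm k g \<Longrightarrow> cm k (\<lambda>x. f x * g x)"
  unfolding cm_def by (auto intro!: continuous_intros)

lemma cm_inverse_shift: "t \<notin> Delta \<mu> k \<Longrightarrow> cm k (\<lambda>x. 1 / (t - x))"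
  unfolding cm_def by (auto intro!: continuous_intros)

lemma cm_integrable: assumes "cm k f" shows "integrable (\<mu> k) f"
proof -
  interpret finite_measure "\<mu> k" by (rule fin_mu)
  have "compact (f ` Delta \<mu> k)"
    using assms unfolding cm_def Delta_props by (intro compact_continuous_image) auto
  then have "bounded (f ` Delta \<mu> k)" by (rule compact_imp_bounded)
  then obtain B where B: "\<forall>y\<in>f ` Delta \<mu> k. norm y \<le> B" unfolding bounded_iff by blast
  show ?thesis
  proof (rule integrable_const_bound)
    show "AE x in \<mu> k. norm (f x) \<le> B" using AE_Delta by eventually_elim (use B in auto)
    show "f \<in> borel_measurable (\<mu> k)" using assms by (auto simp: cm_def intro: borel_mu)
  qed
qed

lemma integral_pos:
  assumes f: "cm k f" and nn: "\<And>x. x \<in> Delta \<mu> k \<Longrightarrow> f x \<ge> 0" and fin: "finite {x \<in> Delta \<mu> k. f x = 0}"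
  shows "(\<integral>x. f x \<partial>\<mu> k) > 0"
proof -
  have ae: "AE x in \<mu> k. 0 \<le> f x" using AE_Delta by eventually_elim (rule nn)
  have "(\<integral>x. f x \<partial>\<mu> k) \<noteq> 0"
  proof
    assume "(\<integral>x. f x \<partial>\<mu> k) = 0"
    then have "AE x in \<mu> k. f x = 0" using integral_nonneg_eq_0_iff_AE[OF cm_integrable[OF f] ae] by simp
    then have "AE x in \<mu> k. x \<in> {x \<in> Delta \<mu> k. f x = 0}" using AE_Delta by eventually_elim simp
    then show False using not_AE_finite[OF fin] by blast
  qed
  moreover have "(\<integral>x. f x \<partial>\<mu> k) \<ge> 0" by (rule integral_nonneg_AE[OF ae])
  ultimately show ?thesis by simp
qed

lemma integral_poly_expand:
  assumes f: "cm k f" and p: "\<forall>j\<ge>n. coeff p j = 0"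
  shows "(\<integral>x. poly p x * f x \<partial>\<mu> k) = (\<Sum>i<n. coeff p i * (\<integral>x. x ^ i * f x \<partial>\<mu> k))"
proof -
  have "(\<integral>x. poly p x * f x \<partial>\<mu> k) = (\<integral>x. (\<Sum>i<n. coeff p i * (x ^ i * f x)) \<partial>\<mu> k)"
    by (simp add: poly_eq_sum_below[OF p] sum_distrib_right mult.assoc)
  also have "\<dots> = (\<Sum>i<n. coeff p i * (\<integral>x. x ^ i * f x \<partial>\<mu> k))"
    by (subst Bochner_Integration.integral_sum) (auto intro!: integrable_mult_right cm_integrable cm_mult f)
  finally show ?thesis .
qed

text \<open>If the prescribed signs differ, a single zero in the gap between the intervals produces
  the change.\<close>

lemma gap_poly:
  assumes "s1 = 1 \<or> s1 = (-1::real)" "s2 = 1 \<or> s2 = -1"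
  obtains g where "degree g \<le> 1" "\<And>x. x \<in> Delta \<mu> I1 \<Longrightarrow> s1 * poly g x > 0" "\<And>x. x \<in> Delta \<mu> I2 \<Longrightarrow> s2 * poly g x > 0"
proof (cases "s1 = s2")
  case True
  show ?thesis by (rule that[of "[:s1:]"]) (use assms True in auto)
next
  case False
  define c where "c = (hi I1 + lo I2) / 2"
  have c: "hi I1 < c" "c < lo I2" using hi_lo by (auto simp: c_def)
  show ?thesis by (rule that[of "smult s2 [:-c, 1:]"]) (use assms False c in \<open>auto simp: Delta_props\<close>)
qed

lemma poly_const_sign:
  assumes "\<And>x. x \<in> Delta \<mu> k \<Longrightarrow> poly p x \<noteq> 0"
  shows "\<exists>s. (s = 1 \<or> s = (-1::real)) \<and> (\<forall>x\<in>Delta \<mu> k. s * poly p x > 0)"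
proof -
  have "continuous_on {lo k..hi k} (poly p)" by (intro continuous_intros)
  then show ?thesis using interval_const_sign[of "lo k" "hi k" "poly p"] assms unfolding Delta_props by metis
qed

text \<open>If \<open>q\<^sub>k\<close> collects the zeros of \<open>B\<^sub>k\<close> in \<open>\<Delta>\<^sub>k\<close> and \<open>g\<close> is constant or has its zero in the gap,
  then \<open>g q\<^sub>1 q\<^sub>2 B\<^sub>k\<close> has constant sign on \<open>\<Delta>\<^sub>k\<close>, for both \<open>k\<close>.\<close>

theorem type_I_normal:
  assumes deg: "\<And>k. \<forall>j\<ge>n k. coeff (B k) j = 0"
    and w: "\<And>k. cm k (w k)" "\<And>k x. x \<in> Delta \<mu> k \<Longrightarrow> w k x \<noteq> 0"
    and orth: "\<And>m. m < n I1 + n I2 \<Longrightarrow> (\<Sum>k\<in>{I1, I2}. \<integral>x. x ^ m * (poly (B k) x * w k x) \<partial>\<mu> k) = 0"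
  shows "B k = 0"
proof -
  have orthp: "(\<integral>x. poly p x * (poly (B I1) x * w I1 x) \<partial>\<mu> I1) + (\<integral>x. poly p x * (poly (B I2) x * w I2 x) \<partial>\<mu> I2) = 0"
    if p: "\<forall>j\<ge>n I1 + n I2. coeff p j = 0" for p
  proof -
    have "(\<Sum>k\<in>{I1, I2}. \<integral>x. poly p x * (poly (B k) x * w k x) \<partial>\<mu> k)
       = (\<Sum>k\<in>{I1, I2}. \<Sum>i<n I1 + n I2. coeff p i * (\<integral>x. x ^ i * (poly (B k) x * w k x) \<partial>\<mu> k))"
      by (intro sum.cong refl integral_poly_expand[OF _ p] cm_mult w) auto
    also have "\<dots> = (\<Sum>i<n I1 + n I2. coeff p i * (\<Sum>k\<in>{I1, I2}. \<integral>x. x ^ i * (poly (B k) x * w k x) \<partial>\<mu> k))"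
      by (subst sum.swap) (simp add: sum_distrib_left distrib_left)
    also have "\<dots> = 0" by (intro sum.neutral ballI) (use orth in auto)
    finally show ?thesis by simp
  qed
  define Q where "Q j cs r s \<longleftrightarrow> (B j \<noteq> 0 \<longrightarrow> B j = (\<Prod>c\<leftarrow>cs. [:-c, 1:]) * r) \<and> set cs \<subseteq> Delta \<mu> j
     \<and> (s = 1 \<or> s = -1)
     \<and> (\<forall>x\<in>Delta \<mu> j. s * (poly r x * w j x) > 0) \<and> (B j = 0 \<longrightarrow> cs = []) \<and> (B j \<noteq> 0 \<longrightarrow> length cs < n j)" for j cs r s
  have fac: "\<exists>cs r s. Q j cs r s" for j
  proof -
    have ex: "\<exists>s. (s = 1 \<or> s = -1) \<and> (\<forall>x\<in>Delta \<mu> j. s * (poly r x * w j x) > 0)"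
      if r: "\<And>x. x \<in> Delta \<mu> j \<Longrightarrow> poly r x \<noteq> 0" for r
    proof -
      have "cm j (\<lambda>x. poly r x * w j x)" by (intro cm_mult w cm_poly)
      then have "continuous_on {lo j..hi j} (\<lambda>x. poly r x * w j x)" by (simp add: cm_def Delta_props)
      then obtain s where
        "s = 1 \<or> s = -1" "\<And>x. x \<in> {lo j..hi j} \<Longrightarrow> s * (poly r x * w j x) > 0"
      proof (rule interval_const_sign)
        show "poly r x * w j x \<noteq> 0" if "x \<in> {lo j..hi j}" for x
          using r[of x] w(2)[of x j] that by (simp add: Delta_props)
      qed (rule that, (assumption | blast)+)
      then show ?thesis unfolding Delta_props by blast
    qed
    show ?thesis
    proof (cases "B j = 0")
      case True
      then show ?thesis using ex[of "[:1:]"] unfolding Q_def by (intro exI[of _ "[]"] exI[of _ "[:1:]"]) auto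
    next
      case False
      from poly_factor_roots[OF False, of "Delta \<mu> j"] obtain cs r where
        cr: "B j = (\<Prod>c\<leftarrow>cs. [:-c, 1:]) * r" "set cs \<subseteq> Delta \<mu> j" "\<And>x. x \<in> Delta \<mu> j \<Longrightarrow> poly r x \<noteq> 0" by blast
      have "r \<noteq> 0" using cr False by auto
      then have "length cs \<le> degree (B j)"
        unfolding cr(1) by (subst degree_mult_eq) (auto simp: linear_prod_nonzero degree_linear_prod)
      also have "\<dots> < n j" using degree_lt_iff[OF False deg] .
      finally show ?thesis using False cr ex[OF cr(3)] unfolding Q_def by blast
    qed
  qed
  then obtain cs r s where Q: "\<And>j. Q j (cs j) (r j) (s j)" by metis
  have
    Bf: "\<And>j. B j \<noteq> 0 \<Longrightarrow> B j = (\<Prod>c\<leftarrow>cs j. [:-c, 1:]) * r j" and csD: "\<And>j. set (cs j) \<subseteq> Delta \<mu> j"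
    and s: "\<And>j. s j = 1 \<or> s j = (-1::real)" and sr: "\<And>j x. x \<in> Delta \<mu> j \<Longrightarrow> s j * (poly (r j) x * w j x) > 0"
    and B0: "\<And>j. B j = 0 \<Longrightarrow> cs j = []" and len: "\<And>j. B j \<noteq> 0 \<Longrightarrow> length (cs j) < n j"
  proof -
    note Q' = Q[unfolded Q_def]
    show "B j = (\<Prod>c\<leftarrow>cs j. [:-c, 1:]) * r j" if "B j \<noteq> 0" for j by (rule mp[OF conjunct1[OF Q'[of j]] that])
    show "set (cs j) \<subseteq> Delta \<mu> j" for j using Q'[of j] by blast
    show "s j = 1 \<or> s j = (-1::real)" for j using Q'[of j] by blast
    show "s j * (poly (r j) x * w j x) > 0" if "x \<in> Delta \<mu> j" for j x using Q'[of j] that by blast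
    show "cs j = []" if "B j = 0" for j using Q'[of j] that by blast
    show "length (cs j) < n j" if "B j \<noteq> 0" for j using Q'[of j] that by blast
  qed
  define q where "q j = (\<Prod>c\<leftarrow>cs j. [:-c, 1::real:])" for j
  have qo: "poly (q j) x \<noteq> 0" if "x \<in> Delta \<mu> (other j)" for j x
    using that csD[of j] Delta_disjoint[of x "other j"] unfolding q_def linear_prod_eq_0_iff by auto
  have "\<exists>t. (t = 1 \<or> t = (-1::real)) \<and> (\<forall>x\<in>Delta \<mu> (other j). t * poly (q j) x > 0)" for j
    by (rule poly_const_sign[OF qo])
  then obtain t where t: "\<And>j. t j = 1 \<or> t j = (-1::real)" and tq: "\<And>j x. x \<in> Delta \<mu> (other j) \<Longrightarrow> t j * poly (q j) x > 0"
    by metis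
  define \<sigma> where "\<sigma> j = s j * t (other j)" for j
  have sg: "\<sigma> j = 1 \<or> \<sigma> j = -1" for j using s[of j] t[of "other j"] by (auto simp: \<sigma>_def)
  have contra: False
    if g: "\<And>j x. x \<in> Delta \<mu> j \<Longrightarrow> B j \<noteq> 0 \<Longrightarrow> \<sigma> j * poly g x > 0"
      and gd: "degree g + length (cs I1) + length (cs I2) < n I1 + n I2" and ne: "B i \<noteq> 0" for g i
  proof -
    define p where "p = g * q I1 * q I2"
    have pq: "poly p x = poly g x * poly (q j) x * poly (q (other j)) x" for x j
      by (cases j) (auto simp: p_def)
    have "degree p \<le> degree g + degree (q I1) + degree (q I2)"
      unfolding p_def by (rule order.trans[OF degree_mult_le]) (simp add: degree_mult_le)
    then have "degree p < n I1 + n I2" using gd by (simp add: q_def degree_linear_prod)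
    then have pc: "\<forall>j\<ge>n I1 + n I2. coeff p j = 0" by (intro coeff_ge_degree) simp
    \<comment> \<open>All zeros of \<open>B j\<close> in \<Delta>_j occur squared; the three
      remaining factors are positive there by the choice of signs.\<close>
    have form: "poly p x * (poly (B j) x * w j x) = (poly (q j) x)\<^sup>2 * ((\<sigma> j * poly g x) * (t (other j) * poly (q (other j)) x) * (s j * (poly (r j) x * w j x)))"
      if "B j \<noteq> 0" for j x
    proof -
      have "poly (B j) x = poly (q j) x * poly (r j) x" using arg_cong[OF Bf[OF that], of "\<lambda>p. poly p x"] by (simp add: q_def)
      moreover have "t (other j) * t (other j) = 1" "s j * s j = 1" using t[of "other j"] s[of j] by auto
      moreover have "(poly (q j) x)\<^sup>2 * ((s j * t (other j) * poly g x) * (t (other j) * poly (q (other j)) x) * (s j * (poly (r j) x * w j x)))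
        = (t (other j) * t (other j)) * (s j * s j) * (poly g x * poly (q j) x * poly (q (other j)) x * (poly (q j) x * poly (r j) x * w j x))"
        by (simp add: power2_eq_square algebra_simps)
      ultimately show ?thesis by (simp only: \<sigma>_def pq[of x j] mult_1_left)
    qed
    have pos: "(\<sigma> j * poly g x) * (t (other j) * poly (q (other j)) x) * (s j * (poly (r j) x * w j x)) > 0"
      if "B j \<noteq> 0" "x \<in> Delta \<mu> j" for j x
      using g[OF that(2,1)] tq[of x "other j"] sr[OF that(2)] that(2) by simp
    have nonneg: "(\<integral>x. poly p x * (poly (B j) x * w j x) \<partial>\<mu> j) \<ge> 0" for j
    proof (cases "B j = 0")
      case False
      show ?thesis
      proof (rule integral_nonneg_AE, use AE_Delta in eventually_elim)
        case (elim x)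
        show ?case unfolding form[OF False] using pos[OF False elim] by simp
      qed
    qed simp
    have "(\<integral>x. poly p x * (poly (B i) x * w i x) \<partial>\<mu> i) > 0"
    proof (rule integral_pos)
      show "cm i (\<lambda>x. poly p x * (poly (B i) x * w i x))" by (intro cm_mult w cm_poly)
      show "poly p x * (poly (B i) x * w i x) \<ge> 0" if "x \<in> Delta \<mu> i" for x
        unfolding form[OF ne] using pos[OF ne that] by simp
      have "{x \<in> Delta \<mu> i. poly p x * (poly (B i) x * w i x) = 0} \<subseteq> set (cs i)"
      proof
        fix x assume x: "x \<in> {x \<in> Delta \<mu> i. poly p x * (poly (B i) x * w i x) = 0}"
        then have "poly p x * (poly (B i) x * w i x) = 0" "x \<in> Delta \<mu> i" by auto
        then have "poly (q i) x = 0" using pos[OF ne, of x] unfolding form[OF ne] by auto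
        then show "x \<in> set (cs i)" by (simp add: q_def linear_prod_eq_0_iff)
      qed
      then show "finite {x \<in> Delta \<mu> i. poly p x * (poly (B i) x * w i x) = 0}" by (rule finite_subset) simp
    qed
    then show False using orthp[OF pc] nonneg[of I1] nonneg[of I2] by (cases i) auto
  qed
  have "B I1 = 0 \<and> B I2 = 0"
  proof (rule ccontr)
    assume ne: "\<not> ?thesis"
    consider "B I1 \<noteq> 0" "B I2 \<noteq> 0" | i where "B i \<noteq> 0" "B (other i) = 0"
      using ne by (metis other.simps)
    then show False
    proof cases
      case 1
      from gap_poly[OF sg[of I1] sg[of I2]] obtain g where
        g: "degree g \<le> 1" "\<And>x. x \<in> Delta \<mu> I1 \<Longrightarrow> \<sigma> I1 * poly g x > 0" "\<And>x. x \<in> Delta \<mu> I2 \<Longrightarrow> \<sigma> I2 * poly g x > 0" by blast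
      show False
      proof (rule contra[of g I1])
        show "\<sigma> j * poly g x > 0" if "x \<in> Delta \<mu> j" for j x using g that by (cases j) auto
        show "degree g + length (cs I1) + length (cs I2) < n I1 + n I2"
          using g(1) len[OF 1(1)] len[OF 1(2)] by linarith
      qed (rule 1)
    next
      \<comment> \<open>The index of the vanishing component may be 0, so the degree count leaves no
        room for a linear \<open>g\<close>. But only one sign has to be matched, and a constant does
        that.\<close>
      case (2 i)
      show False
      proof (rule contra[of "[:\<sigma> i:]" i])
        show "\<sigma> j * poly [:\<sigma> i:] x > 0" if "x \<in> Delta \<mu> j" "B j \<noteq> 0" for j x
        proof -
          have "j = i" using ix_eq_or_other[of j i] that 2 by auto
          then show ?thesis using sg[of i] by auto
        qed
        show "degree [:\<sigma> i:] + length (cs I1) + length (cs I2) < n I1 + n I2"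
          using len[OF 2(1)] B0[OF 2(2)] by (cases i) auto
      qed (rule 2)
    qed
  qed
  then show "B k = 0" by (cases k) auto
qed

text \<open>With fewer zeros, counted with multiplicity, their product \<open>q\<close> would be an
  admissible test polynomial while \<open>q P W\<close> has constant sign on \<Delta>_k. The
  nonnegative polynomial weight is there for the later choice \<open>(t - x)^2\<close>.\<close>

lemma zeros_in_Delta:
  assumes P: "P = (\<Prod>c\<leftarrow>cs. [:-c, 1:]) * r" and r: "\<And>x. x \<in> Delta \<mu> k \<Longrightarrow> poly r x \<noteq> 0"
    and W: "\<And>x. poly W x \<ge> 0" "W \<noteq> 0"
    and orth: "\<And>m. m < n \<Longrightarrow> (\<integral>x. poly P x * x ^ m * poly W x \<partial>\<mu> k) = 0"
  shows "n \<le> length cs"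
proof (rule ccontr)
  assume "\<not> n \<le> length cs"
  define q where "q = (\<Prod>c\<leftarrow>cs. [:-c, 1::real:])"
  have "\<forall>j\<ge>n. coeff q j = 0" using \<open>\<not> n \<le> length cs\<close> by (intro coeff_ge_degree) (simp add: q_def degree_linear_prod)
  have "(\<integral>x. poly q x * (poly P x * poly W x) \<partial>\<mu> k) = (\<Sum>i<n. coeff q i * (\<integral>x. x ^ i * (poly P x * poly W x) \<partial>\<mu> k))"
    by (rule integral_poly_expand) (auto intro: cm_mult simp: \<open>\<forall>j\<ge>n. coeff q j = 0\<close>)
  also have "\<dots> = 0" by (intro sum.neutral ballI) (use orth in \<open>auto simp: mult_ac\<close>)
  finally have 0: "(\<integral>x. poly q x * (poly P x * poly W x) \<partial>\<mu> k) = 0" .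
  have "\<exists>s. (s = 1 \<or> s = (-1::real)) \<and> (\<forall>x\<in>Delta \<mu> k. s * poly r x > 0)"
    by (rule poly_const_sign[OF r])
  then obtain s where s: "s = 1 \<or> s = -1" "\<And>x. x \<in> Delta \<mu> k \<Longrightarrow> s * poly r x > 0"
    by blast
  have form: "s * (poly q x * (poly P x * poly W x)) = (poly q x)\<^sup>2 * (s * poly r x) * poly W x" for x
    by (simp add: P q_def power2_eq_square algebra_simps)
  have "(\<integral>x. s * (poly q x * (poly P x * poly W x)) \<partial>\<mu> k) > 0"
  proof (rule integral_pos)
    show "cm k (\<lambda>x. s * (poly q x * (poly P x * poly W x)))" by (intro cm_mult cm_poly cm_const)
    show "s * (poly q x * (poly P x * poly W x)) \<ge> 0" if "x \<in> Delta \<mu> k" for x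
      unfolding form using s(2)[OF that] W(1)[of x] by simp
    have "{x \<in> Delta \<mu> k. s * (poly q x * (poly P x * poly W x)) = 0} \<subseteq> set cs \<union> {x. poly W x = 0}"
      unfolding form using s(2) by (force simp: q_def linear_prod_eq_0_iff)
    then show "finite {x \<in> Delta \<mu> k. s * (poly q x * (poly P x * poly W x)) = 0}"
      by (rule finite_subset) (simp add: poly_roots_finite W)
  qed
  then show False using 0 by simp
qed

lemma two_factor:
  assumes "P \<noteq> 0"
  obtains cs r where "P = (\<Prod>c\<leftarrow>cs I1. [:-c, 1:]) * (\<Prod>c\<leftarrow>cs I2. [:-c, 1:]) * r"
    "\<And>k. set (cs k) \<subseteq> Delta \<mu> k" "\<And>k x. x \<in> Delta \<mu> k \<Longrightarrow> poly r x \<noteq> 0"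
proof -
  from poly_factor_roots[OF assms, of "Delta \<mu> I1"] obtain c1 r1 where
    1: "P = (\<Prod>c\<leftarrow>c1. [:-c, 1:]) * r1" "set c1 \<subseteq> Delta \<mu> I1" "\<And>x. x \<in> Delta \<mu> I1 \<Longrightarrow> poly r1 x \<noteq> 0" by blast
  have "r1 \<noteq> 0" using 1 assms by auto
  from poly_factor_roots[OF this, of "Delta \<mu> I2"] obtain c2 r where
    2: "r1 = (\<Prod>c\<leftarrow>c2. [:-c, 1:]) * r" "set c2 \<subseteq> Delta \<mu> I2" "\<And>x. x \<in> Delta \<mu> I2 \<Longrightarrow> poly r x \<noteq> 0" by blast
  show ?thesis
  proof (rule that[of "\<lambda>k. case k of I1 \<Rightarrow> c1 | I2 \<Rightarrow> c2" r])
    show "set (case k of I1 \<Rightarrow> c1 | I2 \<Rightarrow> c2) \<subseteq> Delta \<mu> k" for k using 1 2 by (cases k) auto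
    show "poly r x \<noteq> 0" if "x \<in> Delta \<mu> k" for k x using that 1 2 by (cases k) auto
  qed (use 1 2 in \<open>simp add: mult.assoc\<close>)
qed

text \<open>The zeros in the two disjoint intervals are counted separately; the factor for the other
  interval keeps its sign on \<Delta>_k and joins the zero-free remainder.\<close>

lemma type_II_zeros:
  assumes P: "P \<noteq> 0" and W: "\<And>x. poly W x \<ge> 0" "W \<noteq> 0"
    and orth: "\<And>k m. m < n k \<Longrightarrow> (\<integral>x. poly P x * x ^ m * poly W x \<partial>\<mu> k) = 0"
  shows "\<exists>cs r. P = (\<Prod>c\<leftarrow>cs I1. [:-c, 1:]) * (\<Prod>c\<leftarrow>cs I2. [:-c, 1:]) * r \<and>
    (\<forall>k. set (cs k) \<subseteq> Delta \<mu> k) \<and> (\<forall>k. n k \<le> length (cs k)) \<and>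
    degree P = length (cs I1) + length (cs I2) + degree r"
proof -
  from two_factor[OF P] obtain cs r where
    f: "P = (\<Prod>c\<leftarrow>cs I1. [:-c, 1:]) * (\<Prod>c\<leftarrow>cs I2. [:-c, 1:]) * r"
    "\<And>k. set (cs k) \<subseteq> Delta \<mu> k" "\<And>k x. x \<in> Delta \<mu> k \<Longrightarrow> poly r x \<noteq> 0" by blast
  show ?thesis
  proof (intro exI conjI allI)
    show "P = (\<Prod>c\<leftarrow>cs I1. [:-c, 1:]) * (\<Prod>c\<leftarrow>cs I2. [:-c, 1:]) * r" by (rule f(1))
    fix k
    show "set (cs k) \<subseteq> Delta \<mu> k" by (rule f(2))
    show "n k \<le> length (cs k)"
    proof (rule zeros_in_Delta[OF _ _ W orth])
      show "P = (\<Prod>c\<leftarrow>cs k. [:-c, 1:]) * ((\<Prod>c\<leftarrow>cs (other k). [:-c, 1:]) * r)"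
        using f(1) by (cases k) (simp_all add: mult_ac)
      show "poly ((\<Prod>c\<leftarrow>cs (other k). [:-c, 1:]) * r) x \<noteq> 0" if "x \<in> Delta \<mu> k" for x
        using that f(2)[of "other k"] f(3)[OF that] Delta_disjoint[OF that] by (auto simp: linear_prod_eq_0_iff)
    qed
  next
    have "r \<noteq> 0" using P f(1) by auto
    then show "degree P = length (cs I1) + length (cs I2) + degree r"
      unfolding f(1) by (simp add: degree_mult_eq linear_prod_nonzero degree_linear_prod)
  qed
qed

theorem type_II_normal:
  assumes deg: "\<forall>j\<ge>n I1 + n I2. coeff P j = 0" and W: "\<And>x. poly W x \<ge> 0" "W \<noteq> 0"
    and orth: "\<And>k m. m < n k \<Longrightarrow> (\<integral>x. poly P x * x ^ m * poly W x \<partial>\<mu> k) = 0"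
  shows "P = 0"
proof (rule ccontr)
  assume P: "P \<noteq> 0"
  have "\<exists>cs r. P = (\<Prod>c\<leftarrow>cs I1. [:-c, 1:]) * (\<Prod>c\<leftarrow>cs I2. [:-c, 1:]) * r \<and>
    (\<forall>k. set (cs k) \<subseteq> Delta \<mu> k) \<and> (\<forall>k. n k \<le> length (cs k)) \<and>
    degree P = length (cs I1) + length (cs I2) + degree r"
    by (rule type_II_zeros[OF P W orth])
  then obtain cs :: "ix \<Rightarrow> real list" and r :: "real poly"
    where f: "\<forall>k. n k \<le> length (cs k)" "degree P = length (cs I1) + length (cs I2) + degree r"
    by blast
  have "degree P < n I1 + n I2" by (rule degree_lt_iff[OF P deg])
  then show False using spec[OF f(1), of I1] spec[OF f(1), of I2] f(2) by linarith
qed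

end

subsection \<open>Multiple orthogonal polynomials and their recurrences\<close>

text \<open>Gaussian elimination: if the last row is nonzero, its pivot column \<open>p\<close> is
  eliminated and the induction hypothesis applies to the remaining n columns plus one.\<close>

lemma underdetermined_system:
  fixes M :: "nat \<Rightarrow> nat \<Rightarrow> real"
  shows "\<exists>x. (\<exists>j\<le>n. x j \<noteq> 0) \<and> (\<forall>i<n. (\<Sum>j\<le>n. M i j * x j) = 0)"
proof (induct n arbitrary: M)
  case 0
  show ?case by (intro exI[of _ "\<lambda>_. 1"]) auto
next
  case (Suc n)
  show ?case
  proof (cases "\<forall>j\<le>Suc n. M n j = 0")
    case True
    from Suc[of M] obtain x where x: "\<exists>j\<le>n. x j \<noteq> 0" "\<forall>i<n. (\<Sum>j\<le>n. M i j * x j) = 0" by blast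
    have "(\<Sum>j\<le>Suc n. M i j * (if j \<le> n then x j else 0)) = 0" if "i < Suc n" for i
    proof (cases "i = n")
      case False
      then have "(\<Sum>j\<le>n. M i j * (if j \<le> n then x j else 0)) = 0"
        using x(2) that by (simp add: less_Suc_eq)
      then show ?thesis by simp
    next
      case i: True
      show ?thesis by (rule sum.neutral) (use True i in auto)
    qed
    then show ?thesis using x(1) by (intro exI[of _ "\<lambda>j. if j \<le> n then x j else 0"]) (auto simp del: sum.atMost_Suc)
  next
    case False
    then obtain p where p: "p \<le> Suc n" "M n p \<noteq> 0" by blast
    define e where "e j = (if j < p then j else Suc j)" for j
    have bij: "bij_betw e {..n} ({..Suc n} - {p})"
    proof (rule bij_betwI[where g="\<lambda>k. if k < p then k else k - 1"])
      show "e \<in> {..n} \<rightarrow> {..Suc n} - {p}" using p(1) by (auto simp: e_def)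
      show "(\<lambda>k. if k < p then k else k - 1) \<in> {..Suc n} - {p} \<rightarrow> {..n}"
      proof (rule funcsetI)
        fix x assume "x \<in> {..Suc n} - {p}"
        then show "(if x < p then x else x - 1) \<in> {..n}" using p(1) by (cases "x < p") auto
      qed
    qed (auto simp: e_def)
    have split: "(\<Sum>k\<le>Suc n. F k) = F p + (\<Sum>j\<le>n. F (e j))" for F :: "nat \<Rightarrow> real"
    proof -
      have "(\<Sum>k\<le>Suc n. F k) = F p + (\<Sum>k\<in>{..Suc n} - {p}. F k)"
        by (rule sum.remove) (use p in auto)
      also have "(\<Sum>k\<in>{..Suc n} - {p}. F k) = (\<Sum>j\<le>n. F (e j))"
        by (rule sum.reindex_bij_betw[OF bij, symmetric])
      finally show ?thesis .
    qed
    \<comment> \<open>The rows after solving row \<open>n\<close> for the unknown with index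
      \<open>p\<close>; \<open>e\<close> enumerates the other columns.\<close>
    define M' where "M' i j = M i (e j) - M i p * M n (e j) / M n p" for i j
    from Suc[of M'] obtain x where x: "\<exists>j\<le>n. x j \<noteq> 0" "\<forall>i<n. (\<Sum>j\<le>n. M' i j * x j) = 0" by blast
    define y where "y k = (if k = p then - (\<Sum>j\<le>n. M n (e j) * x j) / M n p else if k < p then x k else x (k - 1))" for k
    have ye: "y (e j) = x j" for j by (auto simp: y_def e_def)
    have yp: "y p = - (\<Sum>j\<le>n. M n (e j) * x j) / M n p" by (simp add: y_def)
    have row: "(\<Sum>k\<le>Suc n. M i k * y k) = 0" if "i < Suc n" for i
    proof (cases "i = n")
      case True
      then show ?thesis unfolding split ye yp using p(2) by simp
    next
      case False
      then have "(\<Sum>j\<le>n. M' i j * x j) = 0" using x(2) that by (simp add: less_Suc_eq)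
      moreover have "(\<Sum>j\<le>n. M' i j * x j) = (\<Sum>j\<le>n. M i (e j) * x j) - M i p * (\<Sum>j\<le>n. M n (e j) * x j) / M n p"
        by (simp add: M'_def left_diff_distrib sum_subtractf sum_distrib_left sum_divide_distrib mult.assoc)
      ultimately show ?thesis unfolding split ye yp by simp
    qed
    obtain j where j: "j \<le> n" "x j \<noteq> 0" using x(1) by blast
    have "e j \<le> Suc n" using j(1) by (auto simp: e_def)
    then show ?thesis using j(2) row ye by (intro exI[of _ y]) (metis)
  qed
qed

text \<open>Append the column \<open>- b\<close> to get one unknown more than equations. In a
  nontrivial solution the last unknown cannot vanish, since the kernel is trivial, and dividing by
  it solves the inhomogeneous system.\<close>

lemma square_system:
  fixes M :: "nat \<Rightarrow> nat \<Rightarrow> real"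
  assumes ker: "\<And>x. (\<And>i. i < N \<Longrightarrow> (\<Sum>j<N. M i j * x j) = 0) \<Longrightarrow> \<forall>j<N. x j = 0"
  shows "\<exists>x. \<forall>i<N. (\<Sum>j<N. M i j * x j) = b i"
proof -
  define M' where "M' i j = (if j < N then M i j else - b i)" for i j
  obtain x where x: "\<exists>j\<le>N. x j \<noteq> 0" "\<forall>i<N. (\<Sum>j\<le>N. M' i j * x j) = 0"
    using underdetermined_system[of N M'] by blast
  have eq: "(\<Sum>j<N. M i j * x j) = b i * x N" if "i < N" for i
  proof -
    have "(\<Sum>j\<le>N. M' i j * x j) = (\<Sum>j<N. M' i j * x j) + M' i N * x N"
      unfolding lessThan_Suc_atMost[symmetric] by simp
    also have "(\<Sum>j<N. M' i j * x j) = (\<Sum>j<N. M i j * x j)"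
      by (rule sum.cong) (auto simp: M'_def)
    finally show ?thesis using x(2) that by (simp add: M'_def)
  qed
  have "x N \<noteq> 0"
  proof
    assume 0: "x N = 0"
    have "\<forall>j<N. x j = 0" by (rule ker) (simp add: eq 0)
    then show False using x(1) 0 by (metis le_less)
  qed
  then have "(\<Sum>j<N. M i j * (x j / x N)) = b i" if "i < N" for i
    using eq[OF that] by (simp add: sum_divide_distrib[symmetric])
  then show ?thesis by (intro exI[of _ "\<lambda>j. x j / x N"]) auto
qed

lemma sum_lessThan_add: "(\<Sum>j<a + b. f j) = (\<Sum>j<a. f j) + (\<Sum>j<b. f (a + j))"
  for f :: "nat \<Rightarrow> real"
  by (induct b) (auto simp: add.assoc)

lemma coeff_sum_monom: "coeff (\<Sum>j<n. monom (x j) j) i = (if i < n then x i else 0)"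
  by (simp add: coeff_sum coeff_monom)

section \<open>Existence and uniqueness of the multiple orthogonal polynomials\<close>

context angelesco_system
begin

text \<open>The unknowns are the coefficients of both polynomials listed one after the other. The
  system is square, so normality, which is uniqueness, yields existence.\<close>

lemma is_type_I_exists: "\<exists>A. is_type_I \<mu> n A"
proof -
  define N where "N = n I1 + n I2"
  define mom where "mom k m = (\<integral>x. x ^ m \<partial>\<mu> k)" for k m
  define M where "M m j = (if j < n I1 then mom I1 (m + j) else mom I2 (m + (j - n I1)))" for m j
  define pl where "pl x k = (case k of I1 \<Rightarrow> \<Sum>j<n I1. monom (x j) j | I2 \<Rightarrow> \<Sum>j<n I2. monom (x (n I1 + j)) j)"
    for x :: "nat \<Rightarrow> real" and k
  have plc: "\<forall>j\<ge>n k. coeff (pl x k) j = 0" for x k by (cases k) (auto simp: pl_def coeff_sum_monom)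
  have int1: "(\<integral>t. t ^ m * poly (\<Sum>j<d. monom (y j) j) t \<partial>\<mu> k) = (\<Sum>j<d. mom k (m + j) * y j)" for m d y k
  proof -
    have "(\<integral>t. poly (\<Sum>j<d. monom (y j) j) t * t ^ m \<partial>\<mu> k) = (\<Sum>i<d. y i * (\<integral>x. x ^ i * x ^ m \<partial>\<mu> k))"
      by (subst integral_poly_expand[where n=d]) (auto simp: coeff_sum_monom)
    then show ?thesis by (simp add: mom_def power_add[symmetric] mult.commute add.commute)
  qed
  have MQ: "(\<Sum>j<N. M m j * x j) = (\<Sum>k\<in>{I1, I2}. \<integral>t. t ^ m * poly (pl x k) t \<partial>\<mu> k)" for x m
  proof -
    have "(\<Sum>j<N. M m j * x j) = (\<Sum>j<n I1. mom I1 (m + j) * x j) + (\<Sum>j<n I2. mom I2 (m + j) * x (n I1 + j))"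
      unfolding N_def sum_lessThan_add by (simp add: M_def)
    then show ?thesis by (simp add: pl_def int1)
  qed
  obtain x where x: "\<And>i. i < N \<Longrightarrow> (\<Sum>j<N. M i j * x j) = (if Suc i = N then 1 else 0)"
  proof -
    have "\<exists>x. \<forall>i<N. (\<Sum>j<N. M i j * x j) = (if Suc i = N then 1 else 0)"
    proof (rule square_system)
      fix x assume 0: "\<And>i. i < N \<Longrightarrow> (\<Sum>j<N. M i j * x j) = 0"
      have "pl x k = 0" for k
      proof (rule type_I_normal[where w="\<lambda>k x. 1" and n=n])
        show "(\<Sum>k\<in>{I1, I2}. \<integral>t. t ^ m * (poly (pl x k) t * 1) \<partial>\<mu> k) = 0" if "m < n I1 + n I2" for m
          using 0[of m] that unfolding MQ by (simp add: N_def)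
      qed (use plc in auto)
      then have c: "coeff (pl x k) j = 0" for k j by simp
      show "\<forall>j<N. x j = 0"
      proof (intro allI impI)
        fix j assume j: "j < N"
        show "x j = 0"
        proof (cases "j < n I1")
          case True
          then show ?thesis using c[of I1 j] by (simp add: pl_def coeff_sum_monom)
        next
          case False
          then obtain i where "j = n I1 + i" by (metis le_add_diff_inverse not_less)
          then show ?thesis using c[of I2 i] j by (simp add: pl_def coeff_sum_monom N_def)
        qed
      qed
    qed
    then show ?thesis using that by blast
  qed
  have "is_type_I \<mu> n (pl x)" unfolding is_type_I_def msize_def MQ[symmetric] N_def[symmetric]
    using plc x by auto
  then show ?thesis by blast
qed

lemma is_type_I_unique: assumes A: "is_type_I \<mu> n A" and B: "is_type_I \<mu> n B" shows "A = B"
proof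
  fix k
  have "A k - B k = 0"
  proof (rule type_I_normal[where w="\<lambda>k x. 1" and n=n and B="\<lambda>k. A k - B k"])
    show "\<forall>j\<ge>n k. coeff (A k - B k) j = 0" for k using A B by (auto simp: is_type_I_def)
    fix m assume m: "m < n I1 + n I2"
    have "(\<Sum>k\<in>{I1, I2}. \<integral>t. t ^ m * (poly (A k - B k) t * 1) \<partial>\<mu> k)
       = (\<Sum>k\<in>{I1, I2}. (\<integral>t. t ^ m * poly (A k) t \<partial>\<mu> k) - (\<integral>t. t ^ m * poly (B k) t \<partial>\<mu> k))"
      by (intro sum.cong refl) (auto simp: right_diff_distrib intro!: Bochner_Integration.integral_diff cm_integrable cm_mult)
    also have "\<dots> = (\<Sum>k\<in>{I1, I2}. \<integral>t. t ^ m * poly (A k) t \<partial>\<mu> k) - (\<Sum>k\<in>{I1, I2}. \<integral>t. t ^ m * poly (B k) t \<partial>\<mu> k)"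
      by (rule sum_subtractf)
    also have "\<dots> = 0"
    proof -
      have "(\<Sum>k\<in>{I1, I2}. \<integral>t. t ^ m * poly (D k) t \<partial>\<mu> k) = (if m + 1 = msize n then 1 else 0)" if "is_type_I \<mu> n D" for D
        using that m unfolding is_type_I_def by (auto simp: msize_def)
      from this[OF A] this[OF B] show ?thesis by simp
    qed
    finally show "(\<Sum>k\<in>{I1, I2}. \<integral>t. t ^ m * (poly (A k - B k) t * 1) \<partial>\<mu> k) = 0" .
  qed auto
  then show "A k = B k" by simp
qed

lemma type_I: "is_type_I \<mu> n (type_I \<mu> n)"
  unfolding type_I_def by (rule theI'[of "is_type_I \<mu> n"], rule ex_ex1I[OF is_type_I_exists]) (rule is_type_I_unique)

text \<open>The leading coefficient being fixed, its moments move to the right side; the unknowns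
  are the lower coefficients and normality is again injectivity.\<close>

lemma is_type_II_exists: "\<exists>P. is_type_II \<mu> n P"
proof -
  define N where "N = n I1 + n I2"
  define mom where "mom k m = (\<integral>x. x ^ m \<partial>\<mu> k)" for k m
  define M where "M i j = (if i < n I1 then mom I1 (i + j) else mom I2 ((i - n I1) + j))" for i j
  define pl where "pl x = (\<Sum>j<N. monom (x j) j)" for x :: "nat \<Rightarrow> real"
  have int1: "(\<integral>t. poly (pl x) t * t ^ m \<partial>\<mu> k) = (\<Sum>j<N. mom k (m + j) * x j)" for m x k
  proof -
    have "(\<integral>t. poly (pl x) t * t ^ m \<partial>\<mu> k) = (\<Sum>i<N. x i * (\<integral>x. x ^ i * x ^ m \<partial>\<mu> k))"
      unfolding pl_def by (subst integral_poly_expand[where n=N]) (auto simp: coeff_sum_monom)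
    then show ?thesis by (simp add: mom_def power_add[symmetric] mult.commute add.commute)
  qed
  have M1: "(\<Sum>j<N. M i j * x j) = (\<integral>t. poly (pl x) t * t ^ i \<partial>\<mu> I1)" if "i < n I1" for i x
    using that by (simp add: M_def int1)
  have M2: "(\<Sum>j<N. M (n I1 + i) j * x j) = (\<integral>t. poly (pl x) t * t ^ i \<partial>\<mu> I2)" for i x
    by (simp add: M_def int1)
  have "\<exists>x. \<forall>i<N. (\<Sum>j<N. M i j * x j) = (if i < n I1 then - mom I1 (i + N) else - mom I2 ((i - n I1) + N))"
  proof (rule square_system)
    fix x assume 0: "\<And>i. i < N \<Longrightarrow> (\<Sum>j<N. M i j * x j) = 0"
    have "pl x = 0"
    proof (rule type_II_normal[where n=n and W="[:1:]"])
      show "\<forall>j\<ge>n I1 + n I2. coeff (pl x) j = 0" by (simp add: pl_def coeff_sum_monom N_def)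
      show "(\<integral>t. poly (pl x) t * t ^ m * poly [:1:] t \<partial>\<mu> k) = 0" if "m < n k" for k m
      proof (cases k)
        case I1
        then show ?thesis using 0[of m] that M1[of m x] by (simp add: N_def)
      next
        case I2
        then show ?thesis using 0[of "n I1 + m"] that M2[of m x] by (simp add: N_def)
      qed
    qed auto
    then have "coeff (pl x) j = 0" for j by simp
    then show "\<forall>j<N. x j = 0" unfolding pl_def coeff_sum_monom by metis
  qed
  then obtain x where x: "\<And>i. i < N \<Longrightarrow> (\<Sum>j<N. M i j * x j) = (if i < n I1 then - mom I1 (i + N) else - mom I2 ((i - n I1) + N))"
    by blast
  define P where "P = monom 1 N + pl x"
  have cP: "coeff P j = (if j = N then 1 else if j < N then x j else 0)" for j
    by (auto simp: P_def pl_def coeff_sum_monom)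
  have dP: "degree P = N"
    by (rule antisym) (auto intro!: degree_le le_degree simp: cP)
  have orth: "(\<integral>t. poly P t * t ^ m \<partial>\<mu> k) = 0" if m: "m < n k" for k m
  proof -
    have "(\<integral>t. poly P t * t ^ m \<partial>\<mu> k) = (\<integral>t. t ^ (m + N) + poly (pl x) t * t ^ m \<partial>\<mu> k)"
      by (simp add: P_def poly_monom power_add algebra_simps)
    also have "\<dots> = mom k (m + N) + (\<integral>t. poly (pl x) t * t ^ m \<partial>\<mu> k)"
      unfolding mom_def by (rule Bochner_Integration.integral_add) (auto intro!: cm_integrable cm_mult)
    also have "\<dots> = 0"
    proof (cases k)
      case I1
      then show ?thesis using x[of m] m M1[of m x] by (simp add: N_def)
    next
      case I2
      then show ?thesis using x[of "n I1 + m"] m M2[of m x] by (simp add: N_def)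
    qed
    finally show ?thesis .
  qed
  have "is_type_II \<mu> n P" unfolding is_type_II_def msize_def using dP cP orth by (auto simp: N_def)
  then show ?thesis ..
qed

lemma is_type_II_unique: assumes P: "is_type_II \<mu> n P" and Q: "is_type_II \<mu> n Q" shows "P = Q"
proof -
  have "P - Q = 0"
  proof (rule type_II_normal[where n=n and W="[:1:]"])
    show "\<forall>j\<ge>n I1 + n I2. coeff (P - Q) j = 0"
    proof (intro allI impI)
      fix j assume j: "j \<ge> n I1 + n I2"
      show "coeff (P - Q) j = 0"
      proof (cases "j = n I1 + n I2")
        case True
        then have "degree P = j" "degree Q = j" "lead_coeff P = 1" "lead_coeff Q = 1"
          using P Q by (auto simp: is_type_II_def msize_def)
        then show ?thesis by simp
      next
        case False
        then show ?thesis using P Q j by (simp add: is_type_II_def msize_def coeff_eq_0)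
      qed
    qed
    fix k m assume m: "m < n k"
    have "(\<integral>x. poly (P - Q) x * x ^ m * poly [:1:] x \<partial>\<mu> k) = (\<integral>x. poly P x * x ^ m \<partial>\<mu> k) - (\<integral>x. poly Q x * x ^ m \<partial>\<mu> k)"
      by (subst Bochner_Integration.integral_diff[symmetric]) (auto intro!: cm_integrable cm_mult simp: left_diff_distrib)
    then show "(\<integral>x. poly (P - Q) x * x ^ m * poly [:1:] x \<partial>\<mu> k) = 0" using P Q m by (simp add: is_type_II_def)
  qed auto
  then show ?thesis by simp
qed

lemma type_II: "is_type_II \<mu> n (type_II \<mu> n)"
  unfolding type_II_def by (rule theI'[of "is_type_II \<mu> n"], rule ex_ex1I[OF is_type_II_exists]) (rule is_type_II_unique)

text \<open>Integration against the linear form with densities \<open>B k\<close> with respect to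
  \<mu>_k; all type I statements are phrased through it.\<close>

definition QI :: "(ix \<Rightarrow> real poly) \<Rightarrow> real poly \<Rightarrow> real" where
  "QI B p = (\<Sum>k\<in>{I1, I2}. \<integral>x. poly p x * poly (B k) x \<partial>\<mu> k)"

lemma int_pp: "integrable (\<mu> k) (\<lambda>x. poly p x * poly q x)"
  by (intro cm_integrable cm_mult cm_poly)

lemma QI_add: "QI B (p + q) = QI B p + QI B q"
  by (simp add: QI_def distrib_right int_pp)

lemma QI_smult: "QI B (smult c p) = c * QI B p"
  by (simp add: QI_def mult.assoc distrib_left)

lemma QI_diff: "QI B (p - q) = QI B p - QI B q"
  by (simp add: QI_def left_diff_distrib int_pp)

lemma QI_add_left: "QI (\<lambda>k. B k + D k) p = QI B p + QI D p"
  by (simp add: QI_def distrib_left int_pp)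

lemma QI_diff_left: "QI (\<lambda>k. B k - D k) p = QI B p - QI D p"
  by (simp add: QI_def right_diff_distrib int_pp)

lemma QI_smult_left: "QI (\<lambda>k. smult c (B k)) p = c * QI B p"
  by (simp add: QI_def mult.left_commute[of _ c] distrib_left)

lemma QI_mult_left: "QI (\<lambda>k. q * B k) p = QI B (q * p)"
  by (simp add: QI_def mult_ac)

lemma QI_expand: assumes "\<forall>j\<ge>N. coeff p j = 0" shows "QI B p = (\<Sum>i<N. coeff p i * QI B (monom 1 i))"
  unfolding QI_def integral_poly_expand[OF cm_poly assms]
  by (simp add: poly_monom sum.distrib[symmetric] distrib_left)

lemma type_I_coeff: "j \<ge> n k \<Longrightarrow> coeff (type_I \<mu> n k) j = 0"
  using type_I[of n] by (simp add: is_type_I_def)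

lemma QI_type_I_monom: "m < msize n \<Longrightarrow> QI (type_I \<mu> n) (monom 1 m) = (if Suc m = msize n then 1 else 0)"
  using type_I[of n] by (auto simp: is_type_I_def QI_def poly_monom)

lemma QI_type_I: assumes p: "\<forall>j\<ge>msize n. coeff p j = 0" and n: "msize n > 0"
  shows "QI (type_I \<mu> n) p = coeff p (msize n - 1)"
proof -
  have "QI (type_I \<mu> n) p = (\<Sum>i<msize n. coeff p i * (if i = msize n - 1 then 1 else 0))"
    unfolding QI_expand[OF p] by (intro sum.cong refl) (use n in \<open>auto simp: QI_type_I_monom\<close>)
  also have "\<dots> = coeff p (msize n - 1)" using n by (simp add: if_distrib[of "(*) _"] cong: if_cong)
  finally show ?thesis .
qed

section \<open>Type II polynomials: factorisation, normalising constants, recurrence\<close>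

lemma type_II_degree: "degree (type_II \<mu> n) = msize n" and type_II_monic: "coeff (type_II \<mu> n) (msize n) = 1"
  and type_II_orth: "m < n k \<Longrightarrow> (\<integral>x. poly (type_II \<mu> n) x * x ^ m \<partial>\<mu> k) = 0"
  using type_II[of n] by (auto simp: is_type_II_def)

lemma type_II_coeff: "j > msize n \<Longrightarrow> coeff (type_II \<mu> n) j = 0"
  by (simp add: coeff_eq_0 type_II_degree)

lemma type_II_nonzero: "type_II \<mu> n \<noteq> 0"
  using type_II_monic[of n] by auto

text \<open>The first moment with respect to \<mu>_k that orthogonality leaves free.\<close>

definition h :: "(ix \<Rightarrow> nat) \<Rightarrow> ix \<Rightarrow> real" where
  "h n k = (\<integral>x. poly (type_II \<mu> n) x * x ^ n k \<partial>\<mu> k)"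

lemma type_II_integral:
  assumes "\<forall>j>n k. coeff q j = 0"
  shows "(\<integral>x. poly (type_II \<mu> n) x * poly q x \<partial>\<mu> k) = coeff q (n k) * h n k"
proof -
  have "(\<integral>x. poly q x * poly (type_II \<mu> n) x \<partial>\<mu> k) = (\<Sum>i<Suc (n k). coeff q i * (\<integral>x. x ^ i * poly (type_II \<mu> n) x \<partial>\<mu> k))"
    by (rule integral_poly_expand) (use assms in auto)
  also have "\<dots> = coeff q (n k) * h n k"
    by (simp add: type_II_orth h_def mult.commute[of "_ ^ _"])
  finally show ?thesis by (simp add: mult.commute)
qed

text \<open>At least \<open>n k\<close> zeros in each interval already exhaust the degree, so the
  remainder is constant, and it is 1 because the polynomial is monic.\<close>

lemma type_II_factor:
  obtains q where "type_II \<mu> n = q I1 * q I2" "\<And>k. degree (q k) = n k" "\<And>k. coeff (q k) (n k) = 1"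
    "\<And>k x. poly (q k) x = 0 \<Longrightarrow> x \<in> Delta \<mu> k"
    "\<And>k. \<exists>cs. q k = (\<Prod>c\<leftarrow>cs. [:-c, 1:]) \<and> set cs \<subseteq> Delta \<mu> k \<and> length cs = n k"
proof -
  have "\<exists>cs r. type_II \<mu> n = (\<Prod>c\<leftarrow>cs I1. [:-c, 1:]) * (\<Prod>c\<leftarrow>cs I2. [:-c, 1:]) * r \<and>
    (\<forall>k. set (cs k) \<subseteq> Delta \<mu> k) \<and> (\<forall>k. n k \<le> length (cs k)) \<and>
    degree (type_II \<mu> n) = length (cs I1) + length (cs I2) + degree r"
    by (rule type_II_zeros[where W="[:1:]"]) (auto simp: type_II_nonzero type_II_orth)
  then obtain cs :: "ix \<Rightarrow> real list" and r :: "real poly" where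
    f: "type_II \<mu> n = (\<Prod>c\<leftarrow>cs I1. [:-c, 1:]) * (\<Prod>c\<leftarrow>cs I2. [:-c, 1:]) * r"
    and cs: "\<And>k. set (cs k) \<subseteq> Delta \<mu> k" and len: "\<And>k. n k \<le> length (cs k)"
    and d: "degree (type_II \<mu> n) = length (cs I1) + length (cs I2) + degree r" by blast
  have l: "length (cs I1) = n I1" "length (cs I2) = n I2" "degree r = 0"
    using d len[of I1] len[of I2] unfolding type_II_degree msize_def by linarith+
  have len': "length (cs k) = n k" for k using l by (cases k) auto
  define q where "q k = (\<Prod>c\<leftarrow>cs k. [:-c, 1::real:])" for k
  have "lead_coeff (type_II \<mu> n) = lead_coeff r"
    unfolding f lead_coeff_mult monic_linear_prod by simp
  then have "lead_coeff r = 1" using type_II_monic[of n] by (simp add: type_II_degree)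
  then have "r = 1" using l(3) by (metis degree_0_id of_nat_1 lead_coeff_1 degree_1 one_pCons degree_eq_zeroE coeff_pCons_0)
  show ?thesis
  proof (rule that[of q])
    show "type_II \<mu> n = q I1 * q I2" using f by (simp add: q_def \<open>r = 1\<close>)
    show dq: "degree (q k) = n k" for k by (simp add: q_def degree_linear_prod len')
    show "coeff (q k) (n k) = 1" for k using monic_linear_prod[of "cs k"] dq[of k] by (simp add: q_def)
    show "x \<in> Delta \<mu> k" if "poly (q k) x = 0" for k x
      using that cs[of k] by (auto simp: q_def linear_prod_eq_0_iff)
    show "\<exists>cs. q k = (\<Prod>c\<leftarrow>cs. [:-c, 1:]) \<and> set cs \<subseteq> Delta \<mu> k \<and> length cs = n k" for k
      using cs len' by (auto simp: q_def)
  qed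
qed

text \<open>The sign on \<Delta>_k of the factor carrying the zeros of the other interval: those of
  \<Delta>_2 lie to the right of \<Delta>_1, those of \<Delta>_1 to the left of \<Delta>_2.\<close>

definition hsign :: "(ix \<Rightarrow> nat) \<Rightarrow> ix \<Rightarrow> real" where
  "hsign n k = (case k of I1 \<Rightarrow> (-1) ^ n I2 | I2 \<Rightarrow> 1)"

lemma linear_prod_sign:
  fixes x :: real
  assumes "length cs = n"
  shows "(\<And>c. c \<in> set cs \<Longrightarrow> c < x) \<Longrightarrow> 0 < (\<Prod>c\<leftarrow>cs. x - c)"
    and "(\<And>c. c \<in> set cs \<Longrightarrow> x < c) \<Longrightarrow> 0 < (-1) ^ n * (\<Prod>c\<leftarrow>cs. x - c)"
  using assms
proof (induct cs arbitrary: n)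
  case (Cons c cs)
  { case 1 then show ?case using Cons(1)[of "length cs"] by simp }
  { case 2
    have "0 < (-1) ^ length cs * (\<Prod>c\<leftarrow>cs. x - c)" using Cons(2)[of "length cs"] 2 by simp
    moreover have "0 < c - x" using 2 by simp
    ultimately have "0 < (c - x) * ((-1) ^ length cs * (\<Prod>c\<leftarrow>cs. x - c))" by simp
    then show ?case using 2(2) by (auto simp: algebra_simps) }
qed auto

lemma h_sign: "hsign n k * h n k > 0"
proof -
  obtain q where q: "type_II \<mu> n = q I1 * q I2" "\<And>k. degree (q k) = n k" "\<And>k. coeff (q k) (n k) = 1"
    "\<And>k. \<exists>cs. q k = (\<Prod>c\<leftarrow>cs. [:-c, 1:]) \<and> set cs \<subseteq> Delta \<mu> k \<and> length cs = n k"
    using type_II_factor[of n] by metis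
  have pq: "type_II \<mu> n = q k * q (other k)" using q(1) by (cases k) (auto simp: mult.commute)
  have "(\<integral>x. poly (type_II \<mu> n) x * poly (q k) x \<partial>\<mu> k) = h n k"
    using type_II_integral[of n k "q k"] q(2)[of k] q(3)[of k] by (simp add: coeff_eq_0)
  then have "hsign n k * h n k = (\<integral>x. hsign n k * (poly (type_II \<mu> n) x * poly (q k) x) \<partial>\<mu> k)" by simp
  also have "\<dots> > 0"
  proof (rule integral_pos)
    have pos: "hsign n k * poly (q (other k)) x > 0" if x: "x \<in> Delta \<mu> k" for x
    proof -
      obtain cs where cs: "q (other k) = (\<Prod>c\<leftarrow>cs. [:-c, 1:])" "set cs \<subseteq> Delta \<mu> (other k)" "length cs = n (other k)"
        using q(4) by blast
      show ?thesis
      proof (cases k)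
        case I1
        have "x < c" if "c \<in> set cs" for c using that cs(2) x I1 hi_lo unfolding Delta_props by force
        then show ?thesis using linear_prod_sign(2)[OF cs(3)] I1 cs(1) by (simp add: hsign_def poly_linear_prod)
      next
        case I2
        have "c < x" if "c \<in> set cs" for c using that cs(2) x I2 hi_lo unfolding Delta_props by force
        then show ?thesis using linear_prod_sign(1)[OF cs(3)] I2 cs(1) by (simp add: hsign_def poly_linear_prod)
      qed
    qed
    have form: "hsign n k * (poly (type_II \<mu> n) x * poly (q k) x) = (poly (q k) x)\<^sup>2 * (hsign n k * poly (q (other k)) x)" for x
      by (simp add: pq power2_eq_square algebra_simps)
    show "cm k (\<lambda>x. hsign n k * (poly (type_II \<mu> n) x * poly (q k) x))" by (intro cm_mult cm_poly cm_const)
    show "hsign n k * (poly (type_II \<mu> n) x * poly (q k) x) \<ge> 0" if "x \<in> Delta \<mu> k" for x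
      unfolding form using pos[OF that] by simp
    have "q k \<noteq> 0" using q(3)[of k] by auto
    have "{x \<in> Delta \<mu> k. hsign n k * (poly (type_II \<mu> n) x * poly (q k) x) = 0} \<subseteq> {x. poly (q k) x = 0}"
      unfolding form using pos by force
    then show "finite {x \<in> Delta \<mu> k. hsign n k * (poly (type_II \<mu> n) x * poly (q k) x) = 0}"
      by (rule finite_subset) (rule poly_roots_finite[OF \<open>q k \<noteq> 0\<close>])
  qed
  finally show ?thesis .
qed

lemma h_nonzero: "h n k \<noteq> 0"
  using h_sign[of n k] by auto

text \<open>Integrating the recurrence against \<open>x^(n k - 1)\<close> over \<mu>_k leaves
  \<open>h n k\<close> on one side and only the term \<open>a n k * h (dec n k) k\<close> on the
  other.\<close>

definition aa :: "(ix \<Rightarrow> nat) \<Rightarrow> ix \<Rightarrow> real" where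
  "aa n k = (if n k = 0 then 0 else h n k / h (dec n k) k)"

definition bb :: "(ix \<Rightarrow> nat) \<Rightarrow> ix \<Rightarrow> real" where
  "bb n i = coeff ([:0, 1:] * type_II \<mu> n - type_II \<mu> (inc n i)) (msize n)"

text \<open>The sign of \<open>h n k\<close> depends only on the index of the other measure, which
  lowering \<open>n k\<close> does not change.\<close>

lemma aa_pos: "n k > 0 \<Longrightarrow> aa n k > 0"
proof -
  assume n: "n k > 0"
  have e: "hsign (dec n k) k = hsign n k" by (cases k) (auto simp: hsign_def dec_def)
  have "hsign n k * h n k > 0" "hsign n k * h (dec n k) k > 0" using h_sign[of n k] h_sign[of "dec n k" k] by (auto simp: e)
  then show ?thesis using n by (auto simp: aa_def zero_less_mult_iff zero_less_divide_iff)
qed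

lemma msize_inc [simp]: "msize (inc n i) = Suc (msize n)"
  by (cases i) (auto simp: msize_def inc_def)

lemma msize_dec: "n i > 0 \<Longrightarrow> Suc (msize (dec n i)) = msize n"
  by (cases i) (auto simp: msize_def dec_def)

lemma inc_apply: "inc n i k = (if k = i then Suc (n i) else n k)" by (simp add: inc_def)
lemma dec_apply: "dec n i k = (if k = i then n i - 1 else n k)" by (simp add: dec_def)
lemma inc_dec: "n i > 0 \<Longrightarrow> inc (dec n i) i = n" by (auto simp: dec_def inc_def)

definition rsum :: "((ix \<Rightarrow> nat) \<Rightarrow> ix \<Rightarrow> real) \<Rightarrow> (ix \<Rightarrow> nat) \<Rightarrow> real poly" where
  "rsum a n = (\<Sum>k\<in>{I1, I2}. if n k = 0 then 0 else smult (a n k) (type_II \<mu> (dec n k)))"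

lemma rsum_coeff: "j \<ge> msize n \<Longrightarrow> coeff (rsum a n) j = 0"
proof -
  assume j: "j \<ge> msize n"
  have "coeff (if n k = 0 then 0 else smult (a n k) (type_II \<mu> (dec n k))) j = 0" for k
    using j msize_dec[of n k] by (auto intro!: type_II_coeff)
  then show ?thesis by (simp add: rsum_def)
qed

lemma rsum_integral: assumes m: "m < n k"
  shows "(\<integral>x. poly (rsum a n) x * x ^ m \<partial>\<mu> k) = (if Suc m = n k then a n k * h (dec n k) k else 0)"
proof -
  have t: "(\<integral>x. poly (if n j = 0 then 0 else smult (a n j) (type_II \<mu> (dec n j))) x * x ^ m \<partial>\<mu> k)
    = (if j = k \<and> Suc m = n k then a n k * h (dec n k) k else 0)" for j
  proof (cases "n j = 0")
    case True
    then show ?thesis using m by auto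
  next
    case False
    have "(\<integral>x. poly (type_II \<mu> (dec n j)) x * x ^ m \<partial>\<mu> k) = (if j = k \<and> Suc m = n k then h (dec n k) k else 0)"
    proof (cases "j = k \<and> Suc m = n k")
      case True
      then have "m = dec n k k" by (auto simp: dec_apply)
      with True show ?thesis by (simp add: h_def)
    next
      case False
      then have "m < dec n j k" using m by (auto simp: dec_apply)
      with False show ?thesis by (auto simp: type_II_orth)
    qed
    then show ?thesis using False by (simp add: mult.assoc)
  qed
  have ip: "integrable (\<mu> k) (\<lambda>x. poly q x * x ^ m)" for q by (intro cm_integrable cm_mult) auto
  have "(\<integral>x. poly (rsum a n) x * x ^ m \<partial>\<mu> k)
    = (\<Sum>j\<in>{I1, I2}. \<integral>x. poly (if n j = 0 then 0 else smult (a n j) (type_II \<mu> (dec n j))) x * x ^ m \<partial>\<mu> k)"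
    unfolding rsum_def poly_sum sum_distrib_right by (rule Bochner_Integration.integral_sum) (rule ip)
  also have "\<dots> = (if Suc m = n k then a n k * h (dec n k) k else 0)"
    unfolding t by (cases k) auto
  finally show ?thesis .
qed

lemma x_type_II_integral: "m < n k \<Longrightarrow> (\<integral>x. poly ([:0, 1:] * type_II \<mu> n) x * x ^ m \<partial>\<mu> k) = (if Suc m = n k then h n k else 0)"
proof -
  assume m: "m < n k"
  have "(\<integral>x. poly ([:0, 1:] * type_II \<mu> n) x * x ^ m \<partial>\<mu> k) = (\<integral>x. poly (type_II \<mu> n) x * x ^ Suc m \<partial>\<mu> k)"
    by (rule Bochner_Integration.integral_cong) auto
  also have "\<dots> = (if Suc m = n k then h n k else 0)"
    using m type_II_orth[of "Suc m" n k] unfolding h_def by (cases "Suc m = n k") (simp_all only: if_True if_False, simp)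
  finally show ?thesis .
qed

lemma int_pm: "integrable (\<mu> k) (\<lambda>x. poly q x * x ^ m)"
  by (intro cm_integrable cm_mult) auto

lemma mom_add: "(\<integral>x. poly (p + q) x * x ^ m \<partial>\<mu> k) = (\<integral>x. poly p x * x ^ m \<partial>\<mu> k) + (\<integral>x. poly q x * x ^ m \<partial>\<mu> k)"
  unfolding poly_add distrib_right by (rule Bochner_Integration.integral_add[OF int_pm int_pm])

lemma mom_diff: "(\<integral>x. poly (p - q) x * x ^ m \<partial>\<mu> k) = (\<integral>x. poly p x * x ^ m \<partial>\<mu> k) - (\<integral>x. poly q x * x ^ m \<partial>\<mu> k)"
  unfolding poly_diff left_diff_distrib by (rule Bochner_Integration.integral_diff[OF int_pm int_pm])

lemma mom_smult: "(\<integral>x. poly (smult c p) x * x ^ m \<partial>\<mu> k) = c * (\<integral>x. poly p x * x ^ m \<partial>\<mu> k)"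
  unfolding poly_smult mult.assoc by (rule integral_mult_right_zero)

text \<open>In the difference of both sides the leading terms cancel, \<open>bb\<close> removes the
  coefficient of order \<open>msize n\<close>, and \<open>aa\<close> removes the single surviving
  moment of order \<open>n k - 1\<close> for each k. Normality then makes the difference
  vanish.\<close>

lemma type_II_recurrence:
  "[:0, 1:] * type_II \<mu> n = type_II \<mu> (inc n i) + smult (bb n i) (type_II \<mu> n) + rsum aa n"
proof -
  define D where "D = [:0, 1:] * type_II \<mu> n - type_II \<mu> (inc n i) - smult (bb n i) (type_II \<mu> n) - rsum aa n"
  have "D = 0"
  proof (rule type_II_normal[where n=n and W="[:1:]"])
    show "\<forall>j\<ge>n I1 + n I2. coeff D j = 0"
    proof (intro allI impI)
      fix j assume "j \<ge> n I1 + n I2"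
      then have j: "j \<ge> msize n" by (simp add: msize_def)
      consider "j = msize n" | "j = Suc (msize n)" | "j > Suc (msize n)" using j by linarith
      then show "coeff D j = 0"
      proof cases
        case 1
        then show ?thesis by (simp add: D_def rsum_coeff type_II_monic bb_def)
      next
        case 2
        then show ?thesis using type_II_monic[of "inc n i"] by (simp add: D_def rsum_coeff type_II_monic type_II_coeff)
      next
        case 3
        then obtain j' where "j = Suc j'" "j' > msize n" by (cases j) auto
        then show ?thesis by (simp add: D_def rsum_coeff type_II_coeff)
      qed
    qed
    fix k m assume m: "m < n k"
    have "(\<integral>x. poly D x * x ^ m * poly [:1:] x \<partial>\<mu> k) = (\<integral>x. poly D x * x ^ m \<partial>\<mu> k)" by simp
    also have "\<dots> = 0"
      unfolding D_def mom_diff mom_smult x_type_II_integral[of m n k, OF m] rsum_integral[of m n k, OF m] type_II_orth[of m n k, OF m]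
      using m h_nonzero[of "dec n k" k] type_II_orth[of m "inc n i" k] by (cases "k = i") (auto simp: inc_apply aa_def)
    finally show "(\<integral>x. poly D x * x ^ m * poly [:1:] x \<partial>\<mu> k) = 0" .
  qed auto
  then show ?thesis by (simp add: D_def algebra_simps del: mult_pCons_left)
qed

text \<open>\<open>b\<close> is read off the coefficient of order \<open>msize n\<close> and
  \<open>a\<close> off the moment of order \<open>n k - 1\<close>; where \<open>n k = 0\<close> the
  convention decides. This gives the definite descriptions in \<open>rec_a\<close> and
  \<open>rec_b\<close> their values.\<close>

lemma rec_unique: assumes "is_rec_coeffs \<mu> (a, b)" shows "a = aa \<and> b = bb"
proof -
  have rec: "[:0, 1:] * type_II \<mu> n = type_II \<mu> (inc n i) + smult (b n i) (type_II \<mu> n) + rsum a n" for n i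
    using assms unfolding is_rec_coeffs_def rsum_def by simp
  have a0: "a n k = 0" if "n k = 0" for n k using assms that unfolding is_rec_coeffs_def by simp
  have "b n i = bb n i" for n i
    unfolding bb_def rec[of n i] by (simp add: rsum_coeff type_II_monic)
  moreover have "a n k = aa n k" for n k
  proof (cases "n k = 0")
    case False
    define m where "m = n k - 1"
    have m: "m < n k" "Suc m = n k" using False by (auto simp: m_def)
    have "h n k = (\<integral>x. poly ([:0, 1:] * type_II \<mu> n) x * x ^ m \<partial>\<mu> k)" using m x_type_II_integral[of m n k, OF m(1)] by simp
    also have "\<dots> = a n k * h (dec n k) k"
      unfolding rec[of n k] mom_add mom_smult rsum_integral[of m n k, OF m(1)] type_II_orth[of m n k, OF m(1)]
      using m type_II_orth[of m "inc n k" k] by (simp add: inc_apply)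
    finally show ?thesis using False h_nonzero by (simp add: aa_def)
  qed (simp add: a0 aa_def)
  ultimately show ?thesis by (simp add: fun_eq_iff)
qed

lemma is_rec: "is_rec_coeffs \<mu> (aa, bb)"
  unfolding is_rec_coeffs_def using type_II_recurrence by (auto simp: aa_def rsum_def simp del: mult_pCons_left)

lemma rec_ab: "rec_a \<mu> = aa" "rec_b \<mu> = bb"
proof -
  have "(THE ab. is_rec_coeffs \<mu> ab) = (aa, bb)"
    by (rule the_equality[where P="is_rec_coeffs \<mu>", OF is_rec]) (metis rec_unique surj_pair)
  then show "rec_a \<mu> = aa" "rec_b \<mu> = bb" by (auto simp: rec_a_def rec_b_def)
qed

end

subsection \<open>Bounds for the coefficients and nonvanishing of linear forms\<close>

lemma synthetic_div_eq: "(x - t) * poly (synthetic_div p t) x = poly p x - poly p (t::real)"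
proof -
  have "poly ([:-t, 1:] * synthetic_div p t + [:poly p t:]) x = poly p x"
    by (simp only: synthetic_div_correct')
  then show ?thesis by (simp add: algebra_simps)
qed

lemma synthetic_div_sym: "poly (synthetic_div p t) x = poly (synthetic_div p x) (t::real)"
proof (induct p)
  case (pCons a p)
  have "poly (synthetic_div (pCons a p) t) x = poly p t + x * poly (synthetic_div p t) x" by simp
  also have "\<dots> = poly p x + t * poly (synthetic_div p t) x"
    using synthetic_div_eq[of x t p] by (simp add: algebra_simps)
  also have "\<dots> = poly (synthetic_div (pCons a p) x) t" by (simp add: pCons)
  finally show ?case .
qed simp

text \<open>\<open>f\<close> equals its Lagrange interpolant at the d + 1 nodes; the basis
  polynomials divided by \<open>P'\<close> at their node have leading coefficient
  \<open>1 / P'\<close>.\<close>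

lemma lagrange_top_coeff:
  fixes f :: "real poly"
  assumes Z: "finite Z" "card Z = Suc d" and P: "P = (\<Prod>\<zeta>\<in>Z. [:-\<zeta>, 1:])" and f: "\<forall>j>d. coeff f j = 0"
  shows "coeff f d = (\<Sum>\<zeta>\<in>Z. poly f \<zeta> / poly (pderiv P) \<zeta>)"
proof -
  define L where "L \<zeta> = (\<Prod>\<eta>\<in>Z - {\<zeta>}. [:-\<eta>, 1::real:])" for \<zeta>
  have dL: "degree (L \<zeta>) = d" if "\<zeta> \<in> Z" for \<zeta>
    unfolding L_def by (subst degree_prod_eq_sum_degree) (use that Z in auto)
  have "lead_coeff (L \<zeta>) = 1" for \<zeta> unfolding L_def lead_coeff_prod by simp
  then have cL: "coeff (L \<zeta>) d = 1" if "\<zeta> \<in> Z" for \<zeta> using dL[OF that] by metis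
  have pL: "poly (L \<zeta>) \<eta> = (if \<eta> = \<zeta> then poly (pderiv P) \<zeta> else 0)" if "\<zeta> \<in> Z" "\<eta> \<in> Z" for \<zeta> \<eta>
  proof (cases "\<eta> = \<zeta>")
    case True
    have "P = [:-\<zeta>, 1:] * L \<zeta>" unfolding P L_def using that Z by (subst prod.remove[of Z \<zeta>]) auto
    then have "poly (pderiv P) \<zeta> = poly (L \<zeta>) \<zeta>"
      by (simp add: pderiv_mult pderiv_pCons del: mult_pCons_left)
    then show ?thesis using True by simp
  next
    case False
    have "poly (L \<zeta>) \<eta> = (\<Prod>\<eta>'\<in>Z - {\<zeta>}. \<eta> - \<eta>')" by (simp add: L_def poly_prod)
    also have "\<dots> = 0" using Z that False by (intro prod_zero) auto
    finally show ?thesis using False by simp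
  qed
  have nz: "poly (pderiv P) \<zeta> \<noteq> 0" if "\<zeta> \<in> Z" for \<zeta>
  proof -
    have "poly (L \<zeta>) \<zeta> = (\<Prod>\<eta>'\<in>Z - {\<zeta>}. \<zeta> - \<eta>')" by (simp add: L_def poly_prod)
    also have "\<dots> \<noteq> 0" using Z by (auto simp: prod_zero_iff)
    finally show ?thesis using pL[OF that that] by simp
  qed
  define g where "g = (\<Sum>\<zeta>\<in>Z. smult (poly f \<zeta> / poly (pderiv P) \<zeta>) (L \<zeta>))"
  have cg: "coeff g j = (\<Sum>\<zeta>\<in>Z. poly f \<zeta> / poly (pderiv P) \<zeta> * coeff (L \<zeta>) j)" for j
    by (simp add: g_def coeff_sum)
  have "f = g"
  proof (rule poly_eqI_degree[of Z])
    fix x assume x: "x \<in> Z"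
    have "poly g x = (\<Sum>\<zeta>\<in>Z. if \<zeta> = x then poly f x else 0)"
      unfolding g_def poly_sum by (intro sum.cong refl) (use x nz pL in auto)
    then show "poly f x = poly g x" using x Z by simp
  next
    have "degree f \<le> d" using f by (simp add: degree_le)
    then show "card Z > degree f" using Z by simp
    have "degree g \<le> d" unfolding g_def
      by (rule degree_sum_le) (use Z dL in \<open>auto intro: order_trans[OF degree_smult_le]\<close>)
    then show "card Z > degree g" using Z by simp
  qed
  then have "coeff f d = coeff g d" by simp
  also have "\<dots> = (\<Sum>\<zeta>\<in>Z. poly f \<zeta> / poly (pderiv P) \<zeta>)"
    unfolding cg by (rule sum.cong) (auto simp: cL)
  finally show ?thesis .
qed

lemma distinct_simple_roots:
  assumes "\<And>x. poly (\<Prod>c\<leftarrow>cs. [:-c, 1::real:]) x = 0 \<Longrightarrow> poly (pderiv (\<Prod>c\<leftarrow>cs. [:-c, 1:])) x \<noteq> 0"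
  shows "distinct cs"
  using assms
proof (induct cs)
  case (Cons c cs)
  define R where "R = (\<Prod>c\<leftarrow>cs. [:-c, 1::real:])"
  have eq: "(\<Prod>c\<leftarrow>c # cs. [:-c, 1::real:]) = [:-c, 1:] * R" by (simp add: R_def del: mult_pCons_left)
  have simple: "poly ([:-c, 1:] * R) x = 0 \<Longrightarrow> poly (pderiv ([:-c, 1:] * R)) x \<noteq> 0" for x
    using Cons(2)[of x] unfolding eq .
  have pd: "poly (pderiv ([:-c, 1:] * R)) x = (x - c) * poly (pderiv R) x + poly R x" for x
    by (simp add: pderiv_mult pderiv_pCons del: mult_pCons_left)
  have "c \<notin> set cs"
  proof
    assume "c \<in> set cs"
    then have "poly R c = 0" by (simp add: R_def linear_prod_eq_0_iff)
    then show False using simple[of c] pd[of c] by simp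
  qed
  moreover have "distinct cs"
  proof (rule Cons(1))
    fix x assume x: "poly (\<Prod>c\<leftarrow>cs. [:-c, 1::real:]) x = 0"
    show "poly (pderiv (\<Prod>c\<leftarrow>cs. [:-c, 1:])) x \<noteq> 0"
      using simple[of x] pd[of x] x by (auto simp: R_def[symmetric])
  qed
  ultimately show ?case by simp
qed simp

lemma ex_kernel_vector:
  fixes a b c d :: real
  assumes "a * d = b * c"
  shows "\<exists>u v. (u \<noteq> 0 \<or> v \<noteq> 0) \<and> u * a + v * b = 0 \<and> u * c + v * d = 0"
proof (cases "a = 0 \<and> b = 0")
  case True
  show ?thesis
  proof (cases "c = 0 \<and> d = 0")
    case True
    then show ?thesis using \<open>a = 0 \<and> b = 0\<close> by (intro exI[of _ 1] exI[of _ 0]) auto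
  next
    case False
    then show ?thesis using True by (intro exI[of _ d] exI[of _ "-c"]) auto
  qed
next
  case False
  then show ?thesis using assms by (intro exI[of _ b] exI[of _ "-a"]) (auto simp: algebra_simps)
qed

section \<open>Simple zeros and uniform bounds for the recurrence coefficients\<close>

context angelesco_system
begin

text \<open>If the Wronskian vanished at \<open>x\<close>, a combination of \<open>P\<^sub>n\<close> and \<open>P\<^sub>n\<^sub>+\<^sub>e\<close> would have a double zero
  there; removing it leaves a polynomial of degree less than \<open>|n|\<close> that is orthogonal for the
  weighted measures.\<close>

lemma wronskian_nonzero:
  "poly (type_II \<mu> n) x * poly (pderiv (type_II \<mu> (inc n i))) x
     \<noteq> poly (type_II \<mu> (inc n i)) x * poly (pderiv (type_II \<mu> n)) x"
proof
  define P where "P = type_II \<mu> n"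
  define N where "N = type_II \<mu> (inc n i)"
  assume "poly (type_II \<mu> n) x * poly (pderiv (type_II \<mu> (inc n i))) x
     = poly (type_II \<mu> (inc n i)) x * poly (pderiv (type_II \<mu> n)) x"
  then have "poly P x * poly (pderiv N) x = poly N x * poly (pderiv P) x" by (simp add: P_def N_def)
  from ex_kernel_vector[OF this] obtain u v where uv: "u \<noteq> 0 \<or> v \<noteq> 0"
    "u * poly P x + v * poly N x = 0" "u * poly (pderiv P) x + v * poly (pderiv N) x = 0" by blast
  define G where "G = smult u P + smult v N"
  have G0: "poly G x = 0" "poly (pderiv G) x = 0" using uv by (simp_all add: G_def pderiv_add pderiv_smult)
  have cG: "coeff G (Suc (msize n)) = v" "coeff G (msize n) = u + v * coeff N (msize n)"
    using type_II_monic[of "inc n i"] type_II_monic[of n] by (simp_all add: G_def P_def N_def type_II_coeff)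
  then have Gnz: "G \<noteq> 0" using uv(1) by auto
  obtain H where H: "G = [:-x, 1:] * H" using G0(1) by (meson poly_eq_0_iff_dvd dvdE)
  have "poly H x = 0" using G0(2) unfolding H by (simp add: pderiv_mult pderiv_pCons del: mult_pCons_left)
  then obtain T where T: "H = [:-x, 1:] * T" by (meson poly_eq_0_iff_dvd dvdE)
  define W where "W = [:-x, 1:] * [:-x, 1::real:]"
  have GW: "G = T * W" unfolding H T W_def by (simp only: mult_ac)
  have W: "W \<noteq> 0" "\<And>t. poly W t = (t - x)\<^sup>2"
    unfolding W_def by (auto simp: power2_eq_square algebra_simps)
  have T0: "T \<noteq> 0" using Gnz GW by auto
  have "degree W = 2" unfolding W_def by (subst degree_mult_eq) auto
  then have "degree G = degree T + 2" unfolding GW using T0 W by (simp add: degree_mult_eq)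
  moreover have "degree G \<le> Suc (msize n)"
    by (rule degree_le) (auto simp: G_def P_def N_def type_II_coeff)
  ultimately have dT: "degree T < msize n" by simp
  have "T = 0"
  proof (rule type_II_normal[where n=n and W=W])
    show "\<forall>j\<ge>n I1 + n I2. coeff T j = 0" using dT by (auto simp: msize_def coeff_eq_0)
    fix k m assume m: "m < n k"
    have "(\<integral>t. poly T t * t ^ m * poly W t \<partial>\<mu> k) = (\<integral>t. poly G t * t ^ m \<partial>\<mu> k)"
      by (rule Bochner_Integration.integral_cong) (auto simp: GW mult_ac)
    also have "\<dots> = 0" unfolding G_def mom_add mom_smult P_def N_def
      using m type_II_orth[of m n k] type_II_orth[of m "inc n i" k] by (cases "k = i") (auto simp: inc_apply)
    finally show "(\<integral>t. poly T t * t ^ m * poly W t \<partial>\<mu> k) = 0" .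
  qed (use W in auto)
  then show False using T0 by simp
qed

text \<open>\<open>P\<^sub>n / P\<^sub>n\<^sub>+\<^sub>e\<close> has positive residues of sum \<open>1\<close> at the zeros of \<open>P\<^sub>n\<^sub>+\<^sub>e\<close>; the recurrence expresses
  the first two moments of this probability vector by the coefficients.\<close>

lemma coefficient_bounds_aux:
  assumes R: "\<And>k x. x \<in> Delta \<mu> k \<Longrightarrow> \<bar>x\<bar> \<le> R"
  shows "\<bar>bb n i\<bar> \<le> R" "(bb n i)\<^sup>2 + (aa n I1 + aa n I2) \<le> R\<^sup>2"
proof -
  define P where "P = type_II \<mu> n"
  define N where "N = type_II \<mu> (inc n i)"
  define d where "d = msize n"
  obtain q where q: "N = q I1 * q I2"
    "\<And>k. \<exists>cs. q k = (\<Prod>c\<leftarrow>cs. [:-c, 1:]) \<and> set cs \<subseteq> Delta \<mu> k \<and> length cs = inc n i k"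
    using type_II_factor[of "inc n i"] unfolding N_def by metis
  obtain c1 c2 where c12: "q I1 = (\<Prod>c\<leftarrow>c1. [:-c, 1:])" "set c1 \<subseteq> Delta \<mu> I1" "length c1 = inc n i I1"
     "q I2 = (\<Prod>c\<leftarrow>c2. [:-c, 1:])" "set c2 \<subseteq> Delta \<mu> I2" "length c2 = inc n i I2" using q(2) by metis
  define cs where "cs = c1 @ c2"
  have Ncs: "N = (\<Prod>c\<leftarrow>cs. [:-c, 1:])" unfolding q(1) c12(1,4) cs_def by simp
  have len: "length cs = Suc d" using c12 msize_inc[of n i] by (simp add: cs_def msize_def d_def)
  have wr: "poly P x * poly (pderiv N) x \<noteq> poly N x * poly (pderiv P) x" for x
    unfolding P_def N_def by (rule wronskian_nonzero)
  have "poly (pderiv N) x \<noteq> 0" if "poly N x = 0" for x using wr[of x] that by auto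
  then have "distinct cs" by (intro distinct_simple_roots) (simp add: Ncs[symmetric])
  define Z where "Z = set cs"
  have Z: "finite Z" "card Z = Suc d" using len \<open>distinct cs\<close> by (auto simp: Z_def distinct_card)
  have NZ: "N = (\<Prod>\<zeta>\<in>Z. [:-\<zeta>, 1:])" unfolding Ncs Z_def by (rule prod.distinct_set_conv_list[OF \<open>distinct cs\<close>, symmetric])
  have N0: "poly N \<zeta> = 0" if "\<zeta> \<in> Z" for \<zeta> using that by (simp add: Ncs Z_def linear_prod_eq_0_iff)
  have ZR: "\<bar>\<zeta>\<bar> \<le> R" if "\<zeta> \<in> Z" for \<zeta> using that c12 R by (auto simp: Z_def cs_def)
  define c where "c \<zeta> = poly P \<zeta> / poly (pderiv N) \<zeta>" for \<zeta>
  have lag: "coeff f d = (\<Sum>\<zeta>\<in>Z. poly f \<zeta> / poly (pderiv N) \<zeta>)" if "\<forall>j>d. coeff f j = 0" for f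
    by (rule lagrange_top_coeff[OF Z NZ that])
  have sum1: "(\<Sum>\<zeta>\<in>Z. c \<zeta>) = 1"
    unfolding c_def by (subst lag[symmetric]) (auto simp: P_def d_def type_II_coeff type_II_monic)
  have cpos: "c \<zeta> \<ge> 0" if "\<zeta> \<in> Z" for \<zeta>
  proof -
    \<comment> \<open>The Wronskian has no zero, hence one sign on the interval. At a zero of
      \<open>N\<close> it equals \<open>P N'\<close>, so all \<open>c\<close> share this sign, and
      their sum 1 makes it positive.\<close>
    define wf where "wf x = poly P x * poly (pderiv N) x - poly N x * poly (pderiv P) x" for x
    have "continuous_on {-R..R} wf" unfolding wf_def[abs_def] by (intro continuous_intros)
    moreover have "wf x \<noteq> 0" for x using wr[of x] by (simp add: wf_def)
    ultimately obtain s where s': "s = 1 \<or> s = (-1::real)" "\<And>x. x \<in> {-R..R} \<Longrightarrow> s * wf x > 0"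
      using interval_const_sign[of "-R" R wf] by blast
    note s = s'[unfolded wf_def]
    have sc: "s * c \<zeta> > 0" if z: "\<zeta> \<in> Z" for \<zeta>
    proof -
      have "s * (poly P \<zeta> * poly (pderiv N) \<zeta>) > 0" using s(2)[of \<zeta>] ZR[OF z] N0[OF z] by (simp add: abs_le_iff)
      moreover have "(poly (pderiv N) \<zeta>)\<^sup>2 > 0" using calculation by auto
      ultimately have "s * (poly P \<zeta> * poly (pderiv N) \<zeta>) / (poly (pderiv N) \<zeta>)\<^sup>2 > 0" by (rule divide_pos_pos)
      then show ?thesis by (simp add: c_def power2_eq_square split: if_splits)
    qed
    have "Z \<noteq> {}" using Z by auto
    then have "(\<Sum>\<zeta>\<in>Z. s * c \<zeta>) > 0" using Z sc by (intro sum_pos) auto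
    then have "s > 0" using sum1 by (simp add: sum_distrib_left[symmetric])
    then show ?thesis using sc[OF that] by (simp add: zero_less_mult_iff)
  qed
  \<comment> \<open>\<open>F\<close>, and \<open>F2\<close> below, are the remainders of
    \<open>x P\<close> and \<open>x^2 P\<close> modulo \<open>N\<close>. Their degree is at most
    \<open>d\<close>, so their coefficients of order \<open>d\<close> are the first and second
    moments of the weights \<open>c\<close>.\<close>
  define F where "F = [:0, 1:] * P - N"
  have Frec: "F = smult (bb n i) P + rsum aa n"
    using type_II_recurrence[of n i] by (simp add: F_def P_def N_def)
  have Fc: "coeff F j = 0" if "j > d" for j
    using that unfolding Frec by (simp add: P_def d_def type_II_coeff rsum_coeff)
  have Fz: "poly F \<zeta> = \<zeta> * poly P \<zeta>" if "\<zeta> \<in> Z" for \<zeta> using N0[OF that] by (simp add: F_def)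
  have "coeff F d = bb n i" by (simp add: F_def bb_def P_def N_def d_def)
  moreover have "coeff F d = (\<Sum>\<zeta>\<in>Z. poly F \<zeta> / poly (pderiv N) \<zeta>)" by (rule lag) (use Fc in auto)
  ultimately have b: "bb n i = (\<Sum>\<zeta>\<in>Z. c \<zeta> * \<zeta>)" by (simp add: Fz c_def mult.commute)
  have "\<bar>bb n i\<bar> \<le> (\<Sum>\<zeta>\<in>Z. c \<zeta> * \<bar>\<zeta>\<bar>)"
    unfolding b by (rule order_trans[OF sum_abs]) (use cpos in \<open>simp add: abs_mult\<close>)
  also have "\<dots> \<le> (\<Sum>\<zeta>\<in>Z. c \<zeta> * R)" using ZR cpos by (intro sum_mono mult_left_mono)
  also have "\<dots> = R" by (simp add: sum_distrib_right[symmetric] sum1)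
  finally show "\<bar>bb n i\<bar> \<le> R" .
  define F2 where "F2 = [:0, 1:] * F - smult (bb n i) N"
  have F2e: "F2 = smult (bb n i) F + [:0, 1:] * rsum aa n"
    unfolding F2_def Frec using Frec unfolding F_def by (simp add: algebra_simps smult_add_right smult_diff_right)
  have F2z: "poly F2 \<zeta> = \<zeta>\<^sup>2 * poly P \<zeta>" if "\<zeta> \<in> Z" for \<zeta>
    using N0[OF that] Fz[OF that] by (simp add: F2_def power2_eq_square)
  have F2c: "coeff F2 j = 0" if jd: "j > d" for j
  proof -
    obtain j' where "j = Suc j'" "j' \<ge> d" using jd by (cases j) auto
    then show ?thesis using Fc[OF jd] unfolding F2e by (simp add: rsum_coeff d_def)
  qed
  have rs: "coeff ([:0, 1:] * rsum aa n) d = aa n I1 + aa n I2"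
  proof (cases d)
    case 0
    then have "n I1 = 0" "n I2 = 0" by (auto simp: d_def msize_def)
    then show ?thesis using 0 by (simp add: aa_def)
  next
    case (Suc d')
    have "coeff (if n k = 0 then 0 else smult (aa n k) (type_II \<mu> (dec n k))) d' = aa n k" for k
    proof (cases "n k = 0")
      case False
      then have "msize (dec n k) = d'" using msize_dec[of n k] Suc by (simp add: d_def)
      then show ?thesis using False type_II_monic[of "dec n k"] by simp
    qed (simp add: aa_def)
    then show ?thesis using Suc by (simp add: rsum_def)
  qed
  have "coeff F2 d = (bb n i)\<^sup>2 + (aa n I1 + aa n I2)"
    unfolding F2e coeff_add rs using \<open>coeff F d = bb n i\<close> by (simp add: power2_eq_square)
  moreover have "coeff F2 d = (\<Sum>\<zeta>\<in>Z. poly F2 \<zeta> / poly (pderiv N) \<zeta>)" by (rule lag) (use F2c in auto)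
  ultimately have "(bb n i)\<^sup>2 + (aa n I1 + aa n I2) = (\<Sum>\<zeta>\<in>Z. c \<zeta> * \<zeta>\<^sup>2)" by (simp add: F2z c_def mult.commute)
  also have "\<dots> \<le> (\<Sum>\<zeta>\<in>Z. c \<zeta> * R\<^sup>2)"
  proof (intro sum_mono mult_left_mono)
    fix \<zeta> assume z: "\<zeta> \<in> Z"
    show "\<zeta>\<^sup>2 \<le> R\<^sup>2" using power_mono[OF ZR[OF z] abs_ge_zero, of 2] by simp
    show "c \<zeta> \<ge> 0" by (rule cpos[OF z])
  qed
  also have "\<dots> = R\<^sup>2" by (simp add: sum_distrib_right[symmetric] sum1)
  finally show "(bb n i)\<^sup>2 + (aa n I1 + aa n I2) \<le> R\<^sup>2" .
qed

lemma Delta_bounded: obtains R where "0 < R" "\<And>k x. x \<in> Delta \<mu> k \<Longrightarrow> \<bar>x\<bar> \<le> R"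
proof (rule that[of "\<bar>lo I1\<bar> + \<bar>hi I1\<bar> + \<bar>lo I2\<bar> + \<bar>hi I2\<bar> + 1"])
  fix k x assume "x \<in> Delta \<mu> k"
  then show "\<bar>x\<bar> \<le> \<bar>lo I1\<bar> + \<bar>hi I1\<bar> + \<bar>lo I2\<bar> + \<bar>hi I2\<bar> + 1" by (cases k) (auto simp: Delta_props)
qed simp

lemma aa_nonneg: "aa n k \<ge> 0"
  using aa_pos[of n k] by (cases "n k = 0") (auto simp: aa_def)

lemma coefficient_bounds: obtains B where "0 < B" "\<And>n i. \<bar>bb n i\<bar> \<le> B" "\<And>n i. aa n i \<le> B"
proof -
  obtain R where R: "0 < R" "\<And>k x. x \<in> Delta \<mu> k \<Longrightarrow> \<bar>x\<bar> \<le> R" using Delta_bounded by blast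
  show ?thesis
  proof (rule that[of "R + R\<^sup>2"])
    show "0 < R + R\<^sup>2" using R(1) by (simp add: add_pos_pos)
    fix n i
    have 1: "\<bar>bb n i\<bar> \<le> R" "(bb n i)\<^sup>2 + (aa n I1 + aa n I2) \<le> R\<^sup>2"
      using coefficient_bounds_aux[OF R(2)] by auto
    show "\<bar>bb n i\<bar> \<le> R + R\<^sup>2" using 1(1) zero_le_power2[of R] by linarith
    have "aa n i \<le> aa n I1 + aa n I2" using aa_nonneg[of n I1] aa_nonneg[of n I2] by (cases i) auto
    then show "aa n i \<le> R + R\<^sup>2" using 1(2) zero_le_power2[of "bb n i"] R(1) by linarith
  qed
qed

section \<open>The recurrence of the type I polynomials\<close>

lemma QI_type_II: assumes "\<And>j. \<forall>l>n j. coeff (B j) l = 0"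
  shows "QI B (type_II \<mu> n) = (\<Sum>j\<in>{I1, I2}. coeff (B j) (n j) * h n j)"
  unfolding QI_def by (intro sum.cong refl type_II_integral assms)

text \<open>Pair the form of index \<open>inc n k\<close> with the monic type II polynomial of index
  \<open>n\<close>: normalisation gives 1, while orthogonality leaves only the product of the
  leading coefficient with \<open>h n k\<close>.\<close>

lemma type_I_lead: "coeff (type_I \<mu> (inc n k) k) (n k) * h n k = 1"
proof -
  have "QI (type_I \<mu> (inc n k)) (type_II \<mu> n) = 1"
    by (subst QI_type_I) (auto simp: type_II_coeff type_II_monic)
  moreover have "QI (type_I \<mu> (inc n k)) (type_II \<mu> n) = (\<Sum>j\<in>{I1, I2}. coeff (type_I \<mu> (inc n k) j) (n j) * h n j)"
    by (rule QI_type_II) (auto intro!: type_I_coeff simp: inc_apply)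
  moreover have "coeff (type_I \<mu> (inc n k) (other k)) (n (other k)) = 0"
    by (rule type_I_coeff) (simp add: inc_apply)
  ultimately show ?thesis unfolding ix_sum_other[of _ k] by simp
qed

text \<open>The form of index \<open>n\<close> annihilates the type II polynomial of the same index,
  so its first moment beyond the normalised one is expressed by the subleading coefficient.\<close>

lemma QI_type_I_next: assumes "msize n > 0"
  shows "QI (type_I \<mu> n) (monom 1 (msize n)) = - coeff (type_II \<mu> n) (msize n - 1)"
proof -
  define p where "p = type_II \<mu> n - monom 1 (msize n)"
  have "QI (type_I \<mu> n) (type_II \<mu> n) = 0"
    by (subst QI_type_II) (auto simp: type_I_coeff)
  moreover have "QI (type_I \<mu> n) p = coeff p (msize n - 1)"
  proof (rule QI_type_I[OF _ assms], intro allI impI)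
    fix j assume "j \<ge> msize n"
    then show "coeff p j = 0" by (cases "j = msize n") (auto simp: p_def type_II_monic type_II_coeff)
  qed
  moreover have "coeff p (msize n - 1) = coeff (type_II \<mu> n) (msize n - 1)" using assms by (simp add: p_def)
  ultimately show ?thesis unfolding p_def QI_diff by simp
qed

text \<open>Type I normality applied to the difference of both sides. The degrees fit because
  \<open>aa n k\<close> is the ratio of the leading coefficients \<open>1 / h\<close>; the moments
  below the top one match by the defining conditions, and the top one fixes
  \<open>bb\<close>.\<close>

lemma type_I_recurrence:
  assumes m: "msize m > 0" and n: "n = inc m i"
  shows "[:0, 1:] * type_I \<mu> n k = type_I \<mu> m k + smult (bb m i) (type_I \<mu> n k)
     + (\<Sum>j\<in>{I1, I2}. smult (aa n j) (type_I \<mu> (inc n j) k))"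
proof -
  define T where "T k = [:0, 1:] * type_I \<mu> n k - type_I \<mu> m k - smult (bb m i) (type_I \<mu> n k)
     - (smult (aa n I1) (type_I \<mu> (inc n I1) k) + smult (aa n I2) (type_I \<mu> (inc n I2) k))" for k
  have mn: "m k \<le> n k" for k by (simp add: n inc_apply)
  have sz: "msize n = Suc (msize m)" by (simp add: n)
  have "T k = 0" for k
  proof (rule type_I_normal[where n=n and w="\<lambda>k x. 1"])
    fix k show "\<forall>j\<ge>n k. coeff (T k) j = 0"
    proof (intro allI impI)
      fix j assume j: "j \<ge> n k"
      have e: "aa n I1 * coeff (type_I \<mu> (inc n I1) k) j + aa n I2 * coeff (type_I \<mu> (inc n I2) k) j = aa n k * coeff (type_I \<mu> (inc n k) k) j"
      proof -
        have "coeff (type_I \<mu> (inc n (other k)) k) j = 0" by (rule type_I_coeff) (use j in \<open>simp add: inc_apply\<close>)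
        then show ?thesis by (cases k) auto
      qed
      have 0: "coeff (type_I \<mu> m k) j = 0" "coeff (type_I \<mu> n k) j = 0"
        using j mn[of k] by (auto intro!: type_I_coeff)
      have "coeff ([:0, 1:] * type_I \<mu> n k) j = aa n k * coeff (type_I \<mu> (inc n k) k) j"
      proof (cases "j = n k")
        case True
        show ?thesis
        proof (cases "n k = 0")
          case True
          then show ?thesis using \<open>j = n k\<close> by (simp add: aa_def)
        next
          case False
          define n' where "n' = dec n k"
          have n': "n = inc n' k" using False by (simp add: n'_def inc_dec)
          have "coeff (type_I \<mu> n k) (n' k) * h n' k = 1" unfolding n' by (rule type_I_lead)
          moreover have "n k = Suc (n' k)" unfolding n' by (simp add: inc_apply)
          moreover have "coeff (type_I \<mu> (inc n k) k) (n k) * h n k = 1" by (rule type_I_lead)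
          ultimately show ?thesis using True False h_nonzero[of n' k] h_nonzero[of n k]
            by (simp add: aa_def n'_def[symmetric] field_simps)
        qed
      next
        case False
        then obtain j' where j': "j = Suc j'" "j' \<ge> n k" using j by (cases j) auto
        have "coeff (type_I \<mu> n k) j' = 0" "coeff (type_I \<mu> (inc n k) k) j = 0"
          using j' by (auto intro!: type_I_coeff simp: inc_apply)
        then show ?thesis using j' by simp
      qed
      then show "coeff (T k) j = 0" unfolding T_def coeff_diff coeff_add coeff_smult e 0 by simp
    qed
  next
    fix p assume "p < n I1 + n I2"
    then have p: "p < msize n" by (simp add: msize_def)
    have "QI T (monom 1 p) = QI (type_I \<mu> n) (monom 1 (Suc p)) - QI (type_I \<mu> m) (monom 1 p) - bb m i * QI (type_I \<mu> n) (monom 1 p)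
       - (aa n I1 * QI (type_I \<mu> (inc n I1)) (monom 1 p) + aa n I2 * QI (type_I \<mu> (inc n I2)) (monom 1 p))"
      unfolding T_def QI_diff_left QI_add_left QI_smult_left QI_mult_left by (simp add: monom_Suc)
    also have "\<dots> = 0"
    proof -
      have inc0: "QI (type_I \<mu> (inc n j)) (monom 1 p) = 0" for j using p by (subst QI_type_I_monom) auto
      \<comment> \<open>Only the top moment \<open>p = msize m\<close> sees subleading coefficients;
        \<open>bb m i\<close> is exactly their difference.\<close>
      consider "p + 2 < msize n" | "p + 2 = msize n" | "p + 1 = msize n" using p by linarith
      then show ?thesis
      proof cases
        case 3
        then have pm: "p = msize m" using sz by simp
        have b: "bb m i = coeff (type_II \<mu> m) (msize m - 1) - coeff (type_II \<mu> n) (msize m)"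
          using m by (simp add: bb_def n coeff_pCons split: nat.split)
        have "QI (type_I \<mu> n) (monom 1 (Suc p)) = - coeff (type_II \<mu> n) (msize m)"
          using QI_type_I_next[of n] pm sz by simp
        moreover have "QI (type_I \<mu> m) (monom 1 p) = - coeff (type_II \<mu> m) (msize m - 1)"
          using QI_type_I_next[OF m] pm by simp
        moreover have "QI (type_I \<mu> n) (monom 1 p) = 1" using 3 by (subst QI_type_I_monom) auto
        ultimately show ?thesis by (simp add: inc0 b)
      qed (use sz in \<open>simp_all add: inc0 QI_type_I_monom\<close>)
    qed
    finally show "(\<Sum>k\<in>{I1, I2}. \<integral>x. x ^ p * (poly (T k) x * 1) \<partial>\<mu> k) = 0"
      by (simp add: QI_def poly_monom)
  qed auto
  then show ?thesis by (simp add: T_def algebra_simps)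
qed

text \<open>Dividing a linear form that vanishes at \<open>t\<close> by \<open>t - x\<close> raises the order of orthogonality, while
  the weights \<open>1 / (t - x)\<close> keep their sign on each interval.\<close>

lemma linear_form_nonzero:
  assumes deg: "\<And>k. \<forall>j\<ge>n k. coeff (B k) j = 0"
    and orth: "\<And>m. Suc m < msize n \<Longrightarrow> QI B (monom 1 m) = 0"
    and t: "\<And>k. t \<notin> Delta \<mu> k"
    and zero: "(\<Sum>k\<in>{I1, I2}. \<integral>x. poly (B k) x / (t - x) \<partial>\<mu> k) = 0"
  shows "B k = 0"
proof (rule type_I_normal[where n=n and w="\<lambda>k x. 1 / (t - x)"])
  show c: "cm k (\<lambda>x. 1 / (t - x))" for k using t by (rule cm_inverse_shift)
  show nz: "1 / (t - x) \<noteq> 0" if "x \<in> Delta \<mu> k" for k x using that t[of k] by auto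
  fix m assume "m < n I1 + n I2"
  then have "m < msize n" by (simp add: msize_def)
  then show "(\<Sum>k\<in>{I1, I2}. \<integral>x. x ^ m * (poly (B k) x * (1 / (t - x))) \<partial>\<mu> k) = 0"
  proof (induct m)
    case 0
    then show ?case using zero by simp
  next
    case (Suc m)
    have i: "integrable (\<mu> k) (\<lambda>x. x ^ l * (poly (B k) x * (1 / (t - x))))" "integrable (\<mu> k) (\<lambda>x. x ^ l * poly (B k) x)" for k l
      by (intro cm_integrable cm_mult cm_pow cm_poly c)+
    have e: "(\<integral>x. x ^ Suc m * (poly (B k) x * (1 / (t - x))) \<partial>\<mu> k)
      = t * (\<integral>x. x ^ m * (poly (B k) x * (1 / (t - x))) \<partial>\<mu> k) - (\<integral>x. x ^ m * poly (B k) x \<partial>\<mu> k)" for k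
    proof -
      have "(\<integral>x. x ^ Suc m * (poly (B k) x * (1 / (t - x))) \<partial>\<mu> k)
        = (\<integral>x. t * (x ^ m * (poly (B k) x * (1 / (t - x)))) - x ^ m * poly (B k) x \<partial>\<mu> k)"
      proof (rule integral_cong_AE)
        show "AE x in \<mu> k. x ^ Suc m * (poly (B k) x * (1 / (t - x)))
          = t * (x ^ m * (poly (B k) x * (1 / (t - x)))) - x ^ m * poly (B k) x"
          using AE_Delta
        proof eventually_elim
          case (elim x)
          then have "t - x \<noteq> 0" using t[of k] by auto
          then show ?case by (simp add: field_simps)
        qed
      qed (intro borel_measurable_integrable i Bochner_Integration.integrable_diff integrable_mult_right)+
      also have "\<dots> = t * (\<integral>x. x ^ m * (poly (B k) x * (1 / (t - x))) \<partial>\<mu> k) - (\<integral>x. x ^ m * poly (B k) x \<partial>\<mu> k)"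
        by (subst Bochner_Integration.integral_diff[OF integrable_mult_right[OF i(1)] i(2)])
          (simp only: integral_mult_right_zero)
      finally show ?thesis .
    qed
    have "QI B (monom 1 m) = 0" using Suc(2) by (intro orth)
    moreover have "(\<Sum>k\<in>{I1, I2}. \<integral>x. x ^ Suc m * (poly (B k) x * (1 / (t - x))) \<partial>\<mu> k)
      = t * (\<Sum>k\<in>{I1, I2}. \<integral>x. x ^ m * (poly (B k) x * (1 / (t - x))) \<partial>\<mu> k) - QI B (monom 1 m)"
      unfolding e QI_def ix_sum poly_monom mult_1_left by (simp only: distrib_left add_diff_add)
    moreover have "(\<Sum>k\<in>{I1, I2}. \<integral>x. x ^ m * (poly (B k) x * (1 / (t - x))) \<partial>\<mu> k) = 0"
      by (rule Suc(1)) (use Suc(2) in simp)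
    ultimately show ?case by (simp only: mult_zero_right diff_self)
  qed
qed (use deg in auto)

text \<open>For \<open>t\<close> possibly in \<Delta>_k the weight \<open>1 / (t - x)\<close> is
  unusable on that interval. Instead \<open>B k\<close> itself is divided by its zero
  \<open>t\<close>, and the weight remains only on the other interval. The hypothesis
  \<open>zero\<close> is the regularised Cauchy transform of the form at \<open>t\<close>.\<close>

lemma linear_form_nonzero_inside:
  assumes deg: "\<And>k. \<forall>j\<ge>n k. coeff (B k) j = 0"
    and orth: "\<And>m. Suc (Suc m) < msize n \<Longrightarrow> QI B (monom 1 m) = 0"
    and nk: "n k > 0" and t: "t \<notin> Delta \<mu> (other k)" and Bt: "poly (B k) t = 0"
    and zero: "(\<integral>x. poly (B (other k)) x / (t - x) \<partial>\<mu> (other k)) - (\<integral>x. poly (synthetic_div (B k) x) t \<partial>\<mu> k) = 0"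
  shows "B j = 0"
proof -
  define C where "C = synthetic_div (B k) t"
  have BC: "B k = [:-t, 1:] * C" using synthetic_div_correct'[of t "B k"] Bt by (simp add: C_def del: mult_pCons_left)
  have sC: "poly (synthetic_div (B k) x) t = poly C x" for x unfolding C_def by (rule synthetic_div_sym)
  define D where "D j = (if j = k then - C else B j)" for j
  define w where "w j x = (if j = k then 1 else 1 / (t - x))" for j and x :: real
  \<comment> \<open>Division lowers the degree bound of the component \<open>k\<close> by one, which
    compensates for the orthogonality being one order weaker than outside the intervals.\<close>
  define n' where "n' j = (if j = k then n j - 1 else n j)" for j
  have cw: "cm j (w j)" for j
    using ix_eq_or_other[of j k] cm_inverse_shift[OF t] by (auto simp: w_def[abs_def])
  have "D j = 0" for j
  proof (rule type_I_normal[where n=n' and w=w])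
    show "cm k (w k)" for k by (rule cw)
    show "w j x \<noteq> 0" if "x \<in> Delta \<mu> j" for j x
      using ix_eq_or_other[of j k] that t by (auto simp: w_def)
    show "\<forall>i\<ge>n' j. coeff (D j) i = 0" for j
    proof (cases "j = k")
      case True
      have "C = 0 \<or> degree C < n k - 1"
      proof (cases "C = 0")
        case False
        then have "B k \<noteq> 0" unfolding BC by (simp del: mult_pCons_left)
        from degree_lt_iff[OF this deg] have "degree (B k) < n k" .
        moreover have "degree (B k) = Suc (degree C)" unfolding BC using False by (subst degree_mult_eq) auto
        ultimately have "degree C < n k - 1" by linarith
        then show ?thesis ..
      qed simp
      from coeff_ge_degree[OF this] show ?thesis using True by (simp add: D_def n'_def)
    qed (use deg in \<open>auto simp: D_def n'_def\<close>)
    fix m assume "m < n' I1 + n' I2"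
    then have "Suc m < msize n" using nk by (cases k) (auto simp: n'_def msize_def)
    then show "(\<Sum>j\<in>{I1, I2}. \<integral>x. x ^ m * (poly (D j) x * w j x) \<partial>\<mu> j) = 0"
    proof (induct m)
      case 0
      then show ?case using zero unfolding ix_sum_other[of _ k]
        by (simp add: D_def w_def sC)
    next
      case (Suc m)
      have i: "integrable (\<mu> j) (\<lambda>x. x ^ l * (poly (D j) x * w j x))" "integrable (\<mu> j) (\<lambda>x. x ^ l * poly (B j) x)" for j l
        by (intro cm_integrable cm_mult cm_pow cm_poly cw)+
      have e: "(\<integral>x. x ^ Suc m * (poly (D j) x * w j x) \<partial>\<mu> j)
        = t * (\<integral>x. x ^ m * (poly (D j) x * w j x) \<partial>\<mu> j) - (\<integral>x. x ^ m * poly (B j) x \<partial>\<mu> j)" for j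
      proof -
        have "(\<integral>x. x ^ Suc m * (poly (D j) x * w j x) \<partial>\<mu> j)
          = (\<integral>x. t * (x ^ m * (poly (D j) x * w j x)) - x ^ m * poly (B j) x \<partial>\<mu> j)"
        proof (rule integral_cong_AE)
          show "AE x in \<mu> j. x ^ Suc m * (poly (D j) x * w j x)
            = t * (x ^ m * (poly (D j) x * w j x)) - x ^ m * poly (B j) x"
            using AE_Delta
          proof eventually_elim
            case (elim x)
            show ?case
            proof (cases "j = k")
              case True
              then show ?thesis by (simp add: D_def w_def BC algebra_simps del: mult_pCons_left)
            next
              case False
              then have "t - x \<noteq> 0" using elim t ix_eq_or_other[of j k] by auto
              then show ?thesis using False by (simp add: D_def w_def field_simps)
            qed
          qed
        qed (intro borel_measurable_integrable i Bochner_Integration.integrable_diff integrable_mult_right)+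
        also have "\<dots> = t * (\<integral>x. x ^ m * (poly (D j) x * w j x) \<partial>\<mu> j) - (\<integral>x. x ^ m * poly (B j) x \<partial>\<mu> j)"
          by (subst Bochner_Integration.integral_diff[OF integrable_mult_right[OF i(1)] i(2)])
            (simp only: integral_mult_right_zero)
        finally show ?thesis .
      qed
      have "QI B (monom 1 m) = 0" using Suc(2) by (intro orth) simp
      moreover have "(\<Sum>j\<in>{I1, I2}. \<integral>x. x ^ Suc m * (poly (D j) x * w j x) \<partial>\<mu> j)
        = t * (\<Sum>j\<in>{I1, I2}. \<integral>x. x ^ m * (poly (D j) x * w j x) \<partial>\<mu> j) - QI B (monom 1 m)"
        unfolding e QI_def ix_sum poly_monom mult_1_left by (simp only: distrib_left add_diff_add)
      moreover have "(\<Sum>j\<in>{I1, I2}. \<integral>x. x ^ m * (poly (D j) x * w j x) \<partial>\<mu> j) = 0"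
        by (rule Suc(1)) (use Suc(2) in simp)
      ultimately show ?case by (simp only: mult_zero_right diff_self)
    qed
  qed
  then have "D k = 0" "D (other k) = 0" by auto
  then show "B j = 0" using ix_eq_or_other[of j k] BC by (auto simp: D_def)
qed

end

subsection \<open>The Jacobi operator on the tree\<close>

lemma ell2_nm_sq: "f \<in> ell2 S \<Longrightarrow> (n2 (count_space S) f)\<^sup>2 = (\<Sum>\<^sub>\<infinity>v\<in>S. (cmod (f v))\<^sup>2)"
  by (subst ell2_norm_n2[symmetric]) (auto simp: ell2_norm_def infsum_nonneg)

section \<open>Weighted shifts along an injection\<close>

lemma ell2_boundI:
  assumes 0: "\<And>v. v \<notin> S \<Longrightarrow> g v = 0" and K: "0 \<le> K"
    and s: "(\<lambda>v. K\<^sup>2 * F v) summable_on S" and le: "\<And>v. v \<in> S \<Longrightarrow> (cmod (g v))\<^sup>2 \<le> K\<^sup>2 * F v"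
    and B: "(\<Sum>\<^sub>\<infinity>v\<in>S. F v) \<le> (n2 (count_space S) f)\<^sup>2"
  shows "g \<in> ell2 S" "n2 (count_space S) g \<le> K * n2 (count_space S) f"
proof -
  have sg: "(\<lambda>v. (cmod (g v))\<^sup>2) summable_on S"
    by (rule summable_on_comparison_test[OF s]) (use le in auto)
  then show g: "g \<in> ell2 S" using 0 by (simp add: ell2_def)
  have "(n2 (count_space S) g)\<^sup>2 \<le> (\<Sum>\<^sub>\<infinity>v\<in>S. K\<^sup>2 * F v)"
    unfolding ell2_nm_sq[OF g] by (rule infsum_mono[OF sg s]) (use le in auto)
  also have "\<dots> = K\<^sup>2 * (\<Sum>\<^sub>\<infinity>v\<in>S. F v)" by (rule infsum_cmult_right')
  also have "\<dots> \<le> (K * n2 (count_space S) f)\<^sup>2" unfolding power_mult_distrib using B by (intro mult_left_mono) auto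
  finally show "n2 (count_space S) g \<le> K * n2 (count_space S) f"
    by (rule power2_le_imp_le) (use K in simp)
qed

text \<open>Passing to the i-th child is injective, so each direction of the adjacency is a shift
  whose adjoint is explicit and whose norm is bounded by the supremum of the weights.\<close>

locale weighted_shift =
  fixes S :: "'v set" and \<phi> :: "'v \<Rightarrow> 'v" and c :: "'v \<Rightarrow> real" and K :: real
  assumes inj: "inj_on \<phi> S" and img: "\<phi> ` S \<subseteq> S" and cK: "\<And>v. v \<in> S \<Longrightarrow> \<bar>c v\<bar> \<le> K" and K0: "0 \<le> K"
begin

definition down :: "('v \<Rightarrow> complex) \<Rightarrow> 'v \<Rightarrow> complex" where
  "down f v = (if v \<in> S then of_real (c v) * f (\<phi> v) else 0)"

definition up :: "('v \<Rightarrow> complex) \<Rightarrow> 'v \<Rightarrow> complex" where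
  "up f w = (if w \<in> \<phi> ` S then of_real (c (inv_into S \<phi> w)) * f (inv_into S \<phi> w) else 0)"

lemma up_phi: "v \<in> S \<Longrightarrow> up f (\<phi> v) = of_real (c v) * f v"
  by (simp add: up_def inv_into_f_f[OF inj])

lemma reindex: "(\<Sum>\<^sub>\<infinity>v\<in>S. F (\<phi> v)) = (\<Sum>\<^sub>\<infinity>w\<in>S. if w \<in> \<phi> ` S then F w else 0)" for F :: "'v \<Rightarrow> 'b::{t2_space, topological_comm_monoid_add}"
proof -
  have "(\<Sum>\<^sub>\<infinity>v\<in>S. F (\<phi> v)) = infsum F (\<phi> ` S)"
    using infsum_reindex[OF inj, of F] by (simp add: o_def)
  also have "\<dots> = (\<Sum>\<^sub>\<infinity>w\<in>S. if w \<in> \<phi> ` S then F w else 0)"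
    by (rule infsum_cong_neutral) (use img in auto)
  finally show ?thesis .
qed

lemma summable_reindex: "(\<lambda>v. F (\<phi> v)) summable_on S \<longleftrightarrow> (\<lambda>w. if w \<in> \<phi> ` S then F w else 0) summable_on S" for F :: "'v \<Rightarrow> real"
proof -
  have "(\<lambda>v. F (\<phi> v)) summable_on S \<longleftrightarrow> F summable_on \<phi> ` S"
    using summable_on_reindex[OF inj, of F] by (simp add: o_def)
  also have "\<dots> \<longleftrightarrow> (\<lambda>w. if w \<in> \<phi> ` S then F w else 0) summable_on S"
    by (rule summable_on_cong_neutral) (use img in auto)
  finally show ?thesis .
qed

lemma down_bound: assumes f: "f \<in> ell2 S"
  shows "down f \<in> ell2 S" "n2 (count_space S) (down f) \<le> K * n2 (count_space S) f"
proof -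
  have sf: "(\<lambda>v. (cmod (f v))\<^sup>2) summable_on S" using f by (simp add: ell2_def)
  have s0: "(\<lambda>w. if w \<in> \<phi> ` S then (cmod (f w))\<^sup>2 else 0) summable_on S"
    by (rule summable_on_comparison_test[OF sf]) auto
  then have s1: "(\<lambda>v. (cmod (f (\<phi> v)))\<^sup>2) summable_on S" by (subst summable_reindex)
  have B: "(\<Sum>\<^sub>\<infinity>v\<in>S. (cmod (f (\<phi> v)))\<^sup>2) \<le> (n2 (count_space S) f)\<^sup>2"
    unfolding reindex[of "\<lambda>w. (cmod (f w))\<^sup>2"] ell2_nm_sq[OF f] by (rule infsum_mono[OF s0 sf]) auto
  have le: "(cmod (down f v))\<^sup>2 \<le> K\<^sup>2 * (cmod (f (\<phi> v)))\<^sup>2" if "v \<in> S" for v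
  proof -
    have "(c v)\<^sup>2 \<le> K\<^sup>2" using power_mono[OF cK[OF that] abs_ge_zero, of 2] by simp
    then show ?thesis using that by (simp add: down_def norm_mult power_mult_distrib mult_right_mono)
  qed
  show "down f \<in> ell2 S" "n2 (count_space S) (down f) \<le> K * n2 (count_space S) f"
    by (rule ell2_boundI[OF _ K0 summable_on_cmult_right[OF s1] le B]; simp add: down_def)+
qed

lemma up_bound: assumes f: "f \<in> ell2 S"
  shows "up f \<in> ell2 S" "n2 (count_space S) (up f) \<le> K * n2 (count_space S) f"
proof -
  have sf: "(\<lambda>v. (cmod (f v))\<^sup>2) summable_on S" using f by (simp add: ell2_def)
  define F where "F w = (if w \<in> \<phi> ` S then (cmod (f (inv_into S \<phi> w)))\<^sup>2 else 0)" for w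
  have eq: "(cmod (f (inv_into S \<phi> (\<phi> v))))\<^sup>2 = (cmod (f v))\<^sup>2" if "v \<in> S" for v
    using that by (simp add: inv_into_f_f[OF inj])
  have s1: "F summable_on S"
    unfolding F_def summable_reindex[of "\<lambda>w. (cmod (f (inv_into S \<phi> w)))\<^sup>2", symmetric]
    using sf by (subst summable_on_cong[OF eq])
  have "(\<Sum>\<^sub>\<infinity>w\<in>S. F w) = (n2 (count_space S) f)\<^sup>2"
    unfolding F_def reindex[of "\<lambda>w. (cmod (f (inv_into S \<phi> w)))\<^sup>2", symmetric] ell2_nm_sq[OF f]
    by (rule infsum_cong) (rule eq)
  then have B: "(\<Sum>\<^sub>\<infinity>w\<in>S. F w) \<le> (n2 (count_space S) f)\<^sup>2" by simp
  have le: "(cmod (up f w))\<^sup>2 \<le> K\<^sup>2 * F w" if "w \<in> S" for w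
  proof (cases "w \<in> \<phi> ` S")
    case True
    then obtain v where v: "v \<in> S" "w = \<phi> v" by blast
    have "(c v)\<^sup>2 \<le> K\<^sup>2" using power_mono[OF cK[OF v(1)] abs_ge_zero, of 2] by simp
    then show ?thesis using v by (simp add: up_phi F_def inv_into_f_f[OF inj] norm_mult power_mult_distrib mult_right_mono)
  qed (simp add: up_def F_def)
  show "up f \<in> ell2 S" "n2 (count_space S) (up f) \<le> K * n2 (count_space S) f"
    by (rule ell2_boundI[OF _ K0 summable_on_cmult_right[OF s1] le B]; use img in \<open>auto simp: up_def\<close>)+
qed

lemma ip_down_up: assumes f: "f \<in> ell2 S" and g: "g \<in> ell2 S"
  shows "ip (count_space S) (down f) g = ip (count_space S) f (up g)"
proof -
  have "ip (count_space S) (down f) g = (\<Sum>\<^sub>\<infinity>v\<in>S. down f v * cnj (g v))"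
    by (simp add: ell2_inner_ip[symmetric] ell2_inner_def f g down_bound)
  also have "\<dots> = (\<Sum>\<^sub>\<infinity>v\<in>S. f (\<phi> v) * cnj (up g (\<phi> v)))"
    by (rule infsum_cong) (simp add: down_def up_phi)
  also have "\<dots> = (\<Sum>\<^sub>\<infinity>w\<in>S. if w \<in> \<phi> ` S then f w * cnj (up g w) else 0)"
    by (rule reindex)
  also have "\<dots> = (\<Sum>\<^sub>\<infinity>w\<in>S. f w * cnj (up g w))"
    by (rule infsum_cong) (simp add: up_def)
  also have "\<dots> = ip (count_space S) f (up g)"
    by (simp add: ell2_inner_ip[symmetric] ell2_inner_def f g up_bound)
  finally show ?thesis .
qed

lemma ip_up_down: assumes f: "f \<in> ell2 S" and g: "g \<in> ell2 S"
  shows "ip (count_space S) (up f) g = ip (count_space S) f (down g)"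
  using arg_cong[OF ip_down_up[OF g f], of cnj] by (simp add: ip_cnj)

end

lemma multiplication_ell2:
  fixes c :: "'v \<Rightarrow> real"
  assumes c: "\<And>v. v \<in> S \<Longrightarrow> \<bar>c v\<bar> \<le> K" and K: "0 \<le> K" and f: "f \<in> ell2 S"
  shows "(\<lambda>v. of_real (c v) * f v) \<in> ell2 S"
    "n2 (count_space S) (\<lambda>v. of_real (c v) * f v) \<le> K * n2 (count_space S) f"
proof -
  have sf: "(\<lambda>v. (cmod (f v))\<^sup>2) summable_on S" using f by (simp add: ell2_def)
  have le: "(cmod (of_real (c v) * f v))\<^sup>2 \<le> K\<^sup>2 * (cmod (f v))\<^sup>2" if "v \<in> S" for v
    using power_mono[OF c[OF that] abs_ge_zero, of 2] by (simp add: norm_mult power_mult_distrib mult_right_mono)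
  show "(\<lambda>v. of_real (c v) * f v) \<in> ell2 S"
    "n2 (count_space S) (\<lambda>v. of_real (c v) * f v) \<le> K * n2 (count_space S) f"
    by (rule ell2_boundI[where f=f, OF _ K summable_on_cmult_right[OF sf] le];
      use f ell2_nm_sq[OF f] in \<open>simp add: ell2_def\<close>)+
qed

section \<open>Vertices, products along paths, and boundedness of the Jacobi operator\<close>

fun parent :: "vertex \<Rightarrow> vertex" where
  "parent Root = Root"
| "parent (Child Y i) = Y"

lemma subtree_size: "Y \<in> subtree X \<Longrightarrow> size X \<le> size Y"
  by (induct rule: subtree.induct) auto

lemma not_child_subtree: "X = Child Z i \<Longrightarrow> Z \<notin> subtree X"
  using subtree_size[of Z X] by auto

lemma subtree_cases: "Y \<in> subtree X \<Longrightarrow> Y = X \<or> (\<exists>Z i. Y = Child Z i \<and> Z \<in> subtree X)"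
  by (cases rule: subtree.cases) auto

lemma Pi_ix_pos: "Pi_ix Y k > 0"
  by (induct Y) (auto simp: inc_def)

lemma path_size: "Z \<in> path_to_root Y \<Longrightarrow> size Z \<le> size Y"
  by (induct Y) auto

lemma finite_path: "finite (path_to_root Y)"
  by (induct Y) auto

context angelesco_system
begin

lemma potW_pos: "potW \<mu> Y > 0"
  by (cases Y) (auto simp: rec_ab intro: aa_pos Pi_ix_pos)

lemma mfac_Root: "mfac \<mu> Root = 1"
  by (simp add: mfac_def)

lemma mfac_Child: "mfac \<mu> (Child Y i) = mfac \<mu> Y / sqrt (potW \<mu> (Child Y i))"
proof -
  have "Child Y i \<notin> path_to_root Y" using path_size[of "Child Y i" Y] by auto
  then show ?thesis unfolding mfac_def path_to_root.simps by (subst prod.insert) (auto simp: finite_path)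
qed

lemma mfac_pos: "mfac \<mu> Y > 0"
  unfolding mfac_def by (rule prod_pos) (simp add: potW_pos)

text \<open>On \<open>ell2\<close> the operator is multiplication by the potential plus, for each of
  the two child maps, a shift and its adjoint; hence symmetry and the bound
  \<open>KV + 4 * sqrt B\<close>.\<close>

lemma jacobi_sa_op: "\<exists>C. sa_op (subtree X) (jacobi \<mu> \<kappa> X) C"
proof -
  define S where "S = subtree X"
  obtain B where B: "0 < B" "\<And>n i. \<bar>bb n i\<bar> \<le> B" "\<And>n i. aa n i \<le> B" using coefficient_bounds by blast
  \<comment> \<open>The potential at the root carries the factors \<kappa> and is not covered by the
    uniform bound \<open>B\<close>.\<close>
  define KV where "KV = B + \<bar>potV \<mu> \<kappa> Root\<bar>"
  have V: "\<bar>potV \<mu> \<kappa> Y\<bar> \<le> KV" for Y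
  proof (cases Y)
    case (Child Z i)
    then show ?thesis using B(2)[of "Pi_ix Z" i] by (simp add: KV_def rec_ab)
  qed (use B in \<open>simp add: KV_def\<close>)
  have KV: "0 \<le> KV" using B by (simp add: KV_def)
  have W: "\<bar>sqrt (potW \<mu> (Child Y i))\<bar> \<le> sqrt B" for Y i
    using B(3)[of "Pi_ix Y" i] potW_pos[of "Child Y i"] by (simp add: rec_ab)
  interpret A: weighted_shift S "\<lambda>Y. Child Y I1" "\<lambda>Y. sqrt (potW \<mu> (Child Y I1))" "sqrt B"
    by unfold_locales (use W B in \<open>auto simp: inj_on_def S_def intro: subtree.child\<close>)
  interpret D: weighted_shift S "\<lambda>Y. Child Y I2" "\<lambda>Y. sqrt (potW \<mu> (Child Y I2))" "sqrt B"
    by unfold_locales (use W B in \<open>auto simp: inj_on_def S_def intro: subtree.child\<close>)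
  define M where "M f = (\<lambda>Y. of_real (potV \<mu> \<kappa> Y) * f Y)" for f :: "vertex \<Rightarrow> complex"
  have J: "jacobi \<mu> \<kappa> X f = (\<lambda>Y. M f Y + ((A.up f Y + D.up f Y) + (A.down f Y + D.down f Y)))"
    if f: "f \<in> ell2 S" for f
  proof
    fix Y
    show "jacobi \<mu> \<kappa> X f Y = M f Y + ((A.up f Y + D.up f Y) + (A.down f Y + D.down f Y))"
    proof (cases "Y \<in> S")
      case False
      then have "Y \<notin> (\<lambda>Y. Child Y I1) ` S" "Y \<notin> (\<lambda>Y. Child Y I2) ` S" "f Y = 0"
        using f by (auto simp: S_def ell2_def intro: subtree.child)
      then show ?thesis using False unfolding A.up_def D.up_def A.down_def D.down_def
        by (simp add: jacobi_def M_def S_def)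
    next
      case True
      have up: "A.up f Y + D.up f Y = (if Y = X then 0 else of_real (sqrt (potW \<mu> Y)) * at_parent f Y)"
      proof (cases "Y = X")
        case eq: True
        have "Y \<notin> (\<lambda>Y. Child Y i) ` S" for i using not_child_subtree eq by (auto simp: S_def)
        then show ?thesis using eq unfolding A.up_def D.up_def by simp
      next
        case False
        then obtain Z i where Z: "Y = Child Z i" "Z \<in> S" using subtree_cases[of Y X] True by (auto simp: S_def)
        have "A.up f (Child Z I2) = 0" "D.up f (Child Z I1) = 0" unfolding A.up_def D.up_def by auto
        then show ?thesis using False Z A.up_phi[OF Z(2), of f] D.up_phi[OF Z(2), of f]
          by (cases i) (simp_all del: potW.simps)
      qed
      show ?thesis unfolding up unfolding A.down_def D.down_def using True by (simp add: jacobi_def M_def S_def)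
    qed
  qed
  note e = ell2_sqi
  have M: "M f \<in> ell2 S" "n2 (count_space S) (M f) \<le> KV * n2 (count_space S) f" if "f \<in> ell2 S" for f
    unfolding M_def by (rule multiplication_ell2[OF V KV that])+
  have "sa_op S (jacobi \<mu> \<kappa> X) (KV + 4 * sqrt B)"
  proof
    fix f assume f: "f \<in> ell2 S"
    show "jacobi \<mu> \<kappa> X f \<in> ell2 S"
      unfolding J[OF f] by (intro ell2_add M A.up_bound A.down_bound D.up_bound D.down_bound f)
    have "n2 (count_space S) (jacobi \<mu> \<kappa> X f) \<le> n2 (count_space S) (M f)
       + ((n2 (count_space S) (A.up f) + n2 (count_space S) (D.up f)) + (n2 (count_space S) (A.down f) + n2 (count_space S) (D.down f)))"
      unfolding J[OF f]
      by (rule order_trans[OF n2_triangle] add_mono order_refl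
          | intro e ell2_add M A.up_bound A.down_bound D.up_bound D.down_bound f)+
    also have "\<dots> \<le> (KV + 4 * sqrt B) * n2 (count_space S) f"
      using M(2)[OF f] A.up_bound(2)[OF f] A.down_bound(2)[OF f] D.up_bound(2)[OF f] D.down_bound(2)[OF f]
      by (simp add: algebra_simps del: potW.simps)
    finally show "n2 (count_space S) (jacobi \<mu> \<kappa> X f) \<le> (KV + 4 * sqrt B) * n2 (count_space S) f" .
    fix g assume g: "g \<in> ell2 S"
    show "jacobi \<mu> \<kappa> X (\<lambda>v. a * f v + b * g v) = (\<lambda>v. a * jacobi \<mu> \<kappa> X f v + b * jacobi \<mu> \<kappa> X g v)" for a b
    proof
      fix Y
      have "at_parent (\<lambda>v. a * f v + b * g v) Y = a * at_parent f Y + b * at_parent g Y" by (cases Y) auto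
      then show "jacobi \<mu> \<kappa> X (\<lambda>v. a * f v + b * g v) Y = a * jacobi \<mu> \<kappa> X f Y + b * jacobi \<mu> \<kappa> X g Y"
        by (simp add: jacobi_def algebra_simps)
    qed
    have Msym: "ip (count_space S) (M f) g = ip (count_space S) f (M g)"
      unfolding ip_def M_def by (rule Bochner_Integration.integral_cong) auto
    have "ip (count_space S) (jacobi \<mu> \<kappa> X f) g = ip (count_space S) (M f) g
       + ((ip (count_space S) (A.up f) g + ip (count_space S) (D.up f) g) + (ip (count_space S) (A.down f) g + ip (count_space S) (D.down f) g))"
      unfolding J[OF f] by (simp add: ip_add_left e ell2_add M A.up_bound A.down_bound D.up_bound D.down_bound f g del: potW.simps)
    also have "\<dots> = ip (count_space S) f (jacobi \<mu> \<kappa> X g)"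
      unfolding J[OF g] by (simp add: ip_add_right e ell2_add M A.up_bound A.down_bound D.up_bound D.down_bound f g
        Msym A.ip_up_down A.ip_down_up D.ip_up_down D.ip_down_up del: potW.simps)
    finally show "ip (count_space S) (jacobi \<mu> \<kappa> X f) g = ip (count_space S) f (jacobi \<mu> \<kappa> X g)" .
  next
    show "0 \<le> KV + 4 * sqrt B" using KV B by simp
  qed
  then show ?thesis unfolding S_def by blast
qed

end

subsection \<open>Functions of the second kind\<close>

lemma synthetic_div_diag: "poly (synthetic_div p t) t = poly (pderiv p) (t::real)"
proof -
  have "poly (pderiv p) t = poly (pderiv ([:-t, 1:] * synthetic_div p t + [:poly p t:])) t"
    by (simp only: synthetic_div_correct')
  also have "\<dots> = poly (synthetic_div p t) t"
    by (simp add: pderiv_add pderiv_mult pderiv_pCons del: mult_pCons_left)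
  finally show ?thesis by simp
qed

lemma (in bounded_borel) uniform_limit_integral:
  fixes \<psi> :: "real \<Rightarrow> complex"
  assumes psi: "integrable \<rho> \<psi>" and u: "uniform_limit {-R..R} (\<lambda>n x. poly (p n) x) G sequentially"
    and G: "G \<in> borel_measurable borel"
  shows "integrable \<rho> (\<lambda>x. of_real (G x) * \<psi> x)"
    "(\<lambda>n. \<integral>x. of_real (poly (p n) x) * \<psi> x \<partial>\<rho>) \<longlonglongrightarrow> (\<integral>x. of_real (G x) * \<psi> x \<partial>\<rho>)"
proof -
  have ib: "integrable \<rho> (\<lambda>x. of_real (H x) * \<psi> x)"
    if H: "H \<in> borel_measurable borel" and B: "\<And>x. x \<in> {-R..R} \<Longrightarrow> \<bar>H x\<bar> \<le> B" for H B
  proof (rule Bochner_Integration.integrable_bound)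
    show "integrable \<rho> (\<lambda>x. H x * norm (\<psi> x))"
      by (rule integrable_cont_mult[OF H B]) (use psi in auto)
    show "(\<lambda>x. of_real (H x) * \<psi> x) \<in> borel_measurable \<rho>"
      using psi H by measurable
  qed (auto simp: norm_mult abs_mult)
  have ip: "integrable \<rho> (\<lambda>x. of_real (poly q x) * \<psi> x)" for q
  proof -
    obtain B where "\<And>x. x \<in> {-R..R} \<Longrightarrow> \<bar>poly q x\<bar> \<le> B" using poly_bounded_interval by blast
    then show ?thesis by (intro ib) (auto intro!: borel_measurable_continuous_onI continuous_intros)
  qed
  \<comment> \<open>\<open>G\<close> is only measurable; its boundedness on the interval comes from
    a polynomial within distance 1.\<close>
  obtain N where N: "\<And>x. x \<in> {-R..R} \<Longrightarrow> \<bar>poly (p N) x - G x\<bar> < 1"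
    using uniform_limitD[OF u, of 1] unfolding eventually_sequentially dist_real_def by (meson le_refl zero_less_one)
  obtain B where B: "\<And>x. x \<in> {-R..R} \<Longrightarrow> \<bar>poly (p N) x\<bar> \<le> B" using poly_bounded_interval by blast
  show iG: "integrable \<rho> (\<lambda>x. of_real (G x) * \<psi> x)"
    by (rule ib[OF G, of "B + 1"]) (use N B in fastforce)
  define I where "I = (\<integral>x. norm (\<psi> x) \<partial>\<rho>)"
  have I: "I \<ge> 0" unfolding I_def by simp
  show "(\<lambda>n. \<integral>x. of_real (poly (p n) x) * \<psi> x \<partial>\<rho>) \<longlonglongrightarrow> (\<integral>x. of_real (G x) * \<psi> x \<partial>\<rho>)"
  proof (rule LIMSEQ_I)
    fix e :: real assume e: "0 < e"
    define d where "d = e / (I + 1)"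
    have d: "d > 0" using e I by (simp add: d_def)
    obtain N where N: "\<And>n x. n \<ge> N \<Longrightarrow> x \<in> {-R..R} \<Longrightarrow> \<bar>poly (p n) x - G x\<bar> < d"
      using uniform_limitD[OF u d] unfolding eventually_sequentially dist_real_def by blast
    have "norm ((\<integral>x. of_real (poly (p n) x) * \<psi> x \<partial>\<rho>) - (\<integral>x. of_real (G x) * \<psi> x \<partial>\<rho>)) < e" if n: "n \<ge> N" for n
    proof -
      have "(\<integral>x. of_real (poly (p n) x) * \<psi> x \<partial>\<rho>) - (\<integral>x. of_real (G x) * \<psi> x \<partial>\<rho>)
        = (\<integral>x. of_real (poly (p n) x) * \<psi> x - of_real (G x) * \<psi> x \<partial>\<rho>)"
        by (rule Bochner_Integration.integral_diff[symmetric, OF ip iG])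
      also have "norm \<dots> \<le> (\<integral>x. norm (of_real (poly (p n) x) * \<psi> x - of_real (G x) * \<psi> x) \<partial>\<rho>)"
        by (rule integral_norm_bound)
      also have "\<dots> \<le> (\<integral>x. d * norm (\<psi> x) \<partial>\<rho>)"
      proof (rule integral_mono_AE)
        show "AE x in \<rho>. norm (of_real (poly (p n) x) * \<psi> x - of_real (G x) * \<psi> x) \<le> d * norm (\<psi> x)"
          using AE_R
        proof eventually_elim
          case (elim x)
          have "\<bar>poly (p n) x - G x\<bar> \<le> d" by (rule less_imp_le[OF N[OF n]]) (use elim in auto)
          moreover have "norm (of_real (poly (p n) x) * \<psi> x - of_real (G x) * \<psi> x) = \<bar>poly (p n) x - G x\<bar> * norm (\<psi> x)"
            by (simp add: left_diff_distrib[symmetric] norm_mult flip: of_real_diff)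
          ultimately show ?case by (simp add: mult_right_mono)
        qed
      qed (use psi ip iG in \<open>auto intro!: integrable_norm Bochner_Integration.integrable_diff\<close>)
      also have "\<dots> = d * I" by (simp add: I_def)
      also have "\<dots> < d * (I + 1)" using d by simp
      also have "\<dots> = e" using I by (simp add: d_def)
      finally show ?thesis .
    qed
    then show "\<exists>N. \<forall>n\<ge>N. norm ((\<integral>x. of_real (poly (p n) x) * \<psi> x \<partial>\<rho>) - (\<integral>x. of_real (G x) * \<psi> x \<partial>\<rho>)) < e" by blast
  qed
qed

lemma integral_param_measurable:
  fixes f :: "real \<Rightarrow> real \<Rightarrow> real" and M :: "real measure"
  assumes fin: "finite_measure M" and M: "sets M = sets borel" and f: "(\<lambda>(x, t). f x t) \<in> borel_measurable (borel \<Otimes>\<^sub>M borel)"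
  shows "(\<lambda>x. \<integral>t. f x t \<partial>M) \<in> borel_measurable borel"
proof -
  have "sigma_finite_measure M" using fin by (simp add: finite_measure_def)
  moreover have "(\<lambda>(x, t). f x t) \<in> borel_measurable (borel \<Otimes>\<^sub>M M)"
    using f by (simp add: measurable_cong_sets[OF sets_pair_measure_cong[OF refl M] refl])
  ultimately show ?thesis by (rule sigma_finite_measure.borel_measurable_lebesgue_integral)
qed

section \<open>Cauchy integrals and divided differences\<close>

context angelesco_system
begin

definition cau :: "ix \<Rightarrow> real poly \<Rightarrow> real \<Rightarrow> real" where
  "cau k B x = (\<integral>t. poly B t / (x - t) \<partial>\<mu> k)"

lemma cau_measurable: "cau k B \<in> borel_measurable borel"
proof -
  have [measurable]: "poly B \<in> borel_measurable borel" by (auto intro!: borel_measurable_continuous_onI continuous_intros)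
  show ?thesis unfolding cau_def[abs_def]
    by (rule integral_param_measurable[OF fin_mu sets_mu]) measurable
qed

text \<open>No integrability is needed at \<open>x \<in> \<Delta>\<^sub>k\<close>, where \<open>F x = 0\<close>.\<close>

lemma divided_difference_limit:
  assumes C1: "C1_conv R f F F'" and sub: "Delta \<mu> k \<subseteq> {-R..R}"
    and zero: "\<And>t. t \<in> Delta \<mu> k \<Longrightarrow> F t = 0" "\<And>t. t \<in> Delta \<mu> k \<Longrightarrow> F' t = 0"
  shows "uniform_limit {-R..R} (\<lambda>n x. \<integral>t. poly (synthetic_div (f n) x) t * poly B t \<partial>\<mu> k)
      (\<lambda>x. F x * cau k B x) sequentially"
proof (rule uniform_limitI)
  fix e :: real assume e: "0 < e"
  define M where "M = (\<integral>t. \<bar>poly B t\<bar> \<partial>\<mu> k)"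
  have iB: "integrable (\<mu> k) (\<lambda>t. \<bar>poly B t\<bar>)" by (intro integrable_abs cm_integrable cm_poly)
  have M: "M \<ge> 0" unfolding M_def by simp
  define d where "d = e / (M + 1)"
  have d: "d > 0" using e M by (simp add: d_def)
  have "\<forall>\<^sub>F n in sequentially. \<forall>x\<in>{-R..R}. dist (poly (pderiv (f n)) x) (F' x) < d"
    using C1 d unfolding C1_conv_def by (blast dest: uniform_limitD)
  then show "\<forall>\<^sub>F n in sequentially. \<forall>x\<in>{-R..R}.
      dist (\<integral>t. poly (synthetic_div (f n) x) t * poly B t \<partial>\<mu> k) (F x * cau k B x) < e"
  proof eventually_elim
    case (elim n)
    show ?case
    proof
      fix x assume x: "x \<in> {-R..R}"
      \<comment> \<open>Since \<open>F\<close> and \<open>F'\<close> vanish at \<open>t\<close>, the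
        quotient \<open>F x / (x - t)\<close> is the divided difference of \<open>F\<close>, and on
        the diagonal the default 0 of division is the correct value \<open>F' t\<close>. The mean
        value estimate for \<open>f n - F\<close> bounds the error by \<open>d\<close> uniformly in
        \<open>t\<close>.\<close>
      have key: "\<bar>poly (synthetic_div (f n) x) t - F x / (x - t)\<bar> \<le> d" if t: "t \<in> Delta \<mu> k" for t
      proof (cases "x = t")
        case True
        then show ?thesis using elim[rule_format, OF x] zero(2)[OF t]
          by (simp add: synthetic_div_diag dist_real_def less_imp_le)
      next
        case False
        have tR: "t \<in> {-R..R}" using t sub by blast
        have "norm ((poly (f n) x - F x) - (poly (f n) t - F t)) \<le> d * norm (x - t)"
        proof (rule field_differentiable_bound[of "{-R..R}" _ "\<lambda>x. poly (pderiv (f n)) x - F' x"])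
          fix z assume z: "z \<in> {-R..R}"
          show "((\<lambda>x. poly (f n) x - F x) has_real_derivative poly (pderiv (f n)) z - F' z) (at z within {-R..R})"
          proof (rule DERIV_diff)
            show "(poly (f n) has_real_derivative poly (pderiv (f n)) z) (at z within {-R..R})"
              by (rule DERIV_subset[OF poly_DERIV]) simp
            have "(F has_real_derivative F' z) (at z)" using C1 z unfolding C1_conv_def by blast
            then show "(F has_real_derivative F' z) (at z within {-R..R})" by (rule DERIV_subset) simp
          qed
          show "norm (poly (pderiv (f n)) z - F' z) \<le> d"
            using elim[rule_format, OF z] by (simp add: dist_real_def)
        qed (use x tR in auto)
        then have "\<bar>(poly (f n) x - poly (f n) t) - F x\<bar> \<le> d * \<bar>x - t\<bar>"
          using zero(1)[OF t] by (simp add: algebra_simps)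
        moreover have "poly (f n) x - poly (f n) t = (x - t) * poly (synthetic_div (f n) x) t"
          using synthetic_div_eq[of x t "f n"] by (simp add: synthetic_div_sym)
        moreover have "(x - t) * poly (synthetic_div (f n) x) t - F x = (x - t) * (poly (synthetic_div (f n) x) t - F x / (x - t))"
          using False by (simp add: right_diff_distrib)
        ultimately have "\<bar>x - t\<bar> * \<bar>poly (synthetic_div (f n) x) t - F x / (x - t)\<bar> \<le> \<bar>x - t\<bar> * d"
          by (simp add: abs_mult mult.commute)
        then show ?thesis using False by (simp add: mult_le_cancel_left)
      qed
      have i1: "integrable (\<mu> k) (\<lambda>t. poly (synthetic_div (f n) x) t * poly B t)" by (rule int_pp)
      have i2: "integrable (\<mu> k) (\<lambda>t. F x * (poly B t / (x - t)))"
      proof (cases "x \<in> Delta \<mu> k")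
        case False
        have "cm k (\<lambda>t. poly B t * (1 / (x - t)))" by (intro cm_mult cm_poly cm_inverse_shift False)
        from cm_integrable[OF this] show ?thesis by (intro integrable_mult_right) simp
      qed (simp add: zero(1))
      have "(\<integral>t. poly (synthetic_div (f n) x) t * poly B t \<partial>\<mu> k) - F x * cau k B x
        = (\<integral>t. poly (synthetic_div (f n) x) t * poly B t - F x * (poly B t / (x - t)) \<partial>\<mu> k)"
        unfolding Bochner_Integration.integral_diff[OF i1 i2] cau_def by (simp only: integral_mult_right_zero)
      also have "\<bar>\<dots>\<bar> \<le> (\<integral>t. \<bar>poly (synthetic_div (f n) x) t * poly B t - F x * (poly B t / (x - t))\<bar> \<partial>\<mu> k)"
        by (rule integral_abs_bound)
      also have "\<dots> \<le> (\<integral>t. d * \<bar>poly B t\<bar> \<partial>\<mu> k)"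
      proof (rule integral_mono_AE)
        show "AE t in \<mu> k. \<bar>poly (synthetic_div (f n) x) t * poly B t - F x * (poly B t / (x - t))\<bar> \<le> d * \<bar>poly B t\<bar>"
          using AE_Delta
        proof eventually_elim
          case (elim t)
          have "poly (synthetic_div (f n) x) t * poly B t - F x * (poly B t / (x - t))
            = (poly (synthetic_div (f n) x) t - F x / (x - t)) * poly B t" by (simp add: left_diff_distrib)
          then show ?case using mult_right_mono[OF key[OF elim], of "\<bar>poly B t\<bar>"] by (simp add: abs_mult)
        qed
      qed (use iB i1 i2 in \<open>auto intro!: integrable_abs Bochner_Integration.integrable_diff\<close>)
      also have "\<dots> = d * M" by (simp add: M_def)
      also have "\<dots> < d * (M + 1)" using d by simp
      also have "\<dots> = e" using M by (simp add: d_def)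
      finally show "dist (\<integral>t. poly (synthetic_div (f n) x) t * poly B t \<partial>\<mu> k) (F x * cau k B x) < e"
        by (simp add: dist_real_def)
    qed
  qed
qed

lemma QI_0 [simp]: "QI A 0 = 0" by (simp add: QI_def)

lemma GP_ex: "\<exists>G. \<forall>x. poly G x = QI A (synthetic_div p x)"
proof (induct p)
  case 0
  show ?case by (intro exI[of _ 0]) simp
next
  case (pCons a p)
  then obtain G where G: "\<And>x. poly G x = QI A (synthetic_div p x)" by blast
  have "poly (pCons (QI A p) G) x = QI A (synthetic_div (pCons a p) x)" for x
    unfolding synthetic_div_pCons synthetic_div_correct[symmetric] QI_add QI_smult by (simp add: G)
  then show ?case by blast
qed

text \<open>Off the supports this is \<open>p\<close> times the function of the second kind of
  \<open>A\<close>, minus the Cauchy integral of \<open>p\<close> against the form; it stays a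
  polynomial in \<open>x\<close> even on the supports.\<close>

definition GP :: "(ix \<Rightarrow> real poly) \<Rightarrow> real poly \<Rightarrow> real poly" where
  "GP A p = (SOME G. \<forall>x. poly G x = QI A (synthetic_div p x))"

lemma poly_GP: "poly (GP A p) x = QI A (synthetic_div p x)"
  using someI_ex[OF GP_ex[of A p]] unfolding GP_def by blast

lemma GP_0 [simp]: "GP A 0 = 0"
  by (subst poly_eq_poly_eq_iff[symmetric]) (auto simp: poly_GP)

text \<open>The divided difference of \<open>a + t p(t)\<close> is
  \<open>p(t) + x D p(x, t)\<close>. This has the same shape as \<open>U_pCons\<close>, which makes
  the inductions on \<open>p\<close> below run.\<close>

lemma GP_pCons: "GP A (pCons a p) = pCons (QI A p) (GP A p)"
proof (subst poly_eq_poly_eq_iff[symmetric], rule ext)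
  fix x show "poly (GP A (pCons a p)) x = poly (pCons (QI A p) (GP A p)) x"
    unfolding poly_GP synthetic_div_pCons synthetic_div_correct[symmetric] QI_add QI_smult by (simp add: poly_GP)
qed

end

section \<open>Forms on the subtree and their polynomial identities\<close>

locale tree_system = angelesco_system \<mu> for \<mu> +
  fixes \<kappa> :: "ix \<Rightarrow> real" and X :: vertex and \<rho> :: "real measure"
  assumes kappa: "\<kappa> I1 + \<kappa> I2 = 1"
    and spec_rho: "is_spectral_measure (subtree X) (jacobi \<mu> \<kappa> X) X \<rho>"
begin

definition Cop :: real where "Cop = (SOME C. sa_op (subtree X) (jacobi \<mu> \<kappa> X) C)"

sublocale spectral_op "subtree X" "jacobi \<mu> \<kappa> X" Cop X \<rho>
proof -
  have "sa_op (subtree X) (jacobi \<mu> \<kappa> X) Cop" unfolding Cop_def using someI_ex[OF jacobi_sa_op] .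
  then interpret sa_op "subtree X" "jacobi \<mu> \<kappa> X" Cop .
  show "spectral_op (subtree X) (jacobi \<mu> \<kappa> X) Cop X \<rho>"
    by unfold_locales (auto intro: subtree.self spec_rho)
qed

definition psi :: "vertex \<Rightarrow> real \<Rightarrow> complex" where
  "psi Y = (SOME \<psi>. sqi \<rho> \<psi> \<and> (\<forall>p. (\<integral>x. poly p (of_real x) * \<psi> x \<partial>\<rho>) = U p Y))"

sublocale spectral_transform "subtree X" "jacobi \<mu> \<kappa> X" Cop X \<rho> psi
proof -
  have "sqi \<rho> (psi Y) \<and> (\<forall>p. (\<integral>x. poly p (of_real x) * psi Y x \<partial>\<rho>) = U p Y)" if "Y \<in> subtree X" for Y
  proof -
    have "\<exists>\<psi>. sqi \<rho> \<psi> \<and> (\<forall>p. (\<integral>x. poly p (of_real x) * \<psi> x \<partial>\<rho>) = U p Y)"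
      by (rule ex_density[OF that]) blast
    then show ?thesis unfolding psi_def by (rule someI_ex)
  qed
  then show "spectral_transform (subtree X) (jacobi \<mu> \<kappa> X) Cop X \<rho> psi"
    by unfold_locales auto
qed

text \<open>The linear form of the (virtual, if \<open>X\<close> is the root) parent of \<open>X\<close>.\<close>

definition AZ :: "ix \<Rightarrow> real poly" where
  "AZ = (case X of Root \<Rightarrow> (\<lambda>k. smult (\<kappa> I1) (type_I \<mu> (unit_ix I2) k) + smult (\<kappa> I2) (type_I \<mu> (unit_ix I1) k))
     | Child Z i \<Rightarrow> type_I \<mu> (Pi_ix Z))"

text \<open>The eigenfunctions \<Lambda>, rescaled by a constant so that the value at
  \<open>X\<close> is the type I polynomial itself.\<close>

definition At :: "vertex \<Rightarrow> ix \<Rightarrow> real poly" where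
  "At Y k = smult (mfac \<mu> X / mfac \<mu> Y) (type_I \<mu> (Pi_ix Y) k)"

lemma At_X: "At X = type_I \<mu> (Pi_ix X)"
  using mfac_pos[of X] by (auto simp: At_def fun_eq_iff)

lemma msize_Pi: "msize (Pi_ix Y) \<ge> 2"
  using Pi_ix_pos[of Y I1] Pi_ix_pos[of Y I2] by (simp add: msize_def)

text \<open>The factors \<open>mfac\<close> symmetrise the type I recurrence into the eigenvalue
  equation of the Jacobi operator. On the subtree of \<open>X\<close> the missing parent leaves
  \<open>AZ\<close> as a source term at \<open>X\<close>.\<close>

lemma At_recurrence: assumes Y: "Y \<in> subtree X"
  shows "[:0, 1:] * At Y k = smult (potV \<mu> \<kappa> Y) (At Y k)
     + (if Y = X then AZ k else smult (sqrt (potW \<mu> Y)) (At (parent Y) k))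
     + (\<Sum>i\<in>{I1, I2}. smult (sqrt (potW \<mu> (Child Y i))) (At (Child Y i) k))"
proof -
  define c where "c = mfac \<mu> X / mfac \<mu> Y"
  have ch: "smult (sqrt (potW \<mu> (Child Y i))) (At (Child Y i) k) = smult (c * aa (Pi_ix Y) i) (type_I \<mu> (inc (Pi_ix Y) i) k)" for i
  proof -
    have p: "potW \<mu> (Child Y i) > 0" by (rule potW_pos)
    have "sqrt (potW \<mu> (Child Y i)) * (mfac \<mu> X / mfac \<mu> (Child Y i)) = c * (sqrt (potW \<mu> (Child Y i)) * sqrt (potW \<mu> (Child Y i)))"
      unfolding mfac_Child c_def using mfac_pos[of Y] by (simp del: potW.simps)
    also have "\<dots> = c * aa (Pi_ix Y) i" using p by (simp add: rec_ab)
    finally show ?thesis by (simp add: At_def del: potW.simps)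
  qed
  have base: "[:0, 1:] * type_I \<mu> (Pi_ix Y) k = smult (potV \<mu> \<kappa> Y) (type_I \<mu> (Pi_ix Y) k)
     + (case Y of Root \<Rightarrow> smult (\<kappa> I1) (type_I \<mu> (unit_ix I2) k) + smult (\<kappa> I2) (type_I \<mu> (unit_ix I1) k)
        | Child Z i \<Rightarrow> type_I \<mu> (Pi_ix Z) k)
     + (\<Sum>i\<in>{I1, I2}. smult (aa (Pi_ix Y) i) (type_I \<mu> (inc (Pi_ix Y) i) k))"
  proof (cases Y)
    case Root
    \<comment> \<open>The index (1,1) is the successor of both (0,1) and (1,0). The
      \<kappa>-weighted mean of the two recurrences produces the potential at the root and its
      virtual parent.\<close>
    have P: "Pi_ix Root = inc (unit_ix I2) I1" "Pi_ix Root = inc (unit_ix I1) I2"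
      by (auto simp: fun_eq_iff unit_ix_def inc_def split: if_splits) (metis ix.exhaust)+
    have sz: "msize (unit_ix i) > 0" for i by (simp add: unit_ix_def)
    define s where "s = (\<Sum>i\<in>{I1, I2}. smult (aa (Pi_ix Root) i) (type_I \<mu> (inc (Pi_ix Root) i) k))"
    define A where "A = type_I \<mu> (Pi_ix Root) k"
    have r1: "[:0, 1:] * A = type_I \<mu> (unit_ix I2) k + smult (bb (unit_ix I2) I1) A + s"
      unfolding A_def s_def by (rule type_I_recurrence[OF sz P(1)])
    have r2: "[:0, 1:] * A = type_I \<mu> (unit_ix I1) k + smult (bb (unit_ix I1) I2) A + s"
      unfolding A_def s_def by (rule type_I_recurrence[OF sz P(2)])
    have "[:0, 1:] * A = smult (\<kappa> I1) ([:0, 1:] * A) + smult (\<kappa> I2) ([:0, 1:] * A)"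
      unfolding smult_add_left[symmetric] kappa by simp
    also have "\<dots> = smult (\<kappa> I1) (type_I \<mu> (unit_ix I2) k + smult (bb (unit_ix I2) I1) A + s)
        + smult (\<kappa> I2) (type_I \<mu> (unit_ix I1) k + smult (bb (unit_ix I1) I2) A + s)"
      by (subst r1, subst r2) (rule refl)
    also have "\<dots> = smult (potV \<mu> \<kappa> Root) A + (smult (\<kappa> I1) (type_I \<mu> (unit_ix I2) k) + smult (\<kappa> I2) (type_I \<mu> (unit_ix I1) k))
        + (smult (\<kappa> I1) s + smult (\<kappa> I2) s)"
      by (simp add: rec_ab smult_add_right smult_add_left)
    also have "smult (\<kappa> I1) s + smult (\<kappa> I2) s = s" unfolding smult_add_left[symmetric] kappa by simp
    finally show ?thesis unfolding Root A_def s_def by simp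
  next
    case (Child Z i)
    have "msize (Pi_ix Z) > 0" using msize_Pi[of Z] by simp
    from type_I_recurrence[OF this, of "Pi_ix Y" i k] show ?thesis
      by (simp add: Child rec_ab algebra_simps)
  qed
  have par: "smult c (case Y of Root \<Rightarrow> smult (\<kappa> I1) (type_I \<mu> (unit_ix I2) k) + smult (\<kappa> I2) (type_I \<mu> (unit_ix I1) k)
        | Child Z i \<Rightarrow> type_I \<mu> (Pi_ix Z) k) = (if Y = X then AZ k else smult (sqrt (potW \<mu> Y)) (At (parent Y) k))"
  proof (cases "Y = X")
    case True
    then have "c = 1" using mfac_pos[of X] by (simp add: c_def)
    then show ?thesis using True unfolding AZ_def by (cases X) simp_all
  next
    case False
    then obtain Z i where Z: "Y = Child Z i" using subtree_cases[OF Y] by blast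
    have p: "potW \<mu> Y > 0" by (rule potW_pos)
    have "c = sqrt (potW \<mu> Y) * (mfac \<mu> X / mfac \<mu> Z)"
      unfolding c_def Z mfac_Child by simp
    then show ?thesis using False Z by (simp add: At_def del: potW.simps)
  qed
  have "[:0, 1:] * At Y k = smult c ([:0, 1:] * type_I \<mu> (Pi_ix Y) k)" unfolding At_def c_def[symmetric] by (simp only: mult_smult_right)
  also have "\<dots> = smult (potV \<mu> \<kappa> Y) (At Y k)
     + (if Y = X then AZ k else smult (sqrt (potW \<mu> Y)) (At (parent Y) k))
     + (\<Sum>i\<in>{I1, I2}. smult (c * aa (Pi_ix Y) i) (type_I \<mu> (inc (Pi_ix Y) i) k))"
    unfolding par[symmetric] unfolding base At_def c_def[symmetric] by (simp add: smult_add_right mult.commute)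
  finally show ?thesis unfolding ch .
qed

text \<open>The Jacobi operator on real functions that are not cut off outside the subtree;
  \<open>emb\<close> performs the cut.\<close>

definition jr :: "(vertex \<Rightarrow> real) \<Rightarrow> vertex \<Rightarrow> real" where
  "jr g Y = potV \<mu> \<kappa> Y * g Y + (if Y = X then 0 else sqrt (potW \<mu> Y) * g (parent Y))
     + (\<Sum>i\<in>{I1, I2}. sqrt (potW \<mu> (Child Y i)) * g (Child Y i))"

definition emb :: "(vertex \<Rightarrow> real) \<Rightarrow> vertex \<Rightarrow> complex" where
  "emb g Y = (if Y \<in> subtree X then of_real (g Y) else 0)"

lemma jacobi_emb: "jacobi \<mu> \<kappa> X (emb g) = emb (jr g)"
proof
  fix Y
  show "jacobi \<mu> \<kappa> X (emb g) Y = emb (jr g) Y"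
  proof (cases "Y \<in> subtree X")
    case True
    have ch: "emb g (Child Y i) = of_real (g (Child Y i))" for i using True by (simp add: emb_def subtree.child)
    have "at_parent (emb g) Y = of_real (g (parent Y))" if ne: "Y \<noteq> X"
    proof -
      obtain Z i where "Y = Child Z i" "Z \<in> subtree X" using subtree_cases[OF True] ne by blast
      then show ?thesis by (simp add: emb_def)
    qed
    then show ?thesis using True by (simp add: jacobi_def emb_def[of _ Y] jr_def ch del: potW.simps)
  qed (simp add: jacobi_def emb_def)
qed

lemma QI_step: assumes Y: "Y \<in> subtree X"
  shows "QI (At Y) ([:0, 1:] * p) = jr (\<lambda>Y. QI (At Y) p) Y + (if Y = X then QI AZ p else 0)"
proof -
  have "QI (At Y) ([:0, 1:] * p) = QI (\<lambda>k. [:0, 1:] * At Y k) p" by (rule QI_mult_left[symmetric])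
  also have "\<dots> = QI (\<lambda>k. smult (potV \<mu> \<kappa> Y) (At Y k)
     + (if Y = X then AZ k else smult (sqrt (potW \<mu> Y)) (At (parent Y) k))
     + (smult (sqrt (potW \<mu> (Child Y I1))) (At (Child Y I1) k) + smult (sqrt (potW \<mu> (Child Y I2))) (At (Child Y I2) k))) p"
    unfolding At_recurrence[OF Y] by (simp del: potW.simps)
  also have "\<dots> = jr (\<lambda>Y. QI (At Y) p) Y + (if Y = X then QI AZ p else 0)"
    unfolding QI_add_left QI_smult_left by (simp add: jr_def QI_smult_left[of _ "At (parent Y)"] del: potW.simps)
  finally show ?thesis .
qed

text \<open>Every index on the tree has size at least 2, so constants are orthogonal to the forms;
  the constant term of a polynomial therefore drops out of the inductions.\<close>

lemma QI_At_const: "QI (At Y) [:c:] = 0"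
proof -
  have "QI (type_I \<mu> (Pi_ix Y)) (monom 1 0) = 0" using msize_Pi[of Y] by (subst QI_type_I_monom) auto
  moreover have "[:c:] = smult c (monom 1 0)" by (simp add: monom_0)
  ultimately show ?thesis unfolding At_def QI_smult_left by (simp only: QI_smult mult_zero_right)
qed

abbreviation "rp \<equiv> map_poly complex_of_real"

lemma rp_pCons: "rp (pCons a p) = pCons (of_real a) (rp p)"
  by (simp add: map_poly_pCons)

lemma kd_emb: "(\<lambda>v. of_real c * kdelta X v + emb g v) = emb (\<lambda>Y. g Y + (if Y = X then c else 0))"
  by (auto simp: emb_def kdelta_def fun_eq_iff intro: subtree.self)

text \<open>Under \<open>p \<mapsto> a + x p\<close> the left side gains the source
  \<open>QI AZ p\<close> at \<open>X\<close> by \<open>GP_pCons\<close>, and the right side gains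
  the same source by the recurrence of the forms.\<close>

lemma U_parent_form: "U (rp (GP AZ p)) = emb (\<lambda>Y. QI (At Y) p)"
proof (induct p)
  case 0
  show ?case by (simp add: emb_def fun_eq_iff)
next
  case (pCons a p)
  have "U (rp (GP AZ (pCons a p))) = emb (\<lambda>Y. jr (\<lambda>Y. QI (At Y) p) Y + (if Y = X then QI AZ p else 0))"
    unfolding GP_pCons rp_pCons U_pCons pCons(2) jacobi_emb kd_emb ..
  also have "\<dots> = emb (\<lambda>Y. QI (At Y) (pCons a p))"
  proof
    fix Y
    have "pCons a p = [:a:] + [:0, 1:] * p" by simp
    then have "QI (At Y) (pCons a p) = QI (At Y) ([:0, 1:] * p)" by (simp only: QI_add QI_At_const add_0_left)
    then show "emb (\<lambda>Y. jr (\<lambda>Y. QI (At Y) p) Y + (if Y = X then QI AZ p else 0)) Y = emb (\<lambda>Y. QI (At Y) (pCons a p)) Y"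
      by (cases "Y \<in> subtree X") (simp_all only: emb_def if_True if_False QI_step)
  qed
  finally show ?case .
qed

lemma rho_int_poly: "integrable \<rho> (\<lambda>x. poly G x)"
  using bb.integrable_poly_mult[of "\<lambda>x. 1" G] by simp

lemma rho_U_X: "of_real (\<integral>x. poly G x \<partial>\<rho>) = U (rp G) X"
proof -
  have "U (rp G) X = inn (U (rp G)) (kdelta X)" by (simp add: ip_kdelta subtree.self)
  also have "\<dots> = (\<integral>x. of_real (poly G x) \<partial>\<rho>)" by (simp add: inn_U_kd)
  finally show ?thesis by simp
qed

lemma integral_parent_form: "(\<integral>x. poly (GP AZ p) x \<partial>\<rho>) = QI (At X) p"
proof -
  have "complex_of_real (\<integral>x. poly (GP AZ p) x \<partial>\<rho>) = of_real (QI (At X) p)"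
    unfolding rho_U_X U_parent_form by (simp add: emb_def subtree.self)
  then show ?thesis using of_real_eq_iff by blast
qed

text \<open>The same induction, now with source \<open>QI (At X) p\<close> on the left. On the right
  the recurrence contributes the \<rho>-integral of \<open>GP AZ p\<close>, and the two agree by
  \<open>integral_parent_form\<close>.\<close>

lemma U_root_form: "U (rp (GP (At X) p)) = emb (\<lambda>Y. \<integral>x. poly (GP (At Y) p) x \<partial>\<rho>)"
proof (induct p)
  case 0
  show ?case by (simp add: emb_def fun_eq_iff)
next
  case (pCons a p)
  define r where "r Y = (\<integral>x. poly (GP (At Y) p) x \<partial>\<rho>)" for Y
  have "U (rp (GP (At X) (pCons a p))) = emb (\<lambda>Y. jr r Y + (if Y = X then QI (At X) p else 0))"
    unfolding GP_pCons rp_pCons U_pCons pCons(2) jacobi_emb kd_emb r_def[abs_def] ..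
  also have "\<dots> = emb (\<lambda>Y. \<integral>x. poly (GP (At Y) (pCons a p)) x \<partial>\<rho>)"
  proof
    fix Y
    show "emb (\<lambda>Y. jr r Y + (if Y = X then QI (At X) p else 0)) Y = emb (\<lambda>Y. \<integral>x. poly (GP (At Y) (pCons a p)) x \<partial>\<rho>) Y"
    proof (cases "Y \<in> subtree X")
      case True
      have "poly (GP (At Y) (pCons a p)) x = jr (\<lambda>Y. poly (GP (At Y) p) x) Y + (if Y = X then poly (GP AZ p) x else 0)" for x
      proof -
        have "pCons (poly p x) (synthetic_div p x) = [:poly p x:] + [:0, 1:] * synthetic_div p x" by simp
        then show ?thesis unfolding poly_GP synthetic_div_pCons using QI_step[OF True, of "synthetic_div p x"]
          by (simp only: QI_add QI_At_const add_0_left)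
      qed
      then have "(\<integral>x. poly (GP (At Y) (pCons a p)) x \<partial>\<rho>)
        = (\<integral>x. jr (\<lambda>Y. poly (GP (At Y) p) x) Y + (if Y = X then poly (GP AZ p) x else 0) \<partial>\<rho>)" by simp
      also have "\<dots> = (\<integral>x. jr (\<lambda>Y. poly (GP (At Y) p) x) Y \<partial>\<rho>) + (if Y = X then QI (At X) p else 0)"
      proof (subst Bochner_Integration.integral_add)
        show "integrable \<rho> (\<lambda>x. jr (\<lambda>Y. poly (GP (At Y) p) x) Y)"
          unfolding jr_def by (cases "Y = X")
            (auto intro!: Bochner_Integration.integrable_add integrable_mult_right rho_int_poly simp del: potW.simps)
        show "integrable \<rho> (\<lambda>x. if Y = X then poly (GP AZ p) x else 0)"
          by (cases "Y = X") (auto intro: rho_int_poly)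
      qed (cases "Y = X"; simp add: integral_parent_form)
      also have "(\<integral>x. jr (\<lambda>Y. poly (GP (At Y) p) x) Y \<partial>\<rho>) = jr r Y"
        unfolding jr_def r_def using rho_int_poly by (cases "Y = X") (simp_all del: potW.simps)
      finally show ?thesis by (simp add: emb_def)
    qed (simp add: emb_def)
  qed
  finally show ?case unfolding r_def .
qed

end

subsection \<open>Pointwise form of the kernel\<close>

text \<open>Multiplying by \<open>t - x\<close> shows that all occurrences of \<open>f t\<close>
  cancel. No divided difference of \<open>f\<close> survives, so on its own interval the limit in
  \<open>f\<close> requires no vanishing.\<close>

lemma synthetic_div_bracket:
  fixes f a b :: "real poly"
  shows "synthetic_div (f * a) x * b - synthetic_div (f * b) x * a
    = smult (poly f x) (smult (poly b x) (synthetic_div a x) - smult (poly a x) (synthetic_div b x))"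
proof -
  have s: "(t - x) * poly (synthetic_div p x) t = poly p t - poly p x" for p t
    by (rule synthetic_div_eq)
  have "[:-x, 1:] * (synthetic_div (f * a) x * b - synthetic_div (f * b) x * a)
    = [:-x, 1:] * smult (poly f x) (smult (poly b x) (synthetic_div a x) - smult (poly a x) (synthetic_div b x))"
  proof (subst poly_eq_poly_eq_iff[symmetric], rule ext)
    fix t
    have "poly ([:-x, 1:] * (synthetic_div (f * a) x * b - synthetic_div (f * b) x * a)) t
      = ((t - x) * poly (synthetic_div (f * a) x) t) * poly b t - ((t - x) * poly (synthetic_div (f * b) x) t) * poly a t"
      by (simp add: algebra_simps)
    also have "\<dots> = poly f x * (poly b x * ((t - x) * poly (synthetic_div a x) t) - poly a x * ((t - x) * poly (synthetic_div b x) t))"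
      unfolding s by (simp add: algebra_simps)
    also have "\<dots> = poly ([:-x, 1:] * smult (poly f x) (smult (poly b x) (synthetic_div a x) - smult (poly a x) (synthetic_div b x))) t"
      by (simp add: algebra_simps)
    finally show "poly ([:-x, 1:] * (synthetic_div (f * a) x * b - synthetic_div (f * b) x * a)) t
      = poly ([:-x, 1:] * smult (poly f x) (smult (poly b x) (synthetic_div a x) - smult (poly a x) (synthetic_div b x))) t" .
  qed
  then show ?thesis by (subst (asm) mult_left_cancel) auto
qed

lemma max_sq_deriv: "((\<lambda>y. (max 0 y)\<^sup>2) has_real_derivative 2 * max 0 y) (at (y::real))"
proof -
  consider "y > 0" | "y < 0" | "y = 0" by linarith
  then show ?thesis
  proof cases
    case 1
    have "((\<lambda>y. y\<^sup>2) has_real_derivative 2 * y) (at y)" by (auto intro!: derivative_eq_intros)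
    moreover have "\<forall>\<^sub>F z in nhds y. z\<^sup>2 = (max 0 z)\<^sup>2"
      using eventually_nhds_in_open[of "{0<..}" y] 1 by (auto elim!: eventually_mono)
    ultimately show ?thesis using DERIV_cong_ev[OF refl, of "\<lambda>y. y\<^sup>2" "\<lambda>y. (max 0 y)\<^sup>2" y "2 * y" "2 * y"] 1 by simp
  next
    case 2
    have "((\<lambda>y. 0) has_real_derivative 0) (at y)" by simp
    moreover have "\<forall>\<^sub>F z in nhds y. 0 = (max 0 z)\<^sup>2"
      using eventually_nhds_in_open[of "{..<0}" y] 2 by (auto elim!: eventually_mono)
    ultimately show ?thesis using DERIV_cong_ev[OF refl, of "\<lambda>y. 0" "\<lambda>y. (max 0 y)\<^sup>2" y 0 0] 2 by simp
  next
    case 3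
    have "((\<lambda>z::real. (max 0 z)\<^sup>2 / z) \<longlongrightarrow> 0) (at 0)"
    proof (rule Lim_null_comparison)
      show "\<forall>\<^sub>F z in at 0. norm ((max 0 z)\<^sup>2 / z) \<le> \<bar>z\<bar>"
        by (rule always_eventually) (auto simp: max_def power2_eq_square)
      show "((\<lambda>z::real. \<bar>z\<bar>) \<longlongrightarrow> 0) (at 0)" using tendsto_rabs_zero[OF tendsto_ident_at] .
    qed
    then show ?thesis using 3 by (simp add: has_field_derivative_iff)
  qed
qed

section \<open>Test functions vanishing on the intervals\<close>

context angelesco_system
begin

text \<open>A C1 function whose zero set is exactly \<Delta>_k; squaring the positive parts makes
  the derivative vanish at the endpoints too.\<close>

definition sq :: "ix \<Rightarrow> real \<Rightarrow> real" where
  "sq k x = (max 0 (lo k - x))\<^sup>2 + (max 0 (x - hi k))\<^sup>2"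

definition sq' :: "ix \<Rightarrow> real \<Rightarrow> real" where
  "sq' k x = - (2 * max 0 (lo k - x)) + 2 * max 0 (x - hi k)"

lemma sq_deriv: "(sq k has_real_derivative sq' k x) (at x)"
proof -
  have "((\<lambda>x. (max 0 (lo k - x))\<^sup>2) has_real_derivative (2 * max 0 (lo k - x)) * (- 1)) (at x)"
    by (rule DERIV_chain2[OF max_sq_deriv]) (auto intro!: derivative_eq_intros)
  moreover have "((\<lambda>x. (max 0 (x - hi k))\<^sup>2) has_real_derivative (2 * max 0 (x - hi k)) * 1) (at x)"
    by (rule DERIV_chain2[OF max_sq_deriv]) (auto intro!: derivative_eq_intros)
  ultimately show ?thesis unfolding sq_def[abs_def] sq'_def using DERIV_add by fastforce
qed

lemma sq_cont: "continuous_on UNIV (sq k)" "continuous_on UNIV (sq' k)"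
  unfolding sq_def[abs_def] sq'_def[abs_def] by (intro continuous_intros)+

lemma sq_zero_iff: "sq k x = 0 \<longleftrightarrow> x \<in> Delta \<mu> k"
  by (auto simp: sq_def Delta_props max_def add_nonneg_eq_0_iff)

lemma sq'_zero: "x \<in> Delta \<mu> k \<Longrightarrow> sq' k x = 0"
  by (auto simp: sq'_def Delta_props max_def)

text \<open>The form \<mu>_k itself, so that \<open>QI\<close> and \<open>GP\<close> can be
  restricted to one measure.\<close>

definition ek :: "ix \<Rightarrow> ix \<Rightarrow> real poly" where "ek k j = (if j = k then 1 else 0)"

lemma QI_ek: "QI (ek k) p = (\<integral>x. poly p x \<partial>\<mu> k)"
  unfolding QI_def by (cases k) (auto simp: ek_def)

end

section \<open>From polynomial identities to pointwise identities\<close>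

context tree_system
begin

text \<open>Large enough for both intervals and for the support of \<rho>.\<close>

definition Rr :: real where
  "Rr = Cop + 1 + \<bar>lo I1\<bar> + \<bar>hi I1\<bar> + \<bar>lo I2\<bar> + \<bar>hi I2\<bar>"

lemma Delta_Rr: "Delta \<mu> k \<subseteq> {-Rr..Rr}"
  using C_nonneg by (cases k) (auto simp: Rr_def Delta_props)

lemma Rr_pos: "0 < Rr"
  using C_nonneg by (simp add: Rr_def)

sublocale rr: bounded_borel \<rho> Rr
proof -
  interpret finite_measure \<rho> by (rule fin_rho)
  show "bounded_borel \<rho> Rr"
  proof
    show "sets \<rho> = sets borel" by (rule sets_rho)
    show "0 < Rr" by (rule Rr_pos)
    show "AE x in \<rho>. \<bar>x\<bar> \<le> Rr" using bb.AE_R by eventually_elim (simp add: Rr_def)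
  qed
qed

lemma mu_bounded: "bounded_borel (\<mu> k) Rr"
proof -
  interpret finite_measure "\<mu> k" by (rule fin_mu)
  show ?thesis
  proof
    show "sets (\<mu> k) = sets borel" by (rule sets_mu)
    show "0 < Rr" by (rule Rr_pos)
    show "AE x in \<mu> k. \<bar>x\<bar> \<le> Rr" using AE_Delta by eventually_elim (use Delta_Rr in force)
  qed
qed

lemma mu_limit_zero:
  assumes C1: "C1_conv Rr f F F'" and z: "\<And>x. x \<in> Delta \<mu> k \<Longrightarrow> F x = 0" and Fm: "F \<in> borel_measurable borel"
  shows "(\<lambda>n. \<integral>x. poly (f n) x * poly w x \<partial>\<mu> k) \<longlonglongrightarrow> 0"
proof -
  interpret m: bounded_borel "\<mu> k" Rr by (rule mu_bounded)
  have i: "integrable (\<mu> k) (\<lambda>x. complex_of_real (poly w x))" using cm_integrable[OF cm_poly] by simp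
  have "(\<lambda>n. \<integral>x. of_real (poly (f n) x) * of_real (poly w x) \<partial>\<mu> k) \<longlonglongrightarrow> (\<integral>x. of_real (F x) * complex_of_real (poly w x) \<partial>\<mu> k)"
    by (rule m.uniform_limit_integral(2)[OF i _ Fm]) (use C1 in \<open>simp add: C1_conv_def\<close>)
  moreover have "(\<integral>x. of_real (F x) * complex_of_real (poly w x) \<partial>\<mu> k) = 0"
    by (rule integral_eq_zero_AE) (use AE_Delta[of k] z in \<open>auto elim!: eventually_mono\<close>)
  ultimately have "(\<lambda>n. complex_of_real (\<integral>x. poly (f n) x * poly w x \<partial>\<mu> k)) \<longlonglongrightarrow> of_real 0"
    by (simp flip: of_real_mult)
  then show ?thesis by (simp only: tendsto_of_real_iff)
qed

text \<open>The Wronskian combination of the two polynomial identities, with test polynomial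
  \<open>f\<close>.\<close>

definition BR :: "ix \<Rightarrow> (ix \<Rightarrow> real poly) \<Rightarrow> real poly \<Rightarrow> real poly" where
  "BR k A f = GP AZ (f * A k) - GP A (f * AZ k)"

definition wrp :: "ix \<Rightarrow> (ix \<Rightarrow> real poly) \<Rightarrow> real poly" where
  "wrp k A = AZ k * GP (ek k) (A k) - A k * GP (ek k) (AZ k)"

text \<open>Formally this is \<open>A k\<close> times the function of the second kind of
  \<open>AZ\<close>, minus \<open>AZ k\<close> times that of \<open>A\<close>. The transforms of
  \<mu>_k cancel, which leaves the polynomial \<open>wrp\<close>. For \<open>A = At Y\<close> it is
  the numerator of \<Psi> on \<Delta>_k.\<close>

definition Dk :: "ix \<Rightarrow> (ix \<Rightarrow> real poly) \<Rightarrow> real \<Rightarrow> real" where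
  "Dk k A x = poly (wrp k A) x + poly (A k) x * cau (other k) (AZ (other k)) x
     - poly (AZ k) x * cau (other k) (A (other k)) x"

lemma poly_BR:
  "poly (BR k A f) x = poly f x * poly (wrp k A) x
    + ((\<integral>t. poly (synthetic_div (f * A k) x) t * poly (AZ (other k)) t \<partial>\<mu> (other k))
      - (\<integral>t. poly (synthetic_div (f * AZ k) x) t * poly (A (other k)) t \<partial>\<mu> (other k)))"
proof -
  have "(\<integral>t. poly (synthetic_div (f * A k) x) t * poly (AZ k) t \<partial>\<mu> k) - (\<integral>t. poly (synthetic_div (f * AZ k) x) t * poly (A k) t \<partial>\<mu> k)
     = QI (ek k) (synthetic_div (f * A k) x * AZ k - synthetic_div (f * AZ k) x * A k)"
    unfolding QI_diff QI_ek poly_mult ..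
  also have "\<dots> = poly f x * poly (wrp k A) x"
    unfolding synthetic_div_bracket QI_smult QI_diff wrp_def poly_diff poly_mult poly_GP ..
  finally have own: "(\<integral>t. poly (synthetic_div (f * A k) x) t * poly (AZ k) t \<partial>\<mu> k)
     - (\<integral>t. poly (synthetic_div (f * AZ k) x) t * poly (A k) t \<partial>\<mu> k) = poly f x * poly (wrp k A) x" .
  show ?thesis
    unfolding BR_def poly_diff poly_GP QI_def ix_sum_other[of _ k] own[symmetric] by simp
qed

lemma BR_limit:
  assumes C1: "C1_conv Rr f F F'"
    and zero: "\<And>t. t \<in> Delta \<mu> (other k) \<Longrightarrow> F t = 0" "\<And>t. t \<in> Delta \<mu> (other k) \<Longrightarrow> F' t = 0"
  shows "uniform_limit {-Rr..Rr} (\<lambda>n x. poly (BR k A (f n)) x) (\<lambda>x. F x * Dk k A x) sequentially"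
proof -
  have l: "uniform_limit {-Rr..Rr} (\<lambda>n x. \<integral>t. poly (synthetic_div (f n * p) x) t * poly B t \<partial>\<mu> (other k))
      (\<lambda>x. (F x * poly p x) * cau (other k) B x) sequentially" for p B
    by (rule divided_difference_limit[OF C1_conv_mult[OF C1] Delta_Rr]) (use zero in auto)
  have "uniform_limit {-Rr..Rr} (\<lambda>n x. poly (f n) x * poly (wrp k A) x) (\<lambda>x. F x * poly (wrp k A) x) sequentially"
    by (rule uniform_limit_mult_poly) (use C1 in \<open>simp add: C1_conv_def\<close>)
  from uniform_limit_add[OF this uniform_limit_minus[OF l[of "A k" "AZ (other k)"] l[of "AZ k" "A (other k)"]]]
  show ?thesis unfolding poly_BR by (simp add: Dk_def algebra_simps)
qed

lemma psi_poly: "Y \<in> subtree X \<Longrightarrow> (\<integral>x. of_real (poly G x) * psi Y x \<partial>\<rho>) = U (rp G) Y"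
  using psi_U[of Y "rp G"] by simp

text \<open>The integrals of \<open>GP (At Y) (f * AZ k)\<close> produced by the two identities
  cancel. In what remains the integrals over \<mu>_k cancel as well; the leftover over the other
  measure disappears for test functions vanishing on its interval.\<close>

lemma BR_identity:
  assumes Y: "Y \<in> subtree X"
  shows "(\<integral>x. of_real (poly (BR k (At X) f) x) * psi Y x \<partial>\<rho>) - of_real (\<integral>x. poly (BR k (At Y) f) x \<partial>\<rho>)
    = of_real (\<integral>x. poly f x * poly (At X k * At Y (other k) - At Y k * At X (other k)) x \<partial>\<mu> (other k))"
proof -
  have U: "U (rp (p - q)) Y = U (rp p) Y - U (rp q) Y" for p q
  proof -
    have "rp (p - q) = rp p - rp q" by (rule poly_eqI) (simp add: coeff_map_poly)
    then show ?thesis by (simp add: U_diff)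
  qed
  have i1: "U (rp (GP AZ p)) Y = of_real (QI (At Y) p)" for p using Y by (simp add: U_parent_form emb_def)
  have i3: "U (rp (GP (At X) p)) Y = of_real (\<integral>x. poly (GP (At Y) p) x \<partial>\<rho>)" for p using Y by (simp add: U_root_form emb_def)
  have e1: "(\<integral>x. of_real (poly (BR k (At X) f) x) * psi Y x \<partial>\<rho>) = of_real (QI (At Y) (f * At X k)) - of_real (\<integral>x. poly (GP (At Y) (f * AZ k)) x \<partial>\<rho>)"
    unfolding psi_poly[OF Y] BR_def U i1 i3 ..
  have e2: "(\<integral>x. poly (BR k (At Y) f) x \<partial>\<rho>) = QI (At X) (f * At Y k) - (\<integral>x. poly (GP (At Y) (f * AZ k)) x \<partial>\<rho>)"
    unfolding BR_def poly_diff by (subst Bochner_Integration.integral_diff[OF rho_int_poly rho_int_poly]) (simp add: integral_parent_form)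
  have e3: "QI (At Y) (f * At X k) - QI (At X) (f * At Y k)
    = (\<integral>x. poly f x * poly (At X k * At Y (other k) - At Y k * At X (other k)) x \<partial>\<mu> (other k))"
  proof -
    have "(\<integral>x. poly (f * At X k) x * poly (At Y (other k)) x \<partial>\<mu> (other k)) - (\<integral>x. poly (f * At Y k) x * poly (At X (other k)) x \<partial>\<mu> (other k))
      = (\<integral>x. poly f x * poly (At X k * At Y (other k) - At Y k * At X (other k)) x \<partial>\<mu> (other k))"
      by (subst Bochner_Integration.integral_diff[OF int_pp int_pp, symmetric]) (simp add: algebra_simps)
    then show ?thesis unfolding QI_def ix_sum_other[of _ k] by (simp add: mult_ac)
  qed
  show ?thesis unfolding e1 e2 e3[symmetric] by simp
qed

lemma Dk_measurable: "Dk k A \<in> borel_measurable borel"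
proof -
  have [measurable]: "poly p \<in> borel_measurable borel" for p :: "real poly"
    by (auto intro!: borel_measurable_continuous_onI continuous_intros)
  have [measurable]: "cau j B \<in> borel_measurable borel" for j B by (rule cau_measurable)
  show ?thesis unfolding Dk_def[abs_def] by measurable
qed

lemma psi_integrable: "Y \<in> subtree X \<Longrightarrow> integrable \<rho> (psi Y)"
  by (rule rr.sqi_integrable[OF psi_sqi])

text \<open>Testing against a factor that vanishes to second order on the intervals where the forms are
  singular turns the formal identities into pointwise ones.\<close>

lemma AE_from_polynomial_identity:
  fixes s s' :: "real \<Rightarrow> real" and G H :: "real \<Rightarrow> real" and g e :: "real poly \<Rightarrow> real poly" and err :: "real poly \<Rightarrow> real"
  assumes Y: "Y \<in> subtree X"
    and s: "\<And>x. (s has_real_derivative s' x) (at x)" "continuous_on UNIV s'"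
    and lim: "\<And>f q. C1_conv Rr f (\<lambda>x. s x * poly q x) (\<lambda>x. s' x * poly q x + s x * poly (pderiv q) x) \<Longrightarrow>
        uniform_limit {-Rr..Rr} (\<lambda>n x. poly (g (f n)) x) (\<lambda>x. (s x * poly q x) * G x) sequentially
        \<and> uniform_limit {-Rr..Rr} (\<lambda>n x. poly (e (f n)) x) (\<lambda>x. (s x * poly q x) * H x) sequentially
        \<and> (\<lambda>n. err (f n)) \<longlonglongrightarrow> 0"
    and id: "\<And>f. (\<integral>x. of_real (poly (g f) x) * psi Y x \<partial>\<rho>) - of_real (\<integral>x. poly (e f) x \<partial>\<rho>) = of_real (err f)"
    and m: "G \<in> borel_measurable borel" "H \<in> borel_measurable borel"
  shows "AE x in \<rho>. s x \<noteq> 0 \<longrightarrow> of_real (G x) * psi Y x = of_real (H x)"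
proof -
  have sm[measurable]: "s \<in> borel_measurable borel"
    by (rule borel_measurable_continuous_onI) (use s(1) DERIV_isCont in \<open>auto intro!: continuous_at_imp_continuous_on\<close>)
  have pm[measurable]: "poly p \<in> borel_measurable borel" for p :: "real poly"
    by (auto intro!: borel_measurable_continuous_onI continuous_intros)
  note m[measurable]
  obtain f where f: "C1_conv Rr f s s'" by (rule C1_approx[OF Rr_pos s])
  define h where "h x = of_real (s x * G x) * psi Y x - of_real (s x * H x)" for x
  have key: "integrable \<rho> (\<lambda>x. of_real (s x * poly q x * G x) * psi Y x)
     \<and> integrable \<rho> (\<lambda>x. of_real (s x * poly q x * H x) * (1::complex))
     \<and> (\<integral>x. of_real (s x * poly q x * G x) * psi Y x \<partial>\<rho>) = (\<integral>x. of_real (s x * poly q x * H x) * 1 \<partial>\<rho>)" for q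
  proof -
    define fq where "fq n = f n * q" for n
    note L = lim[OF C1_conv_mult[OF f, of q]]
    have G1: "integrable \<rho> (\<lambda>x. of_real (s x * poly q x * G x) * psi Y x)"
      "(\<lambda>n. \<integral>x. of_real (poly (g (f n * q)) x) * psi Y x \<partial>\<rho>) \<longlonglongrightarrow> (\<integral>x. of_real (s x * poly q x * G x) * psi Y x \<partial>\<rho>)"
      using rr.uniform_limit_integral[OF psi_integrable[OF Y], of "\<lambda>n. g (f n * q)" "\<lambda>x. s x * poly q x * G x"] L by auto
    have one: "integrable \<rho> (\<lambda>x. 1 :: complex)" by simp
    have H1: "integrable \<rho> (\<lambda>x. of_real (s x * poly q x * H x) * (1 :: complex))"
      "(\<lambda>n. \<integral>x. of_real (poly (e (f n * q)) x) * 1 \<partial>\<rho>) \<longlonglongrightarrow> (\<integral>x. of_real (s x * poly q x * H x) * (1 :: complex) \<partial>\<rho>)"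
      using rr.uniform_limit_integral[OF one, of "\<lambda>n. e (f n * q)" "\<lambda>x. s x * poly q x * H x"] L by auto
    have "(\<lambda>n. complex_of_real (err (f n * q))) \<longlonglongrightarrow> of_real 0" using L by (intro tendsto_of_real) simp
    moreover have "complex_of_real (err (f n * q)) = (\<integral>x. of_real (poly (g (f n * q)) x) * psi Y x \<partial>\<rho>) - (\<integral>x. of_real (poly (e (f n * q)) x) * 1 \<partial>\<rho>)" for n
      using id[of "f n * q"] by simp
    ultimately have "(\<lambda>n. (\<integral>x. of_real (poly (g (f n * q)) x) * psi Y x \<partial>\<rho>) - (\<integral>x. of_real (poly (e (f n * q)) x) * 1 \<partial>\<rho>)) \<longlonglongrightarrow> 0"
      by simp
    from LIMSEQ_unique[OF tendsto_diff[OF G1(2) H1(2)] this] G1(1) H1(1) show ?thesis by simp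
  qed
  have "AE x in \<rho>. h x = 0"
  proof (rule rr.determinacy)
    show "integrable \<rho> h" unfolding h_def[abs_def]
      using key[of "[:1:]"] by (intro Bochner_Integration.integrable_diff) simp_all
    fix q
    have "(\<integral>x. of_real (poly q x) * h x \<partial>\<rho>) = (\<integral>x. of_real (s x * poly q x * G x) * psi Y x - of_real (s x * poly q x * H x) * 1 \<partial>\<rho>)"
      by (rule Bochner_Integration.integral_cong) (auto simp: h_def algebra_simps)
    also have "\<dots> = 0" using key[of q] by (subst Bochner_Integration.integral_diff) auto
    finally show "(\<integral>x. of_real (poly q x) * h x \<partial>\<rho>) = 0" .
  qed
  then show ?thesis
  proof eventually_elim
    case (elim x)
    then have "of_real (s x) * (of_real (G x) * psi Y x - of_real (H x)) = 0" by (simp add: h_def algebra_simps)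
    then show ?case by auto
  qed
qed

text \<open>The test function vanishes on the other interval only, so the conclusion covers
  \<Delta>_k itself.\<close>

lemma density_inside: assumes Y: "Y \<in> subtree X"
  shows "AE x in \<rho>. x \<notin> Delta \<mu> (other k) \<longrightarrow> of_real (Dk k (At X) x) * psi Y x = of_real (Dk k (At Y) x)"
proof -
  have "AE x in \<rho>. sq (other k) x \<noteq> 0 \<longrightarrow> of_real (Dk k (At X) x) * psi Y x = of_real (Dk k (At Y) x)"
  proof (rule AE_from_polynomial_identity[OF Y sq_deriv sq_cont(2) _ BR_identity[OF Y, of k] Dk_measurable Dk_measurable])
    fix f q
    assume C1: "C1_conv Rr f (\<lambda>x. sq (other k) x * poly q x) (\<lambda>x. sq' (other k) x * poly q x + sq (other k) x * poly (pderiv q) x)"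
    have z: "sq (other k) t * poly q t = 0" "sq' (other k) t * poly q t + sq (other k) t * poly (pderiv q) t = 0"
      if "t \<in> Delta \<mu> (other k)" for t using that by (simp_all add: sq'_zero sq_zero_iff)
    have "(\<lambda>x. sq (other k) x * poly q x) \<in> borel_measurable borel"
      by (intro borel_measurable_continuous_onI continuous_intros sq_cont(1))
    then show "uniform_limit {-Rr..Rr} (\<lambda>n x. poly (BR k (At X) (f n)) x) (\<lambda>x. (sq (other k) x * poly q x) * Dk k (At X) x) sequentially
        \<and> uniform_limit {-Rr..Rr} (\<lambda>n x. poly (BR k (At Y) (f n)) x) (\<lambda>x. (sq (other k) x * poly q x) * Dk k (At Y) x) sequentially
        \<and> (\<lambda>n. \<integral>x. poly (f n) x * poly (At X k * At Y (other k) - At Y k * At X (other k)) x \<partial>\<mu> (other k)) \<longlonglongrightarrow> 0"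
      by (intro conjI BR_limit[OF C1] mu_limit_zero[OF C1] z)
  qed
  then show ?thesis by (simp add: sq_zero_iff)
qed

section \<open>Points outside both intervals\<close>

definition LL :: "(ix \<Rightarrow> real poly) \<Rightarrow> real \<Rightarrow> real" where
  "LL A x = cau I1 (A I1) x + cau I2 (A I2) x"

lemma LL_measurable: "LL A \<in> borel_measurable borel"
proof -
  have [measurable]: "cau j B \<in> borel_measurable borel" for j B by (rule cau_measurable)
  show ?thesis unfolding LL_def[abs_def] by measurable
qed

definition s2 :: "real \<Rightarrow> real" where "s2 x = sq I1 x * sq I2 x"
definition s2' :: "real \<Rightarrow> real" where "s2' x = sq' I1 x * sq I2 x + sq' I2 x * sq I1 x"

lemma s2_props: "(s2 has_real_derivative s2' x) (at x)" "continuous_on UNIV s2'" "continuous_on UNIV s2"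
  "x \<in> Delta \<mu> k \<Longrightarrow> s2 x = 0" "x \<in> Delta \<mu> k \<Longrightarrow> s2' x = 0" "s2 x \<noteq> 0 \<longleftrightarrow> (\<forall>k. x \<notin> Delta \<mu> k)"
proof -
  show "(s2 has_real_derivative s2' x) (at x)" unfolding s2_def[abs_def] s2'_def by (rule DERIV_mult[OF sq_deriv sq_deriv])
  show "continuous_on UNIV s2'" "continuous_on UNIV s2" unfolding s2_def[abs_def] s2'_def[abs_def]
    by (intro continuous_intros sq_cont)+
  show "x \<in> Delta \<mu> k \<Longrightarrow> s2 x = 0" using sq_zero_iff[of k x] by (cases k) (auto simp: s2_def)
  show "x \<in> Delta \<mu> k \<Longrightarrow> s2' x = 0" using sq_zero_iff[of k x] sq'_zero[of x k] by (cases k) (auto simp: s2'_def)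
  show "s2 x \<noteq> 0 \<longleftrightarrow> (\<forall>k. x \<notin> Delta \<mu> k)" by (auto simp: s2_def sq_zero_iff ix_all)
qed

lemma s2_limits:
  assumes C1: "C1_conv Rr f (\<lambda>x. s2 x * poly q x) (\<lambda>x. s2' x * poly q x + s2 x * poly (pderiv q) x)"
  shows "uniform_limit {-Rr..Rr} (\<lambda>n x. poly (GP A (f n)) x) (\<lambda>x. (s2 x * poly q x) * LL A x) sequentially"
    "(\<lambda>n. QI A (f n)) \<longlonglongrightarrow> 0"
proof -
  have z: "s2 t * poly q t = 0" "s2' t * poly q t + s2 t * poly (pderiv q) t = 0" if "t \<in> Delta \<mu> k" for t k
    using s2_props(4,5)[OF that] by simp_all
  have "uniform_limit {-Rr..Rr} (\<lambda>n x. (\<integral>t. poly (synthetic_div (f n) x) t * poly (A I1) t \<partial>\<mu> I1) + (\<integral>t. poly (synthetic_div (f n) x) t * poly (A I2) t \<partial>\<mu> I2))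
    (\<lambda>x. (s2 x * poly q x) * cau I1 (A I1) x + (s2 x * poly q x) * cau I2 (A I2) x) sequentially"
    by (intro uniform_limit_add divided_difference_limit[OF C1 Delta_Rr] z)
  then show "uniform_limit {-Rr..Rr} (\<lambda>n x. poly (GP A (f n)) x) (\<lambda>x. (s2 x * poly q x) * LL A x) sequentially"
    by (simp add: poly_GP QI_def LL_def distrib_left)
  have m: "(\<lambda>x. s2 x * poly q x) \<in> borel_measurable borel"
    by (intro borel_measurable_continuous_onI continuous_intros s2_props(3))
  have "(\<lambda>n. (\<integral>x. poly (f n) x * poly (A I1) x \<partial>\<mu> I1) + (\<integral>x. poly (f n) x * poly (A I2) x \<partial>\<mu> I2)) \<longlonglongrightarrow> 0 + 0"
    by (intro tendsto_add mu_limit_zero[OF C1 z(1) m])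
  then show "(\<lambda>n. QI A (f n)) \<longlonglongrightarrow> 0" by (simp add: QI_def)
qed

text \<open>Both intervals are now excluded by the test function, so the identity of
  \<open>U_parent_form\<close> localises without a Wronskian and its right side tends to 0.\<close>

lemma density_outside1: assumes Y: "Y \<in> subtree X"
  shows "AE x in \<rho>. (\<forall>k. x \<notin> Delta \<mu> k) \<longrightarrow> of_real (LL AZ x) * psi Y x = 0"
proof -
  have "AE x in \<rho>. s2 x \<noteq> 0 \<longrightarrow> of_real (LL AZ x) * psi Y x = of_real ((\<lambda>x. 0) x)"
  proof (rule AE_from_polynomial_identity[OF Y s2_props(1,2), where g="GP AZ" and e="\<lambda>f. 0" and err="QI (At Y)"])
    show "(\<integral>x. of_real (poly (GP AZ f) x) * psi Y x \<partial>\<rho>) - of_real (\<integral>x. poly 0 x \<partial>\<rho>) = of_real (QI (At Y) f)" for f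
      using Y by (simp add: psi_poly U_parent_form emb_def)
    fix f q
    assume C1: "C1_conv Rr f (\<lambda>x. s2 x * poly q x) (\<lambda>x. s2' x * poly q x + s2 x * poly (pderiv q) x)"
    show "uniform_limit {-Rr..Rr} (\<lambda>n x. poly (GP AZ (f n)) x) (\<lambda>x. (s2 x * poly q x) * LL AZ x) sequentially
        \<and> uniform_limit {-Rr..Rr} (\<lambda>n x. poly 0 x) (\<lambda>x. (s2 x * poly q x) * 0) sequentially
        \<and> (\<lambda>n. QI (At Y) (f n)) \<longlonglongrightarrow> 0"
      using s2_limits[OF C1] by (auto intro: uniform_limit_const)
  qed (auto intro: LL_measurable)
  then show ?thesis by (simp add: s2_props(6))
qed

lemma density_outside2: assumes Y: "Y \<in> subtree X"
  shows "AE x in \<rho>. (\<forall>k. x \<notin> Delta \<mu> k) \<longrightarrow> of_real (LL (At X) x) * psi Y x = of_real (LL (At Y) x)"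
proof -
  have "AE x in \<rho>. s2 x \<noteq> 0 \<longrightarrow> of_real (LL (At X) x) * psi Y x = of_real (LL (At Y) x)"
  proof (rule AE_from_polynomial_identity[OF Y s2_props(1,2), where g="GP (At X)" and e="GP (At Y)" and err="\<lambda>f. 0"])
    show "(\<integral>x. of_real (poly (GP (At X) f) x) * psi Y x \<partial>\<rho>) - of_real (\<integral>x. poly (GP (At Y) f) x \<partial>\<rho>) = of_real 0" for f
      using Y by (simp add: psi_poly U_root_form emb_def)
  qed (auto intro: LL_measurable s2_limits)
  then show ?thesis by (simp add: s2_props(6))
qed

text \<open>The value of \<open>U p\<close> at \<open>X\<close> is its inner product with the root
  vector, hence the \<rho>-integral of \<open>p\<close>; determinacy concludes.\<close>

lemma psi_X: "AE x in \<rho>. psi X x = 1"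
proof -
  have X: "X \<in> subtree X" by (rule subtree.self)
  have "AE x in \<rho>. psi X x - 1 = 0"
  proof (rule rr.determinacy)
    show "integrable \<rho> (\<lambda>x. psi X x - 1)" using psi_integrable[OF X] by simp
    fix p
    have i: "integrable \<rho> (\<lambda>x. of_real (poly p x) * psi X x)"
      using sqi_mult_integrable[OF bb.sqi_poly[of "rp p"] psi_sqi[OF X]] by simp
    have "(\<integral>x. of_real (poly p x) * (psi X x - 1) \<partial>\<rho>) = (\<integral>x. of_real (poly p x) * psi X x - of_real (poly p x) \<partial>\<rho>)"
      by (simp add: algebra_simps)
    also have "\<dots> = U (rp p) X - of_real (\<integral>x. poly p x \<partial>\<rho>)"
      using rho_int_poly[of p] by (subst Bochner_Integration.integral_diff[OF i]) (auto simp: psi_poly[OF X])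
    finally show "(\<integral>x. of_real (poly p x) * (psi X x - 1) \<partial>\<rho>) = 0" by (simp add: rho_U_X)
  qed
  then show ?thesis by eventually_elim simp
qed

text \<open>With \<open>Y = X\<close> the kernel is 1, so off the intervals \<rho> sits on the zeros
  of the parent form.\<close>

lemma LL_AZ_zero: "AE x in \<rho>. (\<forall>k. x \<notin> Delta \<mu> k) \<longrightarrow> LL AZ x = 0"
  using density_outside1[OF subtree.self] psi_X by eventually_elim auto

end

subsection \<open>The explicit eigenfunctions\<close>

lemma synthetic_div_lincomb:
  "synthetic_div (smult u p + smult v q) x = smult u (synthetic_div p x) + smult v (synthetic_div q (x::real))"
proof -
  define sp where "sp = synthetic_div p x"
  define sq where "sq = synthetic_div q x"
  have p: "p = pCons (poly p x) sp - smult x sp" and q: "q = pCons (poly q x) sq - smult x sq"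
    using synthetic_div_correct[of p x] synthetic_div_correct[of q x] by (simp_all add: sp_def sq_def eq_diff_eq)
  have "(smult u p + smult v q) + smult x (smult u sp + smult v sq)
    = smult u (p + smult x sp) + smult v (q + smult x sq)"
    by (simp add: smult_add_right algebra_simps)
  also have "\<dots> = pCons (u * poly p x + v * poly q x) (smult u sp + smult v sq)"
    unfolding sp_def sq_def synthetic_div_correct by simp
  finally show ?thesis using synthetic_div_unique unfolding sp_def sq_def by metis
qed

section \<open>Evaluation of the forms\<close>

context angelesco_system
begin

lemma cauchy_cau: "cauchy (\<mu> k) x = cau k 1 x"
  by (simp add: cauchy_def cau_def)

lemma cau_integrable: "x \<notin> Delta \<mu> k \<Longrightarrow> integrable (\<mu> k) (\<lambda>t. poly B t / (x - t))"
proof -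
  assume x: "x \<notin> Delta \<mu> k"
  have "cm k (\<lambda>t. poly B t * (1 / (x - t)))" by (intro cm_mult cm_poly cm_inverse_shift x)
  from cm_integrable[OF this] show ?thesis by simp
qed

lemma cau_lincomb: assumes "x \<notin> Delta \<mu> k"
  shows "cau k (smult u A + smult v B) x = u * cau k A x + v * cau k B x"
proof -
  have "cau k (smult u A + smult v B) x = (\<integral>t. u * (poly A t / (x - t)) + v * (poly B t / (x - t)) \<partial>\<mu> k)"
    unfolding cau_def by (rule Bochner_Integration.integral_cong) (auto simp: add_divide_distrib)
  also have "\<dots> = u * cau k A x + v * cau k B x" unfolding cau_def
    by (subst Bochner_Integration.integral_add) (auto intro!: integrable_mult_right cau_integrable assms simp del: times_divide_eq_right)
  finally show ?thesis .
qed

lemma cau_smult: "cau k (smult u A) x = u * cau k A x"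
  unfolding cau_def poly_smult times_divide_eq_right[symmetric] by (rule integral_mult_right_zero)

text \<open>Splits \<open>B t\<close> into \<open>B x\<close> and a divided difference; this is how
  the Cauchy transforms of the weights and the polynomials A0 enter the formula for \<Psi>.\<close>

lemma cau_expand: assumes x: "x \<notin> Delta \<mu> k"
  shows "cau k B x = poly B x * cauchy (\<mu> k) x - QI (ek k) (synthetic_div B x)"
proof -
  have i1: "integrable (\<mu> k) (\<lambda>t. poly B x * (1 / (x - t)))"
    using cau_integrable[OF x, of 1] by (intro integrable_mult_right) simp
  have i2: "integrable (\<mu> k) (\<lambda>t. poly (synthetic_div B x) t)" by (intro cm_integrable cm_poly)
  have "cau k B x = (\<integral>t. poly B x * (1 / (x - t)) - poly (synthetic_div B x) t \<partial>\<mu> k)"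
    unfolding cau_def
  proof (rule integral_cong_AE)
    show "AE t in \<mu> k. poly B t / (x - t) = poly B x * (1 / (x - t)) - poly (synthetic_div B x) t"
      using AE_Delta
    proof eventually_elim
      case (elim t)
      then have "x - t \<noteq> 0" using x by auto
      moreover have "(t - x) * poly (synthetic_div B x) t = poly B t - poly B x" by (rule synthetic_div_eq)
      ultimately show ?case by (simp add: field_simps)
    qed
  qed (intro borel_measurable_integrable cau_integrable x Bochner_Integration.integrable_diff i1 i2)+
  also have "\<dots> = poly B x * (\<integral>t. 1 / (x - t) \<partial>\<mu> k) - (\<integral>t. poly (synthetic_div B x) t \<partial>\<mu> k)"
    unfolding Bochner_Integration.integral_diff[OF i1 i2] by (simp only: integral_mult_right_zero)
  finally show ?thesis by (simp add: QI_ek cauchy_def)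
qed

definition A0f :: "(ix \<Rightarrow> real poly) \<Rightarrow> real \<Rightarrow> real" where
  "A0f A x = (\<Sum>k\<in>{I1, I2}. QI (ek k) (synthetic_div (A k) x))"

lemma A0_A0f: "A0 \<mu> n x = A0f (type_I \<mu> n) x"
  unfolding A0_def A0f_def QI_ek by (simp only: synthetic_div_sym[of _ _ x])

lemma A0f_smult: "A0f (\<lambda>k. smult c (A k)) x = c * A0f A x"
proof -
  have "synthetic_div (smult c p) x = smult c (synthetic_div p x)" for p
    using synthetic_div_lincomb[of c p 0 0 x] by simp
  then show ?thesis by (simp add: A0f_def QI_smult distrib_left)
qed

lemma Lfun_cau: "Lfun \<mu> n x = cau I1 (type_I \<mu> n I1) x + cau I2 (type_I \<mu> n I2) x"
  by (simp add: Lfun_def cau_def)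

lemma mass_eq: "mass (\<mu> k) = (\<integral>x. 1 \<partial>\<mu> k)"
  using sets_eq_imp_space_eq[OF sets_mu, of k] by (simp add: mass_def)

lemma mass_pos: "mass (\<mu> k) > 0"
  unfolding mass_eq by (rule integral_pos) auto

lemma type_I_unit: "type_I \<mu> (unit_ix i) = (\<lambda>k. if k = i then [:1 / mass (\<mu> i):] else 0)"
proof (rule is_type_I_unique[OF type_I])
  have m: "mass (\<mu> i) > 0" for i by (rule mass_pos)
  have int: "(\<integral>x. 1 / mass (\<mu> i) \<partial>\<mu> i) = 1"
  proof -
    have "(\<integral>x. 1 / mass (\<mu> i) \<partial>\<mu> i) = (\<integral>x. (1 / mass (\<mu> i)) * 1 \<partial>\<mu> i)" by simp
    also have "\<dots> = (1 / mass (\<mu> i)) * mass (\<mu> i)" unfolding mass_eq by (rule integral_mult_right_zero)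
    finally show ?thesis using m[of i] by simp
  qed
  have sz: "msize (unit_ix i) = 1" by (simp add: unit_ix_def) (simp add: msize_def)
  show "is_type_I \<mu> (unit_ix i) (\<lambda>k. if k = i then [:1 / mass (\<mu> i):] else 0)"
    unfolding is_type_I_def sz
  proof (intro conjI allI impI)
    fix k j assume "unit_ix i k \<le> j"
    then show "coeff (if k = i then [:1 / mass (\<mu> i):] else 0) j = 0"
      by (cases j) (auto simp: unit_ix_def inc_apply)
  next
    fix m :: nat assume "m + 1 = 1"
    then show "(\<Sum>k\<in>{I1, I2}. \<integral>x. x ^ m * poly (if k = i then [:1 / mass (\<mu> i):] else 0) x \<partial>\<mu> k) = 1"
      using int unfolding ix_sum_other[of _ i] by simp
  qed simp
qed

text \<open>Both polynomials are constants solving a two by two system for the moments of order 0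
  and 1; solvability itself shows that \<open>Xi \<mu>\<close> is nonzero.\<close>

lemma type_I_11:
  "type_I \<mu> (\<lambda>_. 1) I1 = [:- 1 / (Xi \<mu> * mass (\<mu> I1)):]" "type_I \<mu> (\<lambda>_. 1) I2 = [:1 / (Xi \<mu> * mass (\<mu> I2)):]" "Xi \<mu> \<noteq> 0"
proof -
  define A where "A = type_I \<mu> (\<lambda>_. 1)"
  have "degree (A k) \<le> 0" for k
    using type_I_coeff[of "\<lambda>_. 1" k] by (intro degree_le) (auto simp: A_def)
  then have "degree (A k) = 0" for k by blast
  then have "\<exists>a. A k = [:a:]" for k by (metis degree_eq_zeroE)
  then obtain a where a: "\<And>k. A k = [:a k:]" by metis
  define m where "m k = mass (\<mu> k)" for k
  define t where "t k = (\<integral>x. x \<partial>\<mu> k)" for k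
  have mp: "m k > 0" for k unfolding m_def by (rule mass_pos)
  have sz: "msize (\<lambda>_. 1) = 2" by (simp add: msize_def)
  have "QI A (monom 1 0) = 0" "QI A (monom 1 1) = 1" using QI_type_I_monom[of 0 "\<lambda>_. 1"] QI_type_I_monom[of 1 "\<lambda>_. 1"] unfolding A_def sz by simp_all
  moreover have "QI A (monom 1 0) = a I1 * m I1 + a I2 * m I2"
    by (simp add: QI_def a m_def mass_eq monom_0 mult.commute)
  moreover have "QI A (monom 1 1) = a I1 * t I1 + a I2 * t I2"
    by (simp add: QI_def a t_def poly_monom mult.commute)
  ultimately have e: "a I1 * m I1 + a I2 * m I2 = 0" "a I1 * t I1 + a I2 * t I2 = 1" by auto
  have Xi: "Xi \<mu> = t I2 / m I2 - t I1 / m I1" by (simp add: Xi_def t_def m_def)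
  have am: "a I2 * m I2 = - (a I1 * m I1)" using e(1) by simp
  have "a I2 * m I2 * Xi \<mu> = a I2 * t I2 - (a I2 * m I2) * t I1 / m I1"
    unfolding Xi using mp[of I1] mp[of I2] by (simp add: field_simps)
  also have "\<dots> = 1" unfolding am using e(2) mp[of I1] by simp
  finally have x: "a I2 * m I2 * Xi \<mu> = 1" .
  then show "Xi \<mu> \<noteq> 0" by auto
  have "a I2 = 1 / (Xi \<mu> * m I2)" using x mp[of I2] \<open>Xi \<mu> \<noteq> 0\<close> by (simp add: field_simps)
  moreover have "a I1 = - 1 / (Xi \<mu> * m I1)"
  proof -
    have "a I1 * m I1 * Xi \<mu> = - 1" using x am by (simp add: algebra_simps)
    then show ?thesis using mp[of I1] \<open>Xi \<mu> \<noteq> 0\<close> by (simp add: field_simps)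
  qed
  ultimately show "type_I \<mu> (\<lambda>_. 1) I1 = [:- 1 / (Xi \<mu> * mass (\<mu> I1)):]" "type_I \<mu> (\<lambda>_. 1) I2 = [:1 / (Xi \<mu> * mass (\<mu> I2)):]"
    using a[of I1] a[of I2] by (simp_all add: A_def m_def)
qed

lemma Delta_measurable [measurable]: "Delta \<mu> k \<in> sets borel"
  by (simp add: Delta_props)

lemma A0_poly: "\<exists>p. \<forall>x. A0 \<mu> n x = poly p x"
  by (intro exI[of _ "GP (ek I1) (type_I \<mu> n I1) + GP (ek I2) (type_I \<mu> n I2)"])
    (simp add: A0_A0f A0f_def poly_GP)

end

section \<open>Nonvanishing denominators and identification of the kernel\<close>

context tree_system
begin

text \<open>The divided differences over \<mu>_k inside \<open>wrp\<close> and those split off the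
  other Cauchy integrals combine to \<open>A0f\<close>.\<close>

lemma Dk_alt: assumes x: "x \<notin> Delta \<mu> (other k)"
  shows "Dk k A x = poly (A k) x * (poly (AZ (other k)) x * cauchy (\<mu> (other k)) x - A0f AZ x)
     - poly (AZ k) x * (poly (A (other k)) x * cauchy (\<mu> (other k)) x - A0f A x)"
  unfolding Dk_def cau_expand[OF x] wrp_def A0f_def ix_sum_other[of _ k]
  by (simp add: poly_GP algebra_simps)

lemma AZ_Child: "X = Child Z i \<Longrightarrow> AZ = type_I \<mu> (Pi_ix Z)"
  unfolding AZ_def by simp

lemma AZ_Root: "X = Root \<Longrightarrow> AZ = (\<lambda>k. [:vkap \<kappa> k / mass (\<mu> k):])"
proof
  fix k assume "X = Root"
  then show "AZ k = [:vkap \<kappa> k / mass (\<mu> k):]"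
    unfolding AZ_def by (cases k) (simp_all add: type_I_unit vkap_def)
qed

lemma AZ_coeff: "j \<ge> Pi_ix X k \<Longrightarrow> coeff (AZ k) j = 0"
proof (cases X)
  case Root
  assume "j \<ge> Pi_ix X k"
  then show ?thesis unfolding AZ_Root[OF Root] using Root by (cases j) auto
next
  case (Child Z i)
  assume "j \<ge> Pi_ix X k"
  then have "j \<ge> Pi_ix Z k" using Child by (auto simp: inc_apply split: if_splits)
  then show ?thesis unfolding AZ_Child[OF Child] by (rule type_I_coeff)
qed

text \<open>The parent form behaves like a type I form of size one less than that of
  \<open>X\<close>, also at the root, where the condition on \<kappa> supplies the
  normalisation.\<close>

lemma AZ_QI: "m + 2 \<le> msize (Pi_ix X) \<Longrightarrow> QI AZ (monom 1 m) = (if m + 2 = msize (Pi_ix X) then 1 else 0)"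
proof (cases X)
  case Root
  assume m: "m + 2 \<le> msize (Pi_ix X)"
  then have m0: "m = 0" using Root by (simp add: msize_def)
  have "QI AZ (monom 1 0) = \<kappa> I1 * QI (type_I \<mu> (unit_ix I2)) (monom 1 0) + \<kappa> I2 * QI (type_I \<mu> (unit_ix I1)) (monom 1 0)"
    unfolding AZ_def using Root by (simp only: vertex.case QI_add_left QI_smult_left)
  also have "\<dots> = 1"
  proof -
    have "QI (type_I \<mu> (unit_ix i)) (monom 1 0) = 1" for i
      using QI_type_I_monom[of 0 "unit_ix i"] by (simp add: unit_ix_def) (simp add: msize_def)
    then show ?thesis using kappa by simp
  qed
  finally show ?thesis using m0 Root by (simp add: msize_def)
next
  case (Child Z i)
  assume "m + 2 \<le> msize (Pi_ix X)"
  then show ?thesis unfolding AZ_Child[OF Child] using Child by (simp add: QI_type_I_monom)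
qed

text \<open>\<open>Dk\<close> is a two by two determinant of values at \<open>x\<close> and
  regularised Cauchy transforms. If it vanished, a nontrivial combination of the forms at
  \<open>X\<close> and its parent would have both entries zero, and dividing it by
  \<open>t - x\<close> contradicts normality.\<close>

lemma Dk_X_nonzero: assumes x: "x \<in> Delta \<mu> k" shows "Dk k (At X) x \<noteq> 0"
proof
  assume 0: "Dk k (At X) x = 0"
  have xo: "x \<notin> Delta \<mu> (other k)" by (rule Delta_disjoint[OF x])
  define r where "r A = cau (other k) (A (other k)) x - QI (ek k) (synthetic_div (A k) x)" for A
  have "Dk k (At X) x = poly (At X k) x * r AZ - poly (AZ k) x * r (At X)"
    unfolding Dk_def wrp_def r_def by (simp add: poly_GP algebra_simps)
  then have "poly (At X k) x * r AZ = poly (AZ k) x * r (At X)" using 0 by simp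
  from ex_kernel_vector[OF this] obtain u v where uv: "u \<noteq> 0 \<or> v \<noteq> 0"
    "u * poly (At X k) x + v * poly (AZ k) x = 0" "u * r (At X) + v * r AZ = 0" by blast
  define B where "B j = smult u (At X j) + smult v (AZ j)" for j
  have QB: "QI B p = u * QI (At X) p + v * QI AZ p" for p
    unfolding B_def QI_add_left QI_smult_left ..
  define N where "N = msize (Pi_ix X)"
  have N2: "N \<ge> 2" unfolding N_def by (rule msize_Pi)
  have B0: "B j = 0" for j
  proof (rule linear_form_nonzero_inside[where n="Pi_ix X" and t=x and k=k])
    show "\<forall>i\<ge>Pi_ix X j. coeff (B j) i = 0" for j
      by (simp add: B_def At_X type_I_coeff AZ_coeff)
    show "QI B (monom 1 m) = 0" if "Suc (Suc m) < msize (Pi_ix X)" for m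
      using that by (simp add: QB At_X QI_type_I_monom AZ_QI)
    show "0 < Pi_ix X k" by (rule Pi_ix_pos)
    show "x \<notin> Delta \<mu> (other k)" by (rule xo)
    show "poly (B k) x = 0" using uv(2) by (simp add: B_def)
    have "(\<integral>t. poly (B (other k)) t / (x - t) \<partial>\<mu> (other k)) = u * cau (other k) (At X (other k)) x + v * cau (other k) (AZ (other k)) x"
      unfolding cau_def[symmetric] B_def by (rule cau_lincomb[OF xo])
    moreover have "(\<integral>t. poly (synthetic_div (B k) t) x \<partial>\<mu> k) = u * QI (ek k) (synthetic_div (At X k) x) + v * QI (ek k) (synthetic_div (AZ k) x)"
    proof -
      have "(\<integral>t. poly (synthetic_div (B k) t) x \<partial>\<mu> k) = QI (ek k) (synthetic_div (B k) x)"
        unfolding QI_ek synthetic_div_sym[of _ _ x] ..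
      then show ?thesis unfolding B_def synthetic_div_lincomb QI_add QI_smult .
    qed
    ultimately show "(\<integral>t. poly (B (other k)) t / (x - t) \<partial>\<mu> (other k)) - (\<integral>t. poly (synthetic_div (B k) t) x \<partial>\<mu> k) = 0"
      using uv(3) by (simp add: r_def algebra_simps)
  qed
  then have QB0: "QI B p = 0" for p by (simp add: QI_def)
  have N: "Suc (N - 2) \<noteq> N" "Suc (Suc (N - 2)) = N" using N2 by linarith+
  \<comment> \<open>The moment of order \<open>N - 2\<close> sees only the parent form; the one of
    order \<open>N - 1\<close> is then left to the form at \<open>X\<close>.\<close>
  have "v = 0"
    using N QB0[of "monom 1 (N - 2)"] N2 unfolding QB by (simp add: At_X QI_type_I_monom AZ_QI N_def[symmetric])
  moreover have "u = 0"
    using QB0[of "monom 1 (N - 1)"] N2 \<open>v = 0\<close> unfolding QB by (simp add: At_X QI_type_I_monom N_def[symmetric])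
  ultimately show False using uv(1) by simp
qed

lemma type_I_form_nonzero:
  assumes n: "msize n > 0" and x: "\<And>k. x \<notin> Delta \<mu> k" shows "LL (type_I \<mu> n) x \<noteq> 0"
proof
  assume 0: "LL (type_I \<mu> n) x = 0"
  have "type_I \<mu> n k = 0" for k
  proof (rule linear_form_nonzero[where n=n and t=x])
    show "QI (type_I \<mu> n) (monom 1 m) = 0" if "Suc m < msize n" for m
      using that by (simp add: QI_type_I_monom)
    show "(\<Sum>k\<in>{I1, I2}. \<integral>t. poly (type_I \<mu> n k) t / (x - t) \<partial>\<mu> k) = 0"
      using 0 by (simp add: LL_def cau_def)
  qed (use x in \<open>auto simp: type_I_coeff\<close>)
  then have "QI (type_I \<mu> n) (monom 1 (msize n - 1)) = 0" by (simp add: QI_def)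
  then show False using n by (simp add: QI_type_I_monom)
qed

lemma Lam_At: "poly (At Y k) x = mfac \<mu> X * Lam \<mu> k x Y"
  by (simp add: At_def Lam_def)

lemma Lam0_At: "A0f (At Y) x = mfac \<mu> X * Lam0 \<mu> x Y"
  unfolding At_def[abs_def] A0f_smult by (simp add: Lam0_def A0_A0f)

lemma ind_Delta: "x \<in> Delta \<mu> k \<Longrightarrow> indicator (Delta \<mu> k) x = (1::real)"
  "x \<in> Delta \<mu> k \<Longrightarrow> indicator (Delta \<mu> (other k)) x = (0::real)"
  using Delta_disjoint by auto

lemma PsiT_Dk:
  assumes X: "X = Child Z i" and x: "x \<in> Delta \<mu> k"
  shows "PsiT \<mu> Z X x Y = Dk k (At Y) x"
proof -
  have mz: "mfac \<mu> Z > 0" by (rule mfac_pos)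
  have Z: "poly (AZ j) x = mfac \<mu> Z * Lam \<mu> j x Z" for j
    unfolding AZ_Child[OF X] Lam_def using mz by simp
  have Z0: "A0f AZ x = mfac \<mu> Z * Lam0 \<mu> x Z"
    unfolding AZ_Child[OF X] Lam0_def A0_A0f using mz by simp
  have "PsiT \<mu> Z X x Y = mfac \<mu> Z * mfac \<mu> X *
     (brk Z (Lam \<mu> k x) (Lam0 \<mu> x) Y + brk Z (Lam \<mu> (other k) x) (Lam \<mu> k x) Y * cauchy (\<mu> (other k)) x)"
    unfolding PsiT_def ix_sum_other[of _ k] using ind_Delta[OF x] by simp
  then show ?thesis
    unfolding Dk_alt[OF Delta_disjoint[OF x]] Lam_At Lam0_At Z Z0 brk_def by (simp add: algebra_simps)
qed

lemma A0f_const: "(\<And>k. degree (A k) = 0) \<Longrightarrow> A0f A x = 0"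
  by (simp add: A0f_def synthetic_div_eq_0_iff[THEN iffD2])

lemma Dk_root:
  assumes X: "X = Root" and x: "x \<in> Delta \<mu> k"
  shows "Dk k (At Y) x = Lam0 \<mu> x Y * vkap \<kappa> k / mass (\<mu> k)
       + (case k of I1 \<Rightarrow> - 1 | I2 \<Rightarrow> 1) * cauchy (\<mu> (other k)) x *
         (Lam \<mu> I2 x Y * vkap \<kappa> I1 / mass (\<mu> I1) - Lam \<mu> I1 x Y * vkap \<kappa> I2 / mass (\<mu> I2))"
proof -
  have AZ: "AZ j = [:vkap \<kappa> j / mass (\<mu> j):]" for j using AZ_Root[OF X] by simp
  have A0: "A0f AZ x = 0" by (rule A0f_const) (simp add: AZ)
  have m: "mfac \<mu> X = 1" using X by (simp add: mfac_Root)
  show ?thesis unfolding Dk_alt[OF Delta_disjoint[OF x]] Lam_At Lam0_At A0 m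
    by (cases k) (simp_all add: AZ algebra_simps)
qed

text \<open>At the root both forms have constant coefficients, so \<open>A0f\<close> vanishes and
  \<open>Dk\<close> is a determinant of constants times one Cauchy transform; the sum of \<kappa>
  being 1 removes \<kappa> from it.\<close>

lemma S_root_Dk:
  assumes X: "X = Root" and x: "x \<in> Delta \<mu> k"
  shows "S_root \<mu> x = Dk k (At X) x"
proof -
  have AZ: "AZ j = [:vkap \<kappa> j / mass (\<mu> j):]" for j using AZ_Root[OF X] by simp
  have A: "At X = type_I \<mu> (\<lambda>_. 1)" using At_X X by simp
  have d: "degree (At X j) = 0" for j unfolding A by (cases j) (simp_all only: type_I_11(1,2) degree_pCons_0)
  have A0: "A0f AZ x = 0" "A0f (At X) x = 0" by (rule A0f_const; simp add: AZ d)+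
  have mp: "mass (\<mu> j) > 0" for j by (rule mass_pos)
  have vk: "vkap \<kappa> I1 + vkap \<kappa> I2 = 1" using kappa by (simp add: vkap_def)
  have D: "Dk k (At X) x = cauchy (\<mu> (other k)) x * (poly (At X k) x * poly (AZ (other k)) x - poly (AZ k) x * poly (At X (other k)) x)"
    unfolding Dk_alt[OF Delta_disjoint[OF x]] A0 by (simp add: algebra_simps)
  have c: "poly (At X I1) x * poly (AZ I2) x - poly (AZ I1) x * poly (At X I2) x = - 1 / (Xi \<mu> * mass (\<mu> I1) * mass (\<mu> I2))"
  proof -
    have "poly (At X I1) x * poly (AZ I2) x - poly (AZ I1) x * poly (At X I2) x
      = - (vkap \<kappa> I1 + vkap \<kappa> I2) / (Xi \<mu> * mass (\<mu> I1) * mass (\<mu> I2))"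
      unfolding A AZ type_I_11(1,2) using mp[of I1] mp[of I2] type_I_11(3) by (simp add: field_simps)
    then show ?thesis unfolding vk .
  qed
  show ?thesis
  proof (cases k)
    case I1
    then show ?thesis using ind_Delta[OF x] c unfolding D S_root_def by simp
  next
    case I2
    have "poly (At X I2) x * poly (AZ I1) x - poly (AZ I2) x * poly (At X I1) x = 1 / (Xi \<mu> * mass (\<mu> I1) * mass (\<mu> I2))"
      using c by (simp add: algebra_simps)
    then show ?thesis using ind_Delta[OF x] I2 unfolding D S_root_def by simp
  qed
qed

lemma PsiR_Dk:
  assumes X: "X = Root" and x: "x \<in> Delta \<mu> k"
  shows "PsiR \<mu> \<kappa> k x Y = Dk k (At Y) x / Dk k (At X) x"
  unfolding PsiR_def S_root_Dk[OF X x] Dk_root[OF X x, of Y] ..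

lemma Psi_inside: assumes x: "x \<in> Delta \<mu> k"
  shows "Psi \<mu> \<kappa> X x Y = Dk k (At Y) x / Dk k (At X) x"
proof (cases X)
  case Root
  have "Psi \<mu> \<kappa> X x Y = PsiR \<mu> \<kappa> k x Y"
    using x Delta_disjoint[OF x] Root by (cases k) simp_all
  then show ?thesis using PsiR_Dk[OF Root x] by simp
next
  case (Child Z i)
  then show ?thesis using PsiT_Dk[OF Child x] by simp
qed

lemma Lvk_LL: "X = Root \<Longrightarrow> Lvk \<mu> \<kappa> x = LL AZ x"
proof -
  assume X: "X = Root"
  have "cau k (AZ k) x = vkap \<kappa> k / mass (\<mu> k) * cauchy (\<mu> k) x" for k
  proof -
    have "AZ k = smult (vkap \<kappa> k / mass (\<mu> k)) 1" using AZ_Root[OF X] by (simp add: one_pCons)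
    then have "cau k (AZ k) x = cau k (smult (vkap \<kappa> k / mass (\<mu> k)) 1) x" by (rule arg_cong)
    also have "\<dots> = vkap \<kappa> k / mass (\<mu> k) * cauchy (\<mu> k) x" unfolding cau_smult cauchy_cau ..
    finally show ?thesis .
  qed
  then show ?thesis by (simp add: Lvk_def LL_def)
qed

text \<open>On an interval divide by the nonzero \<open>Dk k (At X) x\<close>. Off the intervals the
  parent form vanishes almost everywhere, which a type I form cannot do, so \<open>X\<close> is the
  root and \<open>x\<close> lies in E; there divide by the form at \<open>X\<close>, which has no
  zero outside the intervals.\<close>

lemma Psi_psi: assumes Y: "Y \<in> subtree X"
  shows "AE x in \<rho>. complex_of_real (Psi \<mu> \<kappa> X x Y) = psi Y x"
  using density_inside[OF Y, of I1] density_inside[OF Y, of I2] density_outside2[OF Y] LL_AZ_zero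
proof eventually_elim
  case (elim x)
  show ?case
  proof (cases "\<exists>k. x \<in> Delta \<mu> k")
    case True
    then obtain k where k: "x \<in> Delta \<mu> k" by blast
    have "of_real (Dk k (At X) x) * psi Y x = of_real (Dk k (At Y) x)"
      using elim(1,2) Delta_disjoint[OF k] by (cases k) auto
    then show ?thesis using Dk_X_nonzero[OF k] by (simp add: Psi_inside[OF k] field_simps)
  next
    case False
    then have x: "x \<notin> Delta \<mu> k" for k by blast
    then have L0: "LL AZ x = 0" and L: "of_real (LL (At X) x) * psi Y x = of_real (LL (At Y) x)"
      using elim(3,4) by auto
    have root: "X = Root"
    proof (cases X)
      case (Child Z i)
      then show ?thesis using L0[unfolded AZ_Child[OF Child]] type_I_form_nonzero[OF _ x, of "Pi_ix Z"] msize_Pi[of Z] by auto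
    qed
    have nz: "LL (At X) x \<noteq> 0" unfolding At_X using type_I_form_nonzero[OF _ x, of "Pi_ix X"] msize_Pi[of X] by simp
    have "x \<in> Evk \<mu> \<kappa>" using L0 x by (simp add: Evk_def Lvk_LL[OF root])
    then have "Psi \<mu> \<kappa> X x Y = lfun \<mu> x Y / Lfun \<mu> (\<lambda>_. 1) x" using x root by simp
    moreover have "lfun \<mu> x Y = LL (At Y) x"
    proof -
      have m: "mfac \<mu> X = 1" using root by (simp add: mfac_Root)
      show ?thesis by (simp add: lfun_def Lfun_cau LL_def At_def cau_smult m add_divide_distrib)
    qed
    moreover have "Lfun \<mu> (\<lambda>_. 1) x = LL (At X) x"
    proof -
      have "Pi_ix X = (\<lambda>_. 1)" using root by simp
      then show ?thesis unfolding At_X Lfun_cau LL_def by (simp only:)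
    qed
    ultimately have "Psi \<mu> \<kappa> X x Y = LL (At Y) x / LL (At X) x" by (simp only:)
    moreover have "psi Y x = of_real (LL (At Y) x) / of_real (LL (At X) x)"
      using L nz by (simp add: eq_divide_eq mult.commute)
    ultimately show ?thesis by (simp only: of_real_divide)
  qed
qed

lemma Psi_measurable: "(\<lambda>x. Psi \<mu> \<kappa> X x Y) \<in> borel_measurable borel"
proof -
  have [measurable]: "poly p \<in> borel_measurable borel" for p :: "real poly"
    by (auto intro!: borel_measurable_continuous_onI continuous_intros)
  have [measurable]: "cau j B \<in> borel_measurable borel" for j B by (rule cau_measurable)
  have [measurable]: "cauchy (\<mu> j) \<in> borel_measurable borel" for j
    unfolding cauchy_cau[abs_def] by measurable
  have [measurable]: "(\<lambda>x. Lam \<mu> k x V) \<in> borel_measurable borel" for k V unfolding Lam_def by measurable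
  have [measurable]: "(\<lambda>x. A0 \<mu> n x) \<in> borel_measurable borel" for n
  proof -
    obtain p where "\<forall>x. A0 \<mu> n x = poly p x" using A0_poly by blast
    then show ?thesis by simp
  qed
  have [measurable]: "(\<lambda>x. Lam0 \<mu> x V) \<in> borel_measurable borel" for V unfolding Lam0_def by measurable
  have [measurable]: "(\<lambda>x. Lfun \<mu> n x) \<in> borel_measurable borel" for n unfolding Lfun_cau by measurable
  have [measurable]: "(\<lambda>x. lfun \<mu> x V) \<in> borel_measurable borel" for V unfolding lfun_def by measurable
  have [measurable]: "(\<lambda>x. Lvk \<mu> \<kappa> x) \<in> borel_measurable borel" unfolding Lvk_def ix_sum by measurable
  have [measurable]: "(\<lambda>x. S_root \<mu> x) \<in> borel_measurable borel" unfolding S_root_def by measurable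
  have [measurable]: "(\<lambda>x. PsiR \<mu> \<kappa> k x V) \<in> borel_measurable borel" for k V unfolding PsiR_def by measurable
  have [measurable]: "(\<lambda>x. PsiT \<mu> Z W x V) \<in> borel_measurable borel" for Z W V
    unfolding PsiT_def ix_sum brk_def by measurable
  have [measurable]: "Evk \<mu> \<kappa> \<in> sets borel"
  proof -
    have "Evk \<mu> \<kappa> = (UNIV - Delta \<mu> I1 - Delta \<mu> I2) \<inter> {x \<in> space borel. Lvk \<mu> \<kappa> x = 0}" by (auto simp: Evk_def)
    also have "\<dots> \<in> sets borel" by measurable
    finally show ?thesis .
  qed
  show ?thesis by (cases X) (simp_all, measurable)
qed

end

theorem proposition3p4p1:
  fixes \<mu> :: "ix \<Rightarrow> real measure" and \<kappa> :: "ix \<Rightarrow> real"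
    and X :: vertex and \<rho> :: "real measure"
  assumes "angelesco \<mu>"
    and "\<kappa> I1 + \<kappa> I2 = 1"
    and "is_spectral_measure (subtree X) (jacobi \<mu> \<kappa> X) X \<rho>"
  shows
    "(\<forall>\<alpha> \<in> L2 \<rho>. \<forall>Y \<in> subtree X. integrable \<rho> (\<lambda>x. \<alpha> x * of_real (Psi \<mu> \<kappa> X x Y))) \<and>
     unitary_L2_onto \<rho> (subtree X) (cyclic_subspace (subtree X) (jacobi \<mu> \<kappa> X) X) (hat \<mu> \<kappa> X \<rho>) \<and>
     (\<forall>\<alpha> \<in> L2 \<rho>. (L2_norm \<rho> \<alpha>)\<^sup>2 = (ell2_norm (subtree X) (hat \<mu> \<kappa> X \<rho> \<alpha>))\<^sup>2) \<and>
     cyclic_subspace (subtree X) (jacobi \<mu> \<kappa> X) X = {hat \<mu> \<kappa> X \<rho> \<alpha> | \<alpha>. \<alpha> \<in> L2 \<rho>} \<and>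
     (\<forall>\<alpha> \<in> borel_measurable borel.
        continuous_on {x. of_real x \<in> op_spectrum (subtree X) (jacobi \<mu> \<kappa> X)} \<alpha> \<longrightarrow>
        \<alpha> \<in> L2 \<rho> \<and>
        cont_calc (subtree X) (jacobi \<mu> \<kappa> X) \<alpha> (kdelta X) = hat \<mu> \<kappa> X \<rho> \<alpha>) \<and>
     (\<forall>\<alpha> \<in> L2 \<rho>. (\<lambda>x. of_real x * \<alpha> x) \<in> L2 \<rho> \<and>
        hat \<mu> \<kappa> X \<rho> (\<lambda>x. of_real x * \<alpha> x) = jacobi \<mu> \<kappa> X (hat \<mu> \<kappa> X \<rho> \<alpha>))"
proof -
  interpret tree_system \<mu> \<kappa> X \<rho>
    by unfold_locales (use assms in auto)
  show ?thesis
  proof (rule transform_main[where \<Phi>="\<lambda>x Y. complex_of_real (Psi \<mu> \<kappa> X x Y)"])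
    show "(\<lambda>x. complex_of_real (Psi \<mu> \<kappa> X x Y)) \<in> borel_measurable borel" for Y
      using Psi_measurable[of Y] by measurable
    show "AE x in \<rho>. complex_of_real (Psi \<mu> \<kappa> X x Y) = psi Y x" if "Y \<in> subtree X" for Y
      by (rule Psi_psi[OF that])
  qed (simp add: hat_def)
qed

end
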